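(* Let $L$ be a non-Galois totally real cubic field with normal closure $N$, real quadratic subfield $K$ of $N$ with 3-class rank $\varrho$, and conductor $f\ge 1$ of $N/K$; let $t$ be the number of prime divisors of $f$ and $s$ the number of those which split in $K$. (1) If $\tau(L)=\gamma$ (two-dimensional absolute principal factorization, $A=2$), then $t\ge 2$. (2) If $\tau(L)=\alpha_3$ (two-dimensional relative principal factorization, $R=2$), then $s\ge 2$ (and a fortiori $t\ge 2$). (3) If $\tau(L)=\alpha_1$ (two-dimensional capitulation, $C=2$), then $\varrho\ge 2$.
   Context: $N/K$ is cyclic cubic. With $\mathcal{I}_E,\mathcal{P}_E,U_E,\mathrm{Cl}_E$ the fractional ideals, principal ideals, units, class group of $E$ (ideals of subfields identified with extensions): $\mathcal{I}_{N/K}=\{\mathfrak{A}\in\mathcal{I}_N\mid\mathfrak{A}^3\in\mathcal{I}_K\}$, $\mathcal{P}_{N/K}=\mathcal{I}_{N/K}\cap\mathcal{P}_N$, $\mathcal{I}_{L/\mathbb{Q}}=\{\mathfrak{a}\in\mathcal{I}_L\mid\mathfrak{a}^3\in\mathcal{I}_{\mathbb{Q}}\}$, $\mathcal{P}_{L/\mathbb{Q}}=\mathcal{I}_{L/\mathbb{Q}}\cap\mathcal{P}_L$; $(U_K:N_{N/K}(U_N))=3^U$; $A=\dim_{\mathbb{F}_3}\mathcal{P}_{L/\mathbb{Q}}/\mathcal{P}_{\mathbb{Q}}$; $R=\dim_{\mathbb{F}_3}(\ker\overline{N}_{N/L}\cap(\mathcal{P}_{N/K}\mathcal{I}_K)/\mathcal{I}_K)$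 with $\overline{N}_{N/L}:\mathcal{I}_{N/K}/\mathcal{I}_K\to\mathcal{I}_{L/\mathbb{Q}}/\mathcal{I}_{\mathbb{Q}}$ induced by the norm; $C=\dim_{\mathbb{F}_3}\ker(T_{N/K}:\mathrm{Cl}_K\to\mathrm{Cl}_N)$. Types by $(U,A,R,C)$: $\alpha_1=(1,0,0,2)$, $\alpha_3=(1,0,2,0)$, $\gamma=(1,2,0,0)$. *)

theory Defs
  imports
    "HOL-Algebra.Algebra"
    "HOL-Algebra.Algebraic_Closure_Type"
    "HOL-Number_Theory.Number_Theory"
    "Jordan_Normal_Form.Missing_VectorSpace"
begin

abbreviation complex_field :: "complex ring" where
  "complex_field \<equiv> ring_of_type_algebra"

text \<open>
  Number fields are taken inside the complex numbers: a number field is a subfield \<open>E\<close> of the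
  field \<^term>\<open>complex_field\<close> that has finite degree over \<^term>\<open>\<rat> :: complex set\<close>.
\<close>

text \<open>
  The \<open>F\<close>-embeddings of \<open>E\<close> into the complex numbers; extensionality makes two embeddings equal
  when they agree on \<open>E\<close>, so that products over this set are products over embeddings of \<open>E\<close>.
\<close>

definition embeddings :: "complex set \<Rightarrow> complex set \<Rightarrow> (complex \<Rightarrow> complex) set" where
  "embeddings E F =
     {\<sigma> \<in> ring_hom (complex_field\<lparr>carrier := E\<rparr>) complex_field. \<sigma> \<in> extensional E \<and> (\<forall>x\<in>F. \<sigma> x = x)}"

definition totally_real :: "complex set \<Rightarrow> bool" where
  "totally_real E \<longleftrightarrow> (\<forall>\<sigma>\<in>embeddings E \<rat>. \<sigma> ` E \<subseteq> \<real>)"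

definition galois_over :: "complex set \<Rightarrow> complex set \<Rightarrow> bool" where
  "galois_over E F \<longleftrightarrow> {x \<in> E. \<forall>\<sigma>\<in>embeddings E F. \<sigma> ` E = E \<longrightarrow> \<sigma> x = x} = F"

definition normal_closure :: "complex set \<Rightarrow> complex set" where
  "normal_closure E = generate_field complex_field (\<Union>\<sigma>\<in>embeddings E \<rat>. \<sigma> ` E)"

definition rel_norm :: "complex set \<Rightarrow> complex set \<Rightarrow> complex \<Rightarrow> complex" where
  "rel_norm E F x = (\<Prod>\<sigma>\<in>embeddings E F. \<sigma> x)"

definition integers_of :: "complex set \<Rightarrow> complex set" where
  "integers_of E = {x \<in> E. algebraic_int x}"

definition integer_ring :: "complex set \<Rightarrow> complex ring" where
  "integer_ring E = complex_field\<lparr>carrier := integers_of E\<rparr>"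

text \<open>A fractional ideal is a set \<open>J / d\<close> with \<open>J\<close> a nonzero ideal of the ring of integers.\<close>

definition fractional_ideals :: "complex set \<Rightarrow> complex set set" where
  "fractional_ideals E =
     {I. I \<noteq> {0} \<and> (\<exists>d\<in>integers_of E. d \<noteq> 0 \<and> ideal ((\<lambda>x. d * x) ` I) (integer_ring E))}"

text \<open>
  \<^const>\<open>ideal_prod\<close> is formed in the field of complex numbers, so it also applies to fractional
  ideals: it is the set of finite sums of products \<open>x * y\<close> with \<open>x \<in> I\<close> and \<open>y \<in> J\<close>.
\<close>

definition ideal_group :: "complex set \<Rightarrow> complex set monoid" where
  "ideal_group E =
     \<lparr>carrier = fractional_ideals E,
      monoid.mult = (\<lambda>I J. ideal_prod complex_field I J),
      one = integers_of E\<rparr>"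

definition principal_ideal :: "complex set \<Rightarrow> complex \<Rightarrow> complex set" where
  "principal_ideal E x = (\<lambda>y. x * y) ` integers_of E"

definition principal_ideals :: "complex set \<Rightarrow> complex set set" where
  "principal_ideals E = principal_ideal E ` (E - {0})"

definition ideal_extension :: "complex set \<Rightarrow> complex set \<Rightarrow> complex set" where
  "ideal_extension E I = ideal_prod complex_field I (integers_of E)"

text \<open>
  The relative norm of a fractional ideal \<open>I\<close> of \<open>E\<close> is the fractional ideal of \<open>F\<close> generated by
  the norms of the elements of \<open>I\<close>.
\<close>

definition ideal_norm :: "complex set \<Rightarrow> complex set \<Rightarrow> complex set \<Rightarrow> complex set" where
  "ideal_norm E F I = ideal_prod complex_field (rel_norm E F ` I) (integers_of F)"

definition class_group :: "complex set \<Rightarrow> complex set set monoid" where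
  "class_group E = ideal_group E Mod principal_ideals E"

text \<open>
  A commutative group of exponent \<open>p\<close> as a vector space over the field with \<open>p\<close> elements: vector
  addition is the group operation and scalars act by powers. The fields \<open>mult\<close> and \<open>one\<close> of a
  module record play no role.
\<close>

definition power_module :: "('a, 'b) monoid_scheme \<Rightarrow> (int, 'a) module" where
  "power_module G =
     \<lparr>carrier = carrier G, monoid.mult = (\<lambda>x y. x \<otimes>\<^bsub>G\<^esub> y), one = \<one>\<^bsub>G\<^esub>,
      ring.zero = \<one>\<^bsub>G\<^esub>, add = (\<lambda>x y. x \<otimes>\<^bsub>G\<^esub> y), module.smult = (\<lambda>k x. x [^]\<^bsub>G\<^esub> k)\<rparr>"

definition Fp_dim :: "nat \<Rightarrow> ('a, 'b) monoid_scheme \<Rightarrow> nat" where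
  "Fp_dim p G = vectorspace.dim (residue_ring (int p)) (power_module G)"

definition p_class_rank :: "nat \<Rightarrow> complex set \<Rightarrow> nat" where
  "p_class_rank p E =
     Fp_dim p (class_group E Mod ((\<lambda>c. c [^]\<^bsub>class_group E\<^esub> p) ` carrier (class_group E)))"

text \<open>
  For a map \<open>f\<close> into \<open>H\<close> carrying \<open>A\<close> into \<open>B\<close>: the induced map from cosets \<open>A #> x\<close>
  to cosets \<open>B #> f x\<close>.
\<close>

definition induced_map ::
  "('b, 'c) monoid_scheme \<Rightarrow> 'b set \<Rightarrow> ('a \<Rightarrow> 'b) \<Rightarrow> 'a set \<Rightarrow> 'b set" where
  "induced_map H B f c = (\<Union>x\<in>c. B #>\<^bsub>H\<^esub> f x)"

text \<open>
  Ideals of a subfield are identified with their extensions, so the ideals and principal ideals of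
  \<open>F\<close> become the following sets of fractional ideals of \<open>E\<close>.
\<close>

definition extended_ideals :: "complex set \<Rightarrow> complex set \<Rightarrow> complex set set" where
  "extended_ideals E F = ideal_extension E ` fractional_ideals F"

definition extended_principal_ideals :: "complex set \<Rightarrow> complex set \<Rightarrow> complex set set" where
  "extended_principal_ideals E F = ideal_extension E ` principal_ideals F"

definition cubic_ideals :: "complex set \<Rightarrow> complex set \<Rightarrow> complex set set" where
  "cubic_ideals E F =
     {I \<in> fractional_ideals E. I [^]\<^bsub>ideal_group E\<^esub> (3::nat) \<in> extended_ideals E F}"

definition cubic_principal_ideals :: "complex set \<Rightarrow> complex set \<Rightarrow> complex set set" where
  "cubic_principal_ideals E F = cubic_ideals E F \<inter> principal_ideals E"

definition cubic_ideals_quot :: "complex set \<Rightarrow> complex set \<Rightarrow> complex set set monoid" where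
  "cubic_ideals_quot E F = (ideal_group E)\<lparr>carrier := cubic_ideals E F\<rparr> Mod extended_ideals E F"

definition unit_norm_exponent :: "complex set \<Rightarrow> complex set \<Rightarrow> nat" where
  "unit_norm_exponent N K =
     (THE u. card (rcosets\<^bsub>units_of (integer_ring K)\<^esub> (rel_norm N K ` Units (integer_ring N)))
             = 3 ^ u)"

definition absolute_dim :: "complex set \<Rightarrow> nat" where
  "absolute_dim L =
     Fp_dim 3 ((ideal_group L)\<lparr>carrier := cubic_principal_ideals L \<rat>\<rparr>
                 Mod extended_principal_ideals L \<rat>)"

definition relative_dim :: "complex set \<Rightarrow> complex set \<Rightarrow> complex set \<Rightarrow> nat" where
  "relative_dim L K N =
     Fp_dim 3 ((cubic_ideals_quot N K)
       \<lparr>carrier :=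
          kernel (cubic_ideals_quot N K) (cubic_ideals_quot L \<rat>)
            (induced_map (ideal_group L) (extended_ideals L \<rat>) (ideal_norm N L))
          \<inter> carrier ((ideal_group N)
                       \<lparr>carrier := cubic_principal_ideals N K
                                     <#>\<^bsub>ideal_group N\<^esub> extended_ideals N K\<rparr>
                     Mod extended_ideals N K)\<rparr>)"

definition capitulation_dim :: "complex set \<Rightarrow> complex set \<Rightarrow> nat" where
  "capitulation_dim N K =
     Fp_dim 3 ((class_group K)
       \<lparr>carrier := kernel (class_group K) (class_group N)
          (induced_map (ideal_group N) (principal_ideals N) (ideal_extension N))\<rparr>)"

text \<open>
  The type of a non-Galois totally real cubic field \<open>L\<close> with normal closure \<open>N\<close> and quadratic
  subfield \<open>K\<close> of \<open>N\<close>, as the quadruple \<open>(U, A, R, C)\<close>.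
\<close>

definition pf_type :: "complex set \<Rightarrow> complex set \<Rightarrow> complex set \<Rightarrow> nat \<times> nat \<times> nat \<times> nat" where
  "pf_type L K N =
     (unit_norm_exponent N K, absolute_dim L, relative_dim L K N, capitulation_dim N K)"

definition type_alpha1 :: "nat \<times> nat \<times> nat \<times> nat" where "type_alpha1 = (1, 0, 0, 2)"
definition type_alpha3 :: "nat \<times> nat \<times> nat \<times> nat" where "type_alpha3 = (1, 0, 2, 0)"
definition type_gamma :: "nat \<times> nat \<times> nat \<times> nat" where "type_gamma = (1, 2, 0, 0)"

definition prime_ideals :: "complex set \<Rightarrow> complex set set" where
  "prime_ideals E = {P. primeideal P (integer_ring E) \<and> P \<noteq> {0}}"

text \<open>
  Congruence of elements of \<open>E\<close> modulo the \<open>n\<close>-th power of \<open>P\<close> in the localization at \<open>P\<close>,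
  i.e. \<open>v (x - y) \<ge> n\<close> for the \<open>P\<close>-adic valuation \<open>v\<close>.
\<close>

definition local_cong :: "complex set \<Rightarrow> complex set \<Rightarrow> nat \<Rightarrow> complex \<Rightarrow> complex \<Rightarrow> bool" where
  "local_cong E P n x y \<longleftrightarrow>
     (\<exists>s\<in>integers_of E - P. s * (x - y) \<in> P [^]\<^bsub>ideal_group E\<^esub> n)"

text \<open>
  The intersection with \<open>E\<close> of the \<open>n\<close>-th unit group of the completion at \<open>P\<close>: all local units if
  \<open>n = 0\<close>, and the units congruent to 1 modulo the \<open>n\<close>-th power of \<open>P\<close> otherwise.
\<close>

definition local_units :: "complex set \<Rightarrow> complex set \<Rightarrow> nat \<Rightarrow> complex set" where
  "local_units E P n =
     {x \<in> E. (\<exists>s\<in>integers_of E - P. s * x \<in> integers_of E - P) \<and> local_cong E P n x 1}"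

text \<open>
  The elements of \<open>F\<close> that are norms from the completion of \<open>E\<close> at a prime over \<open>P\<close>, for a Galois
  extension \<open>E\<close> of \<open>F\<close> of number fields. Since the local norm group is closed and \<open>E\<close> is dense in
  the product of its completions over \<open>P\<close>, these are the nonzero elements of the \<open>P\<close>-adic closure
  of the set of norms of nonzero elements of \<open>E\<close>, that is, the elements that are congruent to such
  norms modulo every power of \<open>P\<close>.
\<close>

definition local_norms :: "complex set \<Rightarrow> complex set \<Rightarrow> complex set \<Rightarrow> complex set" where
  "local_norms E F P =
     {x \<in> F - {0}. \<forall>m. \<exists>y\<in>E - {0}. local_cong F P m x (rel_norm E F y)}"

text \<open>
  The exponent of the local conductor at \<open>P\<close> is the least \<open>n\<close> such that the \<open>n\<close>-th unit group
  consists of local norms. Both groups are open, hence closed, in the multiplicative group of the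
  completion, so that the inclusion can be tested on elements of the dense subfield \<open>F\<close>.
\<close>

definition conductor_exponent :: "complex set \<Rightarrow> complex set \<Rightarrow> complex set \<Rightarrow> nat" where
  "conductor_exponent E F P = (LEAST n. local_units F P n \<subseteq> local_norms E F P)"

text \<open>
  The (finite part of the) conductor of an abelian extension \<open>E\<close> of \<open>F\<close> is the product of its
  local conductors; for powers of distinct primes, almost all of them trivial, the product is the
  intersection. The infinite part is trivial for the totally real fields considered here.
\<close>

definition conductor :: "complex set \<Rightarrow> complex set \<Rightarrow> complex set" where
  "conductor E F =
     (\<Inter>P\<in>prime_ideals F. P [^]\<^bsub>ideal_group F\<^esub> conductor_exponent E F P)"

definition splits_in_quadratic :: "nat \<Rightarrow> complex set \<Rightarrow> bool" where
  "splits_in_quadratic p K \<longleftrightarrow>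
     (\<exists>P\<in>prime_ideals K. \<exists>Q\<in>prime_ideals K. P \<noteq> Q \<and>
        principal_ideal K (of_nat p) = ideal_prod complex_field P Q)"

end

theory Submission
  imports Defs "Jordan_Normal_Form.Char_Poly"
begin

text \<open>
  The normal closure \<open>N\<close> has a dihedral Galois group, generated by \<open>\<sigma>\<close> of order 3 with fixed field
  \<open>K\<close> and an involution \<open>\<tau>\<close> with fixed field \<open>L\<close>. Suppose that \<open>(x)\<^sup>3 = I\<close> for some \<open>x \<in> N\<close> and a
  fractional ideal \<open>I\<close> of \<open>K\<close>. If the value of \<open>I\<close> at a prime \<open>P\<close> of \<open>K\<close> is not divisible by 3, then
  \<open>N/K\<close> is totally ramified at \<open>P\<close>, so some local unit is not a local norm and the prime number
  below \<open>P\<close> divides \<open>f\<close>. If all values are divisible by 3, then \<open>I\<close> is the cube of an ideal and the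
  class of \<open>(x)\<close> is trivial. This bounds the first two dimensions by numbers of prime divisors of
  \<open>f\<close>: for \<open>x \<in> L\<close> the ideal \<open>I\<close> is rational, so that only its exponent at each prime number matters;
  for relative factorizations \<open>I \<tau>(I)\<close> is the cube of a rational ideal, so that the value of \<open>I\<close> is
  divisible by 3 if \<open>P = \<tau>(P)\<close>, and changes sign modulo 3 from \<open>P\<close> to \<open>\<tau>(P)\<close>. Finally, taking norms
  from \<open>N\<close> to \<open>K\<close> shows that capitulating classes have exponent 3, and the classes of exponent 3 of a
  finite abelian group have the same 3-rank as the group.
\<close>

section \<open>Algebraic integers\<close>

text \<open>That total ramification keeps some local unit from being a local norm is proved without
  class field theory. Dividing x or x^2 by a power of a uniformizer of K gives an element with an
  Eisenstein polynomial over K, so norms become values of an explicit cubic form. As N/K is Galois,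
  the discriminant of this polynomial is a square in K. Modulo P its square root yields a nontrivial
  cube root of unity if 3 is a unit, and a nonzero root of some X^3 + m X if P lies above 3. In both
  cases a self-map of the finite residue field is not injective, hence not surjective, and a missed
  value gives the unit. Above 3 the form of the map depends on which term dominates the
  discriminant. Ideal theory is developed only for quadratic fields, where an ideal times its
  conjugate is generated by a rational number, so that inverses are at hand. In L and N only
  principal ideals, extensions of ideals of subfields and their products occur; they are compared
  through elements, using that a root of an algebraic integer is an algebraic integer. Of the first
  two bounds only the case needed is proved: at most one prime leaves dimension at most 1.\<close>

lemma algebraic_int_eigenvalue:
  fixes x :: complex and v :: "nat \<Rightarrow> complex" and A :: "nat \<Rightarrow> nat \<Rightarrow> int"
  assumes eq: "\<And>i. i < n \<Longrightarrow> x * v i = (\<Sum>j<n. of_int (A i j) * v j)"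
    and k: "k < n" "v k \<noteq> 0"
  shows "algebraic_int x"
proof -
  define M where "M = mat n n (\<lambda>(i, j). A i j)"
  have M: "M \<in> carrier_mat n n" by (simp add: M_def)
  let ?M = "map_mat complex_of_int M"
  have "eigenvector ?M (Matrix.vec n v) x"
    unfolding eigenvector_def
  proof (intro conjI)
    have "Matrix.vec n v $ k \<noteq> 0" using k by simp
    then show "Matrix.vec n v \<noteq> 0\<^sub>v (dim_row ?M)"
      using k M by (metis dim_row_mat(1) index_map_mat(2) M_def index_zero_vec(1))
    show "?M *\<^sub>v Matrix.vec n v = x \<cdot>\<^sub>v Matrix.vec n v"
    proof (rule eq_vecI)
      fix i assume "i < dim_vec (x \<cdot>\<^sub>v Matrix.vec n v)"
      then have i: "i < n" by simp
      then show "(?M *\<^sub>v Matrix.vec n v) $ i = (x \<cdot>\<^sub>v Matrix.vec n v) $ i"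
        using eq[OF i] by (simp add: M_def scalar_prod_def lessThan_atLeast0)
    qed (use M in auto)
  qed (use M in auto)
  then have "eigenvalue ?M x" by (auto simp: eigenvalue_def)
  then have "poly (char_poly ?M) x = 0"
    using eigenvalue_root_char_poly[of ?M n x] M by auto
  moreover have "char_poly ?M = map_poly of_int (char_poly M)"
    using of_int_hom.char_poly_hom[OF M] by simp
  moreover have "lead_coeff (char_poly M) = 1"
    using degree_monic_char_poly[OF M] by simp
  ultimately show ?thesis
    unfolding algebraic_int_altdef_ipoly by auto
qed

definition int_span :: "complex set \<Rightarrow> complex set" where
  "int_span S = {(\<Sum>s\<in>S. of_int (f s) * s) | f :: complex \<Rightarrow> int. True}"

lemma int_spanI: "x = (\<Sum>s\<in>S. of_int (f s) * s) \<Longrightarrow> x \<in> int_span S"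
  by (auto simp: int_span_def)

lemma int_span_add: "x \<in> int_span S \<Longrightarrow> y \<in> int_span S \<Longrightarrow> x + y \<in> int_span S"
proof -
  assume "x \<in> int_span S" "y \<in> int_span S"
  then obtain f g where "x = (\<Sum>s\<in>S. of_int (f s) * s)" "y = (\<Sum>s\<in>S. of_int (g s) * s)"
    by (auto simp: int_span_def)
  then have "x + y = (\<Sum>s\<in>S. of_int (f s + g s) * s)"
    by (simp add: sum.distrib algebra_simps)
  then show ?thesis by (rule int_spanI)
qed

lemma int_span_scale: "x \<in> int_span S \<Longrightarrow> of_int k * x \<in> int_span S"
proof -
  assume "x \<in> int_span S"
  then obtain f where "x = (\<Sum>s\<in>S. of_int (f s) * s)" by (auto simp: int_span_def)
  then have "of_int k * x = (\<Sum>s\<in>S. of_int (k * f s) * s)"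
    by (simp add: sum_distrib_left algebra_simps)
  then show ?thesis by (rule int_spanI)
qed

lemma int_span_base: "finite S \<Longrightarrow> s \<in> S \<Longrightarrow> s \<in> int_span S"
proof -
  assume "finite S" "s \<in> S"
  then have "s = (\<Sum>t\<in>S. of_int (if t = s then 1 else 0) * t)"
    by (simp add: if_distrib[of of_int] if_distrib[of "\<lambda>x. x * _"] sum.delta cong: if_cong)
  then show ?thesis by (rule int_spanI)
qed

lemma int_span_sum:
  assumes "\<And>i. i \<in> I \<Longrightarrow> g i \<in> int_span S"
  shows "(\<Sum>i\<in>I. g i) \<in> int_span S"
proof -
  have "(0::complex) = (\<Sum>s\<in>S. of_int 0 * s)" by simp
  then have "0 \<in> int_span S" by (rule int_spanI)
  then show ?thesis using assms
    by (induction I rule: infinite_finite_induct) (auto intro: int_span_add)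
qed

lemma int_span_mult_closed:
  assumes "\<And>s. s \<in> S \<Longrightarrow> x * s \<in> int_span S" "y \<in> int_span S"
  shows "x * y \<in> int_span S"
proof -
  obtain f where "y = (\<Sum>s\<in>S. of_int (f s) * s)" using assms(2) by (auto simp: int_span_def)
  then have "x * y = (\<Sum>s\<in>S. of_int (f s) * (x * s))" by (simp add: sum_distrib_left algebra_simps)
  then show ?thesis using assms(1) by (auto intro: int_span_sum int_span_scale)
qed

text \<open>The elements of S, listed by \<open>h\<close>, are the entries of an eigenvector with
  eigenvalue x of an integer matrix; \<open>u\<close> is there to make this vector nonzero.\<close>

lemma algebraic_int_of_int_span:
  assumes S: "finite S" and u: "u \<in> S" "u \<noteq> 0"
    and closed: "\<And>s. s \<in> S \<Longrightarrow> x * s \<in> int_span S"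
  shows "algebraic_int x"
proof -
  obtain h where h: "bij_betw h {0..<card S} S" using ex_bij_betw_nat_finite[OF S] by blast
  have "\<exists>f. x * s = (\<Sum>t\<in>S. of_int (f t) * t)" if "s \<in> S" for s
    using closed[OF that] by (auto simp: int_span_def)
  then obtain F where F: "\<And>s. s \<in> S \<Longrightarrow> x * s = (\<Sum>t\<in>S. of_int (F s t) * t)"
    by metis
  obtain k where k: "k < card S" "h k = u"
    using h u(1) by (metis atLeastLessThan_iff bij_betw_iff_bijections)
  show ?thesis
  proof (rule algebraic_int_eigenvalue[where v = h and n = "card S" and A = "\<lambda>i j. F (h i) (h j)"])
    fix i assume "i < card S"
    then have "h i \<in> S" using h by (auto simp: bij_betw_def)
    then have "x * h i = (\<Sum>t\<in>S. of_int (F (h i) t) * t)" by (rule F)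
    also have "\<dots> = (\<Sum>j\<in>{0..<card S}. of_int (F (h i) (h j)) * h j)"
      by (rule sum.reindex_bij_betw[OF h, symmetric])
    finally show "x * h i = (\<Sum>j<card S. of_int (F (h i) (h j)) * h j)"
      by (simp add: lessThan_atLeast0)
  qed (use k u in auto)
qed

lemma algebraic_int_power_reduce:
  assumes "algebraic_int (x :: complex)"
  obtains n f where "n > 0" "x ^ n = (\<Sum>i<n. of_int (f i) * x ^ i)"
proof -
  obtain p :: "int poly" where p: "poly (of_int_poly p) x = 0" "lead_coeff p = 1"
    using assms unfolding algebraic_int_altdef_ipoly by blast
  have pos: "degree p > 0"
  proof (rule ccontr)
    assume "\<not> degree p > 0"
    then obtain a where "p = [:a:]" by (meson degree_eq_zeroE gr0I)
    then show False using p by auto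
  qed
  have "0 = (\<Sum>i\<le>degree p. of_int (coeff p i) * x ^ i)"
    using p(1) by (simp add: poly_altdef)
  also have "\<dots> = (\<Sum>i<degree p. of_int (coeff p i) * x ^ i) + x ^ degree p"
    using p(2) by (simp add: lessThan_Suc_atMost[symmetric])
  finally have "x ^ degree p = - (\<Sum>i<degree p. of_int (coeff p i) * x ^ i)"
    by (simp add: eq_neg_iff_add_eq_0 add.commute)
  also have "\<dots> = (\<Sum>i<degree p. of_int (- coeff p i) * x ^ i)" by (simp add: sum_negf)
  finally show ?thesis by (rule that[OF pos])
qed

text \<open>The products \<open>a ^ i * b ^ j\<close>, with exponents below the degrees of monic
  integer polynomials for a and b, generate a group that is stable under multiplication by a and by
  b, hence by their sum and product.\<close>

lemma algebraic_int_add_mult: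
  assumes a: "algebraic_int (a :: complex)" and b: "algebraic_int (b :: complex)"
  shows algebraic_int_add: "algebraic_int (a + b)" and algebraic_int_mult: "algebraic_int (a * b)"
proof -
  obtain m f where m: "m > 0" "a ^ m = (\<Sum>i<m. of_int (f i) * a ^ i)"
    using algebraic_int_power_reduce[OF a] by blast
  obtain n g where n: "n > 0" "b ^ n = (\<Sum>i<n. of_int (g i) * b ^ i)"
    using algebraic_int_power_reduce[OF b] by blast
  define S where "S = (\<lambda>(i, j). a ^ i * b ^ j) ` ({..<m} \<times> {..<n})"
  have fin: "finite S" by (simp add: S_def)
  have mem: "a ^ i * b ^ j \<in> S" if "i < m" "j < n" for i j
    using that by (auto simp: S_def)
  have one: "1 \<in> S" using mem[of 0 0] m n by simp
  have A: "a * s \<in> int_span S" if s: "s \<in> S" for s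
  proof -
    obtain i j where ij: "i < m" "j < n" "s = a ^ i * b ^ j" using s by (auto simp: S_def)
    show ?thesis
    proof (cases "Suc i < m")
      case True
      then show ?thesis using mem[of "Suc i" j] ij int_span_base[OF fin] by (simp add: mult.assoc)
    next
      case False
      then have "Suc i = m" using ij by simp
      then have "a * s = a ^ m * b ^ j" using ij by auto
      also have "\<dots> = (\<Sum>k<m. of_int (f k) * (a ^ k * b ^ j))"
        unfolding m(2) by (simp add: sum_distrib_right mult.assoc)
      finally show ?thesis by (simp, intro int_span_sum int_span_scale int_span_base[OF fin] mem) (use ij in auto)
    qed
  qed
  have B: "b * s \<in> int_span S" if s: "s \<in> S" for s
  proof -
    obtain i j where ij: "i < m" "j < n" "s = a ^ i * b ^ j" using s by (auto simp: S_def)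
    show ?thesis
    proof (cases "Suc j < n")
      case True
      then show ?thesis using mem[of i "Suc j"] ij int_span_base[OF fin]
        by (simp add: mult.left_commute)
    next
      case False
      then have "Suc j = n" using ij by simp
      then have "b * s = a ^ i * b ^ n" using ij by auto
      also have "\<dots> = (\<Sum>k<n. of_int (g k) * (a ^ i * b ^ k))"
        unfolding n(2) by (simp add: sum_distrib_left mult.left_commute)
      finally show ?thesis by (simp, intro int_span_sum int_span_scale int_span_base[OF fin] mem) (use ij in auto)
    qed
  qed
  show "algebraic_int (a + b)"
  proof (rule algebraic_int_of_int_span[OF fin one])
    fix s assume "s \<in> S"
    then have "a * s + b * s \<in> int_span S" by (intro int_span_add A B)
    then show "(a + b) * s \<in> int_span S" by (simp add: algebra_simps)
  qed simp
  show "algebraic_int (a * b)"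
  proof (rule algebraic_int_of_int_span[OF fin one])
    fix s assume "s \<in> S"
    then have "a * (b * s) \<in> int_span S" by (intro int_span_mult_closed[OF A] B)
    then show "(a * b) * s \<in> int_span S" by (simp add: algebra_simps)
  qed simp
qed

lemma algebraic_int_diff: "algebraic_int a \<Longrightarrow> algebraic_int b \<Longrightarrow> algebraic_int (a - b)"
  for a b :: complex
  using algebraic_int_add[of a "- b"] by auto

lemma algebraic_int_power_root:
  assumes "algebraic_int (x ^ n)" "n > 0"
  shows "algebraic_int (x :: complex)"
proof (rule algebraic_int_root[OF assms(1)])
  show "poly (monom 1 n) x = x ^ n" by (simp add: poly_monom)
qed (use assms in \<open>auto simp: degree_monom_eq\<close>)

lemma Rats_algebraic_int_iff: "x \<in> \<rat> \<Longrightarrow> algebraic_int x \<longleftrightarrow> x \<in> \<int>" for x :: complex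
  using rational_algebraic_int_is_int int_imp_algebraic_int by blast

section \<open>Subfields of the complex numbers and their fractional ideals\<close>

lemma complex_field_simps [simp]:
  "carrier complex_field = UNIV" "x \<otimes>\<^bsub>complex_field\<^esub> y = x * y"
  "x \<oplus>\<^bsub>complex_field\<^esub> y = x + y" "\<one>\<^bsub>complex_field\<^esub> = 1" "\<zero>\<^bsub>complex_field\<^esub> = 0"
  by (simp_all add: ring_of_type_algebra_def)

interpretation complex_field: ring complex_field
  by (rule ring_from_type_algebra)

lemma complex_field_a_inv [simp]: "\<ominus>\<^bsub>complex_field\<^esub> x = - x"
  using complex_field.l_neg[of x] by (simp add: eq_neg_iff_add_eq_0)

lemma complex_field_inv [simp]: "x \<noteq> 0 \<Longrightarrow> inv\<^bsub>complex_field\<^esub> x = inverse x"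
  by (rule comm_monoid.comm_inv_char[OF cring.axioms(2)[OF cring_from_type_algebra]]) auto

text \<open>Subfields are handled with the arithmetic of \<open>complex\<close> instead of record
  operations. Since \<open>inverse 0 = 0\<close>, closure under \<open>inverse\<close> holds without
  a side condition, which lets the simplifier discharge memberships.\<close>

locale complex_subfield =
  fixes F :: "complex set"
  assumes one_closed [simp, intro]: "1 \<in> F"
    and diff_closed [simp, intro]: "x \<in> F \<Longrightarrow> y \<in> F \<Longrightarrow> x - y \<in> F"
    and mult_closed [simp, intro]: "x \<in> F \<Longrightarrow> y \<in> F \<Longrightarrow> x * y \<in> F"
    and inverse_closed [simp, intro]: "x \<in> F \<Longrightarrow> inverse x \<in> F"
begin

lemma zero_closed [simp, intro]: "0 \<in> F"
  using diff_closed[of 1 1] by simp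

lemma uminus_closed [simp, intro]: "x \<in> F \<Longrightarrow> - x \<in> F"
  using diff_closed[of 0 x] by simp

lemma add_closed [simp, intro]: "x \<in> F \<Longrightarrow> y \<in> F \<Longrightarrow> x + y \<in> F"
  using diff_closed[of x "- y"] by simp

lemma divide_closed [simp, intro]: "x \<in> F \<Longrightarrow> y \<in> F \<Longrightarrow> x / y \<in> F"
  by (simp add: divide_inverse)

lemma power_closed [simp, intro]: "x \<in> F \<Longrightarrow> x ^ n \<in> F"
  by (induction n) auto

lemma power_int_closed [simp, intro]: "x \<in> F \<Longrightarrow> x powi n \<in> F"
  by (auto simp: power_int_def)

lemma of_nat_closed [simp, intro]: "of_nat n \<in> F"
  by (induction n) auto

lemma of_int_closed [simp, intro]: "of_int n \<in> F"
  by (cases n rule: int_cases2) auto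

lemma numeral_closed [simp, intro]: "numeral n \<in> F"
  using of_nat_closed[of "numeral n"] by simp

lemma Rats_closed [simp, intro]: "x \<in> \<rat> \<Longrightarrow> x \<in> F"
  by (auto elim!: Rats_cases')

lemma mult_cancel_closed: "x * y \<in> F \<Longrightarrow> x \<in> F \<Longrightarrow> x \<noteq> 0 \<Longrightarrow> y \<in> F"
  using divide_closed[of "x * y" x] by simp

end

lemma complex_subfieldI:
  assumes "subfield F complex_field"
  shows "complex_subfield F"
proof
  interpret subfield F complex_field by fact
  show "1 \<in> F" using one_closed by simp
  show mult: "x * y \<in> F" if "x \<in> F" "y \<in> F" for x y
    using m_closed[OF that] by simp
  show "x - y \<in> F" if "x \<in> F" "y \<in> F" for x y
    using subringE(5,7)[OF subfieldE(1)[OF assms]] that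
    by (metis complex_field_a_inv complex_field_simps(3) uminus_add_conv_diff add.commute)
  show "inverse x \<in> F" if "x \<in> F" for x
  proof (cases "x = 0")
    case True
    then show ?thesis using that by simp
  next
    case False
    then show ?thesis
      using complex_field.subfield_m_inv[OF assms, of x] that by simp
  qed
qed

lemma complex_subfield_Rats: "complex_subfield \<rat>"
  by unfold_locales auto

lemma integers_of_Rats: "integers_of \<rat> = \<int>"
  by (auto simp: integers_of_def Rats_algebraic_int_iff Ints_subset_Rats[THEN subsetD] int_imp_algebraic_int)

context complex_subfield
begin

abbreviation \<O> :: "complex set" where "\<O> \<equiv> integers_of F"

lemma O_subset: "x \<in> \<O> \<Longrightarrow> x \<in> F"
  by (simp add: integers_of_def)

lemma O_one [simp, intro]: "1 \<in> \<O>" by (simp add: integers_of_def)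
lemma O_zero [simp, intro]: "0 \<in> \<O>" by (simp add: integers_of_def)
lemma O_add [simp, intro]: "x \<in> \<O> \<Longrightarrow> y \<in> \<O> \<Longrightarrow> x + y \<in> \<O>"
  by (simp add: integers_of_def algebraic_int_add)
lemma O_mult [simp, intro]: "x \<in> \<O> \<Longrightarrow> y \<in> \<O> \<Longrightarrow> x * y \<in> \<O>"
  by (simp add: integers_of_def algebraic_int_mult)
lemma O_uminus [simp, intro]: "x \<in> \<O> \<Longrightarrow> - x \<in> \<O>"
  by (simp add: integers_of_def)
lemma O_diff [simp, intro]: "x \<in> \<O> \<Longrightarrow> y \<in> \<O> \<Longrightarrow> x - y \<in> \<O>"
  by (simp add: integers_of_def algebraic_int_diff)
lemma O_power [simp, intro]: "x \<in> \<O> \<Longrightarrow> x ^ n \<in> \<O>"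
  by (induction n) auto
lemma O_of_int [simp, intro]: "of_int k \<in> \<O>"
  by (simp add: integers_of_def int_imp_algebraic_int)
lemma O_of_nat [simp, intro]: "of_nat k \<in> \<O>"
  by (simp add: integers_of_def int_imp_algebraic_int)
lemma O_numeral [simp, intro]: "numeral k \<in> \<O>"
  by (simp add: integers_of_def int_imp_algebraic_int)
lemma O_root: "x \<in> F \<Longrightarrow> x ^ n \<in> \<O> \<Longrightarrow> n > 0 \<Longrightarrow> x \<in> \<O>"
  by (auto simp: integers_of_def intro: algebraic_int_power_root)

lemma O_clear_denominator:
  assumes "x \<in> F" "algebraic x"
  obtains d :: int where "d > 0" "of_int d * x \<in> \<O>"
proof -
  obtain p where p: "\<And>i. coeff p i \<in> \<int>" "p \<noteq> 0" "poly p x = 0"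
    using assms(2) by (auto simp: algebraic_def)
  define c where "c = lead_coeff p"
  have c: "c \<in> \<int>" "c \<noteq> 0" using p by (auto simp: c_def)
  then obtain k where k: "c = of_int k" by (auto elim: Ints_cases)
  define n where "n = degree p"
  have n: "n > 0"
  proof (rule ccontr)
    assume "\<not> n > 0"
    then obtain a where "p = [:a:]" by (metis degree_eq_zeroE n_def gr0I)
    then show False using p by auto
  qed
  have "algebraic_int (c * x)"
  proof (rule algebraic_int.intros)
    \<comment> \<open>\<open>q\<close> is \<open>c ^ (n - 1)\<close> times p(X / c): it is monic,
      its coefficients are integers, and c x is a root.\<close>
    define q where "q = (\<Sum>i<n. monom (c ^ (n - 1 - i) * coeff p i) i) + monom 1 n"
    have co: "coeff q i = (if i < n then c ^ (n - 1 - i) * coeff p i else if i = n then 1 else 0)" for i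
      by (auto simp: q_def coeff_sum if_distrib sum.delta)
    have deg: "degree q = n"
      by (intro antisym degree_le le_degree) (auto simp: co)
    show "lead_coeff q = 1" by (simp add: deg co)
    show "\<forall>i. coeff q i \<in> \<int>"
      using p(1) c(1) by (auto simp: co)
    have "poly q (c * x) = (\<Sum>i<n. c ^ (n - 1 - i) * coeff p i * (c * x) ^ i) + (c * x) ^ n"
      by (simp add: q_def poly_sum poly_monom)
    also have "(\<Sum>i<n. c ^ (n - 1 - i) * coeff p i * (c * x) ^ i) = (\<Sum>i<n. c ^ (n - 1) * (coeff p i * x ^ i))"
    proof (rule sum.cong)
      fix i assume "i \<in> {..<n}"
      then have "c ^ (n - 1) = c ^ (n - 1 - i) * c ^ i"
        by (simp add: power_add[symmetric])
      then show "c ^ (n - 1 - i) * coeff p i * (c * x) ^ i = c ^ (n - 1) * (coeff p i * x ^ i)"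
        by (simp add: power_mult_distrib)
    qed simp
    also have "(c * x) ^ n = c ^ (n - 1) * (coeff p n * x ^ n)"
    proof -
      have "c ^ n = c ^ (n - 1) * c" using n by (cases n) auto
      moreover have "coeff p n = c" by (simp add: n_def c_def)
      ultimately show ?thesis by (simp add: power_mult_distrib)
    qed
    also have "(\<Sum>i<n. c ^ (n - 1) * (coeff p i * x ^ i)) + c ^ (n - 1) * (coeff p n * x ^ n) =
        c ^ (n - 1) * poly p x"
      by (simp add: poly_altdef n_def sum_distrib_left lessThan_Suc_atMost[symmetric] distrib_left)
    finally show "poly q (c * x) = 0" using p(3) by simp
  qed
  then have "of_int k * x \<in> \<O>" using assms(1) by (simp add: integers_of_def k)
  moreover have "k \<noteq> 0" using c k by auto
  ultimately show ?thesis
    using that[of "\<bar>k\<bar>"] O_uminus[of "of_int k * x"] by (cases "k > 0") auto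
qed

text \<open>The conditions concern I itself, whereas \<open>fractional_ideals\<close> speaks of the
  scaled set d I as an ideal of a record structure. The two notions agree by
  \<open>fractional_ideals_iff\<close>.\<close>

definition is_frac :: "complex set \<Rightarrow> bool" where
  "is_frac I \<longleftrightarrow> (\<exists>x\<in>I. x \<noteq> 0) \<and> 0 \<in> I \<and> (\<forall>x\<in>I. \<forall>y\<in>I. x + y \<in> I) \<and>
     (\<forall>r\<in>\<O>. \<forall>x\<in>I. r * x \<in> I) \<and> (\<exists>d\<in>\<O>. d \<noteq> 0 \<and> (\<forall>x\<in>I. d * x \<in> \<O>))"

lemma integer_ring_simps [simp]:
  "carrier (integer_ring F) = \<O>" "x \<otimes>\<^bsub>integer_ring F\<^esub> y = x * y"
  "x \<oplus>\<^bsub>integer_ring F\<^esub> y = x + y" "\<one>\<^bsub>integer_ring F\<^esub> = 1" "\<zero>\<^bsub>integer_ring F\<^esub> = 0"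
  by (simp_all add: integer_ring_def)

lemma ideal_integer_ring_iff:
  "ideal J (integer_ring F) \<longleftrightarrow> J \<subseteq> \<O> \<and> 0 \<in> J \<and> (\<forall>x\<in>J. \<forall>y\<in>J. x + y \<in> J) \<and> (\<forall>r\<in>\<O>. \<forall>x\<in>J. r * x \<in> J)"
proof
  assume J: "ideal J (integer_ring F)"
  note add = ideal.axioms(1)[OF J]
  show "J \<subseteq> \<O> \<and> 0 \<in> J \<and> (\<forall>x\<in>J. \<forall>y\<in>J. x + y \<in> J) \<and> (\<forall>r\<in>\<O>. \<forall>x\<in>J. r * x \<in> J)"
  proof (intro conjI ballI)
    show "J \<subseteq> \<O>" using additive_subgroup.a_subset[OF add] by simp
    show "0 \<in> J" using additive_subgroup.zero_closed[OF add] by simp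
    show "x + y \<in> J" if "x \<in> J" "y \<in> J" for x y
      using additive_subgroup.a_closed[OF add that] by simp
    show "r * x \<in> J" if "r \<in> \<O>" "x \<in> J" for r x
      using ideal.I_l_closed[OF J that(2), of r] that by simp
  qed
next
  assume J: "J \<subseteq> \<O> \<and> 0 \<in> J \<and> (\<forall>x\<in>J. \<forall>y\<in>J. x + y \<in> J) \<and> (\<forall>r\<in>\<O>. \<forall>x\<in>J. r * x \<in> J)"
  have ring: "ring (integer_ring F)"
    unfolding integer_ring_def
  by (rule complex_field.subring_is_ring, rule complex_field.subringI) auto
  show "ideal J (integer_ring F)"
  proof (rule idealI[OF ring])
    show "subgroup J (add_monoid (integer_ring F))"
    proof (rule group.subgroupI)
      show grp: "Group.group (add_monoid (integer_ring F))"
        by (rule abelian_group.a_group[OF ring.is_abelian_group[OF ring]])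
      fix a assume a: "a \<in> J"
      then have "a \<in> \<O>" "- a \<in> \<O>" using J by auto
      then have "inv\<^bsub>add_monoid (integer_ring F)\<^esub> a = - a"
        by (intro group.inv_equality[OF grp]) auto
      moreover have "- 1 * a \<in> J" using J a O_uminus[OF O_one] by blast
      ultimately show "inv\<^bsub>add_monoid (integer_ring F)\<^esub> a \<in> J" by simp
    qed (use J in auto)
  next
    fix a x assume "a \<in> J" "x \<in> carrier (integer_ring F)"
    then have "x * a \<in> J" using J by simp
    then show "x \<otimes>\<^bsub>integer_ring F\<^esub> a \<in> J" "a \<otimes>\<^bsub>integer_ring F\<^esub> x \<in> J"
      by (simp_all add: mult.commute)
  qed
qed

lemma fractional_ideals_iff: "I \<in> fractional_ideals F \<longleftrightarrow> is_frac I"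
proof
  assume "I \<in> fractional_ideals F"
  then obtain d where d: "I \<noteq> {0}" "d \<in> \<O>" "d \<noteq> 0" "ideal ((\<lambda>x. d * x) ` I) (integer_ring F)"
    by (auto simp: fractional_ideals_def)
  have J: "(\<lambda>x. d * x) ` I \<subseteq> \<O>" "0 \<in> (\<lambda>x. d * x) ` I"
      "\<And>x y. x \<in> I \<Longrightarrow> y \<in> I \<Longrightarrow> d * x + d * y \<in> (\<lambda>x. d * x) ` I"
      "\<And>r x. r \<in> \<O> \<Longrightarrow> x \<in> I \<Longrightarrow> r * (d * x) \<in> (\<lambda>x. d * x) ` I"
    using d(4) unfolding ideal_integer_ring_iff by auto
  have "0 \<in> I" using J(2) d(3) by auto
  moreover from this d(1) have "\<exists>x\<in>I. x \<noteq> 0" by auto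
  moreover have "x + y \<in> I" if xy: "x \<in> I" "y \<in> I" for x y
  proof -
    obtain z where "z \<in> I" "d * x + d * y = d * z" using J(3)[OF xy] by auto
    moreover from this have "z = x + y" using d(3) by (metis distrib_left mult_cancel_left)
    ultimately show ?thesis by simp
  qed
  moreover have "r * x \<in> I" if rx: "r \<in> \<O>" "x \<in> I" for r x
  proof -
    obtain z where "z \<in> I" "r * (d * x) = d * z" using J(4)[OF rx] by auto
    moreover from this have "z = r * x" using d(3) by (metis mult.left_commute mult_cancel_left)
    ultimately show ?thesis by simp
  qed
  moreover have "\<forall>x\<in>I. d * x \<in> \<O>" using J(1) by auto
  ultimately show "is_frac I" using d(2,3) by (auto simp: is_frac_def)
next
  assume I: "is_frac I"
  then obtain d where d: "d \<in> \<O>" "d \<noteq> 0" "\<forall>x\<in>I. d * x \<in> \<O>" by (auto simp: is_frac_def)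
  have I': "0 \<in> I" "\<forall>x\<in>I. \<forall>y\<in>I. x + y \<in> I" "\<forall>r\<in>\<O>. \<forall>x\<in>I. r * x \<in> I" "\<exists>x\<in>I. x \<noteq> 0"
    using I by (simp_all add: is_frac_def)
  have "ideal ((\<lambda>x. d * x) ` I) (integer_ring F)"
    unfolding ideal_integer_ring_iff
  proof (intro conjI ballI)
    show "(\<lambda>x. d * x) ` I \<subseteq> \<O>" using d by auto
    show "0 \<in> (\<lambda>x. d * x) ` I" using I'(1) by (auto intro!: image_eqI[of _ _ 0])
    fix x assume x: "x \<in> (\<lambda>x. d * x) ` I"
    { fix y assume "y \<in> (\<lambda>x. d * x) ` I"
      with x obtain u v where "u \<in> I" "v \<in> I" "x = d * u" "y = d * v" by auto
      then have "x + y = d * (u + v)" "u + v \<in> I" using I'(2) by (auto simp: algebra_simps)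
      then show "x + y \<in> (\<lambda>x. d * x) ` I" by blast }
    { fix r assume r: "r \<in> \<O>"
      from x obtain u where "u \<in> I" "x = d * u" by auto
      then have "r * x = d * (r * u)" "r * u \<in> I" using I'(3) r by (auto simp: algebra_simps)
      then show "r * x \<in> (\<lambda>x. d * x) ` I" by blast }
  qed
  then show "I \<in> fractional_ideals F"
    using I' d by (auto simp: fractional_ideals_def)
qed

end

subsection \<open>Products of sets\<close>

abbreviation idp :: "complex set \<Rightarrow> complex set \<Rightarrow> complex set" (infixl "\<star>" 75) where
  "I \<star> J \<equiv> ideal_prod complex_field I J"

lemma idp_prod: "i \<in> I \<Longrightarrow> j \<in> J \<Longrightarrow> i * j \<in> I \<star> J"
  using ideal_prod.prod[of i I j J complex_field] by simp

lemma idp_sum: "x \<in> I \<star> J \<Longrightarrow> y \<in> I \<star> J \<Longrightarrow> x + y \<in> I \<star> J"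
  using ideal_prod.sum[of x complex_field I J y] by simp

lemma idp_subsetI:
  assumes "\<And>i j. i \<in> I \<Longrightarrow> j \<in> J \<Longrightarrow> i * j \<in> S" "\<And>x y. x \<in> S \<Longrightarrow> y \<in> S \<Longrightarrow> x + y \<in> S"
  shows "I \<star> J \<subseteq> S"
proof
  fix x assume "x \<in> I \<star> J"
  then show "x \<in> S" by (induction rule: ideal_prod.induct) (auto intro: assms)
qed

lemma idp_commute: "I \<star> J = J \<star> I"
proof -
  have "I \<star> J \<subseteq> J \<star> I" for I J
  proof (rule idp_subsetI)
    show "i * j \<in> J \<star> I" if "i \<in> I" "j \<in> J" for i j
      using idp_prod[OF that(2,1)] by (simp add: mult.commute)
  qed (rule idp_sum)
  then show ?thesis by blast
qed

lemma idp_assoc: "(I \<star> J) \<star> L = I \<star> (J \<star> L)"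
proof -
  have half: "(I \<star> J) \<star> L \<subseteq> I \<star> (J \<star> L)" for I J L
  proof (rule idp_subsetI)
    fix x l assume "x \<in> I \<star> J" and l: "l \<in> L"
    then show "x * l \<in> I \<star> (J \<star> L)"
    proof (induction rule: ideal_prod.induct)
      case (prod i j)
      then have "i * (j * l) \<in> I \<star> (J \<star> L)" using l by (intro idp_prod)
      then show ?case by (simp add: mult.assoc)
    next
      case (sum s1 s2)
      then have "s1 * l + s2 * l \<in> I \<star> (J \<star> L)" using l by (intro idp_sum) auto
      then show ?case by (simp add: distrib_right)
    qed
  qed (rule idp_sum)
  \<comment> \<open>By commutativity the reverse inclusion is the first one for the factors in
    reverse order.\<close>
  have "I \<star> (J \<star> L) = (L \<star> J) \<star> I" by (simp add: idp_commute)
  also have "\<dots> \<subseteq> L \<star> (J \<star> I)" by (rule half)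
  also have "\<dots> = (I \<star> J) \<star> L" by (simp add: idp_commute)
  finally show ?thesis using half[of I J L] by blast
qed

lemma idp_left_commute: "I \<star> (J \<star> L) = J \<star> (I \<star> L)"
  by (metis idp_assoc idp_commute)

lemmas idp_ac = idp_assoc idp_commute idp_left_commute

lemma idp_mono: "I \<subseteq> I' \<Longrightarrow> J \<subseteq> J' \<Longrightarrow> I \<star> J \<subseteq> I' \<star> J'"
  by (rule idp_subsetI) (blast intro: idp_prod, rule idp_sum)

lemma idp_scale: "(\<lambda>y. x * y) ` I \<star> J = (\<lambda>y. x * y) ` (I \<star> J)"
proof
  show "(\<lambda>y. x * y) ` I \<star> J \<subseteq> (\<lambda>y. x * y) ` (I \<star> J)"
  proof (rule idp_subsetI)
    fix u v assume "u \<in> (\<lambda>y. x * y) ` (I \<star> J)" "v \<in> (\<lambda>y. x * y) ` (I \<star> J)"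
    then obtain a b where "u = x * a" "v = x * b" "a \<in> I \<star> J" "b \<in> I \<star> J" by blast
    then show "u + v \<in> (\<lambda>y. x * y) ` (I \<star> J)"
      by (intro image_eqI[of _ _ "a + b"]) (auto intro: idp_sum simp: distrib_left)
  qed (auto simp: mult.assoc intro: idp_prod)
  show "(\<lambda>y. x * y) ` (I \<star> J) \<subseteq> (\<lambda>y. x * y) ` I \<star> J"
  proof clarify
    fix y assume "y \<in> I \<star> J"
    then show "x * y \<in> (\<lambda>y. x * y) ` I \<star> J"
    proof (induction rule: ideal_prod.induct)
      case (prod i j)
      then have "(x * i) * j \<in> (\<lambda>y. x * y) ` I \<star> J" by (intro idp_prod) auto
      then show ?case by (simp add: mult.assoc)
    next
      case (sum s1 s2)
      then have "x * s1 + x * s2 \<in> (\<lambda>y. x * y) ` I \<star> J" by (intro idp_sum) auto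
      then show ?case by (simp add: distrib_left)
    qed
  qed
qed

context complex_subfield
begin

text \<open>Absorbing the ring of integers in a product requires neither a nonzero element nor a
  bounded denominator. This weaker notion therefore serves for cancellation and holds for every
  \<open>principal_ideal\<close>, in any subfield.\<close>

definition is_module :: "complex set \<Rightarrow> bool" where
  "is_module I \<longleftrightarrow> 0 \<in> I \<and> (\<forall>x\<in>I. \<forall>y\<in>I. x + y \<in> I) \<and> (\<forall>r\<in>\<O>. \<forall>x\<in>I. r * x \<in> I)"

lemma is_moduleD:
  assumes "is_module I"
  shows "0 \<in> I" "x \<in> I \<Longrightarrow> y \<in> I \<Longrightarrow> x + y \<in> I" "r \<in> \<O> \<Longrightarrow> x \<in> I \<Longrightarrow> r * x \<in> I"
    "x \<in> I \<Longrightarrow> - x \<in> I" "x \<in> I \<Longrightarrow> y \<in> I \<Longrightarrow> x - y \<in> I"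
proof -
  have *: "0 \<in> I" "\<And>x y. x \<in> I \<Longrightarrow> y \<in> I \<Longrightarrow> x + y \<in> I" "\<And>r x. r \<in> \<O> \<Longrightarrow> x \<in> I \<Longrightarrow> r * x \<in> I"
    using assms by (auto simp: is_module_def)
  have m: "- x \<in> I" if "x \<in> I" for x
    using *(3)[OF _ that, of "- 1"] O_uminus[OF O_one] by simp
  show "0 \<in> I" "x \<in> I \<Longrightarrow> y \<in> I \<Longrightarrow> x + y \<in> I" "r \<in> \<O> \<Longrightarrow> x \<in> I \<Longrightarrow> r * x \<in> I"
    "x \<in> I \<Longrightarrow> - x \<in> I"
    using * m by auto
  show "x \<in> I \<Longrightarrow> y \<in> I \<Longrightarrow> x - y \<in> I" using *(2)[of x "- y"] m by simp
qed

lemma is_frac_alt: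
  "is_frac I \<longleftrightarrow> is_module I \<and> (\<exists>x\<in>I. x \<noteq> 0) \<and> (\<exists>d\<in>\<O>. d \<noteq> 0 \<and> (\<forall>x\<in>I. d * x \<in> \<O>))"
  unfolding is_frac_def is_module_def by blast

lemma is_frac_module: "is_frac I \<Longrightarrow> is_module I"
  by (simp add: is_frac_alt)

lemma is_frac_subset: "is_frac I \<Longrightarrow> I \<subseteq> F"
proof
  fix x assume I: "is_frac I" and x: "x \<in> I"
  then obtain d where "d \<in> \<O>" "d \<noteq> 0" "d * x \<in> \<O>" unfolding is_frac_def by blast
  then show "x \<in> F" using mult_cancel_closed O_subset by blast
qed

lemma idp_O [simp]:
  assumes "is_module I" shows "I \<star> \<O> = I" "\<O> \<star> I = I"
proof -
  show "I \<star> \<O> = I"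
  proof
    show "I \<star> \<O> \<subseteq> I"
    proof (rule idp_subsetI)
      show "i * j \<in> I" if "i \<in> I" "j \<in> \<O>" for i j
        using is_moduleD(3)[OF assms that(2,1)] by (simp add: mult.commute)
    qed (rule is_moduleD(2)[OF assms])
    show "I \<subseteq> I \<star> \<O>" using idp_prod[of _ I 1 \<O>] by auto
  qed
  then show "\<O> \<star> I = I" by (simp add: idp_commute)
qed

lemma is_module_O: "is_module \<O>"
  by (auto simp: is_module_def)

lemma is_frac_O: "is_frac \<O>"
  by (auto simp: is_frac_alt is_module_O intro: bexI[of _ 1])

lemma idp_O_O [simp]: "\<O> \<star> \<O> = \<O>"
  by (simp add: is_module_O)

lemma is_module_idp: "is_module J \<Longrightarrow> I \<noteq> {} \<Longrightarrow> is_module (I \<star> J)"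
  unfolding is_module_def
proof (intro conjI ballI; elim conjE)
  assume J: "0 \<in> J" "\<forall>r\<in>\<O>. \<forall>x\<in>J. r * x \<in> J" and "I \<noteq> {}"
  then show "0 \<in> I \<star> J" using idp_prod[of _ I 0 J] by auto
  fix x assume x: "x \<in> I \<star> J"
  show "x + y \<in> I \<star> J" if "y \<in> I \<star> J" for y using x that by (rule idp_sum)
  fix r assume r: "r \<in> \<O>"
  from x show "r * x \<in> I \<star> J"
  proof (induction rule: ideal_prod.induct)
    case (prod i j)
    then have "i * (r * j) \<in> I \<star> J" using J r by (intro idp_prod) auto
    then show ?case by (simp add: mult.left_commute)
  next
    case (sum s1 s2)
    then have "r * s1 + r * s2 \<in> I \<star> J" by (intro idp_sum) auto
    then show ?case by (simp add: distrib_left)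
  qed
qed

lemma is_frac_idp:
  assumes I: "is_frac I" and J: "is_frac J"
  shows "is_frac (I \<star> J)"
  unfolding is_frac_alt
proof (intro conjI)
  obtain i j where ij: "i \<in> I" "j \<in> J" "i \<noteq> 0" "j \<noteq> 0" using I J by (auto simp: is_frac_alt)
  then show "is_module (I \<star> J)" using is_module_idp J by (auto simp: is_frac_alt)
  show "\<exists>x\<in>I \<star> J. x \<noteq> 0" using ij by (intro bexI[of _ "i * j"] idp_prod) auto
  obtain d e where d: "d \<in> \<O>" "d \<noteq> 0" "\<And>x. x \<in> I \<Longrightarrow> d * x \<in> \<O>"
    and e: "e \<in> \<O>" "e \<noteq> 0" "\<And>x. x \<in> J \<Longrightarrow> e * x \<in> \<O>" using I J unfolding is_frac_alt by auto
  have "d * e * x \<in> \<O>" if "x \<in> I \<star> J" for x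
    using that
  proof (induction rule: ideal_prod.induct)
    case (prod i j)
    then have "(d * i) * (e * j) \<in> \<O>" using d e by blast
    then show ?case by (simp add: algebra_simps)
  qed (auto simp: distrib_left)
  then show "\<exists>d\<in>\<O>. d \<noteq> 0 \<and> (\<forall>x\<in>I \<star> J. d * x \<in> \<O>)"
    using d e by (intro bexI[of _ "d * e"]) auto
qed

abbreviation pid :: "complex \<Rightarrow> complex set" where "pid \<equiv> principal_ideal F"

lemma pid_1 [simp]: "pid 1 = \<O>"
  by (simp add: principal_ideal_def)

lemma pid_mult: "pid x \<star> pid y = pid (x * y)"
proof -
  have "pid x \<star> pid y = (\<lambda>z. x * z) ` (\<O> \<star> pid y)"
    unfolding principal_ideal_def by (rule idp_scale)
  also have "\<O> \<star> pid y = (\<lambda>z. y * z) ` (\<O> \<star> \<O>)"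
    unfolding principal_ideal_def by (subst idp_commute) (rule idp_scale)
  finally show ?thesis by (auto simp: principal_ideal_def image_image mult.assoc)
qed

lemma pid_idp: "is_module I \<Longrightarrow> pid x \<star> I = (\<lambda>z. x * z) ` I"
  unfolding principal_ideal_def by (simp add: idp_scale)

lemma pid_self: "x \<in> pid x"
  unfolding principal_ideal_def by (auto intro: image_eqI[of _ _ 1])

lemma is_module_pid: "is_module (pid x)"
  unfolding is_module_def
proof (intro conjI ballI)
  show "0 \<in> pid x" unfolding principal_ideal_def by (intro image_eqI[of _ _ 0]) auto
  fix y assume "y \<in> pid x"
  then obtain u where u: "u \<in> \<O>" "y = x * u" by (auto simp: principal_ideal_def)
  show "y + z \<in> pid x" if "z \<in> pid x" for z
  proof -
    obtain v where "v \<in> \<O>" "z = x * v" using \<open>z \<in> pid x\<close> by (auto simp: principal_ideal_def)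
    then show ?thesis using u unfolding principal_ideal_def
      by (intro image_eqI[of _ _ "u + v"]) (auto simp: distrib_left)
  qed
  show "r * y \<in> pid x" if "r \<in> \<O>" for r
    using u that unfolding principal_ideal_def by (intro image_eqI[of _ _ "r * u"]) auto
qed

lemma pid_subset_iff: "is_module I \<Longrightarrow> pid x \<subseteq> I \<longleftrightarrow> x \<in> I"
  using pid_self[of x] by (auto simp: principal_ideal_def is_module_def mult.commute)

lemma pid_eq_O_iff: "x \<noteq> 0 \<Longrightarrow> pid x = \<O> \<longleftrightarrow> x \<in> \<O> \<and> inverse x \<in> \<O>"
proof
  assume x: "x \<noteq> 0" and eq: "pid x = \<O>"
  have "1 \<in> pid x" "x \<in> \<O>" using eq pid_self[of x] by auto
  then obtain y where y: "y \<in> \<O>" "1 = x * y" by (auto simp: principal_ideal_def)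
  then have "y = inverse x" using x by (metis inverse_unique)
  then show "x \<in> \<O> \<and> inverse x \<in> \<O>" using y \<open>x \<in> \<O>\<close> by simp
next
  assume x: "x \<noteq> 0" and h: "x \<in> \<O> \<and> inverse x \<in> \<O>"
  have "y \<in> pid x" if "y \<in> \<O>" for y
    unfolding principal_ideal_def using x h that by (intro image_eqI[of _ _ "inverse x * y"]) auto
  then show "pid x = \<O>" using h by (auto simp: principal_ideal_def)
qed

lemma pid_eq_iff:
  assumes "x \<noteq> 0" "y \<noteq> 0"
  shows "pid x = pid y \<longleftrightarrow> x / y \<in> \<O> \<and> y / x \<in> \<O>"
proof -
  have "pid x = pid y \<longleftrightarrow> pid (x / y) = \<O>"
  proof
    assume "pid x = pid y"
    then have "pid (inverse y) \<star> pid x = pid (inverse y) \<star> pid y" by simp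
    then show "pid (x / y) = \<O>" using assms by (simp add: pid_mult field_simps)
  next
    assume "pid (x / y) = \<O>"
    then have "pid y \<star> pid (x / y) = pid y \<star> \<O>" by simp
    then show "pid x = pid y" using assms by (simp add: pid_mult is_module_pid)
  qed
  then show ?thesis using assms by (simp add: pid_eq_O_iff field_simps)
qed

lemma ideal_group_simps [simp]:
  "carrier (ideal_group F) = fractional_ideals F" "I \<otimes>\<^bsub>ideal_group F\<^esub> J = I \<star> J"
  "\<one>\<^bsub>ideal_group F\<^esub> = \<O>"
  by (simp_all add: ideal_group_def)

end

lemma extension_idp:
  assumes "complex_subfield E"
  shows "ideal_extension E (I \<star> J) = ideal_extension E I \<star> ideal_extension E J"
proof -
  interpret complex_subfield E by fact
  have "ideal_extension E I \<star> ideal_extension E J = (I \<star> J) \<star> (\<O> \<star> \<O>)"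
    unfolding ideal_extension_def by (simp only: idp_ac)
  then show ?thesis by (simp add: ideal_extension_def)
qed

section \<open>Ideals of quadratic fields\<close>

locale field_endo = complex_subfield F for F +
  fixes s :: "complex \<Rightarrow> complex"
  assumes s_add [simp]: "x \<in> F \<Longrightarrow> y \<in> F \<Longrightarrow> s (x + y) = s x + s y"
    and s_mult [simp]: "x \<in> F \<Longrightarrow> y \<in> F \<Longrightarrow> s (x * y) = s x * s y"
    and s_one [simp]: "s 1 = 1"
    and s_closed [simp, intro]: "x \<in> F \<Longrightarrow> s x \<in> F"
begin

lemma s_zero [simp]: "s 0 = 0"
  using s_add[of 0 0] by simp

lemma s_uminus [simp]: "x \<in> F \<Longrightarrow> s (- x) = - s x"
  using s_add[of x "- x"] by (simp add: eq_neg_iff_add_eq_0 add.commute)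

lemma s_diff [simp]: "x \<in> F \<Longrightarrow> y \<in> F \<Longrightarrow> s (x - y) = s x - s y"
  using s_add[of x "- y"] by simp

lemma s_eq_0_iff [simp]: "x \<in> F \<Longrightarrow> s x = 0 \<longleftrightarrow> x = 0"
proof
  assume x: "x \<in> F" "s x = 0"
  show "x = 0"
  proof (rule ccontr)
    assume "x \<noteq> 0"
    then have "s (x * inverse x) = 1" by simp
    then show False using x by simp
  qed
qed simp

lemma s_inverse [simp]: "x \<in> F \<Longrightarrow> s (inverse x) = inverse (s x)"
proof (cases "x = 0")
  case False
  assume "x \<in> F"
  then have "s x * s (inverse x) = 1"
    using False by (subst s_mult[symmetric]) auto
  then show ?thesis by (simp add: inverse_unique)
qed simp

lemma s_divide [simp]: "x \<in> F \<Longrightarrow> y \<in> F \<Longrightarrow> s (x / y) = s x / s y"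
  by (simp add: divide_inverse)

lemma s_power [simp]: "x \<in> F \<Longrightarrow> s (x ^ n) = s x ^ n"
  by (induction n) auto

lemma s_of_nat [simp]: "s (of_nat n) = of_nat n"
  by (induction n) auto

lemma s_of_int [simp]: "s (of_int n) = of_int n"
  by (cases n rule: int_cases2) auto

lemma s_numeral [simp]: "s (numeral n) = numeral n"
  using s_of_nat[of "numeral n"] by simp

lemma s_Rats: "x \<in> \<rat> \<Longrightarrow> s x = x"
  by (auto elim!: Rats_cases')

lemma s_inj: "x \<in> F \<Longrightarrow> y \<in> F \<Longrightarrow> s x = s y \<longleftrightarrow> x = y"
  using s_eq_0_iff[of "x - y"] by auto

lemma s_sum: "(\<And>i. i \<in> I \<Longrightarrow> g i \<in> F) \<Longrightarrow> s (\<Sum>i\<in>I. g i) = (\<Sum>i\<in>I. s (g i)) \<and> (\<Sum>i\<in>I. g i) \<in> F"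
  by (induction I rule: infinite_finite_induct) auto

lemma algebraic_int_s: "x \<in> F \<Longrightarrow> algebraic_int x \<Longrightarrow> algebraic_int (s x)"
proof -
  assume x: "x \<in> F" "algebraic_int x"
  then obtain p :: "int poly" where p: "poly (of_int_poly p) x = 0" "lead_coeff p = 1"
    unfolding algebraic_int_altdef_ipoly by blast
  have "poly (of_int_poly p) (s x) = s (poly (of_int_poly p) x)"
    using s_sum[of "{..degree p}" "\<lambda>i. of_int (coeff p i) * x ^ i"] x(1)
    by (simp add: poly_altdef)
  then show "algebraic_int (s x)" using p unfolding algebraic_int_altdef_ipoly by auto
qed

lemma O_s [simp, intro]: "x \<in> \<O> \<Longrightarrow> s x \<in> \<O>"
  by (simp add: integers_of_def algebraic_int_s)

lemma s_idp:
  assumes "I \<subseteq> F" "J \<subseteq> F"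
  shows "s ` (I \<star> J) = s ` I \<star> s ` J"
proof
  have sub: "I \<star> J \<subseteq> F" using assms by (intro idp_subsetI) auto
  show "s ` (I \<star> J) \<subseteq> s ` I \<star> s ` J"
  proof clarify
    fix x assume "x \<in> I \<star> J"
    then show "s x \<in> s ` I \<star> s ` J"
    proof (induction rule: ideal_prod.induct)
      case (prod i j)
      then have "s i * s j \<in> s ` I \<star> s ` J" by (intro idp_prod) auto
      then show ?case using prod assms by (simp add: subsetD)
    next
      case (sum x y)
      then have "s x + s y \<in> s ` I \<star> s ` J" by (intro idp_sum)
      then show ?case using sum sub by (simp add: subsetD)
    qed
  qed
  show "s ` I \<star> s ` J \<subseteq> s ` (I \<star> J)"
  proof (rule idp_subsetI)
    fix x y assume "x \<in> s ` I" "y \<in> s ` J"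
    then obtain i j where "i \<in> I" "j \<in> J" "x = s i" "y = s j" by auto
    moreover from this have "x * y = s (i * j)" using assms by (simp add: subsetD)
    ultimately show "x * y \<in> s ` (I \<star> J)" using idp_prod by blast
  next
    fix x y assume "x \<in> s ` (I \<star> J)" "y \<in> s ` (I \<star> J)"
    then obtain i j where ij: "i \<in> I \<star> J" "j \<in> I \<star> J" "x = s i" "y = s j" by auto
    moreover from this have "x + y = s (i + j)" using sub by (simp add: subsetD)
    moreover have "i + j \<in> I \<star> J" using ij(1,2) by (rule idp_sum)
    ultimately show "x + y \<in> s ` (I \<star> J)" by blast
  qed
qed

end

text \<open>The quadratic field is given through its conjugation \<open>s\<close>: trace and norm
  are fixed by \<open>s\<close>, hence rational, and they decide integrality in
  \<open>O_quadratic\<close>.\<close>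

locale quadratic_field = field_endo +
  assumes s_s [simp]: "x \<in> F \<Longrightarrow> s (s x) = x"
    and s_fixed: "x \<in> F \<Longrightarrow> s x = x \<Longrightarrow> x \<in> \<rat>"
    and s_nontrivial: "\<exists>x\<in>F. s x \<noteq> x"
begin

lemma nrm_Rats: "x \<in> F \<Longrightarrow> x * s x \<in> \<rat>"
  by (rule s_fixed) (auto simp: mult.commute)

lemma tr_Rats: "x \<in> F \<Longrightarrow> x + s x \<in> \<rat>"
  by (rule s_fixed) (auto simp: add.commute)

lemma O_Rats: "x \<in> \<O> \<Longrightarrow> x \<in> \<rat> \<Longrightarrow> x \<in> \<int>"
  by (simp add: integers_of_def Rats_algebraic_int_iff)

lemma nrm_Ints: "x \<in> \<O> \<Longrightarrow> x * s x \<in> \<int>"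
  by (rule O_Rats) (auto intro: nrm_Rats O_subset)

lemma tr_Ints: "x \<in> \<O> \<Longrightarrow> x + s x \<in> \<int>"
  by (rule O_Rats) (auto intro: tr_Rats O_subset)

lemma O_quadratic:
  assumes "x \<in> F" "x + s x \<in> \<int>" "x * s x \<in> \<int>"
  shows "x \<in> \<O>"
proof -
  have "algebraic_int x"
  proof (rule algebraic_int.intros)
    show "lead_coeff [:x * s x, - (x + s x), 1:] = 1" by simp
    show "poly [:x * s x, - (x + s x), 1:] x = 0" by (simp add: algebra_simps)
    show "\<forall>i. coeff [:x * s x, - (x + s x), 1:] i \<in> \<int>"
      using assms(3) Ints_minus[OF assms(2)] by (auto simp: coeff_pCons split: nat.splits)
  qed
  then show ?thesis using assms(1) by (simp add: integers_of_def)
qed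

lemma F_algebraic: "x \<in> F \<Longrightarrow> algebraic x"
proof -
  assume x: "x \<in> F"
  show "algebraic x"
  proof (subst algebraic_altdef, intro exI conjI)
    show "poly [:x * s x, - (x + s x), 1:] x = 0" by (simp add: algebra_simps)
    show "\<forall>i. coeff [:x * s x, - (x + s x), 1:] i \<in> \<rat>"
      using nrm_Rats[OF x] Rats_minus_iff[THEN iffD2, OF tr_Rats[OF x]] by (auto simp: coeff_pCons split: nat.splits)
  qed auto
qed

lemma clear_denominator:
  assumes "x \<in> F" obtains d :: int where "d > 0" "of_int d * x \<in> \<O>"
  using O_clear_denominator[OF assms F_algebraic[OF assms]] by blast

lemma s_image_module: "is_module I \<Longrightarrow> I \<subseteq> F \<Longrightarrow> is_module (s ` I)"
  unfolding is_module_def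
proof (intro conjI ballI; elim conjE)
  assume I: "0 \<in> I" "\<forall>x\<in>I. \<forall>y\<in>I. x + y \<in> I" "\<forall>r\<in>\<O>. \<forall>x\<in>I. r * x \<in> I" "I \<subseteq> F"
  then show "0 \<in> s ` I" by (intro image_eqI[of _ _ 0]) auto
  fix x assume "x \<in> s ` I"
  then obtain u where u: "u \<in> I" "x = s u" by auto
  show "x + y \<in> s ` I" if y: "y \<in> s ` I" for y
  proof -
    obtain v where "v \<in> I" "y = s v" using y by auto
    then show ?thesis using I u by (intro image_eqI[of _ _ "u + v"]) (auto simp: subsetD)
  qed
  fix r assume r: "r \<in> \<O>"
  then show "r * x \<in> s ` I" using I u
    by (intro image_eqI[of _ _ "s r * u"]) (auto simp: subsetD O_subset)
qed

lemma s_image_frac: "is_frac I \<Longrightarrow> is_frac (s ` I)"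
proof -
  assume I: "is_frac I"
  then have sub: "I \<subseteq> F" by (rule is_frac_subset)
  obtain x where "x \<in> I" "x \<noteq> 0" using I by (auto simp: is_frac_alt)
  then have 1: "\<exists>x\<in>s ` I. x \<noteq> 0" using sub by (intro bexI[of _ "s x"]) (auto simp: subsetD)
  obtain d where d: "d \<in> \<O>" "d \<noteq> 0" "\<And>x. x \<in> I \<Longrightarrow> d * x \<in> \<O>" using I by (auto simp: is_frac_alt)
  have "s d * s x \<in> \<O>" if "x \<in> I" for x
    using O_s[OF d(3)[OF that]] that sub d(1) by (simp add: subsetD O_subset)
  then have "\<exists>d\<in>\<O>. d \<noteq> 0 \<and> (\<forall>x\<in>s ` I. d * x \<in> \<O>)"
    using d by (intro bexI[of _ "s d"]) (auto simp: O_subset)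
  then show "is_frac (s ` I)"
    using 1 s_image_module[OF is_frac_module[OF I] sub] by (simp add: is_frac_alt)
qed

lemma s_image_O [simp]: "s ` \<O> = \<O>"
proof
  show "\<O> \<subseteq> s ` \<O>"
  proof
    fix x assume "x \<in> \<O>"
    then show "x \<in> s ` \<O>" by (intro image_eqI[of _ _ "s x"]) (auto simp: O_subset)
  qed
qed auto

lemma s_image_pid: "x \<in> F \<Longrightarrow> s ` pid x = pid (s x)"
proof -
  assume x: "x \<in> F"
  have "s ` pid x = (\<lambda>y. s x * s y) ` \<O>"
    unfolding principal_ideal_def image_image using x O_subset by (intro image_cong) auto
  also have "\<dots> = (\<lambda>y. s x * y) ` (s ` \<O>)" by (simp only: image_image)
  finally show ?thesis by (simp add: principal_ideal_def)
qed

lemma is_frac_pid: "x \<in> F \<Longrightarrow> x \<noteq> 0 \<Longrightarrow> is_frac (pid x)"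
proof -
  assume x: "x \<in> F" "x \<noteq> 0"
  obtain d :: int where d: "d > 0" "of_int d * x \<in> \<O>" using clear_denominator x by blast
  then have "\<forall>y\<in>pid x. of_int d * y \<in> \<O>"
    by (auto simp: principal_ideal_def mult.assoc[symmetric])
  then show ?thesis
    unfolding is_frac_alt using d x is_module_pid pid_self[of x]
    by (intro conjI bexI[of _ "of_int d"] bexI[of _ x]) auto
qed

text \<open>All the integers \<open>x * s x\<close> and \<open>x * s y + y * s x\<close> for \<open>x\<close>, \<open>y\<close> in \<open>I\<close> are multiples of the
  least positive integer \<open>g\<close> of \<open>I \<star> s ` I\<close>, so \<open>x * s y / g\<close> has integral trace and norm.\<close>

lemma integral_norm:
  assumes I: "is_frac I" "I \<subseteq> \<O>"
  obtains g :: nat where "g > 0" "I \<star> s ` I = pid (of_nat g)"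
proof -
  note modI = is_frac_module[OF I(1)]
  have sF: "I \<subseteq> F" using I(2) O_subset by auto
  have modJ: "is_module (I \<star> s ` I)"
    using is_frac_idp[OF I(1) s_image_frac[OF I(1)]] by (rule is_frac_module)
  have ints: "x * s x \<in> I \<star> s ` I" "x * s y + y * s x \<in> I \<star> s ` I" if "x \<in> I" "y \<in> I" for x y
    using that by (auto intro!: idp_prod idp_sum)
  define H where "H = {k::int. of_int k \<in> I \<star> s ` I}"
  have H0: "j - q * k \<in> H" if "j \<in> H" "k \<in> H" for j k q
    using that is_moduleD(5)[OF modJ _ is_moduleD(3)[OF modJ, of "of_int q"]] by (simp add: H_def)
  obtain x where x: "x \<in> I" "x \<noteq> 0" using I by (auto simp: is_frac_alt)
  obtain k0 where k0: "x * s x = of_int k0" using nrm_Ints[of x] I(2) x(1) by (auto elim: Ints_cases)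
  have "x * s x \<noteq> 0" using x sF by (auto simp: subsetD)
  then have "k0 \<noteq> 0" using k0 by auto
  moreover have "k0 \<in> H" using ints(1)[OF x(1) x(1)] k0 by (simp add: H_def)
  moreover from this have "- k0 \<in> H" using H0[of k0 k0 2] by simp
  ultimately have "\<exists>n::nat. n > 0 \<and> int n \<in> H"
    by (intro exI[of _ "nat \<bar>k0\<bar>"]) (auto simp: abs_if)
  define g where "g = (LEAST n::nat. n > 0 \<and> int n \<in> H)"
  have g: "g > 0" "int g \<in> H" and least: "\<And>n. n > 0 \<Longrightarrow> int n \<in> H \<Longrightarrow> g \<le> n"
    using LeastI_ex[OF \<open>\<exists>n::nat. n > 0 \<and> int n \<in> H\<close>] Least_le[of "\<lambda>n. n > 0 \<and> int n \<in> H"]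
    unfolding g_def by auto
  have dvd: "int g dvd k" if k: "k \<in> H" for k
  proof -
    have "k mod int g \<in> H" using H0[OF k g(2), of "k div int g"]
      by (simp add: minus_div_mult_eq_mod)
    then have "0 < k mod int g \<Longrightarrow> g \<le> nat (k mod int g)" using least by simp
    then have "\<not> 0 < k mod int g"
      using least[of "nat (k mod int g)"] g(1) pos_mod_bound[of "int g" k] by linarith
    then show ?thesis using g(1) by (metis dvd_eq_mod_eq_0 of_nat_0_less_iff pos_mod_sign order_le_less)
  qed
  have gdiv: "z / of_nat g \<in> \<int>" if z: "z \<in> I \<star> s ` I" "z \<in> \<int>" for z :: complex
  proof -
    obtain k where k: "z = of_int k" using z(2) by (auto elim: Ints_cases)
    then obtain l where "k = int g * l" using dvd[of k] z(1) by (auto simp: H_def)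
    then have "z / of_nat g = of_int l" using k g(1) by simp
    then show ?thesis by simp
  qed
  have prod: "x * s y \<in> pid (of_nat g)" if xy: "x \<in> I" "y \<in> I" for x y
  proof -
    have O: "x \<in> \<O>" "y \<in> \<O>" "x \<in> F" "y \<in> F" using xy I(2) sF by auto
    define w where "w = x * s y / of_nat g"
    have sw: "s w = y * s x / of_nat g" unfolding w_def using O(3,4) by simp
    have "w + s w = (x * s y + y * s x) / of_nat g" unfolding sw by (simp add: w_def add_divide_distrib)
    moreover have "x * s y + y * s x \<in> \<int>"
      using tr_Ints[of "x * s y"] O by (simp add: mult.commute)
    ultimately have 1: "w + s w \<in> \<int>" using gdiv ints(2)[OF xy] by simp
    have "w * s w = (x * s x / of_nat g) * (y * s y / of_nat g)" unfolding sw by (simp add: w_def)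
    moreover have "x * s x / of_nat g \<in> \<int>" "y * s y / of_nat g \<in> \<int>"
      using gdiv ints(1) xy nrm_Ints O by auto
    ultimately have "w * s w \<in> \<int>" by (simp only: Ints_mult)
    then have "w \<in> \<O>" using 1 O by (intro O_quadratic) (auto simp: w_def)
    moreover have "x * s y = of_nat g * w" using g(1) by (simp add: w_def)
    ultimately show ?thesis unfolding principal_ideal_def by blast
  qed
  have "I \<star> s ` I = pid (of_nat g)"
  proof
    show "I \<star> s ` I \<subseteq> pid (of_nat g)"
      using is_moduleD(2)[OF is_module_pid] prod by (intro idp_subsetI) auto
    show "pid (of_nat g) \<subseteq> I \<star> s ` I"
      using g(2) pid_subset_iff[OF modJ] by (simp add: H_def)
  qed
  then show ?thesis using that g(1) by blast
qed

text \<open>Clearing denominators by d multiplies the product of I with its conjugate by the nonzero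
  rational number \<open>d * s d\<close>, which reduces the claim to the integral case.\<close>

lemma frac_norm:
  assumes I: "is_frac I"
  obtains r where "r \<in> \<rat>" "r \<noteq> 0" "I \<star> s ` I = pid r"
proof -
  obtain d where d: "d \<in> \<O>" "d \<noteq> 0" "\<And>x. x \<in> I \<Longrightarrow> d * x \<in> \<O>" using I by (auto simp: is_frac_alt)
  have dF: "d \<in> F" using d(1) by (rule O_subset)
  let ?J = "pid d \<star> I"
  have J: "?J = (\<lambda>z. d * z) ` I" using I by (simp add: pid_idp is_frac_module)
  have "is_frac ?J" using is_frac_idp[OF is_frac_pid[OF dF d(2)] I] .
  moreover have "?J \<subseteq> \<O>" using d(3) J by auto
  ultimately obtain g :: nat where g: "g > 0" "?J \<star> s ` ?J = pid (of_nat g)"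
    by (rule integral_norm)
  have IF: "I \<subseteq> F" "pid d \<subseteq> F" using is_frac_subset I is_frac_pid[OF dF d(2)] by blast+
  have "s ` ?J = pid (s d) \<star> s ` I" using s_idp[OF IF(2,1)] s_image_pid[OF dF] by simp
  then have "pid (of_nat g) = (pid d \<star> I) \<star> (pid (s d) \<star> s ` I)" using g(2) by simp
  also have "\<dots> = (pid d \<star> pid (s d)) \<star> (I \<star> s ` I)" by (simp only: idp_ac)
  also have "\<dots> = pid (d * s d) \<star> (I \<star> s ` I)" by (simp add: pid_mult)
  finally have "pid (inverse (d * s d)) \<star> pid (of_nat g) =
      (pid (inverse (d * s d)) \<star> pid (d * s d)) \<star> (I \<star> s ` I)" by (simp only: idp_assoc)
  moreover have "d * s d \<noteq> 0" using d dF by simp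
  moreover have "is_module (I \<star> s ` I)"
    using is_frac_idp[OF I s_image_frac[OF I]] by (rule is_frac_module)
  ultimately have "I \<star> s ` I = pid (inverse (d * s d) * of_nat g)"
    by (simp add: pid_mult del: mult_eq_0_iff inverse_mult_distrib)
  moreover have "inverse (d * s d) * of_nat g \<in> \<rat>" by (intro Rats_mult Rats_inverse[OF nrm_Rats[OF dF]]) auto
  ultimately show ?thesis using that[of "inverse (d * s d) * of_nat g"] \<open>d * s d \<noteq> 0\<close> g(1) by simp
qed

definition fr_inv :: "complex set \<Rightarrow> complex set" where
  "fr_inv I = (SOME J. is_frac J \<and> I \<star> J = \<O>)"

text \<open>The conjugate ideal divided by the rational generator of \<open>frac_norm\<close> is an
  inverse. Divisibility and cancellation of ideals of quadratic fields rest on this.\<close>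

lemma fr_inv:
  assumes I: "is_frac I"
  shows "is_frac (fr_inv I)" "I \<star> fr_inv I = \<O>" "fr_inv I \<star> I = \<O>"
proof -
  obtain r where r: "r \<in> \<rat>" "r \<noteq> 0" "I \<star> s ` I = pid r" using frac_norm[OF I] .
  have "I \<star> (pid (inverse r) \<star> s ` I) = pid (inverse r) \<star> (I \<star> s ` I)" by (rule idp_left_commute)
  also have "\<dots> = \<O>" using r by (simp add: pid_mult)
  finally have "I \<star> (pid (inverse r) \<star> s ` I) = \<O>" .
  moreover have "is_frac (pid (inverse r) \<star> s ` I)"
    using r by (intro is_frac_idp is_frac_pid s_image_frac I) auto
  ultimately have "is_frac (fr_inv I) \<and> I \<star> fr_inv I = \<O>"
    unfolding fr_inv_def by (intro someI) auto
  then show "is_frac (fr_inv I)" "I \<star> fr_inv I = \<O>" "fr_inv I \<star> I = \<O>"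
    by (auto simp: idp_commute)
qed

lemma fr_cancel:
  assumes "is_frac I" "is_module J" "is_module L"
  shows "I \<star> J \<subseteq> I \<star> L \<longleftrightarrow> J \<subseteq> L" "I \<star> J = I \<star> L \<longleftrightarrow> J = L"
proof -
  have *: "J \<subseteq> L" if "I \<star> J \<subseteq> I \<star> L" "is_module J" "is_module L" for J L
  proof -
    have "fr_inv I \<star> (I \<star> J) \<subseteq> fr_inv I \<star> (I \<star> L)" by (rule idp_mono[OF order_refl that(1)])
    then show ?thesis using fr_inv[OF assms(1)] that by (simp add: idp_assoc[symmetric])
  qed
  show "I \<star> J \<subseteq> I \<star> L \<longleftrightarrow> J \<subseteq> L"
    by (rule iffI, rule *) (simp_all add: assms idp_mono)
  show "I \<star> J = I \<star> L \<longleftrightarrow> J = L"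
    by (metis * assms(2,3) order_refl subset_antisym)
qed

lemma comm_group_ideal_group: "comm_group (ideal_group F)"
proof (rule comm_groupI)
  fix I assume "I \<in> carrier (ideal_group F)"
  then have "is_frac I" by (simp add: fractional_ideals_iff)
  then show "\<exists>J\<in>carrier (ideal_group F). J \<otimes>\<^bsub>ideal_group F\<^esub> I = \<one>\<^bsub>ideal_group F\<^esub>"
    by (intro bexI[of _ "fr_inv I"]) (auto simp: fractional_ideals_iff fr_inv)
next
  show "I \<otimes>\<^bsub>ideal_group F\<^esub> J = J \<otimes>\<^bsub>ideal_group F\<^esub> I" for I J by (simp add: idp_commute)
qed (auto simp: fractional_ideals_iff is_frac_idp is_frac_O is_frac_module idp_assoc)

lemma ideal_dvd:
  assumes "is_frac I" "is_frac J" "I \<subseteq> J"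
  obtains D where "is_frac D" "D \<subseteq> \<O>" "I = J \<star> D"
proof
  note J = fr_inv[OF assms(2)]
  show "is_frac (fr_inv J \<star> I)" using J assms by (intro is_frac_idp)
  have "fr_inv J \<star> I \<subseteq> fr_inv J \<star> J" using assms(3) by (intro idp_mono) auto
  then show "fr_inv J \<star> I \<subseteq> \<O>" using J by simp
  show "I = J \<star> (fr_inv J \<star> I)" using J assms by (simp add: idp_assoc[symmetric] is_frac_module)
qed

text \<open>The absolute norm of an integral ideal. It is the measure for minimal choices and
  inductions over ideals; the generator is unique by \<open>nm_eq\<close>.\<close>

definition nm :: "complex set \<Rightarrow> nat" where
  "nm I = (SOME g. g > 0 \<and> I \<star> s ` I = pid (of_nat g))"

lemma nm:
  assumes "is_frac I" "I \<subseteq> \<O>"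
  shows "nm I > 0" "I \<star> s ` I = pid (of_nat (nm I))"
proof -
  obtain g :: nat where "g > 0 \<and> I \<star> s ` I = pid (of_nat g)" using integral_norm[OF assms] by blast
  then have "nm I > 0 \<and> I \<star> s ` I = pid (of_nat (nm I))" unfolding nm_def by (rule someI)
  then show "nm I > 0" "I \<star> s ` I = pid (of_nat (nm I))" by auto
qed

lemma pid_of_nat_subset:
  assumes "b > 0" "pid (of_nat a) \<subseteq> pid (of_nat b)"
  shows "b dvd a"
proof -
  have "of_nat a \<in> pid (of_nat b)" using assms(2) pid_self by blast
  then obtain y where y: "y \<in> \<O>" "of_nat a = of_nat b * y" by (auto simp: principal_ideal_def)
  then have "y = of_nat a / of_nat b" using assms(1) by simp
  then have "y \<in> \<int>" using y(1) by (intro O_Rats) auto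
  then obtain k where "y = of_int k" by (auto elim: Ints_cases)
  then have "(of_int (int a) :: complex) = of_int (int b * k)" using y(2) by simp
  then have "int a = int b * k" by (simp only: of_int_eq_iff)
  then show ?thesis by (metis dvd_triv_left int_dvd_int_iff)
qed

lemma nm_eq:
  assumes "is_frac I" "I \<subseteq> \<O>" "g > 0" "I \<star> s ` I = pid (of_nat g)"
  shows "nm I = g"
  using nm[OF assms(1,2)] assms(3,4) pid_of_nat_subset[of "nm I" g] pid_of_nat_subset[of g "nm I"]
  by (intro dvd_antisym) auto

lemma idp_integral: "I \<subseteq> \<O> \<Longrightarrow> J \<subseteq> \<O> \<Longrightarrow> I \<star> J \<subseteq> \<O>"
  by (rule idp_subsetI) (auto simp: subsetD)

lemma nm_mult:
  assumes I: "is_frac I" "I \<subseteq> \<O>" and J: "is_frac J" "J \<subseteq> \<O>"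
  shows "nm (I \<star> J) = nm I * nm J"
proof (rule nm_eq)
  show "is_frac (I \<star> J)" using I J by (intro is_frac_idp)
  show "I \<star> J \<subseteq> \<O>" using I J by (intro idp_integral)
  show "nm I * nm J > 0" using nm I J by simp
  have "s ` (I \<star> J) = s ` I \<star> s ` J" using I J by (intro s_idp is_frac_subset)
  then have "(I \<star> J) \<star> s ` (I \<star> J) = (I \<star> J) \<star> (s ` I \<star> s ` J)" by simp
  also have "\<dots> = (I \<star> s ` I) \<star> (J \<star> s ` J)" by (simp only: idp_ac)
  also have "\<dots> = pid (of_nat (nm I * nm J))" using nm[OF I] nm[OF J] by (simp add: pid_mult)
  finally show "(I \<star> J) \<star> s ` (I \<star> J) = pid (of_nat (nm I * nm J))" .
qed

lemma nm_mem:
  assumes I: "is_frac I" "I \<subseteq> \<O>" shows "of_nat (nm I) \<in> I"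
proof -
  have "of_nat (nm I) \<in> I \<star> s ` I" using nm[OF I] pid_self by simp
  moreover have "s ` I \<subseteq> \<O>" using I(2) by auto
  then have "I \<star> s ` I \<subseteq> I \<star> \<O>" by (intro idp_mono) auto
  ultimately show ?thesis using I is_frac_module by auto
qed

lemma nm_eq_1:
  assumes "is_frac I" "I \<subseteq> \<O>" "nm I = 1" shows "I = \<O>"
proof -
  have "1 \<in> I" using nm_mem[OF assms(1,2)] assms(3) by simp
  then have "x \<in> I" if "x \<in> \<O>" for x
    using is_moduleD(3)[OF is_frac_module[OF assms(1)] that] by fastforce
  then show ?thesis using assms(2) by auto
qed

section \<open>Prime ideals of a quadratic field\<close>

lemma prime_idealD:
  assumes "P \<in> prime_ideals F"
  shows "is_frac P" "P \<subseteq> \<O>" "1 \<notin> P" "x \<in> \<O> \<Longrightarrow> y \<in> \<O> \<Longrightarrow> x * y \<in> P \<Longrightarrow> x \<in> P \<or> y \<in> P"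
proof -
  have P: "primeideal P (integer_ring F)" "P \<noteq> {0}" using assms by (auto simp: prime_ideals_def)
  have id: "P \<subseteq> \<O> \<and> 0 \<in> P \<and> (\<forall>x\<in>P. \<forall>y\<in>P. x + y \<in> P) \<and> (\<forall>r\<in>\<O>. \<forall>x\<in>P. r * x \<in> P)"
    using primeideal.axioms(1)[OF P(1)] by (simp add: ideal_integer_ring_iff)
  then show sub: "P \<subseteq> \<O>" by blast
  have "\<exists>x\<in>P. x \<noteq> 0" using id P(2) by auto
  moreover have "\<exists>d\<in>\<O>. d \<noteq> 0 \<and> (\<forall>x\<in>P. d * x \<in> \<O>)" using sub by (intro bexI[of _ 1]) auto
  ultimately show "is_frac P" using id unfolding is_frac_def by blast
  show "1 \<notin> P"
  proof
    assume "1 \<in> P"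
    then have "r \<in> P" if "r \<in> \<O>" for r using id that by (metis mult.right_neutral)
    then show False using primeideal.I_notcarr[OF P(1)] sub by auto
  qed
  show "x \<in> \<O> \<Longrightarrow> y \<in> \<O> \<Longrightarrow> x * y \<in> P \<Longrightarrow> x \<in> P \<or> y \<in> P"
    using primeideal.I_prime[OF P(1), of x y] by simp
qed

lemma prime_idealI:
  assumes P: "is_frac P" "P \<subseteq> \<O>" "1 \<notin> P"
    and prime: "\<And>x y. x \<in> \<O> \<Longrightarrow> y \<in> \<O> \<Longrightarrow> x * y \<in> P \<Longrightarrow> x \<in> P \<or> y \<in> P"
  shows "P \<in> prime_ideals F"
proof -
  have id: "ideal P (integer_ring F)"
    using P unfolding ideal_integer_ring_iff is_frac_def by blast
  have ring: "ring (integer_ring F)" using ideal.axioms(2)[OF id] .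
  have "primeideal P (integer_ring F)"
  proof (rule primeidealI[OF id])
    show "cring (integer_ring F)"
      by (rule cring.intro[OF ring])
         (rule monoid.monoid_comm_monoidI[OF ring.axioms(2)[OF ring]], simp add: mult.commute)
    show "carrier (integer_ring F) \<noteq> P" using P(3) by auto
  qed (use prime in auto)
  moreover have "P \<noteq> {0}" using P(1) by (auto simp: is_frac_def)
  ultimately show ?thesis by (simp add: prime_ideals_def)
qed

definition ideal_adj :: "complex set \<Rightarrow> complex \<Rightarrow> complex set" where
  "ideal_adj I x = {i + x * r | i r. i \<in> I \<and> r \<in> \<O>}"

lemma ideal_adj:
  assumes I: "is_frac I" "I \<subseteq> \<O>" and x: "x \<in> \<O>"
  shows "is_frac (ideal_adj I x)" "ideal_adj I x \<subseteq> \<O>" "I \<subseteq> ideal_adj I x" "x \<in> ideal_adj I x"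
proof -
  note m = is_moduleD[OF is_frac_module[OF I(1)]]
  show sub: "ideal_adj I x \<subseteq> \<O>" using I(2) x by (auto simp: ideal_adj_def)
  show incl: "I \<subseteq> ideal_adj I x"
  proof
    fix i assume "i \<in> I"
    then show "i \<in> ideal_adj I x" unfolding ideal_adj_def
      by (intro CollectI exI[of _ i] exI[of _ 0]) auto
  qed
  show "x \<in> ideal_adj I x" unfolding ideal_adj_def
    by (intro CollectI exI[of _ 0] exI[of _ 1]) (auto simp: m)
  have "is_module (ideal_adj I x)"
    unfolding is_module_def
  proof (intro conjI ballI)
    show "0 \<in> ideal_adj I x" using incl m(1) by auto
    fix u assume "u \<in> ideal_adj I x"
    then obtain i r where u: "i \<in> I" "r \<in> \<O>" "u = i + x * r" by (auto simp: ideal_adj_def)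
    show "u + v \<in> ideal_adj I x" if v: "v \<in> ideal_adj I x" for v
    proof -
      obtain i' r' where "i' \<in> I" "r' \<in> \<O>" "v = i' + x * r'" using v by (auto simp: ideal_adj_def)
      then have "u + v = (i + i') + x * (r + r')" "i + i' \<in> I" "r + r' \<in> \<O>"
        using u m by (simp_all add: algebra_simps)
      then show ?thesis unfolding ideal_adj_def by blast
    qed
    fix t assume t: "t \<in> \<O>"
    then have "t * u = t * i + x * (t * r)" "t * i \<in> I" "t * r \<in> \<O>"
      using u m(3)[of t i] by (simp_all add: distrib_left mult.left_commute)
    then show "t * u \<in> ideal_adj I x" unfolding ideal_adj_def by blast
  qed
  moreover have "\<exists>u\<in>ideal_adj I x. u \<noteq> 0" using I(1) incl by (auto simp: is_frac_alt)
  moreover have "\<exists>d\<in>\<O>. d \<noteq> 0 \<and> (\<forall>u\<in>ideal_adj I x. d * u \<in> \<O>)" using sub by (intro bexI[of _ 1]) auto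
  ultimately show "is_frac (ideal_adj I x)" unfolding is_frac_alt by blast
qed

text \<open>A proper ideal above I of least norm is maximal: adjoining x gives a divisor of it, and
  if this divisor is still proper, minimality leaves a cofactor of norm 1, so nothing was adjoined.
  Maximality gives primality as usual.\<close>

lemma exists_prime_above:
  assumes I: "is_frac I" "I \<subseteq> \<O>" "I \<noteq> \<O>"
  shows "\<exists>P\<in>prime_ideals F. I \<subseteq> P"
proof -
  define S where "S = {J. is_frac J \<and> J \<subseteq> \<O> \<and> J \<noteq> \<O> \<and> I \<subseteq> J}"
  have "I \<in> S" using I by (simp add: S_def)
  then obtain J where J: "J \<in> S" and min: "\<And>M. M \<in> S \<Longrightarrow> nm J \<le> nm M"
    using ex_has_least_nat[where P = "\<lambda>J. J \<in> S" and k = I and m = nm] by blast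
  have Jp: "is_frac J" "J \<subseteq> \<O>" "J \<noteq> \<O>" "I \<subseteq> J" using J by (auto simp: S_def)
  note m = is_moduleD[OF is_frac_module[OF Jp(1)]]
  have "J \<in> prime_ideals F"
  proof (rule prime_idealI)
    show "1 \<notin> J"
    proof
      assume "1 \<in> J"
      then have "r \<in> J" if "r \<in> \<O>" for r using m(3)[OF that \<open>1 \<in> J\<close>] by simp
      then show False using Jp by auto
    qed
    fix x y assume xy: "x \<in> \<O>" "y \<in> \<O>" "x * y \<in> J"
    show "x \<in> J \<or> y \<in> J"
    proof (cases "x \<in> J")
      case x: False
      note M = ideal_adj[OF Jp(1,2) xy(1)]
      have "ideal_adj J x = \<O>"
      proof (rule ccontr)
        assume ne: "ideal_adj J x \<noteq> \<O>"
        then have MS: "ideal_adj J x \<in> S" using M Jp by (auto simp: S_def)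
        obtain D where D: "is_frac D" "D \<subseteq> \<O>" "J = ideal_adj J x \<star> D"
          using ideal_dvd[OF Jp(1) M(1,3)] .
        have "nm J = nm (ideal_adj J x) * nm D" using nm_mult[OF M(1,2) D(1,2)] D(3) by simp
        moreover have "nm J \<le> nm (ideal_adj J x)" "nm (ideal_adj J x) > 0" using min MS nm M by auto
        ultimately have "nm D \<le> 1" "nm D > 0" using nm[OF D(1,2)] by auto
        then have "D = \<O>" using nm_eq_1 D by simp
        then have "J = ideal_adj J x" using D(3) M(1) is_frac_module by simp
        then show False using M(4) x by simp
      qed
      then have "1 \<in> ideal_adj J x" by simp
      then obtain j r where jr: "j \<in> J" "r \<in> \<O>" "1 = j + x * r" by (auto simp: ideal_adj_def)
      have "y = y * (j + x * r)" using jr(3) by simp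
      then have "y = y * j + r * (x * y)" by (simp add: algebra_simps)
      moreover have "y * j + r * (x * y) \<in> J" using jr xy m by auto
      ultimately show ?thesis by simp
    qed simp
  qed (use Jp in auto)
  then show ?thesis using Jp by blast
qed

text \<open>Suppose some x in J lies outside P. In P = J D primality puts D into P, so P is
  contained in P J, and cancelling P leaves the whole ring inside J.\<close>

lemma prime_maximal:
  assumes P: "P \<in> prime_ideals F" and J: "is_frac J" "J \<subseteq> \<O>" "P \<subseteq> J"
  shows "J = P \<or> J = \<O>"
proof (cases "J \<subseteq> P")
  case False
  then obtain x where x: "x \<in> J" "x \<notin> P" by blast
  note P' = prime_idealD[OF P]
  obtain D where D: "is_frac D" "D \<subseteq> \<O>" "P = J \<star> D" using ideal_dvd[OF P'(1) J(1,3)] .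
  have "D \<subseteq> P"
  proof
    fix d assume d: "d \<in> D"
    then have "x * d \<in> P" using D(3) x idp_prod by blast
    then show "d \<in> P" using P'(4)[of x d] x d D J by auto
  qed
  then have "P \<star> \<O> \<subseteq> P \<star> J" using D(3) P'(1)
    by (metis idp_O(1) idp_commute idp_mono is_frac_module order_refl)
  then have "\<O> \<subseteq> J" using fr_cancel(1)[OF P'(1) is_module_O] J is_frac_module by blast
  then show ?thesis using J by auto
qed (use J in auto)

lemma prime_comaximal:
  assumes P: "P \<in> prime_ideals F" and x: "x \<in> \<O>" "x \<notin> P"
  obtains r where "r \<in> \<O>" "1 - x * r \<in> P"
proof -
  note P' = prime_idealD[OF P]
  note M = ideal_adj[OF P'(1,2) x(1)]
  have "ideal_adj P x = \<O>" using prime_maximal[OF P M(1,2,3)] M(4) x(2) by auto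
  then have "1 \<in> ideal_adj P x" by simp
  then obtain j r where jr: "j \<in> P" "r \<in> \<O>" "1 = j + x * r" by (auto simp: ideal_adj_def)
  then have "1 - x * r \<in> P" by (metis add_diff_cancel_right')
  then show ?thesis using that jr by blast
qed

lemma s_prime: assumes P: "P \<in> prime_ideals F" shows "s ` P \<in> prime_ideals F"
proof (rule prime_idealI)
  note P' = prime_idealD[OF P]
  have PF: "P \<subseteq> F" using P'(1) by (rule is_frac_subset)
  show "is_frac (s ` P)" using P'(1) by (rule s_image_frac)
  show "s ` P \<subseteq> \<O>" using P'(2) by auto
  have mem: "x \<in> s ` P \<longleftrightarrow> s x \<in> P" if "x \<in> F" for x
    using PF that by (force simp: image_iff)
  show "1 \<notin> s ` P" using mem[of 1] P'(3) by simp
  fix x y assume xy: "x \<in> \<O>" "y \<in> \<O>" "x * y \<in> s ` P"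
  then have "s x * s y \<in> P" using mem[of "x * y"] by (simp add: O_subset)
  then show "x \<in> s ` P \<or> y \<in> s ` P" using P'(4)[of "s x" "s y"] xy mem by (auto simp: O_subset)
qed

end

subsection \<open>Residue rings and the class number\<close>

lemma complex_of_real_of_rat: "complex_of_real (of_rat q) = of_rat q"
  by (cases q) (simp add: of_rat_rat)

context quadratic_field
begin

lemma exists_anti_integer:
  obtains \<delta> d where "\<delta> \<in> \<O>" "\<delta> \<noteq> 0" "s \<delta> = - \<delta>" "\<delta> ^ 2 = of_int d" "d \<noteq> 0"
proof -
  obtain x where x: "x \<in> F" "s x \<noteq> x" using s_nontrivial by blast
  obtain d :: int where d: "d > 0" "of_int d * (x - s x) \<in> \<O>"
    using clear_denominator[of "x - s x"] x by auto
  define \<delta> where "\<delta> = of_int d * (x - s x)"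
  have \<delta>: "\<delta> \<in> \<O>" "\<delta> \<noteq> 0" "s \<delta> = - \<delta>" using d x by (auto simp: \<delta>_def algebra_simps)
  have "\<delta> * s \<delta> \<in> \<int>" using \<delta>(1) by (rule nrm_Ints)
  then have "\<delta> ^ 2 \<in> \<int>" using \<delta>(3) by (simp add: power2_eq_square)
  then obtain e where "\<delta> ^ 2 = of_int e" by (auto elim: Ints_cases)
  moreover from this have "e \<noteq> 0" using \<delta>(2) by auto
  ultimately show ?thesis using that \<delta> by blast
qed

text \<open>The traces of x and \<open>x * \<delta>\<close> modulo \<open>2 * m * d\<close> take
  finitely many values. They determine x modulo m, because 2 z is the sum of z + s z and z - s z,
  and the latter is the trace of \<open>z * \<delta>\<close> divided by
  \<open>\<delta>\<close>.\<close>

lemma O_mod_finite: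
  assumes m: "m > (0::nat)"
  shows "\<exists>T. finite T \<and> T \<subseteq> \<O> \<and> (\<forall>x\<in>\<O>. \<exists>t\<in>T. \<exists>y\<in>\<O>. x - t = of_nat m * y)"
proof -
  obtain \<delta> d where \<delta>: "\<delta> \<in> \<O>" "\<delta> \<noteq> 0" "s \<delta> = - \<delta>" "\<delta> ^ 2 = of_int d" "d \<noteq> 0"
    by (rule exists_anti_integer)
  \<comment> \<open>The factor 2 pays for halving z + s z and z - s z, the factor d for dividing by
    \<open>\<delta>\<close>.\<close>
  define M where "M = 2 * int m * d"
  have M: "M \<noteq> 0" using m \<delta>(5) by (simp add: M_def)
  have "\<exists>a::int. of_int a = x + s x" if "x \<in> \<O>" for x
    using tr_Ints[OF that] by (metis Ints_cases)
  then obtain A where A: "\<And>x. x \<in> \<O> \<Longrightarrow> of_int (A x) = x + s x" by metis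
  define \<phi> where "\<phi> x = (A x mod M, A (x * \<delta>) mod M)" for x
  have "\<phi> ` \<O> \<subseteq> {- \<bar>M\<bar>..\<bar>M\<bar>} \<times> {- \<bar>M\<bar>..\<bar>M\<bar>}"
  proof -
    have "k mod M \<in> {- \<bar>M\<bar>..\<bar>M\<bar>}" for k
      using abs_mod_less[OF M, of k] by auto
    then show ?thesis by (auto simp: \<phi>_def)
  qed
  then have fin: "finite (\<phi> ` \<O>)" by (rule finite_subset) auto
  define T where "T = inv_into \<O> \<phi> ` (\<phi> ` \<O>)"
  show ?thesis
  proof (intro exI[of _ T] conjI ballI)
    show "finite T" using fin by (simp add: T_def)
    show "T \<subseteq> \<O>" by (auto simp: T_def inv_into_into)
    fix x assume x: "x \<in> \<O>"
    define t where "t = inv_into \<O> \<phi> (\<phi> x)"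
    have t: "t \<in> T" "t \<in> \<O>" "\<phi> t = \<phi> x"
      using x by (auto simp: t_def T_def inv_into_into f_inv_into_f)
    define z where "z = x - t"
    have z: "z \<in> \<O>" "z \<in> F" using x t O_subset by (auto simp: z_def)
    have \<delta>F: "\<delta> \<in> F" using \<delta>(1) by (rule O_subset)
    have "M dvd A x - A t" "M dvd A (x * \<delta>) - A (t * \<delta>)"
      using t(3) by (auto simp: \<phi>_def mod_eq_dvd_iff dvd_diff_commute)
    then obtain a b where ab: "A x - A t = M * a" "A (x * \<delta>) - A (t * \<delta>) = M * b"
      by (auto elim!: dvdE)
    have "z + s z = of_int (A x) - of_int (A t)"
      using A[OF x] A[OF t(2)] x t(2) by (simp add: z_def O_subset)
    also have "\<dots> = of_int M * of_int a" by (metis ab(1) of_int_diff of_int_mult)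
    finally have 1: "z + s z = of_int M * of_int a" .
    have "(z - s z) * \<delta> = of_int (A (x * \<delta>)) - of_int (A (t * \<delta>))"
      using A[of "x * \<delta>"] A[of "t * \<delta>"] x t(2) \<delta> by (simp add: z_def O_subset algebra_simps)
    also have "\<dots> = of_int M * of_int b" by (metis ab(2) of_int_diff of_int_mult)
    finally have 2: "(z - s z) * \<delta> = of_int M * of_int b" .
    have d0: "of_int d \<noteq> (0::complex)" using \<delta>(5) by simp
    have "(z - s z) * of_int d = of_int M * of_int b * \<delta>"
    proof -
      have "(z - s z) * of_int d = (z - s z) * \<delta> * \<delta>"
        unfolding \<delta>(4)[symmetric] by (simp add: power2_eq_square)
      then show ?thesis unfolding 2 .
    qed
    then have 3: "z - s z = 2 * of_nat m * of_int b * \<delta>"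
      using d0 by (simp add: M_def)
    have "2 * z = 2 * (of_nat m * (of_int d * of_int a + of_int b * \<delta>))"
      using arg_cong2[OF 1 3, of "(+)"] by (simp add: M_def algebra_simps)
    then have "z = of_nat m * (of_int d * of_int a + of_int b * \<delta>)" by simp
    then have "x - t = of_nat m * (of_int d * of_int a + of_int b * \<delta>)" unfolding z_def .
    moreover have "of_int d * of_int a + of_int b * \<delta> \<in> \<O>" using \<delta>(1) by auto
    ultimately show "\<exists>t\<in>T. \<exists>y\<in>\<O>. x - t = of_nat m * y" using t(1) by blast
  qed
qed

text \<open>Such an ideal is a union of cosets of the multiples of m, so it is determined by the
  representatives in \<open>T\<close> that it contains.\<close>

lemma finite_ideals_containing:
  assumes m: "m > (0::nat)"
  shows "finite {J. is_frac J \<and> J \<subseteq> \<O> \<and> of_nat m \<in> J}" (is "finite ?X")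
proof -
  obtain T where T: "finite T" "T \<subseteq> \<O>" "\<And>x. x \<in> \<O> \<Longrightarrow> \<exists>t\<in>T. \<exists>y\<in>\<O>. x - t = of_nat m * y"
    using O_mod_finite[OF m] by auto
  have "inj_on (\<lambda>J. J \<inter> T) ?X"
  proof (rule inj_onI)
    have half: "J \<subseteq> J'" if J: "J \<in> ?X" and J': "J' \<in> ?X" and eq: "J \<inter> T = J' \<inter> T" for J J'
    proof
      fix x assume x: "x \<in> J"
      note mJ = is_moduleD[OF is_frac_module[of J]] and mJ' = is_moduleD[OF is_frac_module[of J']]
      from x J obtain t y where ty: "t \<in> T" "y \<in> \<O>" "x - t = of_nat m * y" using T(3)[of x] by blast
      have "y * of_nat m \<in> J" "y * of_nat m \<in> J'" using mJ(3) mJ'(3) J J' ty by auto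
      moreover have "t = x - y * of_nat m" "x = t + y * of_nat m" using ty by (auto simp: algebra_simps)
      moreover have "x - y * of_nat m \<in> J" using mJ(5) J x \<open>y * of_nat m \<in> J\<close> by blast
      ultimately have "t \<in> J" by simp
      then have "t \<in> J'" using eq ty by blast
      then show "x \<in> J'" using mJ'(2) J' \<open>y * of_nat m \<in> J'\<close> \<open>x = t + y * of_nat m\<close> by auto
    qed
    show "J = J'" if "J \<in> ?X" "J' \<in> ?X" "J \<inter> T = J' \<inter> T" for J J'
      using half[OF that] half[OF that(2,1) that(3)[symmetric]] by blast
  qed
  moreover have "finite ((\<lambda>J. J \<inter> T) ` ?X)" by (rule finite_subset[of _ "Pow T"]) (auto simp: T)
  ultimately show ?thesis by (rule finite_imageD[rotated])
qed

text \<open>Hurwitz's lemma, the substitute for the Euclidean algorithm.\<close>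

lemma hurwitz:
  obtains M :: nat where "M > 0"
    "\<And>x. x \<in> F \<Longrightarrow> \<exists>t w. 0 < t \<and> t \<le> M \<and> w \<in> \<O> \<and> cmod ((of_nat t * x - w) * s (of_nat t * x - w)) < 1"
proof -
  obtain \<delta> d where \<delta>: "\<delta> \<in> \<O>" "\<delta> \<noteq> 0" "s \<delta> = - \<delta>" "\<delta> ^ 2 = of_int d" "d \<noteq> 0"
    by (rule exists_anti_integer)
  have \<delta>F: "\<delta> \<in> F" using \<delta>(1) by (rule O_subset)
  \<comment> \<open>n is the number of boxes for each coordinate. As n exceeds 1 + |d|, an element
    whose coordinates with respect to 1 and \<open>\<delta>\<close> are at most 1 / n has norm below
    (1 + |d|) / n^2 < 1 or equal to it.\<close>
  define n :: nat where "n = nat (1 + \<bar>d\<bar>) + 1"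
  have n: "n > 0" "1 + \<bar>real_of_int d\<bar> < real n" by (auto simp: n_def)
  have n2: "(1 + \<bar>real_of_int d\<bar>) * (1 / real n) ^ 2 < 1"
  proof -
    have "(1 + \<bar>real_of_int d\<bar>) < real n * real n"
      using n mult_mono[of 1 "real n" "real n" "real n"] by linarith
    then show ?thesis using n(1) by (simp add: power2_eq_square field_simps)
  qed
  show ?thesis
  proof (rule that)
    show "n * n > 0" using n by simp
    fix x assume x: "x \<in> F"
    have "(x + s x) / 2 \<in> \<rat>" using tr_Rats[OF x] by auto
    then obtain qa where qa: "(x + s x) / 2 = of_rat qa" by (auto elim: Rats_cases)
    have "(x - s x) / (2 * \<delta>) \<in> \<rat>"
      by (rule s_fixed) (use x \<delta> \<delta>F in \<open>auto simp: field_simps\<close>)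
    then obtain qb where qb: "(x - s x) / (2 * \<delta>) = of_rat qb" by (auto elim: Rats_cases)
    define a b where "a = (of_rat qa :: real)" and "b = (of_rat qb :: real)"
    have rat_ab: "complex_of_real a = of_rat qa" "complex_of_real b = of_rat qb"
      by (simp_all add: a_def b_def complex_of_real_of_rat)
    have xab: "x = of_real a + of_real b * \<delta>"
      unfolding rat_ab qa[symmetric] qb[symmetric] using \<delta>(2) by (simp add: field_simps)
    \<comment> \<open>Pigeonhole principle: the n n + 1 multiples k x with k from 0 to n n are
      sorted into n n boxes by the fractional parts of their two coordinates.\<close>
    define \<phi> where "\<phi> k = (\<lfloor>real n * frac (real k * a)\<rfloor>, \<lfloor>real n * frac (real k * b)\<rfloor>)" for k :: nat
    have rng: "\<lfloor>real n * frac y\<rfloor> \<in> {0..<int n}" for y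
    proof -
      have "0 \<le> real n * frac y" "real n * frac y < real n * 1"
        using n(1) frac_lt_1[of y] frac_ge_0[of y] by (auto intro: mult_strict_left_mono simp del: mult_1_right)
      then show ?thesis by (auto simp: floor_less_iff)
    qed
    have "\<phi> ` {0..n * n} \<subseteq> {0..<int n} \<times> {0..<int n}" using rng unfolding \<phi>_def by blast
    then have "card (\<phi> ` {0..n * n}) \<le> card ({0..<int n} \<times> {0..<int n})" by (intro card_mono) auto
    then have "card (\<phi> ` {0..n * n}) < card {0..n * n}" by (simp add: card_cartesian_product)
    then have "\<not> inj_on \<phi> {0..n * n}" by (rule pigeonhole)
    then obtain k' l' where kl': "k' \<le> n * n" "l' \<le> n * n" "k' \<noteq> l'" "\<phi> k' = \<phi> l'"
      unfolding inj_on_def by auto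
    define k l where "k = min k' l'" and "l = max k' l'"
    have kl: "k \<le> n * n" "l \<le> n * n" "k < l" "\<phi> k = \<phi> l"
      using kl' by (auto simp: k_def l_def min_def max_def)
    define t where "t = l - k"
    define e where "e c = frac (real l * c) - frac (real k * c)" for c
    define f where "f c = \<lfloor>real l * c\<rfloor> - \<lfloor>real k * c\<rfloor>" for c
    have tc: "real t * c = of_int (f c) + e c" for c
      using kl(3) by (simp add: t_def e_def f_def frac_def of_nat_diff algebra_simps)
    have close: "\<bar>frac y - frac z\<bar> \<le> 1 / real n" if "\<lfloor>real n * frac y\<rfloor> = \<lfloor>real n * frac z\<rfloor>" for y z
    proof -
      have "\<bar>real n * frac y - real n * frac z\<bar> < 1" using that by linarith
      moreover have "real n * \<bar>frac y - frac z\<bar> = \<bar>real n * frac y - real n * frac z\<bar>"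
        by (simp add: right_diff_distrib[symmetric] abs_mult)
      ultimately have "real n * \<bar>frac y - frac z\<bar> < 1" by simp
      then show ?thesis using n(1) by (simp add: field_simps)
    qed
    have ea: "\<bar>e a\<bar> \<le> 1 / real n" "\<bar>e b\<bar> \<le> 1 / real n"
      using kl(4) close unfolding \<phi>_def e_def by auto
    define w where "w = of_int (f a) + of_int (f b) * \<delta>"
    define z where "z = of_nat t * x - w"
    have "of_nat t * x = of_real (real t * a) + of_real (real t * b) * \<delta>"
      unfolding xab by (simp add: algebra_simps)
    then have z: "z = of_real (e a) + of_real (e b) * \<delta>"
      unfolding tc z_def w_def by (simp add: algebra_simps)
    have "complex_of_real (e c) = of_rat (of_nat t * q) - of_int (f c)" if "c = of_rat q" for c q
    proof -
      have "e c = real t * c - of_int (f c)" using tc[of c] by simp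
      then show ?thesis using that by (simp add: of_rat_mult complex_of_real_of_rat)
    qed
    then have eR: "complex_of_real (e a) \<in> \<rat>" "complex_of_real (e b) \<in> \<rat>"
      using a_def b_def by auto
    have sz: "s z = of_real (e a) - of_real (e b) * \<delta>"
      unfolding z using eR \<delta> \<delta>F by (simp add: s_Rats)
    have "z * s z = of_real (e a ^ 2) - of_real (e b ^ 2) * \<delta> ^ 2"
      unfolding sz unfolding z by (simp add: algebra_simps power2_eq_square)
    then have "cmod (z * s z) \<le> cmod (of_real (e a ^ 2)) + cmod (of_real (e b ^ 2) * of_int d)"
      using norm_triangle_ineq4 \<delta>(4) by metis
    also have "\<dots> = \<bar>e a\<bar> ^ 2 + \<bar>e b\<bar> ^ 2 * \<bar>real_of_int d\<bar>"
      by (simp add: norm_mult norm_power)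
    also have "\<dots> \<le> (1 / real n) ^ 2 + (1 / real n) ^ 2 * \<bar>real_of_int d\<bar>"
      using ea by (intro add_mono mult_right_mono power_mono) auto
    also have "\<dots> < 1" using n2 by (simp add: algebra_simps)
    finally have "cmod (z * s z) < 1" .
    moreover have "0 < t" "t \<le> n * n" using kl by (auto simp: t_def)
    moreover have "w \<in> \<O>" using \<delta>(1) by (auto simp: w_def)
    ultimately show "\<exists>t w. 0 < t \<and> t \<le> n * n \<and> w \<in> \<O> \<and>
        cmod ((of_nat t * x - w) * s (of_nat t * x - w)) < 1"
      unfolding z_def by blast
  qed
qed

text \<open>After scaling to an integral ideal, take b in it of least nonzero norm. By
  \<open>hurwitz\<close> some t a - w b with 0 < t \<le> M has smaller norm, hence is 0, so t a / b
  is integral. The factorial of M serves for all t at once.\<close>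

lemma class_representatives:
  obtains m :: nat where "m > 0"
    "\<And>I. is_frac I \<Longrightarrow> \<exists>k J. k \<in> F \<and> k \<noteq> 0 \<and> is_frac J \<and> J \<subseteq> \<O> \<and> of_nat m \<in> J \<and> I = pid k \<star> J"
proof -
  obtain M where M: "M > 0"
    "\<And>x. x \<in> F \<Longrightarrow> \<exists>t w. 0 < t \<and> t \<le> M \<and> w \<in> \<O> \<and> cmod ((of_nat t * x - w) * s (of_nat t * x - w)) < 1"
    using hurwitz by blast
  define m :: nat where "m = fact M"
  have m: "m > 0" by (simp add: m_def)
  show ?thesis
  proof (rule that[OF m])
    fix I assume I: "is_frac I"
    then obtain d where d: "d \<in> \<O>" "d \<noteq> 0" "\<And>x. x \<in> I \<Longrightarrow> d * x \<in> \<O>" by (auto simp: is_frac_alt)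
    have dF: "d \<in> F" using d(1) by (rule O_subset)
    define L where "L = pid d \<star> I"
    have Lim: "L = (\<lambda>z. d * z) ` I" unfolding L_def by (rule pid_idp[OF is_frac_module[OF I]])
    have L: "is_frac L" unfolding L_def by (intro is_frac_idp is_frac_pid I dF d)
    have LO: "L \<subseteq> \<O>" using d(3) Lim by auto
    define N where "N b = nat \<lfloor>cmod (b * s b)\<rfloor>" for b
    have N: "cmod (b * s b) = real (N b)" if bO: "b \<in> \<O>" for b
    proof -
      obtain k where "b * s b = of_int k" using nrm_Ints[OF bO] by (auto elim: Ints_cases)
      then show ?thesis by (simp add: N_def)
    qed
    obtain b0 where "b0 \<in> L \<and> b0 \<noteq> 0" using L by (auto simp: is_frac_alt)
    then obtain b where b: "b \<in> L" "b \<noteq> 0" and least: "\<And>c. c \<in> L \<Longrightarrow> c \<noteq> 0 \<Longrightarrow> N b \<le> N c"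
      using ex_has_least_nat[where P = "\<lambda>b. b \<in> L \<and> b \<noteq> 0" and k = b0 and m = N] by blast
    have bO: "b \<in> \<O>" "b \<in> F" using b LO O_subset by auto
    have mem: "of_nat m * a / b \<in> \<O>" if a: "a \<in> L" for a
    proof -
      have aO: "a \<in> \<O>" "a \<in> F" using a LO O_subset by auto
      obtain t w where tw: "0 < t" "t \<le> M" "w \<in> \<O>"
        "cmod ((of_nat t * (a / b) - w) * s (of_nat t * (a / b) - w)) < 1"
        using M(2)[of "a / b"] aO bO by auto
      define z where "z = of_nat t * (a / b) - w"
      have zF: "z \<in> F" using aO bO tw(3) O_subset by (auto simp: z_def)
      have zb: "z * b = of_nat t * a - w * b" using b(2) by (simp add: z_def field_simps)
      have zL: "z * b \<in> L" unfolding zb using is_moduleD[OF is_frac_module[OF L]] a b tw by auto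
      have "z * b = 0"
      proof (rule ccontr)
        assume nz: "z * b \<noteq> 0"
        have "real (N (z * b)) = cmod (z * b * s (z * b))" using N[of "z * b"] zL LO by auto
        also have "\<dots> = cmod (z * s z) * cmod (b * s b)"
          using zF bO by (simp add: norm_mult)
        also have "\<dots> < 1 * cmod (b * s b)"
          using tw(4) b(2) bO by (intro mult_strict_right_mono) (auto simp: z_def)
        finally have "N (z * b) < N b" using N[OF bO(1)] by simp
        then show False using least[OF zL nz] by simp
      qed
      then have "of_nat t * a / b = w" using zb b(2) by (simp add: field_simps)
      moreover have "t dvd m" unfolding m_def using tw by (intro dvd_fact) auto
      moreover from this obtain q where "m = t * q" by (rule dvdE)
      ultimately have "of_nat m * a / b = of_nat q * w" by (auto simp: field_simps)
      then show ?thesis using tw by auto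
    qed
    define J where "J = pid (of_nat m / b) \<star> L"
    have nz: "of_nat m / b \<noteq> 0" using m b by simp
    have Jim: "J = (\<lambda>z. of_nat m / b * z) ` L"
      unfolding J_def by (rule pid_idp[OF is_frac_module[OF L]])
    have J: "is_frac J" unfolding J_def using bO nz by (intro is_frac_idp is_frac_pid L) auto
    have "J \<subseteq> \<O>" using mem unfolding Jim by auto
    moreover have "of_nat m \<in> J" unfolding Jim using b by (intro image_eqI[of _ _ b]) auto
    moreover have "I = pid (b / of_nat m / d) \<star> J"
    proof -
      have "pid (b / of_nat m / d) \<star> J = (pid (b / of_nat m / d) \<star> (pid (of_nat m / b) \<star> pid d)) \<star> I"
        unfolding J_def L_def by (simp only: idp_assoc)
      also have "\<dots> = I" using nz d(2) m b by (simp add: pid_mult is_frac_module[OF I])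
      finally show ?thesis by simp
    qed
    moreover have "b / of_nat m / d \<in> F" "b / of_nat m / d \<noteq> 0" using bO dF m b d by auto
    ultimately show "\<exists>k J. k \<in> F \<and> k \<noteq> 0 \<and> is_frac J \<and> J \<subseteq> \<O> \<and> of_nat m \<in> J \<and> I = pid k \<star> J"
      using J by blast
  qed
qed

subsection \<open>Valuations\<close>

definition unif :: "complex set \<Rightarrow> complex" where
  "unif P = (SOME p. p \<in> P \<and> p \<notin> P \<star> P)"

text \<open>The exponent of P in x, read off from an identity in the localization at P, where u and
  w are units. For x = 0 there is no such n and the value is unspecified, hence the conditions
  \<open>x \<noteq> 0\<close> that follow.\<close>

definition vl :: "complex set \<Rightarrow> complex \<Rightarrow> int" where
  "vl P x = (THE n. \<exists>u w. u \<in> \<O> - P \<and> w \<in> \<O> - P \<and> u * x = unif P powi n * w)"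

abbreviation pw :: "complex set \<Rightarrow> nat \<Rightarrow> complex set" where
  "pw P n \<equiv> P [^]\<^bsub>ideal_group F\<^esub> n"

lemma pw_0 [simp]: "pw P 0 = \<O>"
  by (simp add: nat_pow_def)

lemma pw_Suc [simp]: "pw P (Suc n) = pw P n \<star> P"
  by (simp add: nat_pow_def)

lemma pw_frac: "is_frac P \<Longrightarrow> is_frac (pw P n)"
  by (induction n) (auto intro: is_frac_O is_frac_idp)

lemma pw_integral: "P \<subseteq> \<O> \<Longrightarrow> pw P n \<subseteq> \<O>"
  by (induction n) (auto dest: idp_integral)

lemma nm_O: "nm \<O> = 1"
  by (rule nm_eq) (auto simp: is_frac_O)

lemma nm_pw: "is_frac P \<Longrightarrow> P \<subseteq> \<O> \<Longrightarrow> nm (pw P n) = nm P ^ n"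
  by (induction n) (auto simp: nm_O nm_mult pw_frac pw_integral)

context
  fixes P assumes P: "P \<in> prime_ideals F"
begin

private lemmas Pf = prime_idealD(1)[OF P] and PO = prime_idealD(2)[OF P]
  and P1 = prime_idealD(3)[OF P] and Pp = prime_idealD(4)[OF P]

private lemma Pm: "0 \<in> P" "x \<in> P \<Longrightarrow> y \<in> P \<Longrightarrow> x + y \<in> P" "r \<in> \<O> \<Longrightarrow> x \<in> P \<Longrightarrow> r * x \<in> P"
  using is_moduleD[OF is_frac_module[OF Pf]] by auto

lemma unif: "unif P \<in> P" "unif P \<notin> P \<star> P" "unif P \<noteq> 0" "unif P \<in> F"
proof -
  have "\<not> P \<subseteq> P \<star> P"
  proof
    assume "P \<subseteq> P \<star> P"
    then have "P \<star> \<O> \<subseteq> P \<star> P" by (simp add: is_frac_module Pf)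
    then have "\<O> \<subseteq> P" using fr_cancel(1)[OF Pf] is_module_O is_frac_module[OF Pf] by blast
    then show False using P1 by auto
  qed
  then have "\<exists>p. p \<in> P \<and> p \<notin> P \<star> P" by blast
  then have "unif P \<in> P \<and> unif P \<notin> P \<star> P" unfolding unif_def by (rule someI_ex)
  then show 1: "unif P \<in> P" "unif P \<notin> P \<star> P" by auto
  have "0 \<in> P \<star> P" using idp_prod[of 0 P 0 P] Pm(1) by simp
  then show "unif P \<noteq> 0" using 1 by auto
  show "unif P \<in> F" using 1 is_frac_subset[OF Pf] by auto
qed

lemma out_mult: "u \<in> \<O> - P \<Longrightarrow> w \<in> \<O> - P \<Longrightarrow> u * w \<in> \<O> - P"
  using Pp by auto

lemma out_nonzero: "u \<in> \<O> - P \<Longrightarrow> u \<noteq> 0"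
  using Pm(1) by auto

text \<open>In (unif P) = P J the factor J is not contained in P, since \<open>unif P\<close> lies
  outside the square of P. An element j of J outside P shows that P is generated by
  \<open>unif P\<close> locally.\<close>

lemma unif_cofactor:
  obtains j where "j \<in> \<O> - P" "\<And>x. x \<in> P \<Longrightarrow> \<exists>y\<in>\<O>. j * x = unif P * y"
proof -
  have pf: "is_frac (pid (unif P))" using unif by (intro is_frac_pid)
  have "pid (unif P) \<subseteq> P" using unif(1) pid_subset_iff[OF is_frac_module[OF Pf]] by simp
  then obtain J where J: "is_frac J" "J \<subseteq> \<O>" "pid (unif P) = P \<star> J" by (rule ideal_dvd[OF pf Pf])
  have "\<not> J \<subseteq> P"
  proof
    assume "J \<subseteq> P"
    then have "pid (unif P) \<subseteq> P \<star> P" using J(3) idp_mono[OF order_refl] by metis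
    then show False using pid_self unif(2) by blast
  qed
  then obtain j where j: "j \<in> J" "j \<notin> P" by blast
  show ?thesis
  proof (rule that)
    show "j \<in> \<O> - P" using j J by auto
    fix x assume "x \<in> P"
    then have "x * j \<in> pid (unif P)" using j J(3) idp_prod by simp
    then show "\<exists>y\<in>\<O>. j * x = unif P * y" by (auto simp: principal_ideal_def mult.commute)
  qed
qed

lemma unif_power_mem: "unif P ^ n \<in> pw P n"
proof (induction n)
  case (Suc n)
  then have "unif P ^ n * unif P \<in> pw P n \<star> P" using unif(1) by (intro idp_prod)
  then show ?case by (simp add: mult.commute)
qed simp

text \<open>This turns local divisibility of x into divisibility of ideals. Given (x) = P^n D, the
  product u x lies in the next power of P; cancelling P^n leaves u D inside P, and since u is
  outside P, the prime divides D.\<close>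

lemma O_power_dvd:
  assumes x: "x \<in> \<O>" "x \<noteq> 0" and u: "u \<in> \<O> - P" and eq: "u * x = unif P ^ n * y" "y \<in> \<O>"
  shows "\<exists>D. is_frac D \<and> D \<subseteq> \<O> \<and> pid x = pw P n \<star> D"
  using eq
proof (induction n arbitrary: y)
  case 0
  have "pid x \<subseteq> \<O>" using x pid_subset_iff[OF is_module_O] by simp
  moreover have "is_frac (pid x)" using x O_subset by (intro is_frac_pid)
  ultimately show ?case using is_frac_module by auto
next
  case (Suc n)
  have "u * x = unif P ^ n * (unif P * y)" "unif P * y \<in> \<O>"
    using Suc.prems unif(1) PO by (auto simp: mult.assoc mult.left_commute)
  then obtain D where D: "is_frac D" "D \<subseteq> \<O>" "pid x = pw P n \<star> D" using Suc.IH by blast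
  have modp: "is_module (pw P n \<star> P)" using is_frac_module[OF is_frac_idp[OF pw_frac[OF Pf] Pf]] .
  have "u * x \<in> pw P n \<star> P"
    using Suc.prems(1) is_moduleD(3)[OF modp Suc.prems(2) unif_power_mem[of "Suc n", unfolded pw_Suc]]
    by (simp add: mult.commute)
  then have "pid (u * x) \<subseteq> pw P n \<star> P" using pid_subset_iff[OF modp] by simp
  moreover have "pid (u * x) = pw P n \<star> (pid u \<star> D)"
    using D(3) by (simp add: pid_mult[symmetric] idp_left_commute)
  moreover have "is_module (pid u \<star> D)"
    using is_module_idp[OF is_frac_module[OF D(1)], of "pid u"] pid_self by blast
  ultimately have uD: "pid u \<star> D \<subseteq> P"
    using fr_cancel(1)[OF pw_frac[OF Pf]] is_frac_module[OF Pf] by blast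
  have "D \<subseteq> P"
  proof
    fix e assume "e \<in> D"
    then have "u * e \<in> P" using uD idp_prod[OF pid_self] by blast
    then show "e \<in> P" using Pp[of u e] u D \<open>e \<in> D\<close> by auto
  qed
  then obtain D' where D': "is_frac D'" "D' \<subseteq> \<O>" "D = P \<star> D'" by (rule ideal_dvd[OF D(1) Pf])
  then show ?case using D(3) by (auto simp: idp_assoc)
qed

lemma nm_prime: "nm P \<ge> 2"
  using nm[OF Pf PO] nm_eq_1[OF Pf PO] P1 by (cases "nm P = 1") auto

text \<open>The exponent is the greatest n for which x is locally divisible by
  \<open>unif P ^ n\<close>. It exists because P^n then divides (x) and has norm at least 2^n. By
  \<open>unif_cofactor\<close> a cofactor inside P would allow n + 1.\<close>

lemma vl_exists_O:
  assumes x: "x \<in> \<O>" "x \<noteq> 0"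
  shows "\<exists>n::nat. \<exists>u w. u \<in> \<O> - P \<and> w \<in> \<O> - P \<and> u * x = unif P ^ n * w"
proof -
  define S where "S n \<longleftrightarrow> (\<exists>u y. u \<in> \<O> - P \<and> y \<in> \<O> \<and> u * x = unif P ^ n * y)" for n
  have "S 0" unfolding S_def using x P1 by (intro exI[of _ 1] exI[of _ x]) auto
  have bound: "n \<le> nm (pid x)" if Sn: "S n" for n
  proof -
    obtain u y where uy: "u \<in> \<O> - P" "y \<in> \<O>" "u * x = unif P ^ n * y"
      using Sn by (auto simp: S_def)
    obtain D where D: "is_frac D" "D \<subseteq> \<O>" "pid x = pw P n \<star> D"
      using O_power_dvd[OF x uy(1,3,2)] by blast
    have "nm (pid x) = nm P ^ n * nm D"
      using D nm_mult[OF pw_frac[OF Pf] pw_integral[OF PO] D(1,2)] nm_pw[OF Pf PO] by simp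
    moreover have "nm D > 0" using nm D by simp
    ultimately have "nm P ^ n \<le> nm (pid x)" by simp
    moreover have "2 ^ n \<le> nm P ^ n" using nm_prime by (intro power_mono) auto
    moreover have "n < 2 ^ n" by simp
    ultimately show ?thesis by linarith
  qed
  define n where "n = (GREATEST n. S n)"
  have n: "S n" "\<And>m. S m \<Longrightarrow> m \<le> n"
    using GreatestI_nat[where P = S and b = "nm (pid x)", OF \<open>S 0\<close> bound]
      Greatest_le_nat[where P = S and b = "nm (pid x)", OF _ bound]
    by (simp_all add: n_def)
  obtain u w where uw: "u \<in> \<O> - P" "w \<in> \<O>" "u * x = unif P ^ n * w"
    using n(1) by (auto simp: S_def)
  have "w \<notin> P"
  proof
    assume w: "w \<in> P"
    obtain j where j: "j \<in> \<O> - P" "\<And>x. x \<in> P \<Longrightarrow> \<exists>y\<in>\<O>. j * x = unif P * y"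
      using unif_cofactor by blast
    obtain y where y: "y \<in> \<O>" "j * w = unif P * y" using j(2)[OF w] by blast
    have "j * u * x = unif P ^ n * (j * w)" using uw(3) by (simp add: mult.assoc mult.left_commute)
    also have "\<dots> = unif P ^ Suc n * y" using y(2) by simp
    finally have "S (Suc n)" unfolding S_def using out_mult[OF j(1) uw(1)] y(1)
      by (intro exI[of _ "j * u"] exI[of _ y]) auto
    then show False using n(2)[of "Suc n"] by simp
  qed
  then show ?thesis using uw by blast
qed

lemma vl_eqI:
  assumes "u \<in> \<O> - P" "w \<in> \<O> - P" "u * x = unif P powi n * w"
  shows "vl P x = n"
  unfolding vl_def
proof (rule the_equality)
  show "\<exists>u w. u \<in> \<O> - P \<and> w \<in> \<O> - P \<and> u * x = unif P powi n * w" using assms by blast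
  have half: False if h: "u \<in> \<O> - P" "w \<in> \<O> - P" "u * x = unif P powi n * w"
    "u' \<in> \<O> - P" "w' \<in> \<O> - P" "u' * x = unif P powi m * w'" "n < m" for u w u' w' n m
  proof -
    \<comment> \<open>The subtracted 1 keeps one factor \<open>unif P\<close> apart; it puts a
      product of two elements outside P into P.\<close>
    define k where "k = nat (m - n - 1)"
    have m: "m = n + (1 + int k)" using h(7) by (simp add: k_def)
    have "unif P powi n * (w * u') = u * x * u'" using h(3) by (simp add: mult_ac)
    also have "\<dots> = unif P powi m * w' * u" using h(6) by (simp add: mult_ac)
    also have "unif P powi m = unif P powi n * (unif P * unif P ^ k)"
      unfolding m using unif(3) by (simp add: power_int_add)
    finally have "w * u' = (unif P ^ k * (w' * u)) * unif P"
      using unif(3) by (simp add: mult_ac)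
    moreover have "(unif P ^ k * (w' * u)) * unif P \<in> P"
      using h unif(1) PO by (intro Pm) auto
    ultimately show False using out_mult[OF h(2,4)] by auto
  qed
  fix m assume "\<exists>u w. u \<in> \<O> - P \<and> w \<in> \<O> - P \<and> u * x = unif P powi m * w"
  then obtain u' w' where *: "u' \<in> \<O> - P" "w' \<in> \<O> - P" "u' * x = unif P powi m * w'" by blast
  show "m = n" using half[OF assms *] half[OF * assms] by (cases m n rule: linorder_cases) auto
qed

lemma vl_O_exists:
  assumes x: "x \<in> \<O>" "x \<noteq> 0"
  obtains u w where "u \<in> \<O> - P" "w \<in> \<O> - P" "u * x = unif P powi (vl P x) * w" "vl P x \<ge> 0"
proof -
  obtain n u w where *: "u \<in> \<O> - P" "w \<in> \<O> - P" "u * x = unif P ^ n * w"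
    using vl_exists_O[OF assms] by blast
  moreover from this have "vl P x = int n" using vl_eqI[of u w x "int n"] by simp
  ultimately show ?thesis using that by simp
qed

lemma vl_exists:
  assumes x: "x \<in> F" "x \<noteq> 0"
  obtains u w where "u \<in> \<O> - P" "w \<in> \<O> - P" "u * x = unif P powi (vl P x) * w"
proof -
  obtain d :: int where d: "d > 0" "of_int d * x \<in> \<O>" using clear_denominator x(1) by blast
  obtain u w where a: "u \<in> \<O> - P" "w \<in> \<O> - P"
      "u * (of_int d * x) = unif P powi (vl P (of_int d * x)) * w"
    using vl_O_exists[OF d(2)] d(1) x(2) by (metis mult_eq_0_iff of_int_eq_0_iff less_irrefl)
  obtain u' w' where b: "u' \<in> \<O> - P" "w' \<in> \<O> - P"
      "u' * of_int d = unif P powi (vl P (of_int d)) * w'"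
    using vl_O_exists[of "of_int d"] d(1) by (metis O_of_int of_int_eq_0_iff less_irrefl)
  define n m where "n = vl P (of_int d * x)" and "m = vl P (of_int d)"
  have p: "unif P powi m \<noteq> 0" using unif(3) by simp
  have "unif P powi m * ((u * w') * x) = u * x * (u' * of_int d)"
    using b(3) by (simp add: m_def mult_ac)
  also have "\<dots> = u' * (u * (of_int d * x))" by (simp add: mult_ac)
  also have "\<dots> = unif P powi n * (w * u')" using a(3) by (simp add: n_def mult_ac)
  also have "unif P powi n = unif P powi m * unif P powi (n - m)"
    using unif(3) by (simp add: power_int_diff)
  finally have "(u * w') * x = unif P powi (n - m) * (w * u')"
    using p unif(3) by (simp add: mult.assoc)
  moreover have "u * w' \<in> \<O> - P" "w * u' \<in> \<O> - P" using a b out_mult by auto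
  moreover from calculation have "vl P x = n - m" by (intro vl_eqI)
  ultimately show ?thesis using that by simp
qed

lemma vl_mult:
  assumes "x \<in> F" "y \<in> F" "x \<noteq> 0" "y \<noteq> 0"
  shows "vl P (x * y) = vl P x + vl P y"
proof -
  obtain u w where 1: "u \<in> \<O> - P" "w \<in> \<O> - P" "u * x = unif P powi (vl P x) * w"
    using vl_exists[OF assms(1,3)] by blast
  obtain u' w' where 2: "u' \<in> \<O> - P" "w' \<in> \<O> - P" "u' * y = unif P powi (vl P y) * w'"
    using vl_exists[OF assms(2,4)] by blast
  have "(u * u') * (x * y) = (u * x) * (u' * y)" by (simp add: mult_ac)
  also have "\<dots> = unif P powi (vl P x + vl P y) * (w * w')"
    unfolding 1(3) 2(3) using unif(3) by (simp add: power_int_add mult_ac)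
  finally show ?thesis using out_mult[OF 1(1) 2(1)] out_mult[OF 1(2) 2(2)] by (intro vl_eqI)
qed

lemma vl_O: "x \<in> \<O> \<Longrightarrow> x \<noteq> 0 \<Longrightarrow> vl P x \<ge> 0"
  using vl_O_exists by blast

lemma vl_out: "u \<in> \<O> - P \<Longrightarrow> vl P u = 0"
  by (rule vl_eqI[of 1 u]) (use P1 in auto)

lemma vl_unif: "vl P (unif P) = 1"
  by (rule vl_eqI[of 1 1]) (use P1 in auto)

lemma vl_add:
  assumes "x \<in> F" "y \<in> F" "x \<noteq> 0" "y \<noteq> 0" "x + y \<noteq> 0"
  shows "vl P (x + y) \<ge> min (vl P x) (vl P y)"
proof -
  have half: "vl P (x + y) \<ge> vl P x" if h: "x \<in> F" "y \<in> F" "x \<noteq> 0" "y \<noteq> 0" "x + y \<noteq> 0" "vl P x \<le> vl P y" for x y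
  proof -
    obtain u w where 1: "u \<in> \<O> - P" "w \<in> \<O> - P" "u * x = unif P powi (vl P x) * w"
      using vl_exists[OF h(1,3)] by blast
    obtain u' w' where 2: "u' \<in> \<O> - P" "w' \<in> \<O> - P" "u' * y = unif P powi (vl P y) * w'"
      using vl_exists[OF h(2,4)] by blast
    define k where "k = nat (vl P y - vl P x)"
    have k: "vl P y = vl P x + int k" using h(6) by (simp add: k_def)
    have uF: "u \<in> F" "u' \<in> F" "u \<noteq> 0" "u' \<noteq> 0" using 1 2 O_subset out_nonzero by auto
    define z where "z = u' * w + u * (unif P ^ k * w')"
    have zO: "z \<in> \<O>" using 1 2 unif(1) PO by (auto simp: z_def)
    have "u * u' * (x + y) = u' * (u * x) + u * (u' * y)" by (simp add: algebra_simps)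
    also have "\<dots> = unif P powi (vl P x) * z"
      unfolding 1(3) 2(3) k z_def using unif(3) by (simp add: power_int_add algebra_simps)
    finally have eq: "u * u' * (x + y) = unif P powi (vl P x) * z" .
    then have z0: "z \<noteq> 0" using uF h(5) by auto
    have "vl P (u * u' * (x + y)) = vl P (x + y)"
      using vl_mult[of "u * u'" "x + y"] vl_out[OF out_mult[OF 1(1) 2(1)]] uF h by simp
    moreover have "vl P (unif P powi (vl P x)) = vl P x"
      by (rule vl_eqI[of 1 1]) (use P1 in auto)
    then have "vl P (unif P powi (vl P x) * z) = vl P x + vl P z"
      using vl_mult[of "unif P powi (vl P x)" z] unif zO z0 O_subset by simp
    ultimately show ?thesis using eq vl_O[OF zO z0] by simp
  qed
  show ?thesis using half[of x y] half[of y x] assms by (cases "vl P x \<le> vl P y") (auto simp: add.commute)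
qed

lemma vl_mem_iff: "x \<in> \<O> \<Longrightarrow> x \<noteq> 0 \<Longrightarrow> x \<in> P \<longleftrightarrow> vl P x \<ge> 1"
proof
  assume x: "x \<in> \<O>" "x \<noteq> 0"
  { assume xP: "x \<in> P"
    obtain j where j: "j \<in> \<O> - P" "\<And>x. x \<in> P \<Longrightarrow> \<exists>y\<in>\<O>. j * x = unif P * y"
      using unif_cofactor by blast
    obtain y where y: "y \<in> \<O>" "j * x = unif P * y" using j(2)[OF xP] by blast
    have "y \<noteq> 0" using y x j(1) out_nonzero by auto
    then have "vl P (unif P * y) = 1 + vl P y"
      using vl_mult[of "unif P" y] y unif vl_unif O_subset by simp
    moreover have "vl P (j * x) = vl P x"
      using vl_mult[of j x] vl_out[OF j(1)] j(1) x out_nonzero O_subset by auto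
    ultimately show "vl P x \<ge> 1" using y vl_O[OF y(1) \<open>y \<noteq> 0\<close>] by simp }
  { assume v: "vl P x \<ge> 1"
    show "x \<in> P"
    proof (rule ccontr)
      assume "x \<notin> P"
      then show False using vl_out[of x] x v by simp
    qed }
qed

lemma pw_subset_vl: "x \<in> pw P n \<Longrightarrow> x \<in> F \<and> (x = 0 \<or> vl P x \<ge> int n)"
proof (induction n arbitrary: x)
  case 0
  then show ?case using vl_O O_subset by auto
next
  case (Suc n)
  let ?S = "{x \<in> F. x = 0 \<or> vl P x \<ge> int (Suc n)}"
  have "pw P n \<star> P \<subseteq> ?S"
  proof (rule idp_subsetI)
    fix i j assume "i \<in> pw P n" and j: "j \<in> P"
    then have i: "i \<in> F" "i = 0 \<or> vl P i \<ge> int n" using Suc.IH by auto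
    have "j \<in> F" "j = 0 \<or> vl P j \<ge> 1" using j PO O_subset vl_mem_iff by auto
    then show "i * j \<in> ?S" using i vl_mult[of i j] by auto
  next
    fix x y assume "x \<in> ?S" "y \<in> ?S"
    then show "x + y \<in> ?S" using vl_add[of x y] by (cases "x = 0 \<or> y = 0 \<or> x + y = 0") force+
  qed
  then show ?case using Suc.prems by auto
qed

text \<open>The bridge from the congruences in the definition of the conductor to valuations, in
  which the local arguments are carried out.\<close>

lemma local_cong_iff:
  assumes "x \<in> F" "y \<in> F"
  shows "local_cong F P n x y \<longleftrightarrow> x = y \<or> vl P (x - y) \<ge> int n"
proof
  assume "local_cong F P n x y"
  then obtain u where u: "u \<in> \<O> - P" "u * (x - y) \<in> pw P n" by (auto simp: local_cong_def)
  then have "u * (x - y) = 0 \<or> vl P (u * (x - y)) \<ge> int n" using pw_subset_vl by blast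
  moreover have "u \<noteq> 0" "u \<in> F" using u out_nonzero O_subset by auto
  ultimately show "x = y \<or> vl P (x - y) \<ge> int n"
    using vl_mult[of u "x - y"] vl_out[OF u(1)] assms by auto
next
  have m: "is_module (pw P n)" using is_frac_module[OF pw_frac[OF Pf]] .
  assume h: "x = y \<or> vl P (x - y) \<ge> int n"
  show "local_cong F P n x y"
  proof (cases "x = y")
    case True
    then show ?thesis unfolding local_cong_def using is_moduleD(1)[OF m] P1 by (intro bexI[of _ 1]) auto
  next
    case False
    obtain u w where 1: "u \<in> \<O> - P" "w \<in> \<O> - P" "u * (x - y) = unif P powi (vl P (x - y)) * w"
      using vl_exists[of "x - y"] assms False by auto
    define k where "k = nat (vl P (x - y) - int n)"
    have "vl P (x - y) = int (n + k)" using h False by (simp add: k_def)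
    then have "u * (x - y) = (unif P ^ k * w) * unif P ^ n"
      unfolding 1(3) by (simp only: power_int_of_nat power_add mult_ac)
    moreover have "(unif P ^ k * w) * unif P ^ n \<in> pw P n"
      using is_moduleD(3)[OF m _ unif_power_mem] 1(2) unif(1) PO by auto
    ultimately have "u * (x - y) \<in> pw P n" by simp
    then show ?thesis unfolding local_cong_def using 1(1) by blast
  qed
qed

text \<open>If u x is integral with u outside P, and r inverts u modulo P, then the integer r u x is
  congruent to x. Integers in turn have finitely many representatives modulo \<open>nm P\<close>,
  which lies in P.\<close>

lemma residue_finite:
  "\<exists>T. finite T \<and> (\<forall>x\<in>F. (x = 0 \<or> vl P x \<ge> 0) \<longrightarrow> (\<exists>t\<in>T. t \<in> F \<and> (x - t = 0 \<or> vl P (x - t) \<ge> 1)))"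
proof -
  have q: "nm P > 0" "of_nat (nm P) \<in> P" using nm nm_mem Pf PO by auto
  obtain T where T: "finite T" "T \<subseteq> \<O>" "\<And>x. x \<in> \<O> \<Longrightarrow> \<exists>t\<in>T. \<exists>y\<in>\<O>. x - t = of_nat (nm P) * y"
    using O_mod_finite[OF q(1)] by auto
  have add1: "x + y \<in> F \<and> (x + y = 0 \<or> vl P (x + y) \<ge> 1)"
    if "x \<in> F" "y \<in> F" "x = 0 \<or> vl P x \<ge> 1" "y = 0 \<or> vl P y \<ge> 1" for x y
    using that vl_add[of x y] by (cases "x = 0 \<or> y = 0 \<or> x + y = 0") force+
  have "\<exists>t\<in>T. t \<in> F \<and> (x - t = 0 \<or> vl P (x - t) \<ge> 1)" if x: "x \<in> F" "x = 0 \<or> vl P x \<ge> 0" for x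
  proof -
    have "\<exists>y\<in>\<O>. x - y = 0 \<or> vl P (x - y) \<ge> 1"
    proof (cases "x = 0")
      case False
      obtain u w where 1: "u \<in> \<O> - P" "w \<in> \<O> - P" "u * x = unif P powi (vl P x) * w"
        using vl_exists[OF x(1) False] by blast
      have "u * x = unif P ^ nat (vl P x) * w" using 1(3) x(2) False by (simp add: power_int_def)
      then have uxO: "u * x \<in> \<O>" using 1(2) unif(1) PO by auto
      obtain r where r: "r \<in> \<O>" "1 - u * r \<in> P" using prime_comaximal[OF P, of u] 1(1) by auto
      have "x - r * (u * x) = x * (1 - u * r)" by (simp add: algebra_simps)
      moreover have "vl P (1 - u * r) \<ge> 1" "1 - u * r \<in> F" if "1 - u * r \<noteq> 0"
        using vl_mem_iff[of "1 - u * r"] r 1(1) that O_subset by auto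
      ultimately have "x - r * (u * x) = 0 \<or> vl P (x - r * (u * x)) \<ge> 1"
        using vl_mult[OF x(1), of "1 - u * r"] x(2) False by (cases "1 - u * r = 0") auto
      then show ?thesis using r uxO by (intro bexI[of _ "r * (u * x)"]) auto
    qed auto
    then obtain y where y: "y \<in> \<O>" "x - y = 0 \<or> vl P (x - y) \<ge> 1" by blast
    obtain t z where t: "t \<in> T" "z \<in> \<O>" "y - t = of_nat (nm P) * z" using T(3)[OF y(1)] by blast
    have "z * of_nat (nm P) \<in> P" using q t by (intro Pm)
    then have "y - t \<in> P" using t(3) by (simp add: mult.commute)
    then have "y - t = 0 \<or> vl P (y - t) \<ge> 1" using vl_mem_iff PO by blast
    moreover have "t \<in> F" "y \<in> F" using T t y O_subset by auto
    ultimately show ?thesis using add1[of "x - y" "y - t"] y x t(1) by (intro bexI[of _ t]) auto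
  qed
  then show ?thesis using T(1) by blast
qed

end

end

section \<open>Norm forms of ramified cubic extensions\<close>

text \<open>The norm of \<open>y0 + y1 * A + y2 * A ^ 2\<close> for a root \<open>A\<close> of \<open>X ^ 3 + b * X ^ 2 + c * X + d\<close>.\<close>

definition cubic_norm :: "complex \<Rightarrow> complex \<Rightarrow> complex \<Rightarrow> complex \<Rightarrow> complex \<Rightarrow> complex \<Rightarrow> complex" where
  "cubic_norm b c d y0 y1 y2 =
     y0^3 - b * y0^2 * y1 + (b^2 - 2 * c) * y0^2 * y2 + c * y0 * y1^2 + (3 * d - b * c) * y0 * y1 * y2
     + (c^2 - 2 * b * d) * y0 * y2^2 - d * y1^3 + b * d * y1^2 * y2 - c * d * y1 * y2^2 + d^2 * y2^3"

text \<open>The coefficients 27 and 18 are factored through 3 so that \<open>3 = p ^ k * h\<close>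
  can be substituted at primes above 3.\<close>

definition cubic_disc :: "complex \<Rightarrow> complex \<Rightarrow> complex \<Rightarrow> complex" where
  "cubic_disc b c d = b^2 * c^2 - 4 * c^3 - 4 * b^3 * d - 3^3 * d^2 + 2 * 3^2 * b * c * d"

lemma cubic_norm_eq:
  assumes "b = - (A1 + A2 + A3)" "c = A1 * A2 + A2 * A3 + A1 * A3" "d = - (A1 * A2 * A3)"
  shows "(y0 + y1 * A1 + y2 * A1^2) * (y0 + y1 * A2 + y2 * A2^2) * (y0 + y1 * A3 + y2 * A3^2) =
    cubic_norm b c d y0 y1 y2"
  unfolding cubic_norm_def assms by Groebner_Basis.algebra

lemma cubic_disc_eq:
  assumes "b = - (A1 + A2 + A3)" "c = A1 * A2 + A2 * A3 + A1 * A3" "d = - (A1 * A2 * A3)"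
  shows "((A1 - A2) * (A2 - A3) * (A3 - A1))^2 = cubic_disc b c d"
  unfolding cubic_disc_def assms by Groebner_Basis.algebra

section \<open>Discrete valuations with finite residue field\<close>

locale discrete_valuation = complex_subfield F for F +
  fixes v :: "complex \<Rightarrow> int" and p :: complex
  assumes v_mult: "x \<in> F \<Longrightarrow> y \<in> F \<Longrightarrow> x \<noteq> 0 \<Longrightarrow> y \<noteq> 0 \<Longrightarrow> v (x * y) = v x + v y"
    and v_add: "x \<in> F \<Longrightarrow> y \<in> F \<Longrightarrow> x \<noteq> 0 \<Longrightarrow> y \<noteq> 0 \<Longrightarrow> x + y \<noteq> 0 \<Longrightarrow> v (x + y) \<ge> min (v x) (v y)"
    and p: "p \<in> F" "p \<noteq> 0" "v p = 1"
    and residue: "\<exists>T. finite T \<and> (\<forall>x\<in>F. (x = 0 \<or> v x \<ge> 0) \<longrightarrow> (\<exists>t\<in>T. t \<in> F \<and> (x - t = 0 \<or> v (x - t) \<ge> 1)))"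
begin

text \<open>Counting 0 as divisible by every power repairs the unspecified value \<open>v 0\<close>
  and makes these sets groups under addition.\<close>

definition ge :: "int \<Rightarrow> complex \<Rightarrow> bool" where
  "ge n x \<longleftrightarrow> x \<in> F \<and> (x = 0 \<or> v x \<ge> n)"

lemma ge_F: "ge n x \<Longrightarrow> x \<in> F" by (simp add: ge_def)

lemma ge_0 [simp]: "ge n 0" by (simp add: ge_def)

lemma ge_mono: "ge m x \<Longrightarrow> n \<le> m \<Longrightarrow> ge n x" by (auto simp: ge_def)

lemma ge_add: "ge n x \<Longrightarrow> ge n y \<Longrightarrow> ge n (x + y)"
  using v_add[of x y] by (cases "x = 0 \<or> y = 0 \<or> x + y = 0") (force simp: ge_def)+

lemma ge_mult: "ge m x \<Longrightarrow> ge n y \<Longrightarrow> ge (m + n) (x * y)"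
  using v_mult[of x y] by (cases "x = 0 \<or> y = 0") (force simp: ge_def)+

lemma v_one [simp]: "v 1 = 0"
  using v_mult[of 1 1] by simp

lemma v_power: "x \<in> F \<Longrightarrow> x \<noteq> 0 \<Longrightarrow> v (x ^ n) = int n * v x"
  by (induction n) (auto simp: v_mult algebra_simps)

lemma v_minus_one: "v (- 1) = 0"
  using v_power[of "- 1" 2] by simp

lemma v_uminus: "x \<in> F \<Longrightarrow> v (- x) = v x"
  using v_mult[of "- 1" x] v_minus_one by (cases "x = 0") auto

lemma ge_uminus: "ge n x \<Longrightarrow> ge n (- x)"
  by (simp add: ge_def v_uminus)

lemma ge_diff: "ge n x \<Longrightarrow> ge n y \<Longrightarrow> ge n (x - y)"
  using ge_add[of n x "- y"] ge_uminus[of n y] by simp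

lemma v_inverse: "x \<in> F \<Longrightarrow> x \<noteq> 0 \<Longrightarrow> v (inverse x) = - v x"
  using v_mult[of x "inverse x"] by simp

lemma v_divide: "x \<in> F \<Longrightarrow> y \<in> F \<Longrightarrow> x \<noteq> 0 \<Longrightarrow> y \<noteq> 0 \<Longrightarrow> v (x / y) = v x - v y"
  using v_mult[of x "inverse y"] v_inverse[of y] by (simp add: divide_inverse)

lemma v_powi: "x \<in> F \<Longrightarrow> x \<noteq> 0 \<Longrightarrow> v (x powi n) = n * v x"
  by (auto simp: power_int_def v_power v_inverse)

lemma ge0_add [simp]: "ge 0 x \<Longrightarrow> ge 0 y \<Longrightarrow> ge 0 (x + y)" by (rule ge_add)
lemma ge0_diff [simp]: "ge 0 x \<Longrightarrow> ge 0 y \<Longrightarrow> ge 0 (x - y)" by (rule ge_diff)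
lemma ge0_uminus [simp]: "ge 0 x \<Longrightarrow> ge 0 (- x)" by (rule ge_uminus)
lemma ge0_mult [simp]: "ge 0 x \<Longrightarrow> ge 0 y \<Longrightarrow> ge 0 (x * y)" using ge_mult[of 0 x 0 y] by simp
lemma ge0_one [simp]: "ge 0 1" by (simp add: ge_def)
lemma ge0_power [simp]: "ge 0 x \<Longrightarrow> ge 0 (x ^ n)" by (induction n) auto
lemma ge0_of_nat [simp]: "ge 0 (of_nat n)" by (induction n) auto
lemma ge0_numeral [simp]: "ge 0 (numeral n)" using ge0_of_nat[of "numeral n"] by simp
lemma ge0_p [simp]: "ge 0 p" by (simp add: ge_def p)

lemma ge_mult0: "ge n x \<Longrightarrow> ge 0 y \<Longrightarrow> ge n (x * y)" "ge 0 y \<Longrightarrow> ge n x \<Longrightarrow> ge n (y * x)"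
  using ge_mult[of n x 0 y] ge_mult[of 0 y n x] by auto

lemma ge_ppow_iff: "y \<in> F \<Longrightarrow> ge n (p ^ k * y) \<longleftrightarrow> ge (n - int k) y"
  using p v_mult[of "p ^ k" y] v_power[of p k] by (auto simp: ge_def)

lemma ge_p_iff: "y \<in> F \<Longrightarrow> ge n (p * y) \<longleftrightarrow> ge (n - 1) y"
  using ge_ppow_iff[of y n 1] by simp

lemma ge_p_iff0: "ge 0 y \<Longrightarrow> ge n (p * y) \<longleftrightarrow> ge (n - 1) y"
  by (rule ge_p_iff[OF ge_F])

lemma ge_ppow_iff0: "ge 0 y \<Longrightarrow> ge n (p ^ k * y) \<longleftrightarrow> ge (n - int k) y"
  by (rule ge_ppow_iff[OF ge_F])

lemma ge_ppow: "ge 0 y \<Longrightarrow> n \<le> int k \<Longrightarrow> ge n (p ^ k * y)"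
  using ge_ppow_iff[of y n k] ge_mono[of 0 y "n - int k"] by (simp add: ge_F)

lemma ge_p: "ge 0 y \<Longrightarrow> ge 1 (p * y)"
  using ge_ppow[of y 1 1] by simp

lemma ge_factor:
  assumes "ge (int k) x" obtains y where "ge 0 y" "x = p ^ k * y"
proof
  show "x = p ^ k * (x / p ^ k)" using p by simp
  then show "ge 0 (x / p ^ k)" using assms ge_ppow_iff[of "x / p ^ k" "int k" k] p ge_F[OF assms] by simp
qed

lemma ge1_factor:
  assumes "ge 1 x" obtains y where "ge 0 y" "x = p * y"
  using ge_factor[of 1 x] assms by auto

lemma ge2_factor:
  assumes "ge 2 x" obtains y where "ge 0 y" "x = p\<^sup>2 * y"
  using ge_factor[of 2 x] assms by auto

lemma ge3_factor:
  assumes "ge 3 x" obtains y where "ge 0 y" "x = p ^ 3 * y"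
  using ge_factor[of 3 x] assms by auto

lemma not_ge_iff: "x \<in> F \<Longrightarrow> \<not> ge n x \<longleftrightarrow> x \<noteq> 0 \<and> v x < n"
  by (auto simp: ge_def)

lemma v_eqI: "ge n x \<Longrightarrow> \<not> ge (n + 1) x \<Longrightarrow> v x = n \<and> x \<noteq> 0"
  by (auto simp: ge_def)

lemma ge_unit_mult_iff: "u \<in> F \<Longrightarrow> u \<noteq> 0 \<Longrightarrow> v u = 0 \<Longrightarrow> x \<in> F \<Longrightarrow> ge n (u * x) \<longleftrightarrow> ge n x"
  using v_mult[of u x] by (auto simp: ge_def)

lemma ge1_power: "x \<in> F \<Longrightarrow> ge 1 (x ^ n) \<Longrightarrow> n > 0 \<Longrightarrow> ge 1 x"
proof (cases "x = 0")
  case False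
  assume "x \<in> F" "ge 1 (x ^ n)" "n > 0"
  then have "int n * v x \<ge> 1" using v_power[of x n] False by (simp add: ge_def)
  then have "v x > 0" by (metis \<open>n > 0\<close> int_one_le_iff_zero_less of_nat_0_less_iff zero_less_mult_pos)
  then show ?thesis using \<open>x \<in> F\<close> by (simp add: ge_def)
qed simp

lemma v_sum_dominant: "x \<in> F \<Longrightarrow> x \<noteq> 0 \<Longrightarrow> ge (v x + 1) y \<Longrightarrow> x + y \<noteq> 0 \<and> v (x + y) = v x"
proof -
  assume x: "x \<in> F" "x \<noteq> 0" and y: "ge (v x + 1) y"
  have gx: "ge (v x) x" "ge (v x) y" using x ge_mono[OF y] by (auto simp: ge_def)
  have "\<not> ge (v x + 1) (x + y)"
  proof
    assume "ge (v x + 1) (x + y)"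
    then have "ge (v x + 1) x" using ge_diff[OF _ y] by fastforce
    then show False using x by (simp add: ge_def)
  qed
  then show ?thesis using v_eqI[OF ge_add[OF gx]] by simp
qed

lemma odd_not_square:
  assumes "\<delta> \<in> F" "\<delta>^2 = x + y" "x \<in> F" "x \<noteq> 0" "odd (v x)" "ge (v x + 1) y"
  shows False
proof -
  have "\<delta> \<noteq> 0" "v (\<delta>^2) = v x" using v_sum_dominant[OF assms(3,4,6)] assms(2) by auto
  then have "2 * v \<delta> = v x" using v_power[of \<delta> 2] assms(1) by simp
  then show False using assms(5) by (metis dvd_triv_left)
qed

lemma integrally_closed:
  assumes "w \<in> F" "w^2 = a * w + b" "ge 0 a" "ge 0 b"
  shows "ge 0 w"
proof (rule ccontr)
  assume "\<not> ge 0 w"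
  then have w: "w \<noteq> 0" "v w < 0" using not_ge_iff assms(1) by auto
  have "ge (v w) (a * w)" using ge_mult[OF assms(3), of "v w" w] assms(1) by (simp add: ge_def)
  moreover have "ge (v w) b" using ge_mono[OF assms(4)] w(2) by simp
  ultimately have "ge (v w) (w^2)" using assms(2) ge_add by simp
  then show False using w v_power[of w 2] assms(1) by (simp add: ge_def)
qed

lemma not_ge1_one: "\<not> ge 1 1"
  by (simp add: ge_def)

text \<open>The map \<open>\<phi>\<close> acts on the residue field, which is finite, so that
  surjectivity implies injectivity. Residue classes are modelled by the chosen representatives
  \<open>r x\<close>, which depend only on the class of x.\<close>

lemma residue_surj_imp_inj:
  assumes closed: "\<And>x. ge 0 x \<Longrightarrow> ge 0 (\<phi> x)"
    and cong: "\<And>x y. ge 0 x \<Longrightarrow> ge 0 y \<Longrightarrow> ge 1 (x - y) \<Longrightarrow> ge 1 (\<phi> x - \<phi> y)"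
    and surj: "\<And>w. ge 0 w \<Longrightarrow> \<exists>x. ge 0 x \<and> ge 1 (w - \<phi> x)"
    and xy: "ge 0 x" "ge 0 y" "ge 1 (\<phi> x - \<phi> y)"
  shows "ge 1 (x - y)"
proof -
  obtain T where T: "finite T"
    "\<And>x. x \<in> F \<Longrightarrow> x = 0 \<or> v x \<ge> 0 \<Longrightarrow> \<exists>t\<in>T. t \<in> F \<and> (x - t = 0 \<or> v (x - t) \<ge> 1)"
    using residue by blast
  have sym: "ge 1 (x - y) \<longleftrightarrow> ge 1 (y - x)" for x y
    using ge_uminus[of 1 "x - y"] ge_uminus[of 1 "y - x"] by auto
  have tr: "ge 1 (x - z)" if "ge 1 (x - y)" "ge 1 (y - z)" for x y z
    using ge_add[OF that] by simp
  define r where "r x = (SOME t. t \<in> T \<and> ge 1 (x - t))" for x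
  have r: "r x \<in> T" "ge 1 (x - r x)" "ge 0 (r x)" if x: "ge 0 x" for x
  proof -
    have "\<exists>t. t \<in> T \<and> ge 1 (x - t)" using T(2)[of x] x by (auto simp: ge_def)
    then have *: "r x \<in> T \<and> ge 1 (x - r x)" unfolding r_def by (rule someI_ex)
    then show "r x \<in> T" "ge 1 (x - r x)" by auto
    then have "ge 0 (x - r x)" using ge_mono[of 1 _ 0] by simp
    then have "ge 0 (x - (x - r x))" using x ge0_diff by blast
    then show "ge 0 (r x)" by simp
  qed
  have r_eq: "r x = r y \<longleftrightarrow> ge 1 (x - y)" if "ge 0 x" "ge 0 y" for x y
  proof
    assume "r x = r y"
    then show "ge 1 (x - y)" using r(2)[OF that(1)] r(2)[OF that(2)] sym tr by metis
  next
    assume h: "ge 1 (x - y)"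
    have "ge 1 (x - t) \<longleftrightarrow> ge 1 (y - t)" for t using h sym tr by blast
    then show "r x = r y" by (simp add: r_def)
  qed
  define Q where "Q = r ` {x. ge 0 x}"
  have fin: "finite Q" by (rule finite_subset[OF _ T(1)]) (auto simp: Q_def r)
  have Q0: "ge 0 q" if "q \<in> Q" for q using that r by (auto simp: Q_def)
  have sub: "Q \<subseteq> (\<lambda>q. r (\<phi> q)) ` Q"
  proof
    fix q assume "q \<in> Q"
    then obtain w where w: "ge 0 w" "q = r w" by (auto simp: Q_def)
    obtain x where x: "ge 0 x" "ge 1 (w - \<phi> x)" using surj[OF w(1)] by blast
    have "ge 1 (\<phi> x - \<phi> (r x))" using cong[OF x(1) r(3)[OF x(1)] r(2)[OF x(1)]] .
    then have "ge 1 (w - \<phi> (r x))" using x tr by blast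
    then have "r w = r (\<phi> (r x))" using r_eq w(1) closed[OF r(3)[OF x(1)]] by blast
    then show "q \<in> (\<lambda>q. r (\<phi> q)) ` Q" using w x by (auto simp: Q_def)
  qed
  have inj: "inj_on (\<lambda>q. r (\<phi> q)) Q" by (rule finite_surj_inj[OF fin sub])
  note rx = r[OF xy(1)] and ry = r[OF xy(2)]
  have "ge 1 (\<phi> (r x) - \<phi> x)" using cong[OF xy(1) rx(3) rx(2)] sym by simp
  moreover have "ge 1 (\<phi> y - \<phi> (r y))" using cong[OF xy(2) ry(3) ry(2)] .
  ultimately have "ge 1 (\<phi> (r x) - \<phi> (r y))" using tr[OF tr[OF _ xy(3)]] by blast
  then have "r (\<phi> (r x)) = r (\<phi> (r y))" using r_eq[OF closed[OF rx(3)] closed[OF ry(3)]] by simp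
  moreover have "r x \<in> Q" "r y \<in> Q" using xy by (auto simp: Q_def)
  ultimately have "r x = r y" using inj by (simp add: inj_on_def)
  then show ?thesis using r_eq[OF xy(1,2)] by simp
qed

text \<open>Modulo p the polynomial t (x^3 + m x) takes the same value at 0 and at r, and r is not 0
  there. A self-map of a finite set that is not injective misses a value.\<close>

lemma additive_not_surj:
  assumes r: "ge 0 r" "\<not> ge 1 r" "ge 1 (r^2 + m)" and m: "ge 0 m" and t: "ge 0 t"
    and residue_char: "ge 1 3"
  obtains w where "ge 0 w" "\<And>x. ge 0 x \<Longrightarrow> \<not> ge 1 (w - t * (x^3 + m * x))"
proof (rule ccontr)
  note thesisI = that
  assume *: "\<not> thesis"
  define \<phi> where "\<phi> x = t * (x^3 + m * x)" for x
  have "ge 1 (r - 0)"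
  proof (rule residue_surj_imp_inj[of \<phi>])
    show "ge 0 (\<phi> x)" if "ge 0 x" for x using that m t by (simp add: \<phi>_def)
    show "ge 1 (\<phi> x - \<phi> y)" if "ge 0 x" "ge 0 y" "ge 1 (x - y)" for x y
    proof -
      have "\<phi> x - \<phi> y = (x - y) * (t * (x^2 + x * y + y^2 + m))"
        unfolding \<phi>_def by Groebner_Basis.algebra
      then show ?thesis using that m t by (simp add: ge_mult0)
    qed
    show "\<exists>x. ge 0 x \<and> ge 1 (w - \<phi> x)" if "ge 0 w" for w
      using * thesisI[OF \<open>ge 0 w\<close>] unfolding \<phi>_def by blast
    have "\<phi> r - \<phi> 0 = (r^2 + m) * (t * r)"
      by (simp add: \<phi>_def algebra_simps power2_eq_square power3_eq_cube)
    then show "ge 1 (\<phi> r - \<phi> 0)" using r t by (simp add: ge_mult0)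
  qed (use r in auto)
  then show False using r by simp
qed

text \<open>Isolates the lowest term of a p-adic expansion: everything from order k on is already
  small enough.\<close>

lemma ge_leading:
  assumes "x = a + p ^ k * q" "ge n x" "n \<le> int k" "ge 0 q"
  shows "ge n a"
proof -
  have "ge n (x - p ^ k * q)" using assms by (intro ge_diff ge_ppow)
  then show ?thesis using assms(1) by simp
qed

lemma ge1_leading:
  assumes "x = a + p * q" "ge 1 x" "ge 0 q"
  shows "ge 1 a"
  using ge_leading[of x a 1 q 1] assms by simp

end

text \<open>The polynomial is X^3 + b X^2 + c X + p E, of Eisenstein type. \<open>\<delta>\<close>
  records that its discriminant is a square, as for a Galois cubic extension. The bound on
  \<open>v 3\<close> reflects that the base field has degree 2 over the rationals.\<close>

locale eisenstein_cubic = discrete_valuation +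
  fixes b c E \<delta> :: complex
  assumes b: "ge 1 b" and c: "ge 1 c" and E: "E \<in> F" "E \<noteq> 0" "v E = 0"
    and \<delta>: "\<delta> \<in> F" "\<delta>^2 = cubic_disc b c (p * E)"
    and v3: "v 3 \<le> 2"
begin

abbreviation d where "d \<equiv> p * E"

abbreviation nf where "nf \<equiv> cubic_norm b c d"

lemma E0: "ge 0 E"
  using E by (simp add: ge_def)

lemma d: "d \<in> F" "d \<noteq> 0" "v d = 1"
  using E p v_mult[of p E] by auto

lemma ge1_cube_E: "ge 1 (E * z ^ 3) \<Longrightarrow> z \<in> F \<Longrightarrow> ge 1 z"
  using ge_unit_mult_iff[of E "z ^ 3" 1] E ge1_power[of z 3] by simp

lemma nf_scale: "nf (t * y0) (t * y1) (t * y2) = t ^ 3 * nf y0 y1 y2"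
  unfolding cubic_norm_def by Groebner_Basis.algebra

text \<open>The terms y0^3, d y1^3 and d^2 y2^3 have values congruent to 0, 1 and 2 modulo 3, so
  they cannot cancel. The coordinates are shown to be divisible by p in this order, each time from
  the lowest remaining term.\<close>

lemma nf_ge3:
  assumes z: "ge 0 z0" "ge 0 z1" "ge 0 z2" and n: "ge 3 (nf z0 z1 z2)"
  shows "ge 1 z0 \<and> ge 1 z1 \<and> ge 1 z2"
proof -
  obtain B where B: "ge 0 B" "b = p * B" using ge1_factor b by blast
  obtain C where C: "ge 0 C" "c = p * C" using ge1_factor c by blast
  note rs = B(1) C(1) E0 z
  have F: "z0 \<in> F" "z1 \<in> F" "z2 \<in> F" using z ge_F by auto
  have "nf z0 z1 z2 = z0^3 + p * (- B*z0^2*z1 + (p*B^2-2*C)*z0^2*z2 + C*z0*z1^2 + (3*E - p*B*C)*z0*z1*z2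
      + (p*C^2-2*p*B*E)*z0*z2^2 - E*z1^3 + p*B*E*z1^2*z2 - p*C*E*z1*z2^2 + p*E^2*z2^3)"
    unfolding cubic_norm_def B C by Groebner_Basis.algebra
  then have "ge 1 (z0 ^ 3)"
    by (rule ge1_leading[OF _ ge_mono[OF n]]) (simp_all add: rs)
  then have 0: "ge 1 z0" using ge1_power F by simp
  obtain x where x: "ge 0 x" "z0 = p * x" using ge1_factor[OF 0] .
  note rs = rs x(1)
  have "nf z0 z1 z2 = p * (- (E*z1^3)) + p^2*(p*x^3 - p*B*x^2*z1 + p*(p*B^2-2*C)*x^2*z2 + C*x*z1^2
      + (3*E-p*B*C)*x*z1*z2 + p*(C^2-2*B*E)*x*z2^2 + B*E*z1^2*z2 - C*E*z1*z2^2 + E^2*z2^3)"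
    unfolding cubic_norm_def B C x(2) by Groebner_Basis.algebra
  then have "ge 2 (p * (- (E*z1^3)))"
    by (rule ge_leading[OF _ ge_mono[OF n]]) (simp_all add: rs)
  then have "ge 1 (- (E*z1^3))" using ge_p_iff[of "- (E*z1^3)" 2] E F by simp
  then have "ge 1 (E * z1^3)" using ge_uminus by fastforce
  then have 1: "ge 1 z1" using ge1_cube_E F by simp
  obtain y where y: "ge 0 y" "z1 = p * y" using ge1_factor[OF 1] .
  note rs = rs y(1)
  have "nf z0 z1 z2 = p^2 * (E * (E*z2^3)) + p^3*(x^3 - p*B*x^2*y + (p*B^2-2*C)*x^2*z2 + p*C*x*y^2
      + (3*E-p*B*C)*x*y*z2 + (C^2-2*B*E)*x*z2^2 - p*E*y^3 + p*B*E*y^2*z2 - C*E*y*z2^2)"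
    unfolding cubic_norm_def B C x(2) y(2) by Groebner_Basis.algebra
  then have "ge 3 (p^2 * (E * (E*z2^3)))"
    by (rule ge_leading[OF _ n]) (simp_all add: rs)
  then have "ge 1 (E * (E * z2^3))" using ge_ppow_iff[of "E * (E*z2^3)" 3 2] E F by simp
  then have "ge 1 (E * z2^3)" using ge_unit_mult_iff[of E "E * z2^3" 1] E F by simp
  then have "ge 1 z2" using ge1_cube_E F by simp
  with 0 1 show ?thesis by simp
qed

text \<open>Clear the denominators with the least possible power \<open>p ^ k\<close>. If k were
  positive, the norm of the scaled coordinates would be divisible by \<open>p ^ 3\<close>, and
  \<open>nf_ge3\<close> would allow a smaller power.\<close>

lemma nf_integral:
  assumes y: "y0 \<in> F" "y1 \<in> F" "y2 \<in> F" and n: "ge 0 (nf y0 y1 y2)"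
  shows "ge 0 y0 \<and> ge 0 y1 \<and> ge 0 y2"
proof -
  define Z where "Z k \<longleftrightarrow> ge 0 (p ^ k * y0) \<and> ge 0 (p ^ k * y1) \<and> ge 0 (p ^ k * y2)" for k
  have "ge 0 (p ^ k * x) \<longleftrightarrow> x = 0 \<or> v x + int k \<ge> 0" if "x \<in> F" for k x
    using ge_ppow_iff[OF that, of 0 k] that by (auto simp: ge_def)
  then have "Z (nat (\<bar>v y0\<bar> + \<bar>v y1\<bar> + \<bar>v y2\<bar>))" using y by (auto simp: Z_def)
  then have ex: "Z (LEAST k. Z k)" by (rule LeastI)
  define k where "k = (LEAST k. Z k)"
  have k: "Z k" "\<And>j. Z j \<Longrightarrow> k \<le> j" using ex by (auto simp: k_def intro: Least_le)
  have "k = 0"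
  proof (rule ccontr)
    assume "k \<noteq> 0"
    then obtain j where j: "k = Suc j" by (cases k) auto
    have "nf (p^k*y0) (p^k*y1) (p^k*y2) = p ^ (3 * k) * nf y0 y1 y2"
      by (simp add: nf_scale power_mult[symmetric] mult.commute[of 3 k])
    moreover have "ge 3 (p ^ (3 * k) * nf y0 y1 y2)" using n j by (intro ge_ppow) auto
    ultimately have "ge 1 (p^k*y0) \<and> ge 1 (p^k*y1) \<and> ge 1 (p^k*y2)"
      using k(1) by (intro nf_ge3) (auto simp: Z_def)
    then have "Z j" unfolding Z_def j
      using y p ge_p_iff[of "p^j*y0" 1] ge_p_iff[of "p^j*y1" 1] ge_p_iff[of "p^j*y2" 1]
      by (simp add: mult.assoc)
    then show False using k(2) j by fastforce
  qed
  then show ?thesis using k(1) by (simp add: Z_def)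
qed

text \<open>The values \<open>u\<close> of the norm form that are units come from integral \<open>y0\<close>, \<open>y1\<close>, \<open>y2\<close> and are
  cubes modulo \<open>p\<close>.\<close>

lemma nf_unit:
  assumes y: "y0 \<in> F" "y1 \<in> F" "y2 \<in> F" and u: "ge 0 u" and n: "ge 4 (u - nf y0 y1 y2)"
  shows "ge 0 y0" "ge 0 y1" "ge 0 y2" "ge 1 (u - y0^3)"
proof -
  have "ge 0 (u - (u - nf y0 y1 y2))" by (rule ge0_diff[OF u ge_mono[OF n]]) simp
  then have "ge 0 y0 \<and> ge 0 y1 \<and> ge 0 y2" using y by (intro nf_integral) auto
  then show rs: "ge 0 y0" "ge 0 y1" "ge 0 y2" by auto
  obtain B where B: "ge 0 B" "b = p * B" using ge1_factor b by blast
  obtain C where C: "ge 0 C" "c = p * C" using ge1_factor c by blast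
  note rs = rs B(1) C(1) E0
  have "u - nf y0 y1 y2 = (u - y0^3) + p * (- (- B*y0^2*y1 + (p*B^2-2*C)*y0^2*y2 + C*y0*y1^2 + (3*E - p*B*C)*y0*y1*y2
      + (p*C^2-2*p*B*E)*y0*y2^2 - E*y1^3 + p*B*E*y1^2*y2 - p*C*E*y1*y2^2 + p*E^2*y2^3))"
    unfolding cubic_norm_def B C by Groebner_Basis.algebra
  then show "ge 1 (u - y0^3)"
    by (rule ge1_leading[OF _ ge_mono[OF n]]) (simp_all add: rs)
qed

text \<open>If every unit were a norm modulo \<open>p ^ 4\<close>, every unit would be a cube modulo
  p by \<open>nf_unit\<close>, so cubing would be injective on the residue field. But the
  discriminant is -27 d^2 up to higher order, and its square root produces a cube root of unity
  \<open>\<omega>\<close>, which differs from 1 modulo p because 3 is a unit.\<close>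

lemma tame_not_norm:
  assumes v0: "v 3 = 0"
  obtains u where "u \<in> F" "u \<noteq> 0" "v u = 0"
    "\<And>y0 y1 y2. y0 \<in> F \<Longrightarrow> y1 \<in> F \<Longrightarrow> y2 \<in> F \<Longrightarrow> \<not> ge 4 (u - nf y0 y1 y2)"
proof (rule ccontr)
  note thesisI = that
  assume *: "\<not> thesis"
  obtain B where B: "ge 0 B" "b = p * B" using ge1_factor b by blast
  obtain C where C: "ge 0 C" "c = p * C" using ge1_factor c by blast
  have iE: "ge 0 (inverse E)" using E v_inverse[of E] by (simp add: ge_def)
  have i3: "ge 0 (inverse 3)" using v0 v_inverse[of 3] by (simp add: ge_def)
  define e where "e = p * (B * C * inverse E)"
  define k where "k = p * (C^3 * (inverse E)^2 + p * B^3 * inverse E)"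
  have ek: "ge 1 e" "ge 1 k" unfolding e_def k_def using B C iE by (auto intro!: ge_p)
  \<comment> \<open>Up to order p, \<open>\<delta> / d\<close> is a square root of -27, so 1 - w / 3
    is (-1 - sqrt (-3)) / 2. The shift by e + 9 before halving makes w a root of a monic polynomial
    with integral coefficients; so w is integral also at primes above 2.\<close>
  define w where "w = (\<delta> / d + (e + 9)) / 2"
  have FBC: "B \<in> F" "C \<in> F" "e \<in> F" "k \<in> F" using B C ek ge_F by auto
  have wF: "w \<in> F" using \<delta> d FBC by (simp add: w_def)
  have "(\<delta> / d)^2 = (e + 9)^2 - 108 - 4 * k"
  proof -
    define i where "i = inverse E"
    define t1 t2 t3 where "t1 = B * C * i" and "t2 = C^3 * i^2" and "t3 = B^3 * i"
    have ts: "B * C = E * t1" "C^3 = E^2 * t2" "B^3 = E * t3"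
      using E(2) by (simp_all add: t1_def t2_def t3_def i_def field_simps)
    have "cubic_disc b c d = p^4*(B*C)^2 - 4*p^3*C^3 - 4*p^4*B^3*E - 27*p^2*E^2 + 18*p^3*(B*C)*E"
      unfolding cubic_disc_def B C by Groebner_Basis.algebra
    also have "\<dots> = d^2 * ((p * t1 + 9)^2 - 108 - 4 * (p * (t2 + p * t3)))"
      unfolding ts by Groebner_Basis.algebra
    also have "p * t1 = e" by (simp add: e_def t1_def i_def)
    also have "p * (t2 + p * t3) = k" by (simp add: k_def t2_def t3_def i_def)
    finally have "\<delta>^2 = d^2 * ((e + 9)^2 - 108 - 4 * k)" using \<delta>(2) by simp
    then show ?thesis using d(2) by (simp add: power_divide)
  qed
  moreover have "2 * w = \<delta> / d + (e + 9)" by (simp add: w_def)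
  ultimately have "4 * w^2 = 4 * ((e + 9) * w + (- 27 - k))" by Groebner_Basis.algebra
  then have w2: "w^2 = (e + 9) * w + (- 27 - k)"
    by (rule mult_left_cancel[THEN iffD1, of 4, rotated]) simp
  have w0: "ge 0 w"
    by (rule integrally_closed[OF wF w2]) (use ge_mono[OF ek(1), of 0] ge_mono[OF ek(2), of 0] in auto)
  define j :: complex where "j = inverse 3"
  have j: "3 * j = 1" "ge 0 j" using i3 by (simp_all add: j_def)
  define \<omega> where "\<omega> = 1 - w * j"
  have \<omega>0: "ge 0 \<omega>" unfolding \<omega>_def using w0 j by simp
  have "\<omega>^2 + \<omega> + 1 = (e * w - k) * j^2"
    unfolding \<omega>_def using w2 j(1) by Groebner_Basis.algebra
  moreover have "ge 1 ((e * w - k) * j^2)"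
    using ek w0 j by (intro ge_mult0(1) ge_diff) auto
  ultimately have om: "ge 1 (\<omega>^2 + \<omega> + 1)" by simp
  have "ge 1 (\<omega> - 1)"
  proof (rule residue_surj_imp_inj[of "\<lambda>x. x^3"])
    show "ge 1 (x^3 - y^3)" if "ge 0 x" "ge 0 y" "ge 1 (x - y)" for x y
    proof -
      have "x^3 - y^3 = (x - y) * (x^2 + x * y + y^2)" by Groebner_Basis.algebra
      then show ?thesis using that by (simp add: ge_mult0)
    qed
    show "\<exists>x. ge 0 x \<and> ge 1 (w - x^3)" if w: "ge 0 w" for w
    proof (cases "ge 1 w")
      case True
      then show ?thesis by (intro exI[of _ 0]) auto
    next
      case False
      then have "w \<in> F" "w \<noteq> 0" "v w = 0" using v_eqI[OF w] w ge_F by auto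
      then have "\<exists>y0 y1 y2. y0 \<in> F \<and> y1 \<in> F \<and> y2 \<in> F \<and> ge 4 (w - nf y0 y1 y2)"
        using * thesisI[of w] by blast
      then obtain y0 y1 y2 where y: "y0 \<in> F" "y1 \<in> F" "y2 \<in> F" "ge 4 (w - nf y0 y1 y2)"
        by blast
      then show ?thesis using nf_unit[OF y(1-3) w y(4)] by blast
    qed
    have "\<omega>^3 - 1^3 = (\<omega>^2 + \<omega> + 1) * (\<omega> - 1)"
      by (simp add: algebra_simps power2_eq_square power3_eq_cube)
    then show "ge 1 (\<omega>^3 - 1^3)" using om \<omega>0 by (simp add: ge_mult0)
  qed (use \<omega>0 in auto)
  then have "ge 1 ((\<omega> - 1) * (\<omega> + 2))" using \<omega>0 by (simp add: ge_mult0)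
  then have "ge 1 (\<omega>^2 + \<omega> + 1 - (\<omega> - 1) * (\<omega> + 2))" using om ge_diff by blast
  moreover have "\<omega>^2 + \<omega> + 1 - (\<omega> - 1) * (\<omega> + 2) = 3"
    by (simp add: algebra_simps power2_eq_square)
  ultimately show False using v0 by (simp add: ge_def)
qed

section \<open>Wild ramification at primes above 3\<close>

lemma wild_y0:
  assumes w3: "v 3 \<ge> 1" and y0: "ge 0 y0" and n: "ge 1 (u - y0^3)" and u: "ge 1 (u - 1)"
  obtains n where "ge 0 n" "y0 = 1 + p * n"
proof -
  have "ge 1 3" using w3 by (simp add: ge_def)
  then have "ge 1 (3 * (y0^2 - y0))" using y0 by (intro ge_mult0(1)) auto
  then have "ge 1 ((u - 1) - (u - y0^3) - 3 * (y0^2 - y0))" by (rule ge_diff[OF ge_diff[OF u n]])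
  \<comment> \<open>Modulo 3, cubing is additive: (y0 - 1)^3 agrees with y0^3 - 1.\<close>
  moreover have "(u - 1) - (u - y0^3) - 3 * (y0^2 - y0) = (y0 - 1)^3" by Groebner_Basis.algebra
  ultimately have "ge 1 (y0 - 1)" using ge1_power[of "y0 - 1" 3] y0 ge_F by simp
  then obtain n where "ge 0 n" "y0 - 1 = p * n" by (rule ge1_factor)
  then show ?thesis using that[of n] by (simp add: algebra_simps)
qed

lemma wild_unit:
  assumes "ge 0 w" "k > 0"
  shows "1 + p ^ k * w \<in> F" "1 + p ^ k * w \<noteq> 0" "v (1 + p ^ k * w) = 0" "ge 0 (1 + p ^ k * w)"
    "ge 1 (1 + p ^ k * w - 1)"
proof -
  have "ge 1 (p ^ k * w)" using assms by (intro ge_ppow) auto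
  then show "1 + p ^ k * w \<noteq> 0" "v (1 + p ^ k * w) = 0" "ge 1 (1 + p ^ k * w - 1)"
    using v_sum_dominant[of 1 "p ^ k * w"] by auto
  show "ge 0 (1 + p ^ k * w)" using assms by simp
  then show "1 + p ^ k * w \<in> F" by (rule ge_F)
qed

text \<open>The dominant term of the discriminant, which is a square, makes
  \<open>\<delta> / t\<close> a square root of -m modulo p, that is, a nonzero root of X^3 + m X in
  the residue field.\<close>

lemma wild_square_root:
  assumes t: "t \<in> F" "t \<noteq> 0" and m: "m \<in> F" "m \<noteq> 0" "v m = 0"
    and D: "cubic_disc b c d = - (t^2 * m) + R" "ge (2 * v t + 1) R"
  shows "ge 0 (\<delta> / t)" "\<not> ge 1 (\<delta> / t)" "ge 1 ((\<delta> / t)^2 + m)"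
proof -
  define r where "r = \<delta> / t"
  have rF: "r \<in> F" using t \<delta> by (simp add: r_def)
  have "r^2 + m = (inverse t)^2 * R"
    using \<delta>(2) D(1) t(2) by (simp add: r_def field_simps)
  moreover have "ge (- (2 * v t)) ((inverse t)^2)"
    using t v_power[of "inverse t" 2] v_inverse[of t] by (simp add: ge_def)
  ultimately show 1: "ge 1 ((\<delta> / t)^2 + m)"
    using ge_mult[of "- (2 * v t)" "(inverse t)^2" "2 * v t + 1" R] D(2) by (simp add: r_def)
  have m0: "ge 0 m" "\<not> ge 1 m" using m by (auto simp: ge_def)
  have "ge 0 (r^2 + m - m)" unfolding r_def by (rule ge0_diff[OF ge_mono[OF 1] m0(1)]) simp
  then have "ge 0 r" using integrally_closed[OF rF, of 0 "r^2"] by simp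
  then show "ge 0 (\<delta> / t)" by (simp add: r_def)
  show "\<not> ge 1 (\<delta> / t)"
  proof
    assume "ge 1 (\<delta> / t)"
    then have "ge 1 (r^2 + m - r * r)" using 1 \<open>ge 0 r\<close> by (intro ge_diff ge_mult0) (auto simp: r_def)
    then show False using m0 by (simp add: power2_eq_square)
  qed
qed

lemma v_two: "v 3 \<ge> 1 \<Longrightarrow> v 2 = 0"
proof -
  assume "v 3 \<ge> 1"
  then have "ge 1 3" by (simp add: ge_def)
  then have "\<not> ge 1 2" using ge_diff[of 1 3 2] not_ge1_one by auto
  then show ?thesis using v_eqI[of 0 2] by auto
qed

text \<open>Precision 4 covers all cases: the deepest one, \<open>wild_norm_3\<close>, uses the
  coefficient of \<open>p ^ 3\<close>.\<close>

definition not_norm :: "complex \<Rightarrow> bool" where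
  "not_norm u \<longleftrightarrow> u \<in> F \<and> u \<noteq> 0 \<and> v u = 0 \<and> (\<forall>y0\<in>F. \<forall>y1\<in>F. \<forall>y2\<in>F. \<not> ge 4 (u - nf y0 y1 y2))"

text \<open>The common end of the three wild cases. If the unit \<open>1 + p ^ i * w\<close> is
  close to a norm, then \<open>key\<close> makes w a value of t (x^3 + m x) modulo p, and these
  values do not exhaust the residue field. In each application \<open>v t0 = i + 1\<close>, so the
  discriminant has value 2 (i + 1) and i is the ramification break.\<close>

lemma wild_conclude:
  assumes w3: "v 3 \<ge> 1" and i: "i > 0"
    and t0: "t0 \<in> F" "t0 \<noteq> 0" and m: "m \<in> F" "m \<noteq> 0" "v m = 0"
    and D: "cubic_disc b c d = - (t0^2 * m) + R" "ge (2 * v t0 + 1) R"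
    and t: "ge 0 t"
    and key: "\<And>w n y1 y2. ge 0 w \<Longrightarrow> ge 0 n \<Longrightarrow> ge 0 y1 \<Longrightarrow> ge 0 y2 \<Longrightarrow>
        ge 4 (1 + p ^ i * w - nf (1 + p * n) y1 y2) \<Longrightarrow> \<exists>x. ge 0 x \<and> ge 1 (w - t * (x^3 + m * x))"
  shows "\<exists>u. not_norm u"
proof -
  have m0: "ge 0 m" using m by (simp add: ge_def)
  have c3: "ge 1 3" using w3 by (simp add: ge_def)
  obtain w where w: "ge 0 w" "\<And>x. ge 0 x \<Longrightarrow> \<not> ge 1 (w - t * (x^3 + m * x))"
    using additive_not_surj[OF wild_square_root[OF t0 m D] m0 t c3] by blast
  note u = wild_unit[OF w(1) i]
  have "\<not> ge 4 (1 + p ^ i * w - nf y0 y1 y2)" if y: "y0 \<in> F" "y1 \<in> F" "y2 \<in> F" for y0 y1 y2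
  proof
    assume g: "ge 4 (1 + p ^ i * w - nf y0 y1 y2)"
    note h = nf_unit[OF y u(4) g]
    obtain n where n: "ge 0 n" "y0 = 1 + p * n" using wild_y0[OF w3 h(1,4) u(5)] by blast
    show False using key[OF w(1) n(1) h(2,3)] g w(2) unfolding n(2) by blast
  qed
  then show ?thesis using u unfolding not_norm_def by blast
qed

text \<open>Here -4 b^3 d dominates the discriminant; it equals -(2 b d)^2 (b / d), and b / d is B /
  E. The additive polynomial comes from y1: with y0 = 1 + p n, the contribution of order p to the
  norm form is -(B y1 + E y1^3).\<close>

lemma wild_norm_1:
  assumes w3: "v 3 \<ge> 1" and b1: "v b = 1" "b \<noteq> 0" and c2: "ge 2 c"
  shows "\<exists>u. not_norm u"
proof -
  have bF: "b \<in> F" using b ge_F by simp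
  obtain h where h: "ge 0 h" "3 = p * h" using ge1_factor[of 3] w3 by (auto simp: ge_def)
  obtain B where B: "ge 0 B" "b = p * B" using ge1_factor b by blast
  obtain C where C: "ge 0 C" "c = p^2 * C" using ge2_factor c2 by blast
  have B0: "B \<noteq> 0" "v B = 0" using b1 B(2) v_mult[of p B] p B ge_F by auto
  note rs = h(1) B(1) C(1) E0
  show ?thesis
  proof (rule wild_conclude[OF w3, of 1 "2 * b * d" "B / E"])
    show "2 * b * d \<in> F" "2 * b * d \<noteq> 0" using bF d b1 by auto
    show "B / E \<in> F" "B / E \<noteq> 0" "v (B / E) = 0" using B0 E B ge_F v_divide by auto
    have "v (2 * b * d) = 2" using v_mult[of "2 * b" d] v_mult[of 2 b] v_two[OF w3] bF d b1 by simp
    moreover have "ge 5 (p^5 * (p*B^2*C^2 - 4*p*C^3 - h^3*E^2 + 2*p*h^2*B*C*E))"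
      by (rule ge_ppow) (simp_all add: rs)
    ultimately show "ge (2 * v (2 * b * d) + 1) (p^5 * (p*B^2*C^2 - 4*p*C^3 - h^3*E^2 + 2*p*h^2*B*C*E))"
      by simp
    have "(2 * b * d)^2 * (B / E) = 4 * b^3 * d"
      unfolding B(2) using E(2) by (simp add: field_simps power2_eq_square power3_eq_cube)
    moreover have "cubic_disc b c d = - (4 * b^3 * d) + p^5 * (p*B^2*C^2 - 4*p*C^3 - h^3*E^2 + 2*p*h^2*B*C*E)"
      unfolding cubic_disc_def B(2) C(2) h(2) by Groebner_Basis.algebra
    ultimately show "cubic_disc b c d = - ((2 * b * d)^2 * (B / E)) +
        p^5 * (p*B^2*C^2 - 4*p*C^3 - h^3*E^2 + 2*p*h^2*B*C*E)" by simp
    show "ge 0 (- E)" using E0 by simp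
    fix w n y1 y2 assume y: "ge 0 w" "ge 0 n" "ge 0 y1" "ge 0 y2"
      and g: "ge 4 (1 + p ^ 1 * w - nf (1 + p * n) y1 y2)"
    define y0 where "y0 = 1 + p * n"
    have y0: "ge 0 y0" using y by (simp add: y0_def)
    have "1 + p ^ 1 * w - nf (1 + p * n) y1 y2 = p * (w + B * y1 + E * y1^3) + p^2 *
      (- (h*n + p*h*n^2 + p*n^3 - B*y1*n*(2+p*n) + (B^2-2*C)*y0^2*y2 + C*y0*y1^2 + (h*E-p*B*C)*y0*y1*y2
        + (p^2*C^2-2*B*E)*y0*y2^2 + B*E*y1^2*y2 - p*C*E*y1*y2^2 + E^2*y2^3))"
      unfolding cubic_norm_def B(2) C(2) y0_def using h(2) by Groebner_Basis.algebra
    then have "ge 2 (p * (w + B * y1 + E * y1^3))"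
      by (rule ge_leading[OF _ ge_mono[OF g]]) (simp_all add: rs y y0)
    then have fin: "ge 1 (w + B * y1 + E * y1^3)"
      using ge_p_iff0[of "w + B * y1 + E * y1^3" 2] by (simp add: rs y)
    have "w - (- E) * (y1^3 + m * y1) = w + B * y1 + E * y1^3" if "E * m = B" for m
      unfolding that[symmetric] by (simp add: algebra_simps)
    from this[of "B / E"] have eq: "w - (- E) * (y1^3 + B / E * y1) = w + B * y1 + E * y1^3"
      using E(2) by simp
    show "\<exists>x. ge 0 x \<and> ge 1 (w - (- E) * (x^3 + B / E * x))"
      by (rule exI[of _ y1], unfold eq) (rule conjI[OF y(3) fin])
  qed simp
qed

text \<open>With b, c and 3 divisible by \<open>p ^ 2\<close>, the only contribution of order p to
  the norm form is the term in y1^3.\<close>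

lemma wild_first_step:
  assumes h: "ge 0 h" "3 = p^2 * h" and B: "ge 0 B" "b = p^2 * B" and C: "ge 0 C" "c = p^2 * C"
    and y: "ge 0 n" "ge 0 y1" "ge 0 y2" and g: "ge 2 (1 + p^2 * w - nf (1 + p * n) y1 y2)" "ge 0 w"
  shows "ge 1 y1"
proof -
  define y0 where "y0 = 1 + p * n"
  have y0: "ge 0 y0" using y by (simp add: y0_def)
  have "1 + p^2 * w - nf (1 + p * n) y1 y2 = p * (E * y1^3) + p^2 *
    (w - (p*h*n + p^2*h*n^2 + p*n^3 - B*y0^2*y1 + (p^2*B^2-2*C)*y0^2*y2 + C*y0*y1^2
      + (p*h*E - p^2*B*C)*y0*y1*y2 + (p^2*C^2-2*p*B*E)*y0*y2^2 + p*B*E*y1^2*y2 - p*C*E*y1*y2^2 + E^2*y2^3))"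
    unfolding cubic_norm_def B(2) C(2) y0_def using h(2) by Groebner_Basis.algebra
  then have "ge 2 (p * (E * y1^3))"
    by (rule ge_leading[OF _ g(1)]) (simp_all add: h B C E0 y y0 g)
  then have "ge 1 (E * y1^3)" using ge_p_iff[of "E * y1^3" 2] E y ge_F by simp
  then show ?thesis using ge1_cube_E y ge_F by simp
qed

text \<open>The expansion for the two remaining cases. The coefficient -2 c of y2 shows up as C at
  order \<open>p ^ 2\<close> because -2 = 1 - 3 and 3 is itself divisible by
  \<open>p ^ 2\<close>.\<close>

lemma wild_second_step:
  assumes h: "3 = p^2 * h" and B: "b = p^2 * B" and C: "c = p^2 * C"
  shows "nf (1 + p * n) (p * x) y2 = 1 + p^2 * (C * y2 + E^2 * y2^3) + p^3 *
    (h*n + p*h*n^2 + n^3 - B*(1+p*n)^2*x + p*B^2*(1+p*n)^2*y2 - p*h*C*y2 - 2*C*y2*n*(2+p*n) + p*C*(1+p*n)*x^2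
     + p*(h*E-p*B*C)*(1+p*n)*x*y2 + (p*C^2-2*B*E)*(1+p*n)*y2^2 - p*E*x^3 + p^2*B*E*x^2*y2 - p*C*E*x*y2^2)"
  unfolding cubic_norm_def B C using h by Groebner_Basis.algebra

text \<open>Now -4 c^3 dominates; it equals -(2 c d)^2 (c / d^2), and c / d^2 is C / E^2. The
  additive polynomial E^2 y2^3 + C y2 comes from y2, at order \<open>p ^ 2\<close>.\<close>

lemma wild_norm_2:
  assumes w3: "v 3 = 2" and b2: "ge 2 b" and c2: "v c = 2" "c \<noteq> 0"
  shows "\<exists>u. not_norm u"
proof -
  have w3': "v 3 \<ge> 1" using w3 by simp
  have cF: "c \<in> F" using c ge_F by simp
  obtain h where h: "ge 0 h" "3 = p^2 * h" using ge2_factor[of 3] w3 by (auto simp: ge_def)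
  obtain B where B: "ge 0 B" "b = p^2 * B" using ge2_factor b2 by blast
  obtain C where C: "ge 0 C" "c = p^2 * C" using ge2_factor[of c] c2 cF by (auto simp: ge_def)
  have C0: "C \<noteq> 0" "v C = 0" using c2 C(2) v_mult[of "p^2" C] v_power[of p 2] p C ge_F by auto
  note rs = h(1) B(1) C(1) E0
  show ?thesis
  proof (rule wild_conclude[OF w3', of 2 "2 * c * d" "C / E^2"])
    show "2 * c * d \<in> F" "2 * c * d \<noteq> 0" using cF d c2 by auto
    show "C / E^2 \<in> F" "C / E^2 \<noteq> 0" "v (C / E^2) = 0"
      using C0 E C ge_F v_divide[of C "E^2"] v_power[of E 2] by auto
    have "v (2 * c * d) = 3" using v_mult[of "2 * c" d] v_mult[of 2 c] v_two[OF w3'] cF d c2 by simp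
    moreover have "ge 7 (p^7 * (p*B^2*C^2 - 4*B^3*E - p*h^3*E^2 + 2*p^2*h^2*B*C*E))"
      by (rule ge_ppow) (simp_all add: rs)
    ultimately show "ge (2 * v (2 * c * d) + 1) (p^7 * (p*B^2*C^2 - 4*B^3*E - p*h^3*E^2 + 2*p^2*h^2*B*C*E))"
      by simp
    have "(2 * c * d)^2 * (C / E^2) = 4 * c^3"
      unfolding C(2) using E(2) by (simp add: field_simps power2_eq_square power3_eq_cube)
    moreover have "cubic_disc b c d = - (4 * c^3) + p^7 * (p*B^2*C^2 - 4*B^3*E - p*h^3*E^2 + 2*p^2*h^2*B*C*E)"
      unfolding cubic_disc_def B(2) C(2) h(2) by Groebner_Basis.algebra
    ultimately show "cubic_disc b c d = - ((2 * c * d)^2 * (C / E^2)) +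
        p^7 * (p*B^2*C^2 - 4*B^3*E - p*h^3*E^2 + 2*p^2*h^2*B*C*E)" by simp
    show "ge 0 (E^2)" using E0 by simp
    fix w n y1 y2 assume y: "ge 0 w" "ge 0 n" "ge 0 y1" "ge 0 y2"
      and g: "ge 4 (1 + p ^ 2 * w - nf (1 + p * n) y1 y2)"
    have "ge 1 y1" using wild_first_step[OF h B C y(2-4) ge_mono[OF g]] y by simp
    then obtain x where x: "ge 0 x" "y1 = p * x" by (rule ge1_factor)
    have "1 + p ^ 2 * w - nf (1 + p * n) y1 y2 = p^2 * (w - (C * y2 + E^2 * y2^3)) + p^3 * (-
      (h*n + p*h*n^2 + n^3 - B*(1+p*n)^2*x + p*B^2*(1+p*n)^2*y2 - p*h*C*y2 - 2*C*y2*n*(2+p*n) + p*C*(1+p*n)*x^2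
     + p*(h*E-p*B*C)*(1+p*n)*x*y2 + (p*C^2-2*B*E)*(1+p*n)*y2^2 - p*E*x^3 + p^2*B*E*x^2*y2 - p*C*E*x*y2^2))"
      unfolding x(2) wild_second_step[OF h(2) B(2) C(2)] by (simp add: right_diff_distrib)
    then have "ge 3 (p^2 * (w - (C * y2 + E^2 * y2^3)))"
      by (rule ge_leading[OF _ ge_mono[OF g]]) (simp_all add: rs y x)
    then have fin: "ge 1 (w - (C * y2 + E^2 * y2^3))"
      using ge_ppow_iff0[of "w - (C * y2 + E^2 * y2^3)" 3 2] by (simp add: rs y)
    have "w - E^2 * (y2^3 + m * y2) = w - (C * y2 + E^2 * y2^3)" if "E^2 * m = C" for m
      unfolding that[symmetric] by (simp add: algebra_simps)
    from this[of "C / E^2"] have eq: "w - E^2 * (y2^3 + C / E^2 * y2) = w - (C * y2 + E^2 * y2^3)"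
      using E(2) by simp
    show "\<exists>x. ge 0 x \<and> ge 1 (w - E^2 * (x^3 + C / E^2 * x))"
      by (rule exI[of _ y2], unfold eq) (rule conjI[OF y(4) fin])
  qed simp
qed

text \<open>Now -27 d^2 dominates, and the additive polynomial n^3 + h n comes from the cube of y0 =
  1 + p n, at order \<open>p ^ 3\<close>. Before it becomes visible, the orders p and
  \<open>p ^ 2\<close> force y1 and y2 to be divisible by p.\<close>

lemma wild_norm_3:
  assumes w3: "v 3 = 2" and b3: "ge 3 b" and c3: "ge 3 c"
  shows "\<exists>u. not_norm u"
proof -
  have w3': "v 3 \<ge> 1" using w3 by simp
  obtain h where h: "ge 0 h" "3 = p^2 * h" using ge2_factor[of 3] w3 by (auto simp: ge_def)
  have hF: "h \<in> F" using h ge_F by simp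
  have h0: "h \<noteq> 0" using h(2) by auto
  have hv: "v h = 0" using w3 h(2) h0 v_mult[of "p^2" h] v_power[of p 2] p hF by simp
  obtain B where B: "ge 0 B" "b = p^3 * B" using ge3_factor b3 by blast
  obtain C where C: "ge 0 C" "c = p^3 * C" using ge3_factor c3 by blast
  have B2: "ge 0 (p * B)" "b = p^2 * (p * B)" and C2: "ge 0 (p * C)" "c = p^2 * (p * C)"
    using B C by (simp_all add: power2_eq_square power3_eq_cube)
  note rs = h(1) B(1) C(1) E0
  show ?thesis
  proof (rule wild_conclude[OF w3', of 3 "3 * d * p" h])
    show "3 * d * p \<in> F" "3 * d * p \<noteq> 0" using d p by auto
    show "h \<in> F" "h \<noteq> 0" "v h = 0" by fact+
    have "v (3 * d * p) = 4" using v_mult[of "3 * d" p] v_mult[of 3 d] w3 d p by simp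
    moreover have "ge 9 (p^9 * (p^3*B^2*C^2 - 4*C^3 - 4*p*B^3*E + 2*p^2*h^2*B*C*E))"
      by (rule ge_ppow) (simp_all add: rs)
    ultimately show "ge (2 * v (3 * d * p) + 1) (p^9 * (p^3*B^2*C^2 - 4*C^3 - 4*p*B^3*E + 2*p^2*h^2*B*C*E))"
      by simp
    show "cubic_disc b c d = - ((3 * d * p)^2 * h) + p^9 * (p^3*B^2*C^2 - 4*C^3 - 4*p*B^3*E + 2*p^2*h^2*B*C*E)"
      unfolding cubic_disc_def B(2) C(2) h(2) by Groebner_Basis.algebra
    show "ge 0 1" by simp
    fix w n y1 y2 assume y: "ge 0 w" "ge 0 n" "ge 0 y1" "ge 0 y2"
      and g: "ge 4 (1 + p ^ 3 * w - nf (1 + p * n) y1 y2)"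
    have eq: "1 + p ^ 3 * w = 1 + p^2 * (p * w)" by (simp add: power2_eq_square power3_eq_cube)
    have "ge 2 (1 + p^2 * (p * w) - nf (1 + p * n) y1 y2)" by (rule ge_mono[OF g[unfolded eq]]) simp
    then have "ge 1 y1" using wild_first_step[OF h B2 C2 y(2-4)] y by simp
    then obtain x where x: "ge 0 x" "y1 = p * x" by (rule ge1_factor)
    define Q where "Q = h*n + p*h*n^2 + n^3 - p*B*(1+p*n)^2*x + p*(p*B)^2*(1+p*n)^2*y2 - p*h*(p*C)*y2
      - 2*(p*C)*y2*n*(2+p*n) + p*(p*C)*(1+p*n)*x^2 + p*(h*E-p*(p*B)*(p*C))*(1+p*n)*x*y2
      + (p*(p*C)^2-2*(p*B)*E)*(1+p*n)*y2^2 - p*E*x^3 + p^2*(p*B)*E*x^2*y2 - p*(p*C)*E*x*y2^2"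
    have Q0: "ge 0 Q" unfolding Q_def by (simp add: rs y x)
    have "1 + p ^ 3 * w - nf (1 + p * n) y1 y2 = p^2 * (- (E * (E * y2^3))) + p^3 * (w - C * y2 - Q)"
      unfolding x(2) wild_second_step[OF h(2) B2(2) C2(2)] Q_def
      by (simp add: algebra_simps power2_eq_square power3_eq_cube)
    then have "ge 3 (p^2 * (- (E * (E * y2^3))))"
      by (rule ge_leading[OF _ ge_mono[OF g]]) (simp_all add: rs y x Q0)
    then have "ge 1 (- (E * (E * y2^3)))"
      using ge_ppow_iff0[of "- (E * (E * y2^3))" 3 2] by (simp add: rs y)
    then have "ge 1 (E * (E * y2^3))" using ge_uminus by fastforce
    then have "ge 1 (E * y2^3)" using ge_unit_mult_iff[of E "E * y2^3" 1] E y ge_F by simp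
    then have "ge 1 y2" using ge1_cube_E y ge_F by simp
    then obtain z where z: "ge 0 z" "y2 = p * z" by (rule ge1_factor)
    define y0 where "y0 = 1 + p * n"
    have y0: "ge 0 y0" using y by (simp add: y0_def)
    have "1 + p ^ 3 * w - nf (1 + p * n) y1 y2 = p^3 * (w - (n^3 + h * n)) + p^4 *
      (- (h*n^2 - B*y0^2*x + (p^3*B^2-2*C)*y0^2*z + p*C*y0*x^2 + p*(h*E-p^3*B*C)*y0*x*z
       + p^2*(p^2*C^2-2*B*E)*y0*z^2 - E*x^3 + p^3*B*E*x^2*z - p^3*C*E*x*z^2 + p*E^2*z^3))"
      unfolding cubic_norm_def x(2) z(2) B(2) C(2) y0_def using h(2) by Groebner_Basis.algebra
    then have "ge 4 (p^3 * (w - (n^3 + h * n)))"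
      by (rule ge_leading[OF _ g]) (simp_all add: rs y x y0 z)
    then have "ge 1 (w - (n^3 + h * n))"
      using ge_ppow_iff0[of "w - (n^3 + h * n)" 4 3] by (simp add: rs y)
    then show "\<exists>x. ge 0 x \<and> ge 1 (w - 1 * (x^3 + h * x))"
      unfolding mult_1 using y(2) by (intro exI[of _ n] conjI)
  qed simp
qed

text \<open>The remaining combinations of valuations make the valuation of the discriminant odd.\<close>

lemma c_ge2:
  assumes w3: "v 3 \<ge> 1"
  shows "ge 2 c"
proof (rule ccontr)
  assume "\<not> ge 2 c"
  then have vc: "v c = 1" "c \<noteq> 0" using v_eqI[OF c] by auto
  have cF: "c \<in> F" using c ge_F by simp
  obtain h where h: "ge 0 h" "3 = p * h" using ge1_factor[of 3] w3 by (auto simp: ge_def)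
  obtain B where B: "ge 0 B" "b = p * B" using ge1_factor b by blast
  obtain C where C: "ge 0 C" "c = p * C" using ge1_factor c by blast
  define R where "R = p^4 * (B^2*C^2 - 4*B^3*E - p*h^3*E^2 + 2*p*h^2*B*C*E)"
  have "cubic_disc b c d = - (2^2 * c^3) + R"
    unfolding cubic_disc_def R_def B(2) C(2) h(2) by Groebner_Basis.algebra
  then have "\<delta>^2 = - (2^2 * c^3) + R" using \<delta>(2) by simp
  moreover have "v (- (2^2 * c^3)) = 3"
    using v_uminus[of "2^2 * c^3"] v_mult[of "2^2" "c^3"] v_power[of 2 2] v_power[of c 3] v_two[OF w3] vc cF by simp
  moreover have "ge 4 R" unfolding R_def by (rule ge_ppow) (simp_all add: h B C E0)
  ultimately show False using odd_not_square[OF \<delta>(1), of "- (2^2 * c^3)" R] vc cF by simp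
qed

text \<open>Above 3, whichever of -4 c^3, -4 b^3 d and -27 d^2 dominates the discriminant must have
  even value. As \<open>v d = 1\<close>, this leaves three situations: \<open>v b = 1\<close>; or
  \<open>v 3 = 2\<close> and \<open>v c = 2\<close> with b divisible by \<open>p ^ 2\<close>; or
  \<open>v 3 = 2\<close> with b and c divisible by \<open>p ^ 3\<close>.\<close>

theorem exists_not_norm: "\<exists>u. not_norm u"
proof -
  have F: "b \<in> F" "c \<in> F" using b c ge_F by auto
  have "v 3 \<ge> 0" using ge0_numeral by (simp add: ge_def)
  then consider "v 3 = 0" | "v 3 = 1" | "v 3 = 2" using v3 by linarith
  then show ?thesis
  proof cases
    case 1
    show ?thesis by (rule tame_not_norm[OF 1]) (auto simp: not_norm_def)
  next
    case 2
    then have w3: "v 3 \<ge> 1" by simp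
    obtain h where h: "ge 0 h" "3 = p * h" using ge1_factor[of 3] w3 by (auto simp: ge_def)
    have "ge 2 c" using c_ge2[OF w3] .
    moreover have False if b2: "ge 2 b"
    proof -
      obtain B where B: "ge 0 B" "b = p^2 * B" using ge2_factor b2 by blast
      obtain C where C: "ge 0 C" "c = p^2 * C" using ge2_factor \<open>ge 2 c\<close> by blast
      define R where "R = p^6 * (p^2*B^2*C^2 - 4*C^3 - 4*p*B^3*E + 2*p*h^2*B*C*E)"
      have "cubic_disc b c d = - (3^3 * d^2) + R"
        unfolding cubic_disc_def R_def B(2) C(2) h(2) by Groebner_Basis.algebra
      then have "\<delta>^2 = - (3^3 * d^2) + R" using \<delta>(2) by simp
      moreover have "v (- (3^3 * d^2)) = 5"
        using v_uminus[of "3^3 * d^2"] v_mult[of "3^3" "d^2"] v_power[of 3 3] v_power[of d 2] d 2 by simp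
      moreover have "ge 6 R" unfolding R_def by (rule ge_ppow) (simp_all add: h B C E0)
      ultimately show False using odd_not_square[OF \<delta>(1), of "- (3^3 * d^2)" R] d by simp
    qed
    then have "v b = 1 \<and> b \<noteq> 0" using v_eqI[OF b] by auto
    ultimately show ?thesis using wild_norm_1[OF w3] by blast
  next
    case 3
    then have w3: "v 3 \<ge> 1" by simp
    obtain h where h: "ge 0 h" "3 = p^2 * h" using ge2_factor[of 3] 3 by (auto simp: ge_def)
    have c2: "ge 2 c" using c_ge2[OF w3] .
    show ?thesis
    proof (cases "ge 2 b")
      case False
      then have "v b = 1 \<and> b \<noteq> 0" using v_eqI[OF b] by auto
      then show ?thesis using wild_norm_1[OF w3] c2 by blast
    next
      case b2: True
      show ?thesis
      proof (cases "ge 3 c")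
        case False
        then have "v c = 2 \<and> c \<noteq> 0" using v_eqI[OF c2] by auto
        then show ?thesis using wild_norm_2[OF 3 b2] by blast
      next
        case c3: True
        have "ge 3 b"
        proof (rule ccontr)
          assume "\<not> ge 3 b"
          then have vb: "v b = 2" "b \<noteq> 0" using v_eqI[OF b2] by auto
          obtain B where B: "ge 0 B" "b = p^2 * B" using ge2_factor b2 by blast
          obtain C where C: "ge 0 C" "c = p^3 * C" using ge3_factor c3 by blast
          define R where "R = p^8 * (p^2*B^2*C^2 - 4*p*C^3 - h^3*E^2 + 2*p^2*h^2*B*C*E)"
          have "cubic_disc b c d = - (2^2 * b^3 * d) + R"
            unfolding cubic_disc_def R_def B(2) C(2) h(2) by Groebner_Basis.algebra
          then have "\<delta>^2 = - (2^2 * b^3 * d) + R" using \<delta>(2) by simp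
          moreover have "v (- (2^2 * b^3 * d)) = 7"
            using v_uminus[of "2^2 * b^3 * d"] v_mult[of "2^2 * b^3" d] v_mult[of "2^2" "b^3"]
              v_power[of 2 2] v_power[of b 3] v_two[OF w3] d vb F by simp
          moreover have "ge 8 R" unfolding R_def by (rule ge_ppow) (simp_all add: h B C E0)
          ultimately show False using odd_not_square[OF \<delta>(1), of "- (2^2 * b^3 * d)" R] d vb F by simp
        qed
        then show ?thesis using wild_norm_3[OF 3] c3 by blast
      qed
    qed
  qed
qed

end

section \<open>Ramification and the conductor\<close>

text \<open>Newton iteration for y^3 = x with start value 1. Dividing by the derivative
  \<open>3 * y^2\<close> costs \<open>v 3\<close>, which counts twice in the quadratic error term;
  hence the radius 2 v 3 + 1.\<close>

lemma (in discrete_valuation) cube_approximation: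
  assumes x: "ge (2 * v 3 + 1) (x - 1)"
  shows "\<exists>y\<in>F. y \<noteq> 0 \<and> ge m (y^3 - x)"
proof -
  define n where "n = 2 * v 3 + 1"
  have e: "v 3 \<ge> 0" using ge0_numeral by (simp add: ge_def)
  have "\<exists>y. ge 1 (y - 1) \<and> ge (n + int k) (y^3 - x)" for k
  proof (induction k)
    case 0
    show ?case using ge_uminus[OF x] by (intro exI[of _ 1]) (simp add: n_def)
  next
    case (Suc k)
    then obtain y where y: "ge 1 (y - 1)" "ge (n + int k) (y^3 - x)" by blast
    have "y \<noteq> 0 \<and> v y = 0" using v_sum_dominant[of 1 "y - 1"] y(1) by simp
    then have y0: "y \<noteq> 0" "v y = 0" by auto
    have yF: "y \<in> F" using add_closed[OF ge_F[OF y(1)] one_closed] by simp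
    define i where "i = inverse (3 * y^2)"
    have "v (3 * y^2) = v 3" using v_mult[of 3 "y^2"] v_power[of y 2] yF y0 by simp
    then have i: "ge (- v 3) i" using v_inverse[of "3 * y^2"] yF y0 by (simp add: ge_def i_def)
    have i1: "3 * y^2 * i = 1" using y0 by (simp add: i_def)
    define h where "h = (x - y^3) * i"
    have "ge (n + int k) (x - y^3)" using ge_uminus[OF y(2)] by simp
    from ge_mult[OF this i] have h: "ge (n + int k - v 3) h" by (simp add: h_def)
    have h0: "ge 0 h" "ge 1 h" using ge_mono[OF h] e by (simp_all add: n_def)
    have "(y + h)^3 - x = h * h * (3 * y + h)"
      using i1 unfolding h_def by Groebner_Basis.algebra
    moreover have "ge ((n + int k - v 3) + (n + int k - v 3) + 0) (h * h * (3 * y + h))"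
      using h0(1) yF y0 by (intro ge_mult h) (auto simp: ge_def[of 0 y])
    then have "ge (n + int (Suc k)) (h * h * (3 * y + h))"
      by (rule ge_mono) (use e in \<open>simp add: n_def\<close>)
    moreover have "ge 1 (y + h - 1)" using ge_add[OF y(1) h0(2)] by (simp add: algebra_simps)
    ultimately show ?case by (intro exI[of _ "y + h"]) simp
  qed
  from this[of "nat (m - n)"] obtain y where y: "ge 1 (y - 1)" "ge (n + int (nat (m - n))) (y^3 - x)"
    by blast
  have "y \<noteq> 0" using v_sum_dominant[of 1 "y - 1"] y(1) by simp
  moreover have "y \<in> F" using add_closed[OF ge_F[OF y(1)] one_closed] by simp
  moreover have "ge m (y^3 - x)" by (rule ge_mono[OF y(2)]) simp
  ultimately show ?thesis by blast
qed

context quadratic_field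
begin

lemma discrete_valuation_vl:
  assumes P: "P \<in> prime_ideals F"
  shows "discrete_valuation F (vl P) (unif P)"
proof
  show "vl P (x * y) = vl P x + vl P y" if "x \<in> F" "y \<in> F" "x \<noteq> 0" "y \<noteq> 0" for x y
    using vl_mult[OF P that] .
  show "min (vl P x) (vl P y) \<le> vl P (x + y)" if "x \<in> F" "y \<in> F" "x \<noteq> 0" "y \<noteq> 0" "x + y \<noteq> 0" for x y
    using vl_add[OF P that] .
  show "unif P \<in> F" "unif P \<noteq> 0" "vl P (unif P) = 1" using unif[OF P] vl_unif[OF P] by auto
  show "\<exists>T. finite T \<and> (\<forall>x\<in>F. x = 0 \<or> 0 \<le> vl P x \<longrightarrow> (\<exists>t\<in>T. t \<in> F \<and> (x - t = 0 \<or> 1 \<le> vl P (x - t))))"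
    by (rule residue_finite[OF P])
qed

lemma nm_pid_of_nat: "n > 0 \<Longrightarrow> nm (pid (of_nat n)) = n * n"
proof (rule nm_eq)
  assume n: "n > 0"
  show "is_frac (pid (of_nat n))" using n by (intro is_frac_pid) auto
  show "pid (of_nat n) \<subseteq> \<O>" using pid_subset_iff[OF is_module_O, of "of_nat n"] by simp
  show "pid (of_nat n) \<star> s ` pid (of_nat n) = pid (of_nat (n * n))"
    by (simp add: s_image_pid pid_mult)
qed simp

text \<open>The ideal (q) has norm q^2, while \<open>nm P\<close> is a power of q and at least q. A
  third power of P dividing (q) would be too large.\<close>

lemma vl_prime_le_2:
  assumes P: "P \<in> prime_ideals F" and q: "Factorial_Ring.prime q"
  shows "vl P (of_nat q) \<le> 2"
proof (rule ccontr)
  assume v: "\<not> vl P (of_nat q) \<le> 2"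
  have q0: "q > 0" using q by (simp add: prime_gt_0_nat)
  obtain u w where uw: "u \<in> \<O> - P" "w \<in> \<O> - P" "u * of_nat q = unif P powi (vl P (of_nat q)) * w"
    using vl_O_exists[OF P O_of_nat, of q] q0 by (metis of_nat_eq_0_iff less_irrefl)
  define k where "k = nat (vl P (of_nat q) - 3)"
  have "vl P (of_nat q) = int (3 + k)" using v by (simp add: k_def)
  then have uq: "u * of_nat q = unif P ^ 3 * (unif P ^ k * w)"
    using uw(3) by (simp only: power_int_of_nat power_add mult.assoc)
  have wO: "unif P ^ k * w \<in> \<O>" using uw unif(1)[OF P] prime_idealD(2)[OF P] by auto
  have qn: "of_nat q \<noteq> (0::complex)" using q0 by simp
  obtain D where D: "is_frac D" "D \<subseteq> \<O>" "pid (of_nat q) = pw P 3 \<star> D"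
    using O_power_dvd[OF P O_of_nat qn uw(1) uq wO] by blast
  note Pf = prime_idealD(1)[OF P] and PO = prime_idealD(2)[OF P]
  have eq: "q * q = nm P ^ 3 * nm D"
    using nm_pid_of_nat[OF q0] D nm_mult[OF pw_frac[OF Pf] pw_integral[OF PO] D(1,2)] nm_pw[OF Pf PO]
    by simp
  have g: "nm P \<ge> 2" by (rule nm_prime[OF P])
  have "nm P dvd q ^ 2" using eq by (metis power2_eq_square dvd_mult2 dvd_power_same dvd_power zero_less_numeral dvd_triv_left power_one_right le_imp_power_dvd one_le_numeral)
  then obtain i where i: "i \<le> 2" "nm P = q ^ i" using divides_primepow_nat[OF q] by blast
  then have "i \<ge> 1" using g by (cases i) auto
  then have "q ^ 1 \<le> nm P" unfolding i(2) using q0 by (intro power_increasing) auto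
  then have "q ^ 3 \<le> nm P ^ 3" by (intro power_mono) auto
  also have "\<dots> \<le> nm P ^ 3 * nm D" using nm(1)[OF D(1,2)] by simp
  finally have "q ^ 3 \<le> q * q" using eq by simp
  then show False using prime_gt_1_nat[OF q] by (simp add: power3_eq_cube)
qed

lemma prime_dvd_of_mem:
  assumes P: "P \<in> prime_ideals F" and q: "Factorial_Ring.prime q" "of_nat q \<in> P" and f: "of_nat f \<in> P"
  shows "q dvd f"
proof (rule ccontr)
  assume "\<not> q dvd f"
  then have "coprime (int q) (int f)" using prime_imp_coprime[OF q(1)] by simp
  then have "gcd (int q) (int f) = 1" by (rule coprime_imp_gcd_eq_1)
  moreover obtain a b where "a * int q + b * int f = gcd (int q) (int f)" using bezout_int by blast
  ultimately have ab: "a * int q + b * int f = 1" by simp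
  note m = is_moduleD[OF is_frac_module[OF prime_idealD(1)[OF P]]]
  have "of_int a * of_nat q + of_int b * of_nat f \<in> P" using q f by (intro m) auto
  moreover have "of_int a * of_nat q + of_int b * of_nat f = (of_int (a * int q + b * int f) :: complex)" by simp
  ultimately show False using ab prime_idealD(3)[OF P] by simp
qed

lemma exists_prime_number:
  assumes P: "P \<in> prime_ideals F"
  obtains q :: nat where "Factorial_Ring.prime q" "of_nat q \<in> P"
proof -
  note Pf = prime_idealD(1)[OF P] and PO = prime_idealD(2)[OF P]
  define S where "S n \<longleftrightarrow> n > 0 \<and> of_nat n \<in> P" for n :: nat
  have "S (nm P)" using nm(1)[OF Pf PO] nm_mem[OF Pf PO] by (simp add: S_def)
  then have q: "S (LEAST n. S n)" by (rule LeastI)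
  define q where "q = (LEAST n. S n)"
  have q: "q > 0" "of_nat q \<in> P" and least: "\<And>n. n > 0 \<Longrightarrow> of_nat n \<in> P \<Longrightarrow> q \<le> n"
    using q Least_le[of S] by (auto simp: q_def S_def)
  have "Factorial_Ring.prime q"
  proof (rule ccontr)
    assume np: "\<not> Factorial_Ring.prime q"
    have "q \<noteq> 1" using q(2) prime_idealD(3)[OF P] by auto
    then obtain a b where ab: "q = a * b" "1 < a" "a < q"
      using np q(1) by (metis prime_nat_iff dvdE One_nat_def Suc_lessI nat_dvd_not_less not_less_iff_gr_or_eq dvd_triv_left gr0I mult_0)
    then have b: "0 < b" "b < q" using q(1) by auto
    have "of_nat a * of_nat b \<in> P" using q(2) ab(1) by simp
    then have "of_nat a \<in> P \<or> of_nat b \<in> P" using prime_idealD(4)[OF P] by blast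
    then show False using least[of a] least[of b] ab b by auto
  qed
  then show ?thesis using that q by blast
qed

end

section \<open>Local units and norms in a cyclic cubic extension\<close>

locale cyclic_cubic = N: field_endo N \<sigma> + K: quadratic_field K c
  for N \<sigma> K c +
  assumes K_subset: "K \<subseteq> N"
    and \<sigma>_K: "x \<in> K \<Longrightarrow> \<sigma> x = x"
    and \<sigma>_fixed: "x \<in> N \<Longrightarrow> \<sigma> x = x \<Longrightarrow> x \<in> K"
    and \<sigma>_cubed: "x \<in> N \<Longrightarrow> \<sigma> (\<sigma> (\<sigma> x)) = x"
    and rel_norm_\<sigma>: "y \<in> N \<Longrightarrow> rel_norm N K y = y * \<sigma> y * \<sigma> (\<sigma> y)"
begin

abbreviation "ON \<equiv> integers_of N"
abbreviation "OK \<equiv> integers_of K"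

lemma K_N: "x \<in> K \<Longrightarrow> x \<in> N" using K_subset by auto

lemma OK_ON: "x \<in> OK \<Longrightarrow> x \<in> ON"
  using K_subset by (auto simp: integers_of_def)

lemma ON_K: "x \<in> ON \<Longrightarrow> x \<in> K \<Longrightarrow> x \<in> OK"
  by (simp add: integers_of_def)

text \<open>Integrality at all primes of N above P, expressed with denominators from K outside P so
  that prime ideals of N do not have to be mentioned.\<close>

definition loc :: "complex set \<Rightarrow> complex \<Rightarrow> bool" where
  "loc P y \<longleftrightarrow> y \<in> N \<and> (\<exists>u\<in>OK - P. u * y \<in> ON)"

text \<open>Elements of K near 1 are approximated by cubes, and the cube of an element y of K is the
  norm of y. This makes the \<open>LEAST\<close> in the conductor exponent meaningful.\<close>

lemma conductor_exponent_exists: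
  assumes P: "P \<in> prime_ideals K"
  shows "\<exists>n. local_units K P n \<subseteq> local_norms N K P"
proof -
  interpret V: discrete_valuation K "K.vl P" "K.unif P" by (rule K.discrete_valuation_vl[OF P])
  have cong: "local_cong K P n x y \<longleftrightarrow> V.ge (int n) (x - y)" if "x \<in> K" "y \<in> K" for n x y
    using K.local_cong_iff[OF P that] that by (auto simp: V.ge_def)
  have e: "K.vl P 3 \<ge> 0" using V.ge0_numeral by (simp add: V.ge_def)
  define n where "n = nat (2 * K.vl P 3 + 1)"
  have "x \<in> local_norms N K P" if x: "x \<in> local_units K P n" for x
  proof -
    have xK: "x \<in> K" and c: "local_cong K P n x 1" using x by (auto simp: local_units_def)
    have g: "V.ge (2 * K.vl P 3 + 1) (x - 1)" using cong[OF xK] c e by (simp add: n_def)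
    have "x \<noteq> 0" using V.v_sum_dominant[of 1 "x - 1"] V.ge_mono[OF g] e by simp
    moreover have "\<exists>y\<in>N - {0}. local_cong K P m x (rel_norm N K y)" for m
    proof -
      obtain y where y: "y \<in> K" "y \<noteq> 0" "V.ge (int m) (y^3 - x)"
        using V.cube_approximation[OF g] by blast
      have "rel_norm N K y = y^3" using rel_norm_\<sigma>[OF K_N[OF y(1)]] \<sigma>_K[OF y(1)] by (simp add: power3_eq_cube)
      then have "local_cong K P m x (rel_norm N K y)"
        using cong[OF xK, of "y^3" m] y V.ge_uminus[OF y(3)] by simp
      then show ?thesis using y K_N by blast
    qed
    ultimately show ?thesis using xK by (simp add: local_norms_def)
  qed
  then show ?thesis by blast
qed

lemma conductor_subset:
  assumes P: "P \<in> prime_ideals K" and not: "\<not> local_units K P 0 \<subseteq> local_norms N K P"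
  shows "conductor N K \<subseteq> P"
proof -
  have "local_units K P (conductor_exponent N K P) \<subseteq> local_norms N K P"
    unfolding conductor_exponent_def using conductor_exponent_exists[OF P] by (rule LeastI_ex)
  then have "conductor_exponent N K P \<noteq> 0" using not by metis
  then obtain n where n: "conductor_exponent N K P = Suc n" by (cases "conductor_exponent N K P") auto
  note Pf = K.prime_idealD(1)[OF P] and PO = K.prime_idealD(2)[OF P]
  have "conductor N K \<subseteq> K.pw P (Suc n)" unfolding conductor_def using P n by auto
  also have "\<dots> \<subseteq> OK \<star> P" using K.pw_integral[OF PO, of n] by (simp add: idp_mono)
  also have "\<dots> = P" using K.is_frac_module[OF Pf] by simp
  finally show ?thesis .
qed

context
  fixes P assumes P: "P \<in> prime_ideals K"
begin

lemma out_ON: "u \<in> OK - P \<Longrightarrow> u \<in> ON \<and> u \<in> N \<and> u \<noteq> 0"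
  using K.out_nonzero[OF P] OK_ON N.O_subset by blast

lemma locI: "y \<in> ON \<Longrightarrow> loc P y"
  unfolding loc_def using K.prime_idealD(3)[OF P] N.O_subset by (intro conjI bexI[of _ 1]) auto

lemma loc_mult: "loc P x \<Longrightarrow> loc P y \<Longrightarrow> loc P (x * y)"
proof -
  assume "loc P x" "loc P y"
  then obtain u w where *: "x \<in> N" "y \<in> N" "u \<in> OK - P" "w \<in> OK - P" "u * x \<in> ON" "w * y \<in> ON"
    by (auto simp: loc_def)
  then have "(u * w) * (x * y) \<in> ON" using N.O_mult[of "u * x" "w * y"] by (simp add: mult_ac)
  then show ?thesis unfolding loc_def using * K.out_mult[OF P *(3,4)] by blast
qed

lemma loc_add: "loc P x \<Longrightarrow> loc P y \<Longrightarrow> loc P (x + y)"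
proof -
  assume "loc P x" "loc P y"
  then obtain u w where *: "x \<in> N" "y \<in> N" "u \<in> OK - P" "w \<in> OK - P" "u * x \<in> ON" "w * y \<in> ON"
    by (auto simp: loc_def)
  have "w * (u * x) + u * (w * y) \<in> ON" using * out_ON by blast
  then have "(u * w) * (x + y) \<in> ON" by (simp add: algebra_simps)
  then show ?thesis unfolding loc_def using * K.out_mult[OF P *(3,4)] by blast
qed

lemma loc_uminus: "loc P x \<Longrightarrow> loc P (- x)"
  using loc_mult[of "- 1" x] locI[of "- 1"] by simp

lemma loc_power: "loc P x \<Longrightarrow> loc P (x ^ n)"
  using locI[of 1] by (induction n) (auto intro: loc_mult)

lemma loc_root: "y \<in> N \<Longrightarrow> loc P (y ^ 3) \<Longrightarrow> loc P y"
proof -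
  assume y: "y \<in> N" "loc P (y ^ 3)"
  then obtain u where u: "u \<in> OK - P" "u * y ^ 3 \<in> ON" by (auto simp: loc_def)
  have "u^2 * (u * y^3) \<in> ON" using u out_ON by blast
  then have "(u * y)^3 \<in> ON" by (simp add: power_mult_distrib power2_eq_square power3_eq_cube mult_ac)
  then have "u * y \<in> ON" using N.O_root[of "u * y" 3] u out_ON y(1) by auto
  then show ?thesis using u y(1) by (auto simp: loc_def)
qed

lemma loc_\<sigma>: "loc P y \<Longrightarrow> loc P (\<sigma> y)"
proof -
  assume "loc P y"
  then obtain u where u: "u \<in> OK - P" "u * y \<in> ON" "y \<in> N" by (auto simp: loc_def)
  have "\<sigma> (u * y) \<in> ON" using u by simp
  moreover have "\<sigma> u = u" using u K.O_subset \<sigma>_K by blast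
  moreover have "\<sigma> (u * y) = \<sigma> u * \<sigma> y" using out_ON[OF u(1)] u(3) by simp
  ultimately have "u * \<sigma> y \<in> ON" by simp
  then show ?thesis unfolding loc_def using u by auto
qed

lemma loc_K:
  assumes "loc P x" "x \<in> K" "x \<noteq> 0"
  shows "K.vl P x \<ge> 0"
proof -
  obtain u where u: "u \<in> OK - P" "u * x \<in> ON" using assms(1) by (auto simp: loc_def)
  have uK: "u \<in> K" "u \<noteq> 0" using u K.O_subset out_ON by auto
  then have "u * x \<in> OK" using u assms(2) ON_K by blast
  then have "K.vl P (u * x) \<ge> 0" using K.vl_O[OF P] uK assms by simp
  then show ?thesis using K.vl_mult[OF P uK(1) assms(2) uK(2) assms(3)] K.vl_out[OF P u(1)] by simp
qed

lemma loc_vl_0: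
  assumes "x \<in> K" "x \<noteq> 0" "K.vl P x = 0"
  shows "loc P x" "loc P (inverse x)"
proof -
  have half: "loc P x" if "x \<in> K" "x \<noteq> 0" "K.vl P x = 0" for x
  proof -
    obtain u w where "u \<in> OK - P" "w \<in> OK - P" "u * x = K.unif P powi (K.vl P x) * w"
      using K.vl_exists[OF P \<open>x \<in> K\<close> \<open>x \<noteq> 0\<close>] by blast
    then have "u * x \<in> ON" using that OK_ON by simp
    then show ?thesis unfolding loc_def using \<open>u \<in> OK - P\<close> that K_N by blast
  qed
  interpret V: discrete_valuation K "K.vl P" "K.unif P" by (rule K.discrete_valuation_vl[OF P])
  show "loc P x" using half assms .
  show "loc P (inverse x)" using half[of "inverse x"] assms V.v_inverse by simp
qed

text \<open>The set of \<open>y\<close> with valuation at least \<open>i / 3\<close> at the primes over \<open>P\<close>.\<close>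

definition third :: "nat \<Rightarrow> complex \<Rightarrow> bool" where
  "third i y \<longleftrightarrow> y \<in> N \<and> loc P (y ^ 3 / K.unif P ^ i)"

lemma third_mult: "third i x \<Longrightarrow> third j y \<Longrightarrow> third (i + j) (x * y)"
proof -
  assume *: "third i x" "third j y"
  then have "loc P ((x^3 / K.unif P ^ i) * (y^3 / K.unif P ^ j))" by (intro loc_mult) (auto simp: third_def)
  then show ?thesis using * by (simp add: third_def power_mult_distrib power_add)
qed

text \<open>This is the ultrametric inequality. The mixed terms a^2 b / q are locally integral
  because their cubes are products of powers of a^3 / q and b^3 / q.\<close>

lemma third_add: "third i x \<Longrightarrow> third i y \<Longrightarrow> third i (x + y)"
proof -
  assume x: "third i x" and y: "third i y"
  define q where "q = K.unif P ^ i"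
  have q: "q \<in> N" "q \<noteq> 0" using K.unif(3,4)[OF P] K_N by (auto simp: q_def)
  have xy: "x \<in> N" "y \<in> N" "loc P (x^3 / q)" "loc P (y^3 / q)" using x y by (auto simp: third_def q_def)
  have *: "loc P (a^2 * b / q)" if "a \<in> N" "b \<in> N" "loc P (a^3 / q)" "loc P (b^3 / q)" for a b
  proof (rule loc_root)
    have eq: "(a^2 * b / q)^3 = (a^3 / q)^2 * (b^3 / q)" by (simp add: power2_eq_square power3_eq_cube)
    show "loc P ((a^2 * b / q)^3)" unfolding eq by (intro loc_mult loc_power that)
  qed (use that q in auto)
  have eq: "(x + y)^3 / q = x^3 / q + (x^2 * y / q) * 3 + (y^2 * x / q) * 3 + y^3 / q"
    by (simp add: power2_eq_square power3_eq_cube algebra_simps add_divide_distrib)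
  have "loc P 3" by (rule locI) simp
  then have "loc P ((x + y)^3 / q)" unfolding eq by (intro loc_add loc_mult * xy)
  then show ?thesis using xy by (simp add: third_def q_def)
qed

lemma third_uminus: "third i x \<Longrightarrow> third i (- x)"
  using loc_uminus[of "x^3 / K.unif P ^ i"] by (simp add: third_def power3_eq_cube)

lemma third_K:
  assumes "third i x" "x \<in> K" "x \<noteq> 0"
  shows "3 * K.vl P x \<ge> int i"
proof -
  interpret V: discrete_valuation K "K.vl P" "K.unif P" by (rule K.discrete_valuation_vl[OF P])
  have "K.vl P (x^3 / K.unif P ^ i) \<ge> 0"
    using assms V.p by (intro loc_K) (auto simp: third_def)
  moreover have "K.vl P (x^3 / K.unif P ^ i) = 3 * K.vl P x - int i"
    using V.v_divide[of "x^3" "K.unif P ^ i"] V.v_power[of x 3] V.v_power[of "K.unif P" i] V.p assms by simp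
  ultimately show ?thesis by simp
qed

text \<open>Lagrange interpolation of y and its conjugates at A and its conjugates.
  \<open>\<sigma>\<close> permutes the weights \<open>e1\<close>, \<open>e2\<close>,
  \<open>e3\<close> cyclically along with the nodes, so it fixes the coefficients of the
  interpolating polynomial, which therefore lie in K.\<close>

lemma K_coordinates:
  assumes A: "A \<in> N" "\<sigma> A \<noteq> A" and y: "y \<in> N"
  obtains y0 y1 y2 where "y0 \<in> K" "y1 \<in> K" "y2 \<in> K" "y = y0 + y1 * A + y2 * A^2"
proof -
  define A2 A3 where "A2 = \<sigma> A" and "A3 = \<sigma> A2"
  have AN: "A2 \<in> N" "A3 \<in> N" using A by (auto simp: A2_def A3_def)
  have \<sigma>A: "\<sigma> A = A2" "\<sigma> A2 = A3" "\<sigma> A3 = A" using \<sigma>_cubed[OF A(1)] by (auto simp: A2_def A3_def)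
  have d1: "A \<noteq> A2" using A(2) \<sigma>A(1) by simp
  then have d2: "A2 \<noteq> A3" using N.s_inj[of A A2] A AN \<sigma>A by simp
  then have d3: "A3 \<noteq> A" using N.s_inj[of A2 A3] A AN \<sigma>A by auto
  define Y2 Y3 where "Y2 = \<sigma> y" and "Y3 = \<sigma> Y2"
  have YN: "Y2 \<in> N" "Y3 \<in> N" using y by (auto simp: Y2_def Y3_def)
  have \<sigma>Y: "\<sigma> y = Y2" "\<sigma> Y2 = Y3" "\<sigma> Y3 = y" using \<sigma>_cubed[OF y] by (auto simp: Y2_def Y3_def)
  define e1 e2 e3 where "e1 = y / ((A - A2) * (A - A3))" and "e2 = Y2 / ((A2 - A3) * (A2 - A))"
    and "e3 = Y3 / ((A3 - A) * (A3 - A2))"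
  have eN: "e1 \<in> N" "e2 \<in> N" "e3 \<in> N" using y YN A AN by (auto simp: e1_def e2_def e3_def)
  have \<sigma>e: "\<sigma> e1 = e2" "\<sigma> e2 = e3" "\<sigma> e3 = e1"
    using y YN A AN by (simp_all add: e1_def e2_def e3_def \<sigma>A \<sigma>Y)
  define y0 y1 y2 where "y0 = e1 * (A2 * A3) + e2 * (A3 * A) + e3 * (A * A2)"
    and "y1 = - (e1 * (A2 + A3) + e2 * (A3 + A) + e3 * (A + A2))" and "y2 = e1 + e2 + e3"
  have "y0 \<in> K" "y1 \<in> K" "y2 \<in> K"
    using eN A AN by (auto intro!: \<sigma>_fixed simp: y0_def y1_def y2_def \<sigma>e \<sigma>A)
  moreover have "y0 + y1 * A + y2 * A^2 = e1 * ((A - A2) * (A - A3))"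
    unfolding y0_def y1_def y2_def by (simp add: algebra_simps power2_eq_square)
  then have "y = y0 + y1 * A + y2 * A^2" using d1 d3 by (simp add: e1_def)
  ultimately show ?thesis using that by blast
qed

text \<open>A and its conjugates have a third of the value of a uniformizer of K. Their elementary
  symmetric functions are fixed by \<open>\<sigma>\<close> and so are coefficients of an Eisenstein
  polynomial over K. The product \<open>\<delta>\<close> of the differences is fixed as well, which
  puts a square root of the discriminant into K, and norms from N are values of the cubic form at
  coordinates with respect to A.\<close>

lemma ramified_uniformizer:
  assumes A: "A \<in> N" "A \<noteq> 0" and loc: "loc P (A^3 / K.unif P)" "loc P (K.unif P / A^3)"
  shows "\<not> local_units K P 0 \<subseteq> local_norms N K P"
proof
  assume sub: "local_units K P 0 \<subseteq> local_norms N K P"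
  interpret V: discrete_valuation K "K.vl P" "K.unif P" by (rule K.discrete_valuation_vl[OF P])
  define \<pi> where "\<pi> = K.unif P"
  have \<pi>: "\<pi> \<in> K" "\<pi> \<in> N" "\<pi> \<noteq> 0" "\<sigma> \<pi> = \<pi>" using V.p K_N \<sigma>_K by (auto simp: \<pi>_def)
  define A2 A3 where "A2 = \<sigma> A" and "A3 = \<sigma> A2"
  have AN: "A2 \<in> N" "A3 \<in> N" "A2 \<noteq> 0" "A3 \<noteq> 0" using A by (auto simp: A2_def A3_def)
  have \<sigma>A: "\<sigma> A = A2" "\<sigma> A2 = A3" "\<sigma> A3 = A" using \<sigma>_cubed[OF A(1)] by (auto simp: A2_def A3_def)
  have loc2: "loc P (A2^3 / \<pi>)" "loc P (\<pi> / A2^3)"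
    using loc_\<sigma>[OF loc(1)] loc_\<sigma>[OF loc(2)] A \<pi> by (simp_all add: \<sigma>A \<pi>_def[symmetric])
  have loc3: "loc P (A3^3 / \<pi>)" "loc P (\<pi> / A3^3)"
    using loc_\<sigma>[OF loc2(1)] loc_\<sigma>[OF loc2(2)] AN \<pi> by (simp_all add: \<sigma>A)
  have t: "third 1 A" "third 1 A2" "third 1 A3"
    using loc loc2 loc3 A AN by (simp_all add: third_def \<pi>_def)
  define b c0 d where "b = - (A + A2 + A3)" and "c0 = A * A2 + A2 * A3 + A * A3" and "d = - (A * A2 * A3)"
  define \<delta> where "\<delta> = (A - A2) * (A2 - A3) * (A3 - A)"
  have K: "b \<in> K" "c0 \<in> K" "d \<in> K" "\<delta> \<in> K"
    using A AN by (auto intro!: \<sigma>_fixed simp: b_def c0_def d_def \<delta>_def \<sigma>A)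
  have tb: "third 1 b" unfolding b_def using t by (intro third_add third_uminus)
  have tc: "third 2 c0" unfolding c0_def
    using third_mult[OF t(1,2)] third_mult[OF t(2,3)] third_mult[OF t(1,3)]
    by (intro third_add) (simp_all only: one_add_one)
  have d0: "d \<noteq> 0" using A AN by (simp add: d_def)
  have "third 3 d" unfolding d_def
    using third_uminus[OF third_mult[OF third_mult[OF t(1,2)] t(3)]] by (simp add: numeral_3_eq_3)
  then have vd1: "K.vl P d \<ge> 1" using third_K[of 3 d] K d0 by simp
  have "\<pi>^3 / d^3 = - ((\<pi> / A^3) * (\<pi> / A2^3) * (\<pi> / A3^3))"
    by (simp add: d_def power3_eq_cube)
  moreover have "loc P (- ((\<pi> / A^3) * (\<pi> / A2^3) * (\<pi> / A3^3)))"
    using loc loc2 loc3 by (intro loc_uminus loc_mult) (simp_all add: \<pi>_def)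
  ultimately have l: "loc P (\<pi>^3 / d^3)" by (simp only:)
  have "K.vl P (\<pi>^3 / d^3) \<ge> 0" by (rule loc_K[OF l]) (use K d0 \<pi> in auto)
  moreover have "K.vl P (\<pi>^3 / d^3) = 3 - 3 * K.vl P d"
    using V.v_divide[of "\<pi>^3" "d^3"] V.v_power[of \<pi> 3] V.v_power[of d 3] K d0 \<pi> V.p by (simp add: \<pi>_def)
  ultimately have vd: "K.vl P d = 1" using vd1 by simp
  have vE: "K.vl P (d / \<pi>) = 0" using V.v_divide[of d \<pi>] K d0 \<pi> V.p vd by (simp add: \<pi>_def)
  interpret W: eisenstein_cubic K "K.vl P" "K.unif P" b c0 "d / \<pi>" \<delta>
  proof
    show "V.ge 1 b" using third_K[OF tb] K by (cases "b = 0") (auto simp: V.ge_def)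
    show "V.ge 1 c0" using third_K[OF tc] K by (cases "c0 = 0") (auto simp: V.ge_def)
    show "d / \<pi> \<in> K" "d / \<pi> \<noteq> 0" "K.vl P (d / \<pi>) = 0" using K \<pi> d0 vE by auto
    show "\<delta> \<in> K" by fact
    have "K.unif P * (d / \<pi>) = d" using \<pi> by (simp add: \<pi>_def)
    then show "\<delta>^2 = cubic_disc b c0 (K.unif P * (d / \<pi>))"
      using cubic_disc_eq[of b A A2 A3 c0 d] by (simp add: b_def c0_def d_def \<delta>_def)
    show "K.vl P 3 \<le> 2" using K.vl_prime_le_2[OF P, of 3] by simp
  qed
  have dd: "K.unif P * (d / \<pi>) = d" using \<pi> by (simp add: \<pi>_def)
  obtain u where u: "W.not_norm u" using W.exists_not_norm by blast
  have uK: "u \<in> K" "u \<noteq> 0" "K.vl P u = 0" using u by (auto simp: W.not_norm_def)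
  obtain r w where rw: "r \<in> OK - P" "w \<in> OK - P" "r * u = K.unif P powi (K.vl P u) * w"
    using K.vl_exists[OF P uK(1,2)] by blast
  have "u \<in> local_units K P 0"
  proof -
    have "r * u \<in> OK - P" using rw uK(3) by simp
    moreover have "V.ge 0 (u - 1)" using uK by (intro V.ge0_diff) (auto simp: V.ge_def)
    then have "local_cong K P 0 u 1" using K.local_cong_iff[OF P uK(1), of 1 0] by (auto simp: V.ge_def)
    ultimately show ?thesis unfolding local_units_def using uK(1) rw(1) by blast
  qed
  then have "u \<in> local_norms N K P" using sub by blast
  then obtain y where y: "y \<in> N" "local_cong K P 4 u (rel_norm N K y)"
    unfolding local_norms_def by blast
  \<comment> \<open>An A in K would have a valuation with 3 v A = 1.\<close>
  have "\<sigma> A \<noteq> A"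
  proof
    assume "\<sigma> A = A"
    then have AK: "A \<in> K" using \<sigma>_fixed A by blast
    have "A^3 / \<pi> \<in> K" "\<pi> / A^3 \<in> K" "A^3 / \<pi> \<noteq> 0" "\<pi> / A^3 \<noteq> 0" using AK A \<pi> by auto
    then have "K.vl P (A^3 / \<pi>) \<ge> 0" "K.vl P (\<pi> / A^3) \<ge> 0" using loc_K loc by (simp_all add: \<pi>_def)
    moreover have "K.vl P (A^3 / \<pi>) = 3 * K.vl P A - 1" "K.vl P (\<pi> / A^3) = 1 - 3 * K.vl P A"
      using V.v_divide[of "A^3" \<pi>] V.v_divide[of \<pi> "A^3"] V.v_power[of A 3] AK A \<pi> V.p
      by (simp_all add: \<pi>_def)
    ultimately show False by presburger
  qed
  then obtain y0 y1 y2 where co: "y0 \<in> K" "y1 \<in> K" "y2 \<in> K" "y = y0 + y1 * A + y2 * A^2"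
    using K_coordinates[OF A(1) _ y(1)] by blast
  have co2: "\<sigma> y = y0 + y1 * A2 + y2 * A2^2"
    using co A K_N \<sigma>_K by (simp add: \<sigma>A)
  have co3: "\<sigma> (\<sigma> y) = y0 + y1 * A3 + y2 * A3^2"
    unfolding co2 using co AN K_N \<sigma>_K by (simp add: \<sigma>A)
  have nf: "rel_norm N K y = cubic_norm b c0 d y0 y1 y2"
  proof -
    have "rel_norm N K y = y * \<sigma> y * \<sigma> (\<sigma> y)" by (rule rel_norm_\<sigma>[OF y(1)])
    also have "\<dots> = (y0 + y1 * A + y2 * A^2) * (y0 + y1 * A2 + y2 * A2^2) * (y0 + y1 * A3 + y2 * A3^2)"
      by (rule arg_cong2[of _ _ _ _ "(*)", OF arg_cong2[of _ _ _ _ "(*)", OF co(4) co2] co3])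
    also have "\<dots> = cubic_norm b c0 d y0 y1 y2"
      by (rule cubic_norm_eq) (simp_all add: b_def c0_def d_def)
    finally show ?thesis .
  qed
  have nfK: "cubic_norm b c0 d y0 y1 y2 \<in> K" unfolding cubic_norm_def using K co by simp
  have "V.ge 4 (u - cubic_norm b c0 d y0 y1 y2)"
    using y(2) K.local_cong_iff[OF P uK(1) nfK, of 4] uK(1) nfK unfolding nf by (auto simp: V.ge_def)
  then show False using u co unfolding W.not_norm_def dd by blast
qed

text \<open>Only the value of k modulo 3 matters: A, or A^2 if the residue is 2, is divided by a
  power of the uniformizer so that its cube gets value 1.\<close>

theorem ramified_local_units:
  assumes A: "A \<in> N" "A \<noteq> 0" and k: "k \<in> K" "k \<noteq> 0" "\<not> 3 dvd K.vl P k"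
    and loc: "loc P (A^3 / k)" "loc P (k / A^3)"
  shows "\<not> local_units K P 0 \<subseteq> local_norms N K P"
proof -
  interpret V: discrete_valuation K "K.vl P" "K.unif P" by (rule K.discrete_valuation_vl[OF P])
  define \<pi> n where "\<pi> = K.unif P" and "n = K.vl P k"
  have \<pi>: "\<pi> \<in> K" "\<pi> \<in> N" "\<pi> \<noteq> 0" using V.p K_N by (auto simp: \<pi>_def)
  define \<kappa> where "\<kappa> = k / \<pi> powi n"
  have \<kappa>: "\<kappa> \<in> K" "\<kappa> \<noteq> 0" using k \<pi> by (auto simp: \<kappa>_def)
  have "K.vl P \<kappa> = 0"
    using V.v_divide[of k "\<pi> powi n"] V.v_powi[of \<pi> n] k \<pi> V.p by (simp add: \<kappa>_def \<pi>_def n_def)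
  then have l\<kappa>: "loc P \<kappa>" "loc P (inverse \<kappa>)" using loc_vl_0 \<kappa> by auto
  define \<epsilon> where "\<epsilon> = \<kappa> * (A^3 / k)"
  have l\<epsilon>: "loc P \<epsilon>" "loc P (inverse \<epsilon>)"
  proof -
    have "inverse \<epsilon> = inverse \<kappa> * (k / A^3)" by (simp add: \<epsilon>_def divide_inverse mult_ac)
    then show "loc P \<epsilon>" "loc P (inverse \<epsilon>)"
      using loc_mult[OF l\<kappa>(1) loc(1)] loc_mult[OF l\<kappa>(2) loc(2)] by (simp_all only: \<epsilon>_def)
  qed
  have A3: "A^3 = \<pi> powi n * \<epsilon>" using k \<pi> by (simp add: \<epsilon>_def \<kappa>_def)
  have pow: "(\<pi> powi i)^3 = \<pi> powi (i * 3)" "(\<pi> powi i)^2 = \<pi> powi (i * 2)" for i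
    using power_int_mult[of \<pi> i 3] power_int_mult[of \<pi> i 2] by simp_all
  have \<epsilon>0: "\<epsilon> \<noteq> 0" using A \<kappa> k by (simp add: \<epsilon>_def)
  have "n mod 3 = 1 \<or> n mod 3 = 2" using k(3) unfolding n_def by presburger
  then consider j where "n = 3 * j + 1" | j where "n = 3 * j + 2"
    by (metis mult_div_mod_eq)
  then show ?thesis
  proof cases
    case 1
    define A' where "A' = A / \<pi> powi j"
    have "A'^3 = A^3 / \<pi> powi (3 * j)"
      by (simp add: A'_def power_divide pow mult.commute)
    also have "\<dots> = \<pi> * \<epsilon>" unfolding A3 1 using \<pi> by (simp add: power_int_add)
    finally have eq: "A'^3 = \<pi> * \<epsilon>" .
    show ?thesis
    proof (rule ramified_uniformizer)
      show "A' \<in> N" "A' \<noteq> 0" using A \<pi> by (auto simp: A'_def)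
      show "loc P (A'^3 / K.unif P)" "loc P (K.unif P / A'^3)"
        using l\<epsilon> \<pi>(3) \<epsilon>0 unfolding eq \<pi>_def by (simp_all add: inverse_eq_divide)
    qed
  next
    case 2
    \<comment> \<open>The exponent is chosen so that 2 (3 j + 2) - 3 (2 j + 1) = 1.\<close>
    define A' where "A' = A^2 / \<pi> powi (2 * j + 1)"
    have "A'^3 = (A^3)^2 / \<pi> powi ((2 * j + 1) * 3)"
      by (simp add: A'_def power_divide pow power_mult[symmetric])
    also have "\<dots> = (\<pi> powi n)^2 / \<pi> powi ((2 * j + 1) * 3) * \<epsilon>^2" unfolding A3 by (simp add: power_mult_distrib)
    also have "(\<pi> powi n)^2 / \<pi> powi ((2 * j + 1) * 3) = \<pi> powi (n * 2 - (2 * j + 1) * 3)"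
      using \<pi> by (simp add: pow power_int_diff)
    also have "n * 2 - (2 * j + 1) * 3 = 1" using 2 by simp
    finally have eq: "A'^3 = \<pi> * \<epsilon>^2" by simp
    show ?thesis
    proof (rule ramified_uniformizer)
      show "A' \<in> N" "A' \<noteq> 0" using A \<pi> by (auto simp: A'_def)
      show "loc P (A'^3 / K.unif P)" "loc P (K.unif P / A'^3)"
        using loc_power[OF l\<epsilon>(1), of 2] loc_power[OF l\<epsilon>(2), of 2] \<pi>(3) \<epsilon>0 unfolding eq \<pi>_def
        by (simp_all add: inverse_eq_divide power_divide)
    qed
  qed
qed

end

theorem ramified_dvd_conductor:
  assumes P: "P \<in> prime_ideals K" and q: "Factorial_Ring.prime q" "of_nat q \<in> P"
    and f: "f \<ge> 1" "conductor N K = principal_ideal K (of_nat f)"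
    and A: "A \<in> N" "A \<noteq> 0" and k: "k \<in> K" "k \<noteq> 0" "\<not> 3 dvd K.vl P k"
    and loc: "loc P (A^3 / k)" "loc P (k / A^3)"
  shows "q \<in> prime_factors f"
proof -
  have "conductor N K \<subseteq> P"
    by (rule conductor_subset[OF P ramified_local_units[OF P A k loc]])
  then have "of_nat f \<in> P" using f(2) K.pid_self by blast
  then have "q dvd f" by (rule K.prime_dvd_of_mem[OF P q])
  then show ?thesis using q f(1) by (auto simp: prime_factors_dvd)
qed

end

section \<open>The normal closure of a cubic field\<close>

lemma subfield_Rats: "subfield \<rat> complex_field"
proof (rule field.subfieldI'[OF field_from_type_algebra])
  show "subring \<rat> complex_field" by (rule complex_field.subringI) auto
qed auto

lemma Span_simps [simp]:
  "x \<in> complex_field.Span K [] \<longleftrightarrow> x = 0"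
  "x \<in> complex_field.Span K (u # us) \<longleftrightarrow> (\<exists>k\<in>K. \<exists>w\<in>complex_field.Span K us. x = k * u + w)"
  by (simp_all add: complex_field.line_extension_mem_iff)

declare complex_field.Span.simps [simp del]

lemma independent_simps [simp]:
  "complex_field.independent K []"
  "complex_field.independent K (u # us) \<longleftrightarrow>
    u \<notin> complex_field.Span K us \<and> complex_field.independent K us"
  using complex_field.independent_backwards[of K u us]
  by (auto simp del: Span_simps intro: complex_field.li_Cons)

lemma Span_two: "a \<in> K \<Longrightarrow> b \<in> K \<Longrightarrow> a * x + b \<in> complex_field.Span K [x, 1]"
proof -
  assume a: "a \<in> K" and b: "b \<in> K"
  have "b \<in> complex_field.Span K [1]"
    by (subst Span_simps(2), rule bexI[of _ b], rule bexI[of _ 0]) (simp_all add: b)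
  then show ?thesis
    by (subst Span_simps(2)) (rule bexI[of _ a], rule bexI[of _ b], simp_all add: a)
qed

lemma independent_length:
  assumes "complex_field.dimension n \<rat> E" "complex_field.independent \<rat> us" "set us \<subseteq> E"
  shows "length us \<le> n"
  using complex_field.independent_length_le_dimension[OF subfield_Rats assms] .

lemma Span_not_all:
  assumes "complex_field.dimension n \<rat> E" "complex_field.independent \<rat> us" "length us \<noteq> n"
  shows "complex_field.Span \<rat> us \<noteq> E"
  using complex_field.dimension_is_inj[OF subfield_Rats assms(1)]
    complex_field.dimension_independent[OF assms(2)] assms(3) by auto

text \<open>Degree 3 in the form in which it is used: every irrational x generates the field, with
  power basis 1, x, x^2, because 3 is prime.\<close>

locale cubic_field = complex_subfield L for L +
  assumes exists_irrational: "\<exists>x\<in>L. x \<notin> \<rat>"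
    and indep: "x \<in> L \<Longrightarrow> x \<notin> \<rat> \<Longrightarrow> a \<in> \<rat> \<Longrightarrow> b \<in> \<rat> \<Longrightarrow> c \<in> \<rat> \<Longrightarrow> a + b * x + c * x^2 = 0 \<Longrightarrow> a = 0 \<and> b = 0 \<and> c = 0"
    and span: "x \<in> L \<Longrightarrow> x \<notin> \<rat> \<Longrightarrow> z \<in> L \<Longrightarrow> \<exists>a\<in>\<rat>. \<exists>b\<in>\<rat>. \<exists>c\<in>\<rat>. z = a + b * x + c * x^2"

lemma Rats_of_linear: "p \<in> \<rat> \<Longrightarrow> q \<in> \<rat> \<Longrightarrow> q \<noteq> 0 \<Longrightarrow> p + q * x = 0 \<Longrightarrow> (x::complex) \<in> \<rat>"
proof -
  assume h: "p \<in> \<rat>" "q \<in> \<rat>" "q \<noteq> 0" "p + q * x = 0"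
  then have "q * x = - p" by (simp add: eq_neg_iff_add_eq_0 add.commute)
  then have "x = - p / q" using h(3) by (simp add: field_simps)
  then show ?thesis using h by simp
qed

text \<open>If x were quadratic, a further element z outside the span of x and 1 would make x z, z,
  x, 1 four independent elements in a space of dimension 3.\<close>

lemma cubic_fieldI:
  assumes L: "subfield L complex_field" "complex_field.dimension 3 \<rat> L"
  shows "cubic_field L"
proof -
  interpret complex_subfield L by (rule complex_subfieldI[OF L(1)])
  have ind2: "complex_field.independent \<rat> [x, 1]" if "x \<notin> \<rat>" for x using that by auto
  have indep: "a = 0 \<and> b = 0 \<and> c = 0"
    if x: "x \<in> L" "x \<notin> \<rat>" and abc: "a \<in> \<rat>" "b \<in> \<rat>" "c \<in> \<rat>" "a + b * x + c * x^2 = 0" for x a b c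
  proof (cases "c = 0")
    case True
    then have "b = 0" using abc x Rats_of_linear[of a b x] by auto
    then show ?thesis using abc True by simp
  next
    case False
    define P Q where "P = - b / c" and "Q = - a / c"
    have PQ: "P \<in> \<rat>" "Q \<in> \<rat>" using abc by (auto simp: P_def Q_def)
    have "c * x^2 = c * (P * x + Q)"
      using abc(4) False unfolding P_def Q_def by (simp add: field_simps) (simp add: eq_neg_iff_add_eq_0 algebra_simps)
    then have x2: "x^2 = P * x + Q" using False by simp
    have "complex_field.Span \<rat> [x, 1] \<noteq> L" by (rule Span_not_all[OF L(2) ind2[OF x(2)]]) simp
    moreover have "complex_field.Span \<rat> [x, 1] \<subseteq> L" using x(1) by auto
    ultimately obtain z where z: "z \<in> L" "z \<notin> complex_field.Span \<rat> [x, 1]" by blast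
    have "x * z \<notin> complex_field.Span \<rat> [z, x, 1]"
    proof
      assume "x * z \<in> complex_field.Span \<rat> [z, x, 1]"
      then obtain k l m where klm: "k \<in> \<rat>" "l \<in> \<rat>" "m \<in> \<rat>" "x * z = k * z + (l * x + m)" by auto
      \<comment> \<open>\<open>m0\<close> is minus the norm of x - k from the quadratic field
        generated by x. Multiplying (x - k) z = l x + m by x - P + k thus expresses z through x and
        1.\<close>
      define m0 where "m0 = Q + k * P - k^2"
      have m0: "(x - k) * (x - P + k) = m0"
        unfolding m0_def using x2 by Groebner_Basis.algebra
      have "x - k \<noteq> 0" using x(2) klm(1) by auto
      moreover have "x - P + k \<noteq> 0"
      proof
        assume "x - P + k = 0"
        then have "x = P - k" by (simp add: algebra_simps)
        then show False using x(2) PQ klm by simp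
      qed
      ultimately have m00: "m0 \<noteq> 0" using m0 by auto
      have m0R: "m0 \<in> \<rat>" using PQ klm by (simp add: m0_def power2_eq_square)
      have "m0 * z = (l * P + m + l * (k - P)) * x + (l * Q + m * (k - P))"
      proof -
        have xkz: "(x - k) * z = l * x + m" using klm(4) by (simp add: algebra_simps)
        have "m0 * z = (x - P + k) * ((x - k) * z)" unfolding m0[symmetric] by (simp add: mult_ac)
        also have "\<dots> = l * x^2 + (m + l * (k - P)) * x + m * (k - P)"
          unfolding xkz by (simp add: algebra_simps power2_eq_square)
        finally show ?thesis unfolding x2 by (simp add: algebra_simps)
      qed
      moreover define W1 W2 where "W1 = l * P + m + l * (k - P)" and "W2 = l * Q + m * (k - P)"
      ultimately have "z = (W1 * x + W2) / m0"
        using m00 by (simp add: eq_divide_eq mult.commute)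
      then have zW: "z = (W1 / m0) * x + W2 / m0"
        by (simp add: add_divide_distrib)
      have "W1 / m0 \<in> \<rat>" "W2 / m0 \<in> \<rat>"
        using klm PQ m0R by (auto simp: W1_def W2_def)
      then have "z \<in> complex_field.Span \<rat> [x, 1]" unfolding zW by (rule Span_two)
      then show False using z(2) by blast
    qed
    then have "complex_field.independent \<rat> [x * z, z, x, 1]"
      using z(2) ind2[OF x(2)] unfolding independent_simps by blast
    then have "length [x * z, z, x, 1] \<le> 3"
      by (rule independent_length[OF L(2)]) (use x z in auto)
    then show ?thesis by simp
  qed
  show ?thesis
  proof
    show "\<exists>x\<in>L. x \<notin> \<rat>"
    proof (rule ccontr)
      assume "\<not> (\<exists>x\<in>L. x \<notin> \<rat>)"
      then have "complex_field.Span \<rat> [1] = L" by auto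
      moreover have "complex_field.Span \<rat> [1] \<noteq> L" by (rule Span_not_all[OF L(2)]) auto
      ultimately show False by blast
    qed
    show "\<exists>a\<in>\<rat>. \<exists>b\<in>\<rat>. \<exists>c\<in>\<rat>. z = a + b * x + c * x^2" if x: "x \<in> L" "x \<notin> \<rat>" and z: "z \<in> L" for x z
    proof (rule ccontr)
      assume *: "\<not> (\<exists>a\<in>\<rat>. \<exists>b\<in>\<rat>. \<exists>c\<in>\<rat>. z = a + b * x + c * x^2)"
      have "z \<notin> complex_field.Span \<rat> [x^2, x, 1]"
      proof
        assume "z \<in> complex_field.Span \<rat> [x^2, x, 1]"
        then obtain k l m where "k \<in> \<rat>" "l \<in> \<rat>" "m \<in> \<rat>" "z = k * x^2 + (l * x + m)" by auto
        then have "z = m + l * x + k * x^2" by simp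
        then show False using * \<open>k \<in> \<rat>\<close> \<open>l \<in> \<rat>\<close> \<open>m \<in> \<rat>\<close> by blast
      qed
      moreover have "x^2 \<notin> complex_field.Span \<rat> [x, 1]"
      proof
        assume "x^2 \<in> complex_field.Span \<rat> [x, 1]"
        then obtain l m where lm: "l \<in> \<rat>" "m \<in> \<rat>" "x^2 = l * x + m" by auto
        then have "(- m) + (- l) * x + 1 * x^2 = 0" by simp
        then show False using indep[OF x, of "- m" "- l" 1] lm by simp
      qed
      ultimately have "complex_field.independent \<rat> [z, x^2, x, 1]"
        using ind2[OF x(2)] unfolding independent_simps by blast
      then have "length [z, x^2, x, 1] \<le> 3"
        by (rule independent_length[OF L(2)]) (use x z in auto)
      then show False by simp
    qed
  qed (fact indep)
qed

lemma quadratic_span: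
  assumes K: "subfield K complex_field" "complex_field.dimension 2 \<rat> K"
  shows "\<exists>x\<in>K. x \<notin> \<rat>" "x \<in> K \<Longrightarrow> x \<notin> \<rat> \<Longrightarrow> z \<in> K \<Longrightarrow> \<exists>a\<in>\<rat>. \<exists>b\<in>\<rat>. z = a + b * x"
proof -
  interpret complex_subfield K by (rule complex_subfieldI[OF K(1)])
  show "\<exists>x\<in>K. x \<notin> \<rat>"
  proof (rule ccontr)
    assume "\<not> (\<exists>x\<in>K. x \<notin> \<rat>)"
    then have "complex_field.Span \<rat> [1] = K" by auto
    moreover have "complex_field.Span \<rat> [1] \<noteq> K" by (rule Span_not_all[OF K(2)]) auto
    ultimately show False by blast
  qed
  show "\<exists>a\<in>\<rat>. \<exists>b\<in>\<rat>. z = a + b * x" if x: "x \<in> K" "x \<notin> \<rat>" and z: "z \<in> K"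
  proof (rule ccontr)
    assume *: "\<not> (\<exists>a\<in>\<rat>. \<exists>b\<in>\<rat>. z = a + b * x)"
    have "z \<notin> complex_field.Span \<rat> [x, 1]"
    proof
      assume "z \<in> complex_field.Span \<rat> [x, 1]"
      then obtain l m where "l \<in> \<rat>" "m \<in> \<rat>" "z = l * x + m" by auto
      then have "z = m + l * x" by simp
      then show False using * \<open>l \<in> \<rat>\<close> \<open>m \<in> \<rat>\<close> by blast
    qed
    moreover have "complex_field.independent \<rat> [x, 1]" using x by auto
    ultimately have "complex_field.independent \<rat> [z, x, 1]" unfolding independent_simps by blast
    then have "length [z, x, 1] \<le> 2"
      by (rule independent_length[OF K(2)]) (use x z in auto)
    then show False by simp
  qed
qed

lemma quadratic_roots:
  fixes p q :: complex
  obtains r1 r2 where "r1 + r2 = - p" "r1 * r2 = q"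
proof
  show "(- p + csqrt (p^2 - 4 * q)) / 2 + (- p - csqrt (p^2 - 4 * q)) / 2 = - p"
    by (simp add: field_simps)
  have "((- p + csqrt (p^2 - 4 * q)) / 2) * ((- p - csqrt (p^2 - 4 * q)) / 2) = (p^2 - (csqrt (p^2 - 4 * q))^2) / 4"
    by (simp add: field_simps power2_eq_square)
  then show "((- p + csqrt (p^2 - 4 * q)) / 2) * ((- p - csqrt (p^2 - 4 * q)) / 2) = q"
    by simp
qed

lemma (in cubic_field) exists_roots:
  obtains \<alpha> b c d \<alpha>2 \<alpha>3 where "\<alpha> \<in> L" "\<alpha> \<notin> \<rat>" "b \<in> \<rat>" "c \<in> \<rat>" "d \<in> \<rat>"
    "b = - (\<alpha> + \<alpha>2 + \<alpha>3)" "c = \<alpha> * \<alpha>2 + \<alpha>2 * \<alpha>3 + \<alpha> * \<alpha>3" "d = - (\<alpha> * \<alpha>2 * \<alpha>3)"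
proof -
  obtain \<alpha> where \<alpha>: "\<alpha> \<in> L" "\<alpha> \<notin> \<rat>" using exists_irrational by blast
  obtain a0 a1 a2 where a: "a0 \<in> \<rat>" "a1 \<in> \<rat>" "a2 \<in> \<rat>" "\<alpha>^3 = a0 + a1 * \<alpha> + a2 * \<alpha>^2"
    using span[OF \<alpha>, of "\<alpha>^3"] \<alpha> by auto
  \<comment> \<open>r1 and r2 are the roots of the quotient of X^3 - a2 X^2 - a1 X - a0 by X -
    \<alpha>.\<close>
  obtain r1 r2 where r: "r1 + r2 = - (\<alpha> - a2)" "r1 * r2 = - a1 - a2 * \<alpha> + \<alpha>^2"
    by (rule quadratic_roots)
  show ?thesis
  proof (rule that[of \<alpha> "- a2" "- a1" "- a0" r1 r2])
    show "- a2 = - (\<alpha> + r1 + r2)" using r(1) by (simp add: algebra_simps)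
    have "\<alpha> * r1 + r1 * r2 + \<alpha> * r2 = \<alpha> * (r1 + r2) + r1 * r2" by (simp add: algebra_simps)
    then show "- a1 = \<alpha> * r1 + r1 * r2 + \<alpha> * r2" unfolding r by (simp add: algebra_simps power2_eq_square)
    have "\<alpha> * r1 * r2 = \<alpha> * (r1 * r2)" by simp
    also have "\<dots> = a0" unfolding r using a(4) by (simp add: algebra_simps power2_eq_square power3_eq_cube)
    finally show "- a0 = - (\<alpha> * r1 * r2)" by simp
  qed (use \<alpha> a in auto)
qed

section \<open>Roots and embeddings of a cubic field\<close>

locale cubic_roots = cubic_field L for L +
  fixes \<alpha> b c d \<alpha>2 \<alpha>3 :: complex
  assumes \<alpha>: "\<alpha> \<in> L" "\<alpha> \<notin> \<rat>" and bcd: "b \<in> \<rat>" "c \<in> \<rat>" "d \<in> \<rat>"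
    and vieta: "b = - (\<alpha> + \<alpha>2 + \<alpha>3)" "c = \<alpha> * \<alpha>2 + \<alpha>2 * \<alpha>3 + \<alpha> * \<alpha>3" "d = - (\<alpha> * \<alpha>2 * \<alpha>3)"
begin

lemma root_iff: "r^3 + b * r^2 + c * r + d = 0 \<longleftrightarrow> r \<in> {\<alpha>, \<alpha>2, \<alpha>3}"
proof -
  have "r^3 + b * r^2 + c * r + d = (r - \<alpha>) * (r - \<alpha>2) * (r - \<alpha>3)"
    unfolding vieta by (simp add: algebra_simps power2_eq_square power3_eq_cube)
  then show ?thesis by auto
qed

lemma roots_irrational: "r \<in> {\<alpha>, \<alpha>2, \<alpha>3} \<Longrightarrow> r \<notin> \<rat>"
proof
  assume r: "r \<in> {\<alpha>, \<alpha>2, \<alpha>3}" "r \<in> \<rat>"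
  have *: False if "s \<in> \<rat>" "s + t + \<alpha> = - b" "s * t + t * \<alpha> + s * \<alpha> = c" for s t
  proof -
    have "(c + s * (b + s)) + (b + s) * \<alpha> + 1 * \<alpha>^2 = 0"
    proof -
      have t: "t = - b - s - \<alpha>" using that(2) by (simp add: algebra_simps)
      show ?thesis unfolding that(3)[symmetric] t by (simp add: algebra_simps power2_eq_square)
    qed
    then show False using indep[OF \<alpha>, of "c + s * (b + s)" "b + s" 1] bcd that(1) by simp
  qed
  show False using r \<alpha> *[of \<alpha>2 \<alpha>3] *[of \<alpha>3 \<alpha>2] vieta by (auto simp: algebra_simps)
qed

text \<open>This extends independence to the roots that need not lie in L. Dividing the cubic by a
  quadratic relation of r leaves a remainder U X + V that vanishes at r and hence is 0; then the
  linear cofactor has the rational root -(P + b).\<close>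

lemma indep_root:
  assumes r: "r \<in> {\<alpha>, \<alpha>2, \<alpha>3}" and pqs: "p \<in> \<rat>" "q \<in> \<rat>" "s \<in> \<rat>" "p + q * r + s * r^2 = 0"
  shows "p = 0 \<and> q = 0 \<and> s = 0"
proof (cases "s = 0")
  case True
  then have "q = 0" using pqs roots_irrational[OF r] Rats_of_linear[of p q r] by auto
  then show ?thesis using pqs True by simp
next
  case False
  define P Q where "P = - q / s" and "Q = - p / s"
  have PQ: "P \<in> \<rat>" "Q \<in> \<rat>" using pqs by (auto simp: P_def Q_def)
  have "s * r^2 = s * (P * r + Q)"
    using pqs(4) False unfolding P_def Q_def by (simp add: field_simps) (simp add: eq_neg_iff_add_eq_0 algebra_simps)
  then have r2: "r^2 = P * r + Q" using False by simp
  have r0: "r^3 + b * r^2 + c * r + d = 0" using r root_iff by blast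
  define U V where "U = P^2 + Q + b * P + c" and "V = P * Q + b * Q + d"
  have UV: "U \<in> \<rat>" "V \<in> \<rat>" using PQ bcd by (auto simp: U_def V_def power2_eq_square)
  have "r^3 = r^2 * r" by (simp add: power3_eq_cube power2_eq_square)
  also have "\<dots> = (P * r + Q) * r" by (simp only: r2)
  also have "\<dots> = P * r^2 + Q * r" by (simp add: algebra_simps power2_eq_square)
  finally have r3: "r^3 = P * (P * r + Q) + Q * r" unfolding r2 .
  have "V + U * r = r^3 + b * r^2 + c * r + d"
    unfolding U_def V_def r3 r2 by (simp add: algebra_simps power2_eq_square)
  then have "V + U * r = 0" using r0 by simp
  then have "U = 0" using UV roots_irrational[OF r] Rats_of_linear[of V U r] by auto
  then have "V = 0" using \<open>V + U * r = 0\<close> by simp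
  define z where "z = - (P + b)"
  have "z^3 + b * z^2 + c * z + d = (z^2 - P * z - Q) * (z + P + b) + U * z + V"
    unfolding U_def V_def z_def by (simp add: algebra_simps power2_eq_square power3_eq_cube)
  then have "z^3 + b * z^2 + c * z + d = 0" using \<open>U = 0\<close> \<open>V = 0\<close> by (simp add: z_def)
  then have "z \<notin> \<rat>" using root_iff roots_irrational by blast
  then show ?thesis using PQ bcd by (simp add: z_def)
qed

text \<open>A multiple root would also be a root of the derivative, which is a rational relation of
  degree 2.\<close>

lemma distinct_roots: "\<alpha> \<noteq> \<alpha>2" "\<alpha> \<noteq> \<alpha>3" "\<alpha>2 \<noteq> \<alpha>3"
proof -
  have *: "c + 2 * b * r + 3 * r^2 \<noteq> 0" if "r \<in> {\<alpha>, \<alpha>2, \<alpha>3}" for r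
    using indep_root[OF that, of c "2 * b" 3] bcd by auto
  have "c + 2 * b * \<alpha> + 3 * \<alpha>^2 = (\<alpha> - \<alpha>2) * (\<alpha> - \<alpha>3)"
    unfolding vieta by (simp add: algebra_simps power2_eq_square)
  then show "\<alpha> \<noteq> \<alpha>2" "\<alpha> \<noteq> \<alpha>3" using *[of \<alpha>] by auto
  have "c + 2 * b * \<alpha>2 + 3 * \<alpha>2^2 = (\<alpha>2 - \<alpha>) * (\<alpha>2 - \<alpha>3)"
    unfolding vieta by (simp add: algebra_simps power2_eq_square)
  then show "\<alpha>2 \<noteq> \<alpha>3" using *[of \<alpha>2] by auto
qed

definition co :: "complex \<Rightarrow> complex \<times> complex \<times> complex" where
  "co z = (SOME (p, q, s). p \<in> \<rat> \<and> q \<in> \<rat> \<and> s \<in> \<rat> \<and> z = p + q * \<alpha> + s * \<alpha>^2)"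

text \<open>The embedding of L that sends \<alpha> to r, as substitution of r in coordinates. It is
  additive for every r, but multiplicativity in \<open>ev_mult\<close> requires r to be a
  root.\<close>

definition ev :: "complex \<Rightarrow> complex \<Rightarrow> complex" where
  "ev r z = (case co z of (p, q, s) \<Rightarrow> p + q * r + s * r^2)"

lemma ev_eq:
  assumes "p \<in> \<rat>" "q \<in> \<rat>" "s \<in> \<rat>"
  shows "ev r (p + q * \<alpha> + s * \<alpha>^2) = p + q * r + s * r^2"
proof -
  have "co (p + q * \<alpha> + s * \<alpha>^2) = (p, q, s)"
    unfolding co_def
  proof (rule some_equality)
    fix t assume t: "case t of (p', q', s') \<Rightarrow> p' \<in> \<rat> \<and> q' \<in> \<rat> \<and> s' \<in> \<rat> \<and>
      p + q * \<alpha> + s * \<alpha>^2 = p' + q' * \<alpha> + s' * \<alpha>^2"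
    obtain p' q' s' where tt: "t = (p', q', s')" by (cases t)
    then have "(p - p') + (q - q') * \<alpha> + (s - s') * \<alpha>^2 = 0" using t by (simp add: algebra_simps)
    then have "p - p' = 0 \<and> q - q' = 0 \<and> s - s' = 0" using t tt assms by (intro indep[OF \<alpha>]) auto
    then show "t = (p, q, s)" using tt by simp
  qed (use assms in simp)
  then show ?thesis by (simp add: ev_def)
qed

lemma L_cases:
  assumes "z \<in> L"
  obtains p q s where "p \<in> \<rat>" "q \<in> \<rat>" "s \<in> \<rat>" "z = p + q * \<alpha> + s * \<alpha>^2" "\<And>r. ev r z = p + q * r + s * r^2"
proof -
  obtain p q s where pqs: "p \<in> \<rat>" "q \<in> \<rat>" "s \<in> \<rat>" "z = p + q * \<alpha> + s * \<alpha>^2"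
    using span[OF \<alpha> assms] by blast
  show ?thesis by (rule that[OF pqs]) (unfold pqs(4), rule ev_eq[OF pqs(1-3)])
qed

lemma ev_Rats: "x \<in> \<rat> \<Longrightarrow> ev r x = x"
  using ev_eq[of x 0 0 r] by simp

lemma ev_\<alpha>: "ev r \<alpha> = r"
  using ev_eq[of 0 1 0 r] by simp

lemma ev_self: "x \<in> L \<Longrightarrow> ev \<alpha> x = x"
  by (erule L_cases) simp

lemma ev_add: "x \<in> L \<Longrightarrow> y \<in> L \<Longrightarrow> ev r (x + y) = ev r x + ev r y"
proof -
  assume x: "x \<in> L" and y: "y \<in> L"
  obtain p q s where 1: "p \<in> \<rat>" "q \<in> \<rat>" "s \<in> \<rat>" "x = p + q * \<alpha> + s * \<alpha>^2" "ev r x = p + q * r + s * r^2"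
    by (rule L_cases[OF x]) blast
  obtain p' q' s' where 2: "p' \<in> \<rat>" "q' \<in> \<rat>" "s' \<in> \<rat>" "y = p' + q' * \<alpha> + s' * \<alpha>^2" "ev r y = p' + q' * r + s' * r^2"
    by (rule L_cases[OF y]) blast
  have eq: "x + y = (p + p') + (q + q') * \<alpha> + (s + s') * \<alpha>^2" using 1(4) 2(4) by (simp add: algebra_simps)
  have "ev r (x + y) = (p + p') + (q + q') * r + (s + s') * r^2"
    unfolding eq by (rule ev_eq) (use 1 2 in auto)
  then show ?thesis unfolding 1(5) 2(5) by (simp add: algebra_simps)
qed

text \<open>The multiplication table modulo the cubic. That the coefficients on the right are free
  of r is what makes substitution of one root for another multiplicative.\<close>

lemma root_product:
  assumes "r^3 + b * r^2 + c * r + d = 0"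
  shows "(p + q * r + s * r^2) * (p' + q' * r + s' * r^2) =
    (p * p' - d * (q * s' + s * q') + b * d * (s * s'))
    + (p * q' + q * p' - c * (q * s' + s * q') + (b * c - d) * (s * s')) * r
    + (p * s' + q * q' + s * p' - b * (q * s' + s * q') + (b^2 - c) * (s * s')) * r^2"
proof -
  have r3: "r^3 = - b * r^2 - c * r - d" using assms by (simp add: algebra_simps eq_neg_iff_add_eq_0)
  have "r^4 = r^3 * r" by (simp add: power4_eq_xxxx power3_eq_cube)
  also have "\<dots> = (- b * r^2 - c * r - d) * r" by (simp only: r3)
  also have "\<dots> = - b * r^3 - c * r^2 - d * r"
    by (simp add: algebra_simps power2_eq_square power3_eq_cube)
  finally have r4: "r^4 = (b^2 - c) * r^2 + (b * c - d) * r + b * d"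
    unfolding r3 by (simp add: algebra_simps power2_eq_square)
  have "(p + q * r + s * r^2) * (p' + q' * r + s' * r^2) =
      p * p' + (p * q' + q * p') * r + (p * s' + q * q' + s * p') * r^2 + (q * s' + s * q') * r^3 + s * s' * r^4"
    by (simp add: algebra_simps power2_eq_square power3_eq_cube power4_eq_xxxx)
  then show ?thesis unfolding r3 r4 by (simp add: algebra_simps)
qed

lemma ev_mult:
  assumes r: "r \<in> {\<alpha>, \<alpha>2, \<alpha>3}" and x: "x \<in> L" and y: "y \<in> L"
  shows "ev r (x * y) = ev r x * ev r y"
proof -
  have r0: "r^3 + b * r^2 + c * r + d = 0" "\<alpha>^3 + b * \<alpha>^2 + c * \<alpha> + d = 0" using r root_iff by blast+
  obtain p q s where 1: "p \<in> \<rat>" "q \<in> \<rat>" "s \<in> \<rat>" "x = p + q * \<alpha> + s * \<alpha>^2" "ev r x = p + q * r + s * r^2"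
    by (rule L_cases[OF x]) blast
  obtain p' q' s' where 2: "p' \<in> \<rat>" "q' \<in> \<rat>" "s' \<in> \<rat>" "y = p' + q' * \<alpha> + s' * \<alpha>^2" "ev r y = p' + q' * r + s' * r^2"
    by (rule L_cases[OF y]) blast
  show ?thesis unfolding 1(5) 2(5) unfolding root_product[OF r0(1)] unfolding 1(4) 2(4) unfolding root_product[OF r0(2)]
    by (rule ev_eq) (use 1 2 bcd in \<open>auto simp: power2_eq_square\<close>)
qed

lemma embeddings_hom:
  assumes "\<phi> \<in> embeddings E F" "x \<in> E" "y \<in> E"
  shows "\<phi> (x + y) = \<phi> x + \<phi> y" "\<phi> (x * y) = \<phi> x * \<phi> y"
  using assms by (auto simp: embeddings_def Ring.ring_hom_def)

lemma embeddingsI: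
  assumes "\<And>x y. x \<in> E \<Longrightarrow> y \<in> E \<Longrightarrow> f (x + y) = f x + f y"
    "\<And>x y. x \<in> E \<Longrightarrow> y \<in> E \<Longrightarrow> f (x * y) = f x * f y" "\<And>x. x \<in> F \<Longrightarrow> f x = x" "1 \<in> F" "F \<subseteq> E"
    "\<And>x y. x \<in> E \<Longrightarrow> y \<in> E \<Longrightarrow> x + y \<in> E \<and> x * y \<in> E"
  shows "restrict f E \<in> embeddings E F"
  using assms by (auto simp: embeddings_def Ring.ring_hom_def subset_iff)

lemma ev_embedding: "r \<in> {\<alpha>, \<alpha>2, \<alpha>3} \<Longrightarrow> restrict (ev r) L \<in> embeddings L \<rat>"
  by (rule embeddingsI) (auto simp: ev_add ev_mult ev_Rats)

lemma embeddings_L: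
  assumes \<phi>: "\<phi> \<in> embeddings L \<rat>"
  shows "\<exists>r\<in>{\<alpha>, \<alpha>2, \<alpha>3}. \<forall>z\<in>L. \<phi> z = ev r z"
proof -
  have Q: "\<phi> x = x" if "x \<in> \<rat>" for x using \<phi> that by (simp add: embeddings_def)
  note h = embeddings_hom[OF \<phi>]
  have cub: "\<phi> (p + q * \<alpha> + s * \<alpha>^2) = p + q * \<phi> \<alpha> + s * (\<phi> \<alpha>)^2" if "p \<in> \<rat>" "q \<in> \<rat>" "s \<in> \<rat>" for p q s
    using that \<alpha> by (simp add: h Q power2_eq_square)
  have "\<phi> (\<alpha> * (\<alpha> * \<alpha>)) = \<phi> \<alpha> * (\<phi> \<alpha> * \<phi> \<alpha>)" using \<alpha> by (simp add: h)
  moreover have "\<alpha> * (\<alpha> * \<alpha>) = (- d) + (- c) * \<alpha> + (- b) * \<alpha>^2"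
    unfolding vieta by (simp add: algebra_simps power2_eq_square)
  ultimately have "\<phi> \<alpha> * (\<phi> \<alpha> * \<phi> \<alpha>) = (- d) + (- c) * \<phi> \<alpha> + (- b) * (\<phi> \<alpha>)^2"
    using cub[of "- d" "- c" "- b"] bcd by simp
  then have "(\<phi> \<alpha>)^3 + b * (\<phi> \<alpha>)^2 + c * \<phi> \<alpha> + d = 0"
    by (simp add: power3_eq_cube mult.assoc)
  then have "\<phi> \<alpha> \<in> {\<alpha>, \<alpha>2, \<alpha>3}" using root_iff by blast
  moreover have "\<phi> z = ev (\<phi> \<alpha>) z" if "z \<in> L" for z
    using \<open>z \<in> L\<close> by (rule L_cases) (use cub in simp)
  ultimately show ?thesis by blast
qed

lemma constant_of_conjugates:
  assumes "q * \<alpha> + s * \<alpha>^2 = q * \<alpha>2 + s * \<alpha>2^2" "q * \<alpha> + s * \<alpha>^2 = q * \<alpha>3 + s * \<alpha>3^2"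
  shows "q = 0 \<and> s = 0"
proof -
  have "(\<alpha> - \<alpha>2) * (q + s * (\<alpha> + \<alpha>2)) = 0" "(\<alpha> - \<alpha>3) * (q + s * (\<alpha> + \<alpha>3)) = 0"
    using assms by (simp_all add: algebra_simps power2_eq_square)
  then have *: "q + s * (\<alpha> + \<alpha>2) = 0" "q + s * (\<alpha> + \<alpha>3) = 0" using distinct_roots by auto
  then have "s * (\<alpha>2 - \<alpha>3) = 0" by Groebner_Basis.algebra
  then have "s = 0" using distinct_roots by simp
  then show ?thesis using * by simp
qed

text \<open>Used in contraposition to get a root outside L. With a second root L contains all three,
  each embedding maps L onto itself, and an element fixed by all of them has equal values at three
  conjugates, hence is rational.\<close>

lemma galois_if_root_in_L:
  assumes "\<alpha>2 \<in> L"
  shows "galois_over L \<rat>"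
proof -
  have "\<alpha>3 = - b - \<alpha> - \<alpha>2" using vieta by simp
  then have roots_L: "r \<in> L" if "r \<in> {\<alpha>, \<alpha>2, \<alpha>3}" for r using that assms \<alpha> bcd by auto
  have img: "restrict (ev r) L ` L = L" if r: "r \<in> {\<alpha>, \<alpha>2, \<alpha>3}" for r
  proof
    show "restrict (ev r) L ` L \<subseteq> L"
    proof clarsimp
      fix z assume "z \<in> L"
      then show "ev r z \<in> L" by (rule L_cases) (use roots_L[OF r] in auto)
    qed
    show "L \<subseteq> restrict (ev r) L ` L"
    proof
      fix z assume "z \<in> L"
      then obtain p q s where pqs: "p \<in> \<rat>" "q \<in> \<rat>" "s \<in> \<rat>" "z = p + q * r + s * r^2"
        using span[OF roots_L[OF r] roots_irrational[OF r]] by blast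
      then have "z = ev r (p + q * \<alpha> + s * \<alpha>^2)" using ev_eq by simp
      moreover have "p + q * \<alpha> + s * \<alpha>^2 \<in> L" using pqs \<alpha> by auto
      ultimately show "z \<in> restrict (ev r) L ` L" by (auto intro: image_eqI)
    qed
  qed
  have "x \<in> \<rat>" if x: "x \<in> L" "\<forall>\<sigma>\<in>embeddings L \<rat>. \<sigma> ` L = L \<longrightarrow> \<sigma> x = x" for x
  proof -
    have fixr: "ev r x = x" if "r \<in> {\<alpha>, \<alpha>2, \<alpha>3}" for r
      using x(2) ev_embedding[OF that] img[OF that] x(1) by fastforce
    obtain p q s where pqs: "p \<in> \<rat>" "x = p + q * \<alpha> + s * \<alpha>^2" "\<And>r. ev r x = p + q * r + s * r^2"
      by (rule L_cases[OF x(1)]) blast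
    have "q = 0 \<and> s = 0"
      by (rule constant_of_conjugates) (use fixr[of \<alpha>2] fixr[of \<alpha>3] pqs(2,3) in auto)
    then show ?thesis using pqs by simp
  qed
  moreover have "\<sigma> x = x" if "x \<in> \<rat>" "\<sigma> \<in> embeddings L \<rat>" for x \<sigma>
    using that by (simp add: embeddings_def)
  ultimately show ?thesis unfolding galois_over_def by auto
qed

end

section \<open>The splitting field and its dihedral automorphisms\<close>

locale normal_cubic = cubic_roots +
  assumes root_notin_L: "\<alpha>2 \<notin> L"
begin

text \<open>As \<alpha> lies in L, the root \<alpha>2 is quadratic over L; so these sums already
  form a field.\<close>

definition N where "N = {x + y * \<alpha>2 | x y. x \<in> L \<and> y \<in> L}"

lemma N_I: "x \<in> L \<Longrightarrow> y \<in> L \<Longrightarrow> x + y * \<alpha>2 \<in> N"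
  by (auto simp: N_def)

lemma N_cases:
  assumes "z \<in> N" obtains x y where "x \<in> L" "y \<in> L" "z = x + y * \<alpha>2"
  using assms by (auto simp: N_def)

lemma L_subset_N: "x \<in> L \<Longrightarrow> x \<in> N"
  using N_I[of x 0] by simp

lemma \<alpha>3_eq: "\<alpha>3 = (- b - \<alpha>) + (- 1) * \<alpha>2"
  using vieta by simp

lemma roots_N: "r \<in> {\<alpha>, \<alpha>2, \<alpha>3} \<Longrightarrow> r \<in> N"
  using L_subset_N[OF \<alpha>(1)] N_I[of 0 1] N_I[of "- b - \<alpha>" "- 1"] \<alpha> bcd by (auto simp: \<alpha>3_eq)

lemma N_unique:
  assumes "x \<in> L" "y \<in> L" "x + y * \<alpha>2 = 0"
  shows "x = 0 \<and> y = 0"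
proof -
  have "y = 0"
  proof (rule ccontr)
    assume "y \<noteq> 0"
    have "y * \<alpha>2 = - x" using assms(3) by (simp add: eq_neg_iff_add_eq_0 add.commute)
    moreover have "\<alpha>2 = (y * \<alpha>2) / y" using \<open>y \<noteq> 0\<close> by simp
    ultimately have "\<alpha>2 = - x / y" by (simp only:)
    then show False using root_notin_L assms by simp
  qed
  then show ?thesis using assms(3) by simp
qed

text \<open>g is a root of the quotient of the cubic by X - r. The three pairs are the images of
  (\<alpha>, \<alpha>2) under the identity, \<open>\<tau>\<close> and \<open>\<sigma>\<close>;
  further automorphisms arise as compositions.\<close>

lemma pair_relation:
  assumes "(r, g) \<in> {(\<alpha>, \<alpha>2), (\<alpha>, \<alpha>3), (\<alpha>2, \<alpha>3)}"
  shows "g * g = - (b + r) * g - (c + b * r + r^2)"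
  using assms unfolding vieta by (auto simp: algebra_simps power2_eq_square)

lemma N_mult_eq:
  assumes "(r, g) \<in> {(\<alpha>, \<alpha>2), (\<alpha>, \<alpha>3), (\<alpha>2, \<alpha>3)}"
  shows "(x + y * g) * (x' + y' * g) =
    (x * x' - y * y' * (c + b * r + r^2)) + (x * y' + x' * y - y * y' * (b + r)) * g"
proof -
  have "(x + y * g) * (x' + y' * g) = x * x' + (x * y' + x' * y) * g + y * y' * (g * g)"
    by (simp add: algebra_simps)
  then show ?thesis unfolding pair_relation[OF assms] by (simp add: algebra_simps)
qed

lemma complex_subfield_N: "complex_subfield N"
proof
  show "1 \<in> N" using L_subset_N by simp
  show diff: "x - y \<in> N" if x: "x \<in> N" and y: "y \<in> N" for x y
  proof -
    obtain u w where 1: "u \<in> L" "w \<in> L" "x = u + w * \<alpha>2" by (rule N_cases[OF x])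
    obtain u' w' where 2: "u' \<in> L" "w' \<in> L" "y = u' + w' * \<alpha>2" by (rule N_cases[OF y])
    have eq: "x - y = (u - u') + (w - w') * \<alpha>2" using 1 2 by (simp add: algebra_simps)
    show ?thesis unfolding eq using 1 2 by (intro N_I) auto
  qed
  show mult: "x * y \<in> N" if x: "x \<in> N" and y: "y \<in> N" for x y
  proof -
    obtain u w where 1: "u \<in> L" "w \<in> L" "x = u + w * \<alpha>2" by (rule N_cases[OF x])
    obtain u' w' where 2: "u' \<in> L" "w' \<in> L" "y = u' + w' * \<alpha>2" by (rule N_cases[OF y])
    show ?thesis unfolding 1(3) 2(3) N_mult_eq[of \<alpha> \<alpha>2, simplified]
      using 1 2 \<alpha> bcd by (intro N_I) auto
  qed
  show "inverse z \<in> N" if z: "z \<in> N" for z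
  proof (cases "z = 0")
    case False
    obtain x y where 1: "x \<in> L" "y \<in> L" "z = x + y * \<alpha>2" by (rule N_cases[OF z])
    \<comment> \<open>z' is the conjugate of z over L, and n is the relative norm.\<close>
    define z' where "z' = x + y * \<alpha>3"
    define n where "n = x^2 - x * y * (b + \<alpha>) + y^2 * (c + b * \<alpha> + \<alpha>^2)"
    have n: "z * z' = n" unfolding 1(3) z'_def n_def vieta by (simp add: algebra_simps power2_eq_square)
    have z': "z' = (x - y * (b + \<alpha>)) + (- y) * \<alpha>2"
      unfolding z'_def \<alpha>3_eq by (simp add: algebra_simps)
    have "z' \<noteq> 0"
    proof
      assume z0: "z' = 0"
      have "x - y * (b + \<alpha>) = 0 \<and> - y = 0"
        by (rule N_unique[OF _ _ trans[OF sym[OF z'] z0]]) (use 1 \<alpha> bcd in auto)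
      then show False using False 1 by simp
    qed
    then have n0: "n \<noteq> 0" using n False by auto
    have nL: "n \<in> L" using 1 \<alpha> bcd by (auto simp: n_def)
    have "inverse z = z' * inverse n" using n n0 False by (simp add: field_simps)
    moreover have "z' \<in> N" unfolding z' using 1 \<alpha> bcd by (intro N_I) auto
    moreover have "inverse n \<in> N" using nL by (intro L_subset_N) auto
    ultimately show ?thesis using mult by simp
  qed (use z in simp)
qed

sublocale N: complex_subfield N by (rule complex_subfield_N)

definition coN :: "complex \<Rightarrow> complex \<times> complex" where
  "coN z = (SOME (x, y). x \<in> L \<and> y \<in> L \<and> z = x + y * \<alpha>2)"

definition ext :: "complex \<Rightarrow> complex \<Rightarrow> complex \<Rightarrow> complex" where
  "ext r g z = (case coN z of (x, y) \<Rightarrow> ev r x + ev r y * g)"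

lemma ext_eq:
  assumes "x \<in> L" "y \<in> L"
  shows "ext r g (x + y * \<alpha>2) = ev r x + ev r y * g"
proof -
  have "coN (x + y * \<alpha>2) = (x, y)"
    unfolding coN_def
  proof (rule some_equality)
    fix t assume t: "case t of (x', y') \<Rightarrow> x' \<in> L \<and> y' \<in> L \<and> x + y * \<alpha>2 = x' + y' * \<alpha>2"
    obtain x' y' where tt: "t = (x', y')" by (cases t)
    then have "(x - x') + (y - y') * \<alpha>2 = 0" using t by (simp add: algebra_simps)
    then have "x - x' = 0 \<and> y - y' = 0" using t tt assms by (intro N_unique) auto
    then show "t = (x, y)" using tt by simp
  qed (use assms in simp)
  then show ?thesis by (simp add: ext_def)
qed

lemma ev_diff: "x \<in> L \<Longrightarrow> y \<in> L \<Longrightarrow> ev r (x - y) = ev r x - ev r y"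
  using ev_add[of "x - y" y r] by simp

lemma ext_endo:
  assumes rg: "(r, g) \<in> {(\<alpha>, \<alpha>2), (\<alpha>, \<alpha>3), (\<alpha>2, \<alpha>3)}"
  shows "field_endo N (ext r g)"
proof
  have r: "r \<in> {\<alpha>, \<alpha>2, \<alpha>3}" "g \<in> {\<alpha>, \<alpha>2, \<alpha>3}" using rg by auto
  show "ext r g (x + y) = ext r g x + ext r g y" if x: "x \<in> N" and y: "y \<in> N" for x y
  proof -
    obtain u w where 1: "u \<in> L" "w \<in> L" "x = u + w * \<alpha>2" by (rule N_cases[OF x])
    obtain u' w' where 2: "u' \<in> L" "w' \<in> L" "y = u' + w' * \<alpha>2" by (rule N_cases[OF y])
    have eq: "x + y = (u + u') + (w + w') * \<alpha>2" using 1 2 by (simp add: algebra_simps)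
    show ?thesis
      unfolding eq ext_eq[OF add_closed[OF 1(1) 2(1)] add_closed[OF 1(2) 2(2)]]
      unfolding 1(3) 2(3) ext_eq[OF 1(1,2)] ext_eq[OF 2(1,2)]
      using 1 2 by (simp add: ev_add algebra_simps)
  qed
  show "ext r g (x * y) = ext r g x * ext r g y" if x: "x \<in> N" and y: "y \<in> N" for x y
  proof -
    obtain u w where 1: "u \<in> L" "w \<in> L" "x = u + w * \<alpha>2" by (rule N_cases[OF x])
    obtain u' w' where 2: "u' \<in> L" "w' \<in> L" "y = u' + w' * \<alpha>2" by (rule N_cases[OF y])
    define e1 e2 where "e1 = c + b * \<alpha> + \<alpha>^2" and "e2 = b + \<alpha>"
    have eL: "e1 \<in> L" "e2 \<in> L" using \<alpha> bcd by (auto simp: e1_def e2_def)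
    have ee: "ev r e1 = c + b * r + r^2" "ev r e2 = b + r"
      using ev_eq[of c b 1 r] ev_eq[of b 1 0 r] bcd by (auto simp: e1_def e2_def)
    have xy: "x * y = (u * u' - w * w' * e1) + (u * w' + u' * w - w * w' * e2) * \<alpha>2"
      unfolding 1(3) 2(3) e1_def e2_def by (rule N_mult_eq) simp
    have "ext r g (x * y) = ev r (u * u' - w * w' * e1) + ev r (u * w' + u' * w - w * w' * e2) * g"
      unfolding xy by (rule ext_eq) (use 1 2 eL in auto)
    also have "\<dots> = (ev r u * ev r u' - ev r w * ev r w' * ev r e1)
        + (ev r u * ev r w' + ev r u' * ev r w - ev r w * ev r w' * ev r e2) * g"
      using 1 2 eL by (simp add: ev_add ev_diff ev_mult[OF r(1)])
    also have "\<dots> = (ev r u + ev r w * g) * (ev r u' + ev r w' * g)"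
      unfolding ee by (rule N_mult_eq[OF rg, symmetric])
    finally show ?thesis unfolding 1(3) 2(3) ext_eq[OF 1(1,2)] ext_eq[OF 2(1,2)] .
  qed
  show "ext r g 1 = 1" using ext_eq[of 1 0 r g] by (simp add: ev_Rats)
  show "ext r g z \<in> N" if z: "z \<in> N" for z
  proof -
    obtain x y where 1: "x \<in> L" "y \<in> L" "z = x + y * \<alpha>2" by (rule N_cases[OF z])
    have "ev r x \<in> N" if "x \<in> L" for x
      using that by (rule L_cases) (use roots_N[OF r(1)] in auto)
    then show ?thesis unfolding 1(3) ext_eq[OF 1(1,2)] using 1 roots_N[OF r(2)] by auto
  qed
qed

definition \<sigma> where "\<sigma> = ext \<alpha>2 \<alpha>3"
definition \<tau> where "\<tau> = ext \<alpha> \<alpha>3"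

sublocale S: field_endo N \<sigma> unfolding \<sigma>_def by (rule ext_endo) simp
sublocale T: field_endo N \<tau> unfolding \<tau>_def by (rule ext_endo) simp

lemma \<tau>_L: "x \<in> L \<Longrightarrow> \<tau> x = x"
  using ext_eq[of x 0 \<alpha> \<alpha>3] by (simp add: \<tau>_def ev_self ev_Rats)

lemma roots_N' [simp]: "\<alpha> \<in> N" "\<alpha>2 \<in> N" "\<alpha>3 \<in> N" "b \<in> N" "c \<in> N" "d \<in> N"
  using roots_N bcd by auto

lemma \<sigma>_roots [simp]: "\<sigma> \<alpha> = \<alpha>2" "\<sigma> \<alpha>2 = \<alpha>3" "\<sigma> \<alpha>3 = \<alpha>"
proof -
  show 1: "\<sigma> \<alpha> = \<alpha>2" using ext_eq[of \<alpha> 0 \<alpha>2 \<alpha>3] \<alpha> by (simp add: \<sigma>_def ev_\<alpha> ev_Rats)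
  show 2: "\<sigma> \<alpha>2 = \<alpha>3" using ext_eq[of 0 1 \<alpha>2 \<alpha>3] by (simp add: \<sigma>_def ev_Rats)
  have "\<sigma> (- b - \<alpha> - \<alpha>2) = - b - \<alpha>2 - \<alpha>3" using S.s_Rats[OF bcd(1)] by (simp add: 1 2)
  then show "\<sigma> \<alpha>3 = \<alpha>" unfolding vieta(1) by simp
qed

lemma \<tau>_roots [simp]: "\<tau> \<alpha> = \<alpha>" "\<tau> \<alpha>2 = \<alpha>3" "\<tau> \<alpha>3 = \<alpha>2"
proof -
  show 1: "\<tau> \<alpha> = \<alpha>" using \<tau>_L \<alpha> by simp
  show 2: "\<tau> \<alpha>2 = \<alpha>3" using ext_eq[of 0 1 \<alpha> \<alpha>3] by (simp add: \<tau>_def ev_Rats)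
  have "\<tau> (- b - \<alpha> - \<alpha>2) = - b - \<alpha> - \<alpha>3" using T.s_Rats[OF bcd(1)] by (simp add: 1 2)
  then show "\<tau> \<alpha>3 = \<alpha>2" unfolding vieta(1) by simp
qed

text \<open>Values outside N are permitted, so that embeddings of N and compositions of
  automorphisms are covered alike and can be compared by their values at \<alpha> and
  \<alpha>2.\<close>

definition hom_N :: "(complex \<Rightarrow> complex) \<Rightarrow> bool" where
  "hom_N f \<longleftrightarrow> (\<forall>x\<in>N. \<forall>y\<in>N. f (x + y) = f x + f y \<and> f (x * y) = f x * f y) \<and> (\<forall>x\<in>\<rat>. f x = x)"

lemma hom_N_basic: "hom_N (\<lambda>x. x)" "hom_N \<sigma>" "hom_N (\<lambda>x. \<sigma> (\<sigma> x))" "hom_N (\<lambda>x. \<sigma> (\<sigma> (\<sigma> x)))"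
  "hom_N \<tau>" "hom_N (\<lambda>x. \<tau> (\<tau> x))" "hom_N (\<lambda>x. \<sigma> (\<tau> x))" "hom_N (\<lambda>x. \<tau> (\<sigma> (\<sigma> x)))"
  by (auto simp: hom_N_def S.s_Rats T.s_Rats)

lemma hom_N_eval:
  assumes f: "hom_N f" and pqs: "p \<in> \<rat>" "q \<in> \<rat>" "s \<in> \<rat>" "p' \<in> \<rat>" "q' \<in> \<rat>" "s' \<in> \<rat>"
  shows "f ((p + q * \<alpha> + s * \<alpha>^2) + (p' + q' * \<alpha> + s' * \<alpha>^2) * \<alpha>2) =
    (p + q * f \<alpha> + s * (f \<alpha>)^2) + (p' + q' * f \<alpha> + s' * (f \<alpha>)^2) * f \<alpha>2"
  using f pqs by (simp add: hom_N_def power2_eq_square)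

lemma hom_N_agree:
  assumes f: "hom_N f" and g: "hom_N g" and eq: "f \<alpha> = g \<alpha>" "f \<alpha>2 = g \<alpha>2" and z: "z \<in> N"
  shows "f z = g z"
proof -
  obtain x y where 1: "x \<in> L" "y \<in> L" "z = x + y * \<alpha>2" by (rule N_cases[OF z])
  obtain p q s where 2: "p \<in> \<rat>" "q \<in> \<rat>" "s \<in> \<rat>" "x = p + q * \<alpha> + s * \<alpha>^2" by (rule L_cases[OF 1(1)])
  obtain p' q' s' where 3: "p' \<in> \<rat>" "q' \<in> \<rat>" "s' \<in> \<rat>" "y = p' + q' * \<alpha> + s' * \<alpha>^2" by (rule L_cases[OF 1(2)])
  show ?thesis
    unfolding 1(3) 2(4) 3(4) hom_N_eval[OF f 2(1-3) 3(1-3)] hom_N_eval[OF g 2(1-3) 3(1-3)] eq ..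
qed

lemma \<sigma>_cubed: "z \<in> N \<Longrightarrow> \<sigma> (\<sigma> (\<sigma> z)) = z"
  by (rule hom_N_agree[OF hom_N_basic(4,1)]) simp_all

lemma \<tau>_\<tau>: "z \<in> N \<Longrightarrow> \<tau> (\<tau> z) = z"
  by (rule hom_N_agree[OF hom_N_basic(6,1)]) simp_all

lemma \<sigma>_\<tau>: "z \<in> N \<Longrightarrow> \<sigma> (\<tau> z) = \<tau> (\<sigma> (\<sigma> z))"
  by (rule hom_N_agree[OF hom_N_basic(7,8)]) simp_all

lemma \<tau>_fixed: "z \<in> N \<Longrightarrow> \<tau> z = z \<Longrightarrow> z \<in> L"
proof (erule N_cases)
  fix x y assume 1: "x \<in> L" "y \<in> L" "z = x + y * \<alpha>2" and h: "\<tau> z = z"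
  have "\<tau> z = x + y * \<alpha>3" unfolding 1(3) \<tau>_def using ext_eq[OF 1(1,2)] 1 by (simp add: ev_self)
  then have "x + y * \<alpha>2 = x + y * \<alpha>3" using h 1(3) by metis
  then have "y * (\<alpha>2 - \<alpha>3) = 0" by (simp add: right_diff_distrib)
  then show "z \<in> L" using distinct_roots 1 by simp
qed

text \<open>A square root of the discriminant. It is fixed by \<open>\<sigma>\<close> and negated by
  \<open>\<tau>\<close>, hence a generator of the quadratic subfield.\<close>

definition \<delta> where "\<delta> = (\<alpha> - \<alpha>2) * (\<alpha>2 - \<alpha>3) * (\<alpha>3 - \<alpha>)"

lemma \<delta>: "\<delta> \<in> N" "\<delta> \<noteq> 0" "\<sigma> \<delta> = \<delta>" "\<tau> \<delta> = - \<delta>" "\<delta>^2 \<in> \<rat>" "\<delta> \<notin> \<rat>"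
proof -
  show "\<delta> \<in> N" by (simp add: \<delta>_def)
  show "\<delta> \<noteq> 0" using distinct_roots by (simp add: \<delta>_def)
  show "\<sigma> \<delta> = \<delta>" by (simp add: \<delta>_def)
  show \<tau>: "\<tau> \<delta> = - \<delta>" by (simp add: \<delta>_def) (simp add: algebra_simps)
  have "\<delta>^2 = cubic_disc b c d" unfolding \<delta>_def by (rule cubic_disc_eq) (fact vieta)+
  then show "\<delta>^2 \<in> \<rat>" using bcd by (simp add: cubic_disc_def)
  show "\<delta> \<notin> \<rat>" using T.s_Rats[of \<delta>] \<tau> \<open>\<delta> \<noteq> 0\<close> by auto
qed

lemma \<sigma>_L_fixed:
  assumes "x \<in> L" "\<sigma> x = x" shows "x \<in> \<rat>"
proof -
  obtain p q s where 1: "p \<in> \<rat>" "q \<in> \<rat>" "s \<in> \<rat>" "x = p + q * \<alpha> + s * \<alpha>^2" by (rule L_cases[OF assms(1)])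
  have "\<sigma> (\<sigma> x) = x" using assms(2) by simp
  moreover have "\<sigma> x = p + q * \<alpha>2 + s * \<alpha>2^2" unfolding 1(4) using 1 by (simp add: S.s_Rats)
  moreover from this have "\<sigma> (\<sigma> x) = p + q * \<alpha>3 + s * \<alpha>3^2" using 1 by (simp add: S.s_Rats)
  ultimately have "q = 0 \<and> s = 0" using assms(2) 1(4) by (intro constant_of_conjugates) simp_all
  then show ?thesis using 1 by simp
qed

text \<open>z is the sum of its \<open>\<tau>\<close>-invariant part x and an anti-invariant part
  \<open>y * \<delta>\<close>. Since \<open>\<tau> z\<close> is fixed by \<open>\<sigma>\<close>
  too, x and y are elements of L fixed by \<open>\<sigma>\<close>, hence rational.\<close>

lemma \<sigma>_fixed:
  assumes z: "z \<in> N" "\<sigma> z = z"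
  shows "\<exists>p\<in>\<rat>. \<exists>q\<in>\<rat>. z = p + q * \<delta>"
proof -
  have \<tau>z: "\<sigma> (\<tau> z) = \<tau> z" using \<sigma>_\<tau>[OF z(1)] z(2) by simp
  define x y where "x = (z + \<tau> z) / 2" and "y = (z - \<tau> z) / (2 * \<delta>)"
  have "x \<in> L" by (rule \<tau>_fixed) (use z in \<open>auto simp: x_def \<tau>_\<tau> add.commute\<close>)
  moreover have "\<sigma> x = x" using z \<tau>z by (simp add: x_def)
  ultimately have x: "x \<in> \<rat>" by (rule \<sigma>_L_fixed)
  have "y \<in> L" by (rule \<tau>_fixed) (use z \<delta> in \<open>auto simp: y_def \<tau>_\<tau> field_simps\<close>)
  moreover have "\<sigma> y = y" using z \<tau>z \<delta> by (simp add: y_def)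
  ultimately have y: "y \<in> \<rat>" by (rule \<sigma>_L_fixed)
  have "z = x + y * \<delta>" using \<delta>(2) by (simp add: x_def y_def field_simps)
  then show ?thesis using x y by blast
qed

lemma normal_closure_eq: "normal_closure L = N"
proof
  let ?U = "\<Union>\<phi>\<in>embeddings L \<rat>. \<phi> ` L"
  show "normal_closure L \<subseteq> N"
  proof
    fix x assume "x \<in> normal_closure L"
    then have "x \<in> generate_field complex_field ?U" by (simp add: normal_closure_def)
    then show "x \<in> N"
    proof (induction rule: generate_field.induct)
      case (incl h)
      then obtain \<phi> z where h: "\<phi> \<in> embeddings L \<rat>" "z \<in> L" "h = \<phi> z" by blast
      obtain r where "r \<in> {\<alpha>, \<alpha>2, \<alpha>3}" "\<phi> z = ev r z" using embeddings_L[OF h(1)] h(2) by blast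
      then show ?case unfolding h(3) using h(2) by (auto elim!: L_cases)
    qed auto
  qed
  show "N \<subseteq> normal_closure L"
  proof
    have mem: "ev r x \<in> generate_field complex_field ?U" if "r \<in> {\<alpha>, \<alpha>2, \<alpha>3}" "x \<in> L" for r x
    proof (rule generate_field.incl)
      have "restrict (ev r) L x = ev r x" using that by simp
      then show "ev r x \<in> ?U" using ev_embedding[OF that(1)] that(2) by (metis UN_I image_eqI)
    qed
    fix z assume "z \<in> N"
    then obtain x y where 1: "x \<in> L" "y \<in> L" "z = x + y * \<alpha>2" by (rule N_cases)
    have "x \<in> generate_field complex_field ?U" "y \<in> generate_field complex_field ?U" "\<alpha>2 \<in> generate_field complex_field ?U"
      using mem[of \<alpha> x] mem[of \<alpha> y] mem[of \<alpha>2 \<alpha>] 1 \<alpha> by (simp_all add: ev_self ev_\<alpha>)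
    then have "x \<oplus>\<^bsub>complex_field\<^esub> (y \<otimes>\<^bsub>complex_field\<^esub> \<alpha>2) \<in> generate_field complex_field ?U"
      by (intro generate_field.eng_add generate_field.eng_mult)
    then show "z \<in> normal_closure L" by (simp add: 1(3) normal_closure_def)
  qed
qed

lemma embedding_hom_N: "\<phi> \<in> embeddings N E \<Longrightarrow> \<rat> \<subseteq> E \<Longrightarrow> hom_N \<phi>"
  using embeddings_hom[of \<phi> N E] unfolding hom_N_def by (auto simp: embeddings_def)

lemma hom_N_root: "hom_N f \<Longrightarrow> f \<alpha> \<in> {\<alpha>, \<alpha>2, \<alpha>3}"
proof -
  assume f: "hom_N f"
  have "f (\<alpha> * (\<alpha> * \<alpha>) + (b * (\<alpha> * \<alpha>) + (c * \<alpha> + d))) = f \<alpha> * (f \<alpha> * f \<alpha>) + (b * (f \<alpha> * f \<alpha>) + (c * f \<alpha> + d))"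
    using f bcd by (simp add: hom_N_def)
  moreover have "\<alpha> * (\<alpha> * \<alpha>) + (b * (\<alpha> * \<alpha>) + (c * \<alpha> + d)) = 0"
    unfolding vieta by (simp add: algebra_simps)
  moreover have "f 0 = 0" using f by (simp add: hom_N_def)
  ultimately have "(f \<alpha>)^3 + b * (f \<alpha>)^2 + c * f \<alpha> + d = 0"
    by (simp add: power3_eq_cube power2_eq_square mult.assoc add.assoc)
  then show ?thesis using root_iff by blast
qed

text \<open>An automorphism fixing \<open>\<delta>\<close> is determined by the image of \<open>\<alpha>\<close>.\<close>

lemma hom_N_\<delta>_agree:
  assumes f: "hom_N f" "f \<delta> = \<delta>" and g: "hom_N g" "g \<delta> = \<delta>" and eq: "f \<alpha> = g \<alpha>" and z: "z \<in> N"
  shows "f z = g z"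
proof (rule hom_N_agree[OF f(1) g(1) eq _ z])
  \<comment> \<open>\<open>e\<close> is the derivative of the cubic, and \<delta> = - e(\<alpha>)
    (\<alpha>2 - \<alpha>3). With \<alpha>2 - \<alpha>3 written as 2 \<alpha>2 + b + \<alpha>, this
    recovers \<alpha>2 from \<alpha> and \<delta>.\<close>
  define e where "e r = 3 * (r * r) + (2 * b * r + c)" for r
  have \<delta>_eq: "\<delta> + (3 * (\<alpha> * \<alpha>) + (2 * b * \<alpha> + c)) * (2 * \<alpha>2 + (b + \<alpha>)) = 0"
    unfolding \<delta>_def vieta by (simp add: algebra_simps)
  have *: "\<delta> + e (h \<alpha>) * (2 * h \<alpha>2 + (b + h \<alpha>)) = 0" if h: "hom_N h" "h \<delta> = \<delta>" for h
  proof -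
    have "h (\<delta> + (3 * (\<alpha> * \<alpha>) + (2 * b * \<alpha> + c)) * (2 * \<alpha>2 + (b + \<alpha>))) =
      \<delta> + (3 * (h \<alpha> * h \<alpha>) + (2 * b * h \<alpha> + c)) * (2 * h \<alpha>2 + (b + h \<alpha>))"
      using h bcd \<delta>(1) by (simp add: hom_N_def)
    moreover have "h 0 = 0" using h(1) by (simp add: hom_N_def)
    ultimately show ?thesis unfolding \<delta>_eq e_def by simp
  qed
  have "e (f \<alpha>) \<noteq> 0"
    using indep_root[OF hom_N_root[OF f(1)], of c "2 * b" 3] bcd by (auto simp: e_def power2_eq_square algebra_simps)
  moreover have "e (f \<alpha>) * (2 * f \<alpha>2 + (b + f \<alpha>)) = e (f \<alpha>) * (2 * g \<alpha>2 + (b + f \<alpha>))"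
    using *[OF f] *[OF g] unfolding eq by (metis add_left_cancel)
  ultimately show "f \<alpha>2 = g \<alpha>2" by simp
qed

lemma extensional_eqI: "\<phi> \<in> embeddings N E \<Longrightarrow> (\<And>z. z \<in> N \<Longrightarrow> \<phi> z = f z) \<Longrightarrow> \<phi> = restrict f N"
  by (auto simp: embeddings_def extensional_def restrict_def)

text \<open>An embedding over L sends the quadratic element \<alpha>2 to \<alpha>2 or \<alpha>3,
  hence is the identity or \<open>\<tau>\<close>. These two differ at \<alpha>2, so the product over
  the set of embeddings has two factors.\<close>

lemma rel_norm_L: "y \<in> N \<Longrightarrow> rel_norm N L y = y * \<tau> y"
proof -
  assume y: "y \<in> N"
  have "embeddings N L = {restrict (\<lambda>x. x) N, restrict \<tau> N}"
  proof
    show "embeddings N L \<subseteq> {restrict (\<lambda>x. x) N, restrict \<tau> N}"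
    proof
      fix \<phi> assume \<phi>: "\<phi> \<in> embeddings N L"
      then have L: "\<And>x. x \<in> L \<Longrightarrow> \<phi> x = x" by (simp add: embeddings_def)
      have hom: "hom_N \<phi>" using \<phi> by (rule embedding_hom_N) auto
      have "\<phi> (\<alpha>2 * \<alpha>2 + ((b + \<alpha>) * \<alpha>2 + (c + b * \<alpha> + \<alpha>^2))) =
          \<phi> \<alpha>2 * \<phi> \<alpha>2 + ((b + \<alpha>) * \<phi> \<alpha>2 + (c + b * \<alpha> + \<alpha>^2))"
        using hom L[of "b + \<alpha>"] L[of "c + b * \<alpha> + \<alpha>^2"] \<alpha> bcd L_subset_N by (simp add: hom_N_def)
      moreover have "(\<alpha>, \<alpha>2) \<in> {(\<alpha>, \<alpha>2), (\<alpha>, \<alpha>3), (\<alpha>2, \<alpha>3)}" by simp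
      from pair_relation[OF this] have "\<alpha>2 * \<alpha>2 + ((b + \<alpha>) * \<alpha>2 + (c + b * \<alpha> + \<alpha>^2)) = 0"
        by (simp only:) (simp add: algebra_simps)
      moreover have "\<phi> 0 = 0" using L by simp
      ultimately have "\<phi> \<alpha>2 * \<phi> \<alpha>2 + ((b + \<alpha>) * \<phi> \<alpha>2 + (c + b * \<alpha> + \<alpha>^2)) = 0" by simp
      then have "(\<phi> \<alpha>2 - \<alpha>2) * (\<phi> \<alpha>2 - \<alpha>3) = 0"
        unfolding vieta by (simp add: algebra_simps power2_eq_square)
      then consider "\<phi> \<alpha>2 = \<alpha>2" | "\<phi> \<alpha>2 = \<alpha>3" by auto
      then show "\<phi> \<in> {restrict (\<lambda>x. x) N, restrict \<tau> N}"
      proof cases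
        case 1
        have "\<phi> z = z" if "z \<in> N" for z
          by (rule hom_N_agree[OF hom hom_N_basic(1)]) (use L \<alpha> 1 that in auto)
        then have "\<phi> = restrict (\<lambda>x. x) N" by (rule extensional_eqI[OF \<phi>])
        then show ?thesis by simp
      next
        case 2
        have "\<phi> z = \<tau> z" if "z \<in> N" for z
          by (rule hom_N_agree[OF hom hom_N_basic(5)]) (use L \<alpha> 2 that in auto)
        then have "\<phi> = restrict \<tau> N" by (rule extensional_eqI[OF \<phi>])
        then show ?thesis by simp
      qed
    qed
    show "{restrict (\<lambda>x. x) N, restrict \<tau> N} \<subseteq> embeddings N L"
      using L_subset_N \<tau>_L by (auto intro!: embeddingsI)
  qed
  moreover have "restrict (\<lambda>x. x) N \<alpha>2 \<noteq> restrict \<tau> N \<alpha>2" using distinct_roots by simp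
  then have "restrict (\<lambda>x. x) N \<noteq> restrict \<tau> N" by metis
  ultimately show ?thesis using y by (simp add: rel_norm_def)
qed

lemma rel_norm_K:
  assumes K: "\<rat> \<subseteq> K" "K \<subseteq> N" "\<delta> \<in> K" "\<And>x. x \<in> K \<Longrightarrow> \<sigma> x = x" and y: "y \<in> N"
  shows "rel_norm N K y = y * \<sigma> y * \<sigma> (\<sigma> y)"
proof -
  let ?f1 = "restrict (\<lambda>x. x) N" and ?f2 = "restrict \<sigma> N" and ?f3 = "restrict (\<lambda>x. \<sigma> (\<sigma> x)) N"
  have "embeddings N K = {?f1, ?f2, ?f3}"
  proof
    show "embeddings N K \<subseteq> {?f1, ?f2, ?f3}"
    proof
      fix \<phi> assume \<phi>: "\<phi> \<in> embeddings N K"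
      then have \<phi>\<delta>: "\<phi> \<delta> = \<delta>" using K by (simp add: embeddings_def)
      have hom: "hom_N \<phi>" using \<phi> K(1) by (rule embedding_hom_N)
      note agree = hom_N_\<delta>_agree[OF hom \<phi>\<delta>]
      from hom_N_root[OF hom] consider "\<phi> \<alpha> = \<alpha>" | "\<phi> \<alpha> = \<alpha>2" | "\<phi> \<alpha> = \<alpha>3" by blast
      then show "\<phi> \<in> {?f1, ?f2, ?f3}"
      proof cases
        case 1
        then have "\<phi> = ?f1" using agree[OF hom_N_basic(1)] by (intro extensional_eqI[OF \<phi>]) simp
        then show ?thesis by simp
      next
        case 2
        then have "\<phi> = ?f2" using agree[OF hom_N_basic(2)] \<delta> by (intro extensional_eqI[OF \<phi>]) simp
        then show ?thesis by simp
      next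
        case 3
        then have "\<phi> = ?f3" using agree[OF hom_N_basic(3)] \<delta> by (intro extensional_eqI[OF \<phi>]) simp
        then show ?thesis by simp
      qed
    qed
    show "{?f1, ?f2, ?f3} \<subseteq> embeddings N K"
      using K by (auto intro!: embeddingsI)
  qed
  moreover have "?f1 \<alpha> \<noteq> ?f2 \<alpha>" "?f1 \<alpha> \<noteq> ?f3 \<alpha>" "?f2 \<alpha> \<noteq> ?f3 \<alpha>" using distinct_roots by auto
  then have "?f1 \<noteq> ?f2" "?f1 \<noteq> ?f3" "?f2 \<noteq> ?f3" by metis+
  ultimately show ?thesis using y by (simp add: rel_norm_def mult.assoc)
qed

text \<open>A generator k' with rational square is written as x + y \<delta> with x, y in L;
  comparing its square with that of its conjugate gives x = 0 or y = 0. As L has odd degree,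
  elements of L with rational square are rational. So y = 0 is impossible, and then y is
  rational.\<close>

lemma quadratic_subfield:
  assumes K: "subfield K complex_field" "K \<subseteq> N" "complex_field.dimension 2 \<rat> K"
  shows "K = {p + q * \<delta> | p q. p \<in> \<rat> \<and> q \<in> \<rat>}" "\<delta> \<in> K"
proof -
  interpret K: complex_subfield K by (rule complex_subfieldI[OF K(1)])
  obtain k where k: "k \<in> K" "k \<notin> \<rat>" using quadratic_span(1)[OF K(1,3)] by blast
  obtain p q where pq: "p \<in> \<rat>" "q \<in> \<rat>" "k^2 = p + q * k"
    using quadratic_span(2)[OF K(1,3) k, of "k^2"] k(1) by auto
  \<comment> \<open>Completing the square: the square of k' is rational.\<close>
  define k' where "k' = k - q / 2"
  have k': "k' \<in> K" "k' \<in> N" using k pq K(2) by (auto simp: k'_def)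
  have k'R: "k' \<notin> \<rat>"
  proof
    assume "k' \<in> \<rat>"
    then have "k' + q / 2 \<in> \<rat>" using pq by simp
    then show False using k(2) by (simp add: k'_def)
  qed
  define h where "h = q / 2"
  have "k'^2 = k^2 - 2 * h * k + h^2"
    unfolding k'_def h_def[symmetric] by (simp add: algebra_simps power2_eq_square)
  also have "\<dots> = p + h^2" unfolding pq(3) by (simp add: h_def)
  finally have k2: "k'^2 \<in> \<rat>" using pq by (simp add: h_def)
  define x y where "x = (k' + \<tau> k') / 2" and "y = (k' - \<tau> k') / (2 * \<delta>)"
  have x: "x \<in> L" by (rule \<tau>_fixed) (use k' in \<open>auto simp: x_def \<tau>_\<tau> add.commute\<close>)
  have y: "y \<in> L" by (rule \<tau>_fixed) (use k' \<delta> in \<open>auto simp: y_def \<tau>_\<tau> field_simps\<close>)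
  have kxy: "k' = x + y * \<delta>" using \<delta>(2) by (simp add: x_def y_def field_simps)
  have no_sqrt: "z \<in> \<rat>" if "z \<in> L" "z^2 \<in> \<rat>" for z
  proof (rule ccontr)
    assume "z \<notin> \<rat>"
    then show False using indep[OF that(1), of "- (z^2)" 0 1] that(2) by simp
  qed
  have "(\<tau> k')^2 = k'^2" using T.s_Rats[OF k2] k' by (metis T.s_power)
  then have "(k' - \<tau> k') * (k' + \<tau> k') = 0" by (simp add: algebra_simps power2_eq_square)
  then have "x = 0 \<or> y = 0" by (auto simp: x_def y_def)
  moreover have "y \<noteq> 0" using no_sqrt[OF x] k2 k'R kxy by auto
  ultimately have ky: "k' = y * \<delta>" "y \<noteq> 0" using kxy by auto
  have "y^2 = k'^2 / \<delta>^2" using ky \<delta>(2) by (simp add: power_mult_distrib)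
  then have "y^2 \<in> \<rat>" using k2 \<delta>(5) by simp
  then have yR: "y \<in> \<rat>" using no_sqrt y by blast
  have "\<delta> = k' / y" using ky by simp
  then show \<delta>K: "\<delta> \<in> K" using k' yR by auto
  show "K = {p + q * \<delta> | p q. p \<in> \<rat> \<and> q \<in> \<rat>}"
    using quadratic_span(2)[OF K(1,3) \<delta>K \<delta>(6)] \<delta>K by blast
qed

lemma cyclic_cubic_N:
  assumes K: "subfield K complex_field" "K \<subseteq> N" "complex_field.dimension 2 \<rat> K"
  shows "cyclic_cubic N \<sigma> K \<tau>"
proof -
  note Keq = quadratic_subfield(1)[OF K] and \<delta>K = quadratic_subfield(2)[OF K]
  interpret K: complex_subfield K by (rule complex_subfieldI[OF K(1)])
  have KN: "x \<in> K \<Longrightarrow> x \<in> N" for x using K(2) by auto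
  have \<tau>K: "\<tau> (p + q * \<delta>) = p - q * \<delta>" if "p \<in> \<rat>" "q \<in> \<rat>" for p q
    using that \<delta> by (simp add: T.s_Rats)
  have \<sigma>K: "\<sigma> x = x" if "x \<in> K" for x
    using that \<delta> unfolding Keq by (auto simp: S.s_Rats)
  have quad: "quadratic_field K \<tau>"
  proof
    show "\<tau> x \<in> K" if x: "x \<in> K" for x
    proof -
      obtain p q where pq: "p \<in> \<rat>" "q \<in> \<rat>" "x = p + q * \<delta>" using x Keq by blast
      show ?thesis unfolding pq(3) \<tau>K[OF pq(1,2)] using pq \<delta>K by auto
    qed
    show "x \<in> \<rat>" if x: "x \<in> K" "\<tau> x = x" for x
    proof -
      obtain p q where pq: "p \<in> \<rat>" "q \<in> \<rat>" "x = p + q * \<delta>" using x Keq by blast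
      have "q * \<delta> = 0" using x(2) unfolding pq(3) \<tau>K[OF pq(1,2)] by (simp add: algebra_simps)
      then show ?thesis using pq \<delta>(2) by auto
    qed
    show "\<exists>x\<in>K. \<tau> x \<noteq> x" using \<delta> \<delta>K by (intro bexI[of _ \<delta>]) auto
  qed (use KN \<tau>_\<tau> in auto)
  have fixd: "x \<in> K" if "x \<in> N" "\<sigma> x = x" for x
    using \<sigma>_fixed[OF that] Keq by blast
  have norm: "rel_norm N K y = y * \<sigma> y * \<sigma> (\<sigma> y)" if "y \<in> N" for y
    by (rule rel_norm_K[OF _ K(2) \<delta>K \<sigma>K that]) auto
  show ?thesis
    by (rule cyclic_cubic.intro[OF S.field_endo_axioms quad cyclic_cubic_axioms.intro])
       (fact K(2) \<sigma>K fixd \<sigma>_cubed norm)+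
qed

end

theorem normal_closure_automorphisms:
  assumes L: "subfield L complex_field" "complex_field.dimension 3 \<rat> L" "\<not> galois_over L \<rat>"
    and N: "N = normal_closure L"
    and K: "subfield K complex_field" "K \<subseteq> N" "complex_field.dimension 2 \<rat> K"
  obtains \<sigma> \<tau> where "cyclic_cubic N \<sigma> K \<tau>" "field_endo N \<tau>" "\<And>x. x \<in> N \<Longrightarrow> \<tau> (\<tau> x) = x"
    "\<And>x. x \<in> L \<Longrightarrow> \<tau> x = x" "L \<subseteq> N" "\<And>x. x \<in> N \<Longrightarrow> rel_norm N L x = x * \<tau> x"
proof -
  interpret cubic_field L by (rule cubic_fieldI[OF L(1,2)])
  obtain \<alpha> b c d \<alpha>2 \<alpha>3 where *: "\<alpha> \<in> L" "\<alpha> \<notin> \<rat>" "b \<in> \<rat>" "c \<in> \<rat>" "d \<in> \<rat>"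
    "b = - (\<alpha> + \<alpha>2 + \<alpha>3)" "c = \<alpha> * \<alpha>2 + \<alpha>2 * \<alpha>3 + \<alpha> * \<alpha>3" "d = - (\<alpha> * \<alpha>2 * \<alpha>3)"
    by (rule exists_roots)
  interpret R: cubic_roots L \<alpha> b c d \<alpha>2 \<alpha>3 by unfold_locales (fact *)+
  interpret R: normal_cubic L \<alpha> b c d \<alpha>2 \<alpha>3
    by unfold_locales (use R.galois_if_root_in_L L(3) in blast)
  have N': "N = R.N" using N R.normal_closure_eq by simp
  show ?thesis
  proof (rule that)
    show "cyclic_cubic N R.\<sigma> K R.\<tau>" unfolding N' by (rule R.cyclic_cubic_N) (use K N' in auto)
    show "field_endo N R.\<tau>" unfolding N' by (rule R.T.field_endo_axioms)
  qed (use N' R.\<tau>_\<tau> R.\<tau>_L R.L_subset_N R.rel_norm_L in auto)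
qed

section \<open>Groups of prime exponent as vector spaces\<close>

locale prime_exponent_group = comm_group G for G (structure) +
  fixes p :: nat
  assumes p_prime: "Factorial_Ring.prime p"
    and exponent: "x \<in> carrier G \<Longrightarrow> x [^] p = \<one>"
begin

lemma int_pow_mod: "x \<in> carrier G \<Longrightarrow> x [^] (k mod int p) = x [^] k" for k :: int
proof -
  assume x: "x \<in> carrier G"
  have "x [^] k = x [^] (int p * (k div int p) + k mod int p)" by simp
  also have "\<dots> = (x [^] int p) [^] (k div int p) \<otimes> x [^] (k mod int p)"
    by (subst int_pow_mult[OF x]) (simp only: int_pow_pow[OF x])
  also have "x [^] int p = \<one>" using exponent[OF x] by (simp add: int_pow_int)
  finally show ?thesis using x by (simp add: int_pow_one)
qed

lemma power_module_simps [simp]: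
  "carrier (power_module G) = carrier G" "x \<oplus>\<^bsub>power_module G\<^esub> y = x \<otimes> y"
  "\<zero>\<^bsub>power_module G\<^esub> = \<one>" "module.smult (power_module G) k x = x [^] k"
  by (simp_all add: power_module_def)

lemma vectorspace_power_module: "vectorspace (residue_ring (int p)) (power_module G)"
proof -
  interpret R: residues_prime p "residue_ring (int p)"
    by (rule residues_prime.intro) (rule p_prime)
  have "abelian_group (power_module G)"
    by (rule abelian_groupI) (auto simp: m_ac intro: l_inv_ex)
  then have "module (residue_ring (int p)) (power_module G)"
  proof (intro moduleI R.cring)
    fix a b x assume "x \<in> carrier (power_module G)"
    then have x: "x \<in> carrier G" by simp
    show "module.smult (power_module G) (a \<oplus>\<^bsub>residue_ring (int p)\<^esub> b) x
        = module.smult (power_module G) a x \<oplus>\<^bsub>power_module G\<^esub> module.smult (power_module G) b x"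
      using int_pow_mod[OF x] int_pow_mult[OF x] by (simp add: R.res_add_eq)
    show "module.smult (power_module G) (a \<otimes>\<^bsub>residue_ring (int p)\<^esub> b) x
        = module.smult (power_module G) a (module.smult (power_module G) b x)"
      using int_pow_mod[OF x] by (simp add: R.res_mult_eq int_pow_pow[OF x] mult.commute)
  qed (auto simp: int_pow_distrib R.res_one_eq)
  then show ?thesis using R.is_field by (rule vectorspace.intro)
qed

lemma Fp_dim_le_one:
  assumes g: "g \<in> carrier G" "\<And>x. x \<in> carrier G \<Longrightarrow> \<exists>k::int. x = g [^] k"
  shows "Fp_dim p G \<le> 1"
proof -
  interpret V: vectorspace "residue_ring (int p)" "power_module G" by (rule vectorspace_power_module)
  interpret R: residues_prime p "residue_ring (int p)"
    by (rule residues_prime.intro) (rule p_prime)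
  have p: "int p > 0" using p_prime by (simp add: prime_gt_0_nat)
  have "x \<in> V.span {g}" if x: "x \<in> carrier G" for x
  proof -
    obtain k :: int where "x = g [^] k" using g(2)[OF x] by blast
    then have "x = g [^] (k mod int p)" using int_pow_mod[OF g(1)] by simp
    moreover have "V.lincomb (\<lambda>_. k mod int p) {g} = g [^] (k mod int p)"
      unfolding V.lincomb_def using g(1) by (subst V.finsum_insert) auto
    moreover have "k mod int p \<in> carrier (residue_ring (int p))" using p by (simp add: R.res_carrier_eq)
    ultimately show ?thesis unfolding V.span_def by (intro CollectI exI[of _ "\<lambda>_. k mod int p"] exI[of _ "{g}"]) auto
  qed
  then have "V.gen_set {g}" using V.span_is_subset2[of "{g}"] g(1) by auto
  then have "V.dim \<le> card {g}" using g(1) by (intro V.gen_ge_dim) auto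
  then show ?thesis by (simp add: Fp_dim_def)
qed

text \<open>Finiteness of the group provides a finite basis, whose length is then
  \<open>dim\<close>. A basis with at most one element g leaves only the p powers of g.\<close>

lemma card_le_of_Fp_dim_le_one:
  assumes fin: "finite (carrier G)" and dim: "Fp_dim p G \<le> 1"
  shows "card (carrier G) \<le> p"
proof -
  interpret V: vectorspace "residue_ring (int p)" "power_module G" by (rule vectorspace_power_module)
  interpret R: residues_prime p "residue_ring (int p)"
    by (rule residues_prime.intro) (rule p_prime)
  have p: "p > 0" using p_prime by (simp add: prime_gt_0_nat)
  have "V.gen_set (carrier G)"
    using V.span_is_subset2[of "carrier G"] V.in_own_span[of "carrier G"] by auto
  then have "V.fin_dim" unfolding V.fin_dim_def using fin by (intro exI[of _ "carrier G"]) auto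
  then obtain \<beta> where \<beta>: "finite \<beta>" "V.basis \<beta>" using V.finite_basis_exists by blast
  then have "card \<beta> \<le> 1" using V.dim_basis[OF \<beta>] dim by (simp add: Fp_dim_def)
  then obtain g where g: "\<beta> \<subseteq> {g}" "g \<in> carrier G"
  proof (cases "\<beta> = {}")
    case True then show ?thesis using that[of \<one>] by simp
  next
    case False
    then obtain h where h: "h \<in> \<beta>" by blast
    then have "\<beta> = {h}" using \<open>card \<beta> \<le> 1\<close> \<beta>(1) by (metis card_le_Suc0_iff_eq One_nat_def insertI1 singletonD subsetI subset_antisym insert_subset empty_subsetI)
    moreover have "h \<in> carrier G" using h \<beta>(2) by (auto simp: V.basis_def)
    ultimately show ?thesis using that[of h] by simp
  qed
  have "carrier G \<subseteq> (\<lambda>k. g [^] k) ` {0..<int p}"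
  proof
    fix x assume "x \<in> carrier G"
    then have "x \<in> V.span \<beta>" using \<beta>(2) by (simp add: V.basis_def)
    then obtain a A where A: "A \<subseteq> \<beta>" "a \<in> A \<rightarrow> carrier (residue_ring (int p))" "x = V.lincomb a A"
      by (auto simp: V.span_def)
    then consider "A = {}" | "A = {g}" using g(1) by blast
    then show "x \<in> (\<lambda>k. g [^] k) ` {0..<int p}"
    proof cases
      case 1
      then show ?thesis using A(3) p by (auto simp: V.lincomb_def intro!: image_eqI[of _ _ 0])
    next
      case 2
      then have "x = g [^] (a g)"
        unfolding A(3) V.lincomb_def 2 using g(2) by (subst V.finsum_insert) auto
      then show ?thesis using A(2) 2 by (auto simp: R.res_carrier_eq)
    qed
  qed
  then have "card (carrier G) \<le> card ((\<lambda>k. g [^] k) ` {0..<int p})" by (intro card_mono) auto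
  also have "\<dots> \<le> p" using card_image_le[of "{0..<int p}" "\<lambda>k. g [^] k"] by simp
  finally show ?thesis .
qed

end

text \<open>The index \<open>k\<close> attached to \<open>x\<close> need only be well defined modulo 3 on the classes \<open>\<phi> x\<close>.\<close>

lemma Fp_dim_3_le_one_if_index:
  fixes G :: "('a, 'b) monoid_scheme" (structure) and \<phi> :: "'c :: comm_monoid_mult \<Rightarrow> 'a" and index :: "'c \<Rightarrow> int \<Rightarrow> bool"
  assumes S: "1 \<in> S" "\<And>x y. x \<in> S \<Longrightarrow> y \<in> S \<Longrightarrow> x * y \<in> S"
    and \<phi>: "carrier G = \<phi> ` S" "\<one>\<^bsub>G\<^esub> = \<phi> 1"
      "\<And>x y. x \<in> S \<Longrightarrow> y \<in> S \<Longrightarrow> \<phi> x \<otimes>\<^bsub>G\<^esub> \<phi> y = \<phi> (x * y)"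
    and index: "\<And>x. x \<in> S \<Longrightarrow> \<exists>k. index x k"
      "\<And>x y k l. x \<in> S \<Longrightarrow> y \<in> S \<Longrightarrow> index x k \<Longrightarrow> index y l \<Longrightarrow> index (x * y) (k + l)"
      "\<And>x k. x \<in> S \<Longrightarrow> index x k \<Longrightarrow> 3 dvd k \<Longrightarrow> \<phi> x = \<phi> 1"
  shows "Fp_dim 3 G \<le> 1"
proof -
  have cube: "\<phi> (x * x * x) = \<phi> 1" if x: "x \<in> S" for x
  proof -
    obtain k where "index x k" using index(1)[OF x] by blast
    then have "index (x * x * x) (k + k + k)" using x S by (intro index(2)) auto
    then show ?thesis using x S index(3)[of "x * x * x" "k + k + k"] by auto
  qed
  \<comment> \<open>G is an arbitrary record at this point. Inverses come from \<open>cube\<close>: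
    the index of a cube is divisible by 3, so x x is inverse to x.\<close>
  interpret comm_group G
  proof (rule comm_groupI)
    fix x assume "x \<in> carrier G"
    then obtain a where a: "a \<in> S" "x = \<phi> a" using \<phi> by auto
    then show "\<exists>y\<in>carrier G. y \<otimes>\<^bsub>G\<^esub> x = \<one>\<^bsub>G\<^esub>"
      using cube[of a] S \<phi> by (intro bexI[of _ "\<phi> (a * a)"]) auto
    show "\<one>\<^bsub>G\<^esub> \<otimes>\<^bsub>G\<^esub> x = x" using a S \<phi>(2,3) by simp
  qed (use S \<phi> in \<open>auto simp: mult_ac\<close>)
  interpret prime_exponent_group G 3
  proof
    fix x assume "x \<in> carrier G"
    then obtain a where a: "a \<in> S" "x = \<phi> a" using \<phi> by auto
    then show "x [^] (3::nat) = \<one>"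
      using cube[of a] S \<phi> by (simp add: numeral_3_eq_3)
  qed auto
  show ?thesis
  proof (cases "\<exists>x\<in>S. \<exists>k. index x k \<and> \<not> 3 dvd k")
    case False
    then have "x = \<one>" if "x \<in> carrier G" for x
      using that index(1,3) \<phi>(1,2) by (metis imageE)
    then show ?thesis by (intro Fp_dim_le_one[of \<one>]) (auto intro: exI[of _ 0])
  next
    case True
    then obtain x k where x: "x \<in> S" "index x k" "\<not> 3 dvd k" by blast
    have xG: "\<phi> x \<in> carrier G" using x \<phi> by simp
    show ?thesis
    proof (rule Fp_dim_le_one[OF xG])
      fix z assume z: "z \<in> carrier G"
      then obtain y where y: "y \<in> S" "z = \<phi> y" using \<phi> by auto
      obtain l where l: "index y l" using index(1)[OF y(1)] by blast
      \<comment> \<open>k is invertible modulo 3, so adding k at most twice makes the index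
        divisible by 3.\<close>
      have "3 dvd l \<or> 3 dvd l + k \<or> 3 dvd l + k + k" using x(3) by presburger
      then consider "\<phi> y = \<phi> 1" | "\<phi> (y * x) = \<phi> 1" | "\<phi> (y * x * x) = \<phi> 1"
        using index(3)[OF y(1) l] index(3)[OF S(2)[OF y(1) x(1)] index(2)[OF y(1) x(1) l x(2)]]
          index(3)[OF S(2)[OF S(2)[OF y(1) x(1)] x(1)] index(2)[OF S(2)[OF y(1) x(1)] x(1) index(2)[OF y(1) x(1) l x(2)] x(2)]]
        by blast
      then show "\<exists>k::int. z = \<phi> x [^] k"
      proof cases
        case 1
        then show ?thesis using y \<phi> by (intro exI[of _ 0]) simp
      next
        case 2
        then have "z \<otimes> \<phi> x = \<one>" using y x \<phi> by simp
        then have "z = inv (\<phi> x)" using z xG by (simp add: inv_equality)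
        then show ?thesis using xG by (intro exI[of _ "-1"]) (simp add: int_pow_neg int_pow_1)
      next
        case 3
        then have "z \<otimes> (\<phi> x \<otimes> \<phi> x) = \<one>" using y x \<phi> S by (simp add: mult_ac)
        then have "z = inv (\<phi> x \<otimes> \<phi> x)" using z xG by (simp add: inv_equality)
        moreover have "\<phi> x [^] (2::int) = \<phi> x \<otimes> \<phi> x"
          using int_pow_mult[OF xG, of 1 1] xG by (simp add: int_pow_1)
        ultimately show ?thesis using xG by (intro exI[of _ "-2"]) (simp add: int_pow_neg)
      qed
    qed
  qed
qed

lemma (in comm_group) Fp_dim_le_one_if_card_le_3:
  assumes H: "subgroup H G" and exp: "\<And>x. x \<in> H \<Longrightarrow> x [^] (3::nat) = \<one>"
    and Hfin: "finite H" and H3: "card H \<le> 3"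
  shows "Fp_dim 3 (G\<lparr>carrier := H\<rparr>) \<le> 1"
proof -
  have HG: "H \<subseteq> carrier G" using H by (rule subgroup.subset)
  have cg: "comm_group (G\<lparr>carrier := H\<rparr>)"
  proof (rule group.group_comm_groupI[OF subgroup_imp_group[OF H]])
    fix x y assume "x \<in> carrier (G\<lparr>carrier := H\<rparr>)" "y \<in> carrier (G\<lparr>carrier := H\<rparr>)"
    then have "x \<in> carrier G" "y \<in> carrier G" using HG by auto
    then show "x \<otimes>\<^bsub>G\<lparr>carrier := H\<rparr>\<^esub> y = y \<otimes>\<^bsub>G\<lparr>carrier := H\<rparr>\<^esub> x" using m_comm[of x y] by simp
  qed
  have pow: "x [^]\<^bsub>G\<lparr>carrier := H\<rparr>\<^esub> (3::nat) = \<one>\<^bsub>G\<lparr>carrier := H\<rparr>\<^esub>"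
    if x: "x \<in> carrier (G\<lparr>carrier := H\<rparr>)" for x
  proof -
    have "x \<in> H" using x by simp
    then have "x [^] (3::nat) = \<one>" by (rule exp)
    then show ?thesis by (simp only: nat_pow_consistent[of x 3 H] monoid.simps(2) monoid.update_convs partial_object.update_convs) simp
  qed
  have prime3: "Factorial_Ring.prime (3::nat)" by simp
  interpret H: prime_exponent_group "G\<lparr>carrier := H\<rparr>" 3
    by (rule prime_exponent_group.intro[OF cg prime_exponent_group_axioms.intro[OF prime3 pow]])
  show ?thesis
  proof (cases "H = {\<one>}")
    case True
    show ?thesis
    proof (rule H.Fp_dim_le_one[of \<one>])
      fix x assume "x \<in> carrier (G\<lparr>carrier := H\<rparr>)"
      then have "x = \<one> [^]\<^bsub>G\<lparr>carrier := H\<rparr>\<^esub> (0::int)" using True by simp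
      then show "\<exists>k::int. x = \<one> [^]\<^bsub>G\<lparr>carrier := H\<rparr>\<^esub> k" by (rule exI)
    qed (simp add: True)
  next
    case False
    then obtain g where g: "g \<in> H" "g \<noteq> \<one>" using subgroup.one_closed[OF H] by blast
    have gG: "g \<in> carrier G" using g subgroup.subset[OF H] by blast
    have "g \<otimes> g \<noteq> g" using g gG by simp
    moreover have "g \<otimes> g \<noteq> \<one>"
      using g gG exp[of g] by (auto simp: numeral_3_eq_3)
    ultimately have "card {\<one>, g, g \<otimes> g} = 3" using g by auto
    moreover have "{\<one>, g, g \<otimes> g} \<subseteq> H" using g H by (auto intro: subgroup.one_closed subgroup.m_closed)
    ultimately have "H = {\<one>, g, g \<otimes> g}" using H3 Hfin card_seteq by metis
    moreover have "g [^]\<^bsub>G\<lparr>carrier := H\<rparr>\<^esub> (0::int) = \<one>" "g [^]\<^bsub>G\<lparr>carrier := H\<rparr>\<^esub> (1::int) = g"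
      "g [^]\<^bsub>G\<lparr>carrier := H\<rparr>\<^esub> (2::int) = g \<otimes> g"
      using g H.int_pow_mult[of g 1 1] by (auto simp: H.int_pow_1)
    ultimately have "\<exists>k::int. x = g [^]\<^bsub>G\<lparr>carrier := H\<rparr>\<^esub> k" if "x \<in> H" for x
      using that by (metis insertE empty_iff)
    then show ?thesis using g(1) by (intro H.Fp_dim_le_one[of g]) auto
  qed
qed


text \<open>The cubing map has image C and kernel T, so comparing orders shows that T has as many
  elements as the quotient by C, that is, at most 3. The subgroup H is contained in T.\<close>

lemma (in comm_group) Fp_dim_exponent_3_subgroup_le_one:
  assumes fin: "finite (carrier G)" and H: "subgroup H G" and exp: "\<And>x. x \<in> H \<Longrightarrow> x [^] (3::nat) = \<one>"
    and dim: "Fp_dim 3 (G Mod ((\<lambda>c. c [^] (3::nat)) ` carrier G)) \<le> 1"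
  shows "Fp_dim 3 (G\<lparr>carrier := H\<rparr>) \<le> 1"
proof -
  define cb where "cb = (\<lambda>c. c [^] (3::nat))"
  define C where "C = cb ` carrier G"
  define T where "T = {x \<in> carrier G. cb x = \<one>}"
  interpret h: group_hom G G cb
    by unfold_locales (auto simp: hom_def cb_def nat_pow_distrib)
  have C: "subgroup C G" unfolding C_def by (rule h.img_is_subgroup)
  have T: "T = kernel G G cb" by (simp add: T_def kernel_def)
  have Cn: "C \<lhd> G" using C by (simp add: normal_iff_subgroup)
  interpret Q: prime_exponent_group "G Mod C" 3
  proof (intro prime_exponent_group.intro prime_exponent_group_axioms.intro)
    show "comm_group (G Mod C)" using C by (rule abelian_FactGroup)
    fix x assume "x \<in> carrier (G Mod C)"
    then obtain a where a: "a \<in> carrier G" "x = C #> a" by (auto simp: carrier_FactGroup)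
    have "x [^]\<^bsub>G Mod C\<^esub> (3::nat) = C #> cb a"
      using a Cn by (simp add: cb_def normal.FactGroup_pow)
    also have "\<dots> = C" using a C by (intro coset_join2) (auto simp: C_def cb_def)
    finally show "x [^]\<^bsub>G Mod C\<^esub> (3::nat) = \<one>\<^bsub>G Mod C\<^esub>" by simp
  qed auto
  have "card (carrier (G Mod C)) \<le> 3"
    using fin dim by (intro Q.card_le_of_Fp_dim_le_one) (auto simp: carrier_FactGroup C_def cb_def)
  moreover have "carrier (G Mod C) = rcosets C" by (simp add: FactGroup_def)
  ultimately have le: "card (rcosets C) \<le> 3" by simp
  have "card (rcosets T) = card C"
  proof -
    interpret CG: group "G\<lparr>carrier := C\<rparr>" using C by (rule subgroup_imp_group)
    interpret k: group_hom G "G\<lparr>carrier := C\<rparr>" cb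
      by unfold_locales (auto simp: hom_def C_def cb_def nat_pow_distrib)
    have "G Mod kernel G (G\<lparr>carrier := C\<rparr>) cb \<cong> G\<lparr>carrier := C\<rparr>"
      by (rule k.FactGroup_iso) (simp add: C_def)
    moreover have "kernel G (G\<lparr>carrier := C\<rparr>) cb = T" by (simp add: T_def kernel_def)
    ultimately show ?thesis by (auto dest: iso_same_card simp: FactGroup_def)
  qed
  have "card (rcosets C) * card C = Coset.order G" using lagrange[OF C] .
  moreover have "card (rcosets T) * card T = Coset.order G"
    using lagrange[of T] h.subgroup_kernel by (simp add: T)
  moreover have "Coset.order G > 0" using fin by (simp add: order_gt_0_iff_finite)
  ultimately have "card T = card (rcosets C)" using \<open>card (rcosets T) = card C\<close>
    by (metis mult.commute mult_cancel2 gr_implies_not0 mult_0)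
  then have T3: "card T \<le> 3" using le by simp
  have HT: "H \<subseteq> T" using exp subgroup.subset[OF H] by (auto simp: T_def cb_def)
  have "finite T" using fin by (simp add: T_def)
  then have H3: "card H \<le> 3" using le_trans[OF card_mono[OF _ HT] T3] by simp
  have Hfin: "finite H" using \<open>finite T\<close> HT by (rule finite_subset[rotated])
  have HG: "H \<subseteq> carrier G" using H by (rule subgroup.subset)
  show ?thesis by (rule Fp_dim_le_one_if_card_le_3[OF H exp Hfin H3])
qed

section \<open>Values of ideals and cubes of ideals\<close>

context quadratic_field
begin

lemma s_powi: "x \<in> F \<Longrightarrow> s (x powi n) = s x powi n"
  by (auto simp: power_int_def)

lemma mem_pw_if_vl:
  assumes P: "P \<in> prime_ideals F" and x: "x \<in> \<O>" "x \<noteq> 0" "vl P x \<ge> int n"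
  shows "x \<in> pw P n"
proof -
  obtain u w where uw: "u \<in> \<O> - P" "w \<in> \<O> - P" "u * x = unif P powi (vl P x) * w" "vl P x \<ge> 0"
    using vl_O_exists[OF P x(1,2)] .
  define m where "m = nat (vl P x) - n"
  have "unif P powi (vl P x) = unif P ^ (n + m)" using x(3) uw(4) by (simp add: m_def power_int_def)
  then have eq: "u * x = unif P ^ n * (unif P ^ m * w)" using uw(3) by (simp add: power_add mult_ac)
  have "unif P \<in> \<O>" using unif(1)[OF P] prime_idealD(2)[OF P] by blast
  then have "unif P ^ m * w \<in> \<O>" using uw by simp
  then obtain D where D: "is_frac D" "D \<subseteq> \<O>" "pid x = pw P n \<star> D"
    using O_power_dvd[OF P x(1,2) uw(1) eq] by blast
  have "pw P n \<star> D \<subseteq> pw P n \<star> \<O>" using D(2) by (intro idp_mono) auto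
  also have "\<dots> = pw P n" using pw_frac[OF prime_idealD(1)[OF P]] is_frac_module by simp
  finally show ?thesis using D(3) pid_self[of x] by auto
qed

lemma s_mem_image_iff: "P \<subseteq> F \<Longrightarrow> x \<in> F \<Longrightarrow> s x \<in> s ` P \<longleftrightarrow> x \<in> P"
  using s_inj by blast

text \<open>\<open>unif\<close> at the conjugate prime is chosen independently of
  \<open>unif P\<close>. But the conjugate of \<open>unif P\<close> lies in the conjugate prime and
  outside its square, hence has value 1 there as well.\<close>

lemma vl_s:
  assumes P: "P \<in> prime_ideals F" and x: "x \<in> F" "x \<noteq> 0"
  shows "vl (s ` P) (s x) = vl P x"
proof -
  note sP = s_prime[OF P]
  have PF: "P \<subseteq> F" using prime_idealD(1)[OF P] is_frac_subset by blast
  interpret V: discrete_valuation F "vl (s ` P)" "unif (s ` P)" by (rule discrete_valuation_vl[OF sP])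
  define p where "p = unif P"
  have p: "p \<in> P" "p \<notin> P \<star> P" "p \<noteq> 0" "p \<in> F" using unif[OF P] by (auto simp: p_def)
  have pO: "p \<in> \<O>" using p prime_idealD(2)[OF P] by blast
  have v1: "vl (s ` P) (s p) = 1"
  proof (rule ccontr)
    assume "vl (s ` P) (s p) \<noteq> 1"
    moreover have "vl (s ` P) (s p) \<ge> 1" using vl_mem_iff[OF sP, of "s p"] p pO by simp
    ultimately have "s p \<in> pw (s ` P) 2" using p pO by (intro mem_pw_if_vl[OF sP]) auto
    also have "pw (s ` P) 2 = s ` P \<star> s ` P"
      using prime_idealD(1)[OF sP] is_frac_module by (simp add: numeral_2_eq_2)
    also have "\<dots> = s ` (P \<star> P)" using PF by (simp add: s_idp)
    finally have "p \<in> P \<star> P"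
      using s_mem_image_iff[OF is_frac_subset[OF is_frac_idp] p(4)] prime_idealD(1)[OF P] by blast
    then show False using p by blast
  qed
  have out: "vl (s ` P) (s u) = 0 \<and> s u \<in> F \<and> s u \<noteq> 0" if u: "u \<in> \<O> - P" for u
    using u out_nonzero[OF P u] O_subset[of u] s_mem_image_iff[OF PF, of u] by (auto intro!: vl_out[OF sP])
  obtain u w where uw: "u \<in> \<O> - P" "w \<in> \<O> - P" "u * x = p powi (vl P x) * w"
    unfolding p_def using vl_exists[OF P x] .
  have uwF: "u \<in> F" "w \<in> F" using uw O_subset by blast+
  have "s u * s x = s (u * x)" using uwF x by simp
  also have "\<dots> = s p powi (vl P x) * s w" unfolding uw(3) using uwF p s_powi[OF p(4)] by simp
  finally have "vl (s ` P) (s u * s x) = vl (s ` P) (s p powi (vl P x) * s w)" by simp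
  then show ?thesis
    using out[OF uw(1)] out[OF uw(2)] x p v1 V.v_powi[of "s p" "vl P x"] V.v_mult by simp
qed

text \<open>n is the minimum of the valuation on I, attained at x. The element y of the inverse
  ideal certifies minimality: I y is integral while x y is a unit at P.\<close>

definition ideal_val :: "complex set \<Rightarrow> complex set \<Rightarrow> int \<Rightarrow> bool" where
  "ideal_val P I n \<longleftrightarrow> (\<exists>x\<in>I. \<exists>y\<in>F. x \<in> F \<and> x * y \<in> \<O> - P \<and> (\<forall>z\<in>I. z * y \<in> \<O>) \<and> vl P x = n)"

lemma ideal_val_s:
  assumes P: "P \<in> prime_ideals F" and I: "I \<subseteq> F" and v: "ideal_val P I n"
  shows "ideal_val (s ` P) (s ` I) n"
proof -
  obtain x y where *: "x \<in> I" "y \<in> F" "x \<in> F" "x * y \<in> \<O> - P" "\<And>z. z \<in> I \<Longrightarrow> z * y \<in> \<O>" "vl P x = n"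
    using v by (auto simp: ideal_val_def)
  have PF: "P \<subseteq> F" using prime_idealD(1)[OF P] is_frac_subset by blast
  have "x \<noteq> 0" using out_nonzero[OF P *(4)] by auto
  moreover have "s (x * y) \<in> \<O> - s ` P"
    using * s_mem_image_iff[OF PF, of "x * y"] O_s[of "x * y"] by (auto simp del: s_mult)
  then have "s x * s y \<in> \<O> - s ` P" using s_mult[OF *(3,2)] by simp
  moreover have "s z * s y \<in> \<O>" if "z \<in> I" for z using O_s[OF *(5)[OF that]] that I *(2) by (auto simp: subset_iff)
  ultimately show ?thesis unfolding ideal_val_def
    using * vl_s[OF P *(3)] by (intro bexI[of _ "s x"] bexI[of _ "s y"]) auto
qed

context
  fixes P assumes P: "P \<in> prime_ideals F"
begin

text \<open>The product of I with its inverse is the whole ring, hence not inside P, so some product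
  x y of elements lies outside P.\<close>

lemma ideal_val_exists:
  assumes I: "is_frac I"
  shows "\<exists>n. ideal_val P I n"
proof -
  have "\<exists>x\<in>I. \<exists>y\<in>fr_inv I. x * y \<notin> P"
  proof (rule ccontr)
    assume "\<not> ?thesis"
    then have "I \<star> fr_inv I \<subseteq> P"
      using is_moduleD(2)[OF is_frac_module[OF prime_idealD(1)[OF P]]] by (intro idp_subsetI) auto
    then show False using fr_inv(2)[OF I] prime_idealD(3)[OF P] by auto
  qed
  then obtain x y where xy: "x \<in> I" "y \<in> fr_inv I" "x * y \<notin> P" by blast
  have "z * y \<in> \<O>" if "z \<in> I" for z using idp_prod[OF that xy(2)] fr_inv(2)[OF I] by simp
  moreover have "y \<in> F" "x \<in> F" using xy is_frac_subset[OF fr_inv(1)[OF I]] is_frac_subset[OF I] by auto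
  ultimately show ?thesis unfolding ideal_val_def using xy by blast
qed

lemma ideal_val_le:
  assumes v: "ideal_val P I n" and z: "z \<in> I" "z \<in> F" "z \<noteq> 0"
  shows "n \<le> vl P z"
proof -
  obtain x y where *: "x \<in> I" "y \<in> F" "x \<in> F" "x * y \<in> \<O> - P" "\<And>z. z \<in> I \<Longrightarrow> z * y \<in> \<O>" "vl P x = n"
    using v by (auto simp: ideal_val_def)
  have nz: "x \<noteq> 0" "y \<noteq> 0" using out_nonzero[OF P *(4)] by auto
  have "vl P x + vl P y = 0" using vl_mult[OF P *(3,2) nz] vl_out[OF P *(4)] by simp
  moreover have "vl P z + vl P y \<ge> 0"
    using vl_mult[OF P z(2) *(2) z(3) nz(2)] vl_O[OF P *(5)[OF z(1)]] z nz by simp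
  ultimately show ?thesis using * by simp
qed

lemma ideal_val_attained:
  assumes "ideal_val P I n" obtains x where "x \<in> I" "x \<in> F" "x \<noteq> 0" "vl P x = n"
proof -
  obtain x y where *: "x \<in> I" "y \<in> F" "x \<in> F" "x * y \<in> \<O> - P" "vl P x = n"
    using assms by (auto simp: ideal_val_def)
  show ?thesis using out_nonzero[OF P *(4)] by (intro that[OF *(1,3) _ *(5)]) auto
qed

lemma ideal_val_unique:
  assumes "ideal_val P I n" "ideal_val P I m"
  shows "n = m"
proof -
  have le: "i \<le> j" if i: "ideal_val P I i" and j: "ideal_val P I j" for i j
  proof -
    obtain x where "x \<in> I" "x \<in> F" "x \<noteq> 0" "vl P x = j" using ideal_val_attained[OF j] .
    then show ?thesis using ideal_val_le[OF i, of x] by simp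
  qed
  show ?thesis using le[OF assms] le[OF assms(2,1)] by simp
qed

lemma ideal_val_mult:
  assumes I: "ideal_val P I n" and J: "ideal_val P J m"
  shows "ideal_val P (I \<star> J) (n + m)"
proof -
  obtain x y where 1: "x \<in> I" "y \<in> F" "x \<in> F" "x * y \<in> \<O> - P" "\<And>z. z \<in> I \<Longrightarrow> z * y \<in> \<O>" "vl P x = n"
    using I by (auto simp: ideal_val_def)
  obtain x' y' where 2: "x' \<in> J" "y' \<in> F" "x' \<in> F" "x' * y' \<in> \<O> - P" "\<And>z. z \<in> J \<Longrightarrow> z * y' \<in> \<O>" "vl P x' = m"
    using J by (auto simp: ideal_val_def)
  have nz: "x \<noteq> 0" "x' \<noteq> 0" using out_nonzero[OF P 1(4)] out_nonzero[OF P 2(4)] by auto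
  have "I \<star> J \<subseteq> {z. z * (y * y') \<in> \<O>}"
  proof (rule idp_subsetI)
    fix i j assume "i \<in> I" "j \<in> J"
    then have "(i * y) * (j * y') \<in> \<O>" using 1 2 by blast
    then show "i * j \<in> {z. z * (y * y') \<in> \<O>}" by (simp add: mult_ac)
  qed (auto simp: distrib_right)
  moreover have "(x * y) * (x' * y') \<in> \<O> - P" using out_mult[OF P 1(4) 2(4)] .
  then have "x * x' * (y * y') \<in> \<O> - P" by (simp add: mult_ac)
  ultimately show ?thesis unfolding ideal_val_def
    using 1 2 nz idp_prod[OF 1(1) 2(1)] vl_mult[OF P 1(3) 2(3) nz]
    by (intro bexI[of _ "x * x'"] bexI[of _ "y * y'"]) auto
qed

lemma ideal_val_pid:
  assumes x: "x \<in> F" "x \<noteq> 0"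
  shows "ideal_val P (pid x) (vl P x)"
proof -
  have "x * inverse x \<in> \<O> - P" using x prime_idealD(3)[OF P] by simp
  moreover have "\<forall>z\<in>pid x. z * inverse x \<in> \<O>" using x by (auto simp: principal_ideal_def field_simps)
  ultimately show ?thesis unfolding ideal_val_def using x pid_self[of x] by blast
qed

end

text \<open>Induction on the norm. At a prime P above I the value is positive and divisible by 3,
  hence at least 3, so P^3 divides I; the cofactor has smaller norm and its values are still
  divisible by 3.\<close>

lemma integral_ideal_cube_root:
  assumes I: "is_frac I" "I \<subseteq> \<O>"
    and v: "\<And>P n. P \<in> prime_ideals F \<Longrightarrow> ideal_val P I n \<Longrightarrow> 3 dvd n"
  shows "\<exists>J. is_frac J \<and> I = J \<star> J \<star> J"
  using I v
proof (induction "nm I" arbitrary: I rule: less_induct)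
  case less
  note I = less.prems(1,2) and v = less.prems(3)
  show ?case
  proof (cases "I = \<O>")
    case True
    then show ?thesis using is_frac_O by (intro exI[of _ \<O>]) auto
  next
    case False
    then obtain P where P: "P \<in> prime_ideals F" "I \<subseteq> P" using exists_prime_above[OF I] by blast
    note Pf = prime_idealD(1)[OF P(1)] and PO = prime_idealD(2)[OF P(1)]
    obtain n where n: "ideal_val P I n" using ideal_val_exists[OF P(1) I(1)] by blast
    obtain x where x: "x \<in> I" "x \<in> F" "x \<noteq> 0" "vl P x = n" using ideal_val_attained[OF P(1) n] .
    have "n \<ge> 1" using vl_mem_iff[OF P(1), of x] x P(2) I(2) by auto
    then have n3: "n \<ge> 3" using v[OF P(1) n] by presburger
    have "I \<subseteq> pw P 3"
    proof
      fix z assume z: "z \<in> I"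
      show "z \<in> pw P 3"
      proof (cases "z = 0")
        case True
        then show ?thesis using is_frac_module[OF pw_frac[OF Pf]] is_moduleD(1) by blast
      next
        case False
        then show ?thesis
          using ideal_val_le[OF P(1) n z] n3 z I(2) O_subset by (intro mem_pw_if_vl[OF P(1)]) auto
      qed
    qed
    then obtain D where D: "is_frac D" "D \<subseteq> \<O>" "I = pw P 3 \<star> D"
      by (rule ideal_dvd[OF I(1) pw_frac[OF Pf]])
    have pw3: "pw P 3 = P \<star> P \<star> P" using Pf is_frac_module by (simp add: numeral_3_eq_3)
    have "nm I = nm P ^ 3 * nm D"
      using nm_mult[OF pw_frac[OF Pf] pw_integral[OF PO] D(1,2), of 3] nm_pw[OF Pf PO, of 3] D(3) by simp
    moreover have "nm P ^ 3 \<ge> 2 ^ 3" using nm_prime[OF P(1)] by (intro power_mono) auto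
    moreover have "nm D > 0" using nm[OF D(1,2)] by simp
    ultimately have "nm D < nm I" by simp
    moreover have "3 dvd m" if Q: "Q \<in> prime_ideals F" and m: "ideal_val Q D m" for Q m
    proof -
      obtain l where l: "ideal_val Q P l" using ideal_val_exists[OF Q Pf] by blast
      have "ideal_val Q I (l + l + l + m)" unfolding D(3) pw3 by (intro ideal_val_mult[OF Q] l m)
      then have "3 dvd l + l + l + m" by (rule v[OF Q])
      then show ?thesis by presburger
    qed
    ultimately obtain J where J: "is_frac J" "D = J \<star> J \<star> J" using less.hyps D(1,2) by blast
    show ?thesis using J is_frac_idp[OF Pf J(1)] unfolding D(3) pw3 J(2)
      by (intro exI[of _ "P \<star> J"]) (simp add: idp_ac)
  qed
qed

lemma ideal_cube_root:
  assumes I: "is_frac I"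
    and v: "\<And>P n. P \<in> prime_ideals F \<Longrightarrow> ideal_val P I n \<Longrightarrow> 3 dvd n"
  obtains J where "is_frac J" "I = J \<star> J \<star> J"
proof -
  obtain d where d: "d \<in> \<O>" "d \<noteq> 0" "\<And>x. x \<in> I \<Longrightarrow> d * x \<in> \<O>" using I by (auto simp: is_frac_def)
  have dF: "d \<in> F" using d O_subset by blast
  \<comment> \<open>Scaling by a cube makes the ideal integral and changes its values by multiples
    of 3 only.\<close>
  define I' where "I' = pid (d^3) \<star> I"
  have d3: "is_frac (pid (d^3))" using d dF by (intro is_frac_pid) auto
  have I': "is_frac I'" unfolding I'_def using d3 I by (rule is_frac_idp)
  have "(d * d) * (d * x) \<in> \<O>" if "x \<in> I" for x using d that by blast
  then have "I' \<subseteq> \<O>" unfolding I'_def using I is_frac_module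
    by (auto simp: pid_idp power3_eq_cube mult_ac)
  moreover have "3 dvd n" if P: "P \<in> prime_ideals F" and n: "ideal_val P I' n" for P n
  proof -
    interpret V: discrete_valuation F "vl P" "unif P" by (rule discrete_valuation_vl[OF P])
    obtain m where m: "ideal_val P I m" using ideal_val_exists[OF P I] by blast
    have "ideal_val P I' (vl P (d^3) + m)" unfolding I'_def
      using d dF m by (intro ideal_val_mult[OF P] ideal_val_pid[OF P]) auto
    then have "n = 3 * vl P d + m" using ideal_val_unique[OF P n] d dF V.v_power[of d 3] by simp
    then show ?thesis using v[OF P m] by simp
  qed
  ultimately obtain J where J: "is_frac J" "I' = J \<star> J \<star> J" using integral_ideal_cube_root[OF I'] by blast
  have Jm: "is_module (pid (inverse d) \<star> J)" using J is_frac_pid[of "inverse d"] d dF is_frac_idp is_frac_module by auto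
  have "pid (inverse d ^ 3) \<star> I' = pid (inverse d ^ 3 * d ^ 3) \<star> I"
    unfolding I'_def idp_assoc[symmetric] pid_mult ..
  also have "\<dots> = I" using d I is_frac_module by (simp add: power_mult_distrib[symmetric])
  finally have "I = pid (inverse d ^ 3) \<star> I'" ..
  also have "pid (inverse d ^ 3) = pid (inverse d) \<star> pid (inverse d) \<star> pid (inverse d)"
    by (simp add: pid_mult power3_eq_cube)
  finally have "I = (pid (inverse d) \<star> J) \<star> (pid (inverse d) \<star> J) \<star> (pid (inverse d) \<star> J)"
    unfolding J(2) by (simp add: idp_ac)
  moreover have "is_frac (pid (inverse d) \<star> J)" using J d dF by (intro is_frac_idp is_frac_pid) auto
  ultimately show ?thesis by (rule that[rotated])
qed

end

section \<open>Extensions of ideals and their cosets\<close>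

lemma Rats_frac_principal:
  assumes I: "complex_subfield.is_frac \<rat> I"
  shows "\<exists>r\<in>\<rat>. r \<noteq> 0 \<and> I = principal_ideal \<rat> r"
proof -
  interpret Q: complex_subfield \<rat> by (rule complex_subfield_Rats)
  note m = Q.is_moduleD[OF Q.is_frac_module[OF I]]
  obtain d where "d \<in> Q.\<O>" "d \<noteq> 0" "\<And>x. x \<in> I \<Longrightarrow> d * x \<in> Q.\<O>" using I by (auto simp: Q.is_frac_def)
  then obtain e :: int where e: "e \<noteq> 0" "\<And>x. x \<in> I \<Longrightarrow> of_int e * x \<in> \<int>"
    by (auto simp: integers_of_Rats elim!: Ints_cases)
  define J where "J = {k :: int. of_int k / of_int e \<in> I}"
  have J_int: "\<exists>k\<in>J. x = of_int k / of_int e" if x: "x \<in> I" for x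
  proof -
    obtain k where "of_int e * x = of_int k" using e(2)[OF x] by (auto elim: Ints_cases)
    then have "x = of_int k / of_int e" using e(1) by (simp add: field_simps)
    then show ?thesis using x by (auto simp: J_def)
  qed
  have J_diff: "k - j * l \<in> J" if "k \<in> J" "l \<in> J" for k j l
  proof -
    have "of_int k / of_int e - of_int j * (of_int l / of_int e) \<in> I"
      using that by (intro m(5) m(3)) (auto simp: J_def integers_of_Rats)
    then show ?thesis by (simp add: J_def diff_divide_distrib)
  qed
  obtain x where x: "x \<in> I" "x \<noteq> 0" using I unfolding Q.is_frac_def by blast
  obtain k0 where "k0 \<in> J" "x = of_int k0 / of_int e" using J_int[OF x(1)] by blast
  then have k0: "k0 \<in> J" "k0 \<noteq> 0" using x(2) by auto
  have "\<bar>k0\<bar> \<in> J" using J_diff[OF k0(1) k0(1), of 2] k0(1) by (auto simp: abs_if)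
  then have ex: "\<exists>n::nat. n > 0 \<and> int n \<in> J" using k0 by (intro exI[of _ "nat \<bar>k0\<bar>"]) auto
  define n where "n = (LEAST n::nat. n > 0 \<and> int n \<in> J)"
  have n: "n > 0" "int n \<in> J" using LeastI_ex[OF ex] by (auto simp: n_def)
  have dvd: "int n dvd k" if k: "k \<in> J" for k
  proof (rule ccontr)
    assume "\<not> int n dvd k"
    then have "k mod int n > 0" using n(1) by (metis dvd_eq_mod_eq_0 of_nat_0_less_iff pos_mod_sign order_le_less)
    moreover have "k mod int n \<in> J" using J_diff[OF k n(2), of "k div int n"] by (simp add: minus_div_mult_eq_mod)
    ultimately have "n \<le> nat (k mod int n)" unfolding n_def by (intro Least_le) auto
    moreover have "k mod int n < int n" using n(1) by simp
    ultimately show False using n(1) by linarith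
  qed
  define r :: complex where "r = of_int (int n) / of_int e"
  have r: "r \<in> \<rat>" "r \<noteq> 0" "r \<in> I" using n e(1) by (auto simp: r_def J_def)
  have "x \<in> principal_ideal \<rat> r" if x: "x \<in> I" for x
  proof -
    obtain k where k: "k \<in> J" "x = of_int k / of_int e" using J_int[OF x] by blast
    then obtain l where "k = int n * l" using dvd by blast
    then have "x = r * of_int l" using k by (simp add: r_def)
    then show ?thesis by (auto simp: principal_ideal_def)
  qed
  then have "I = principal_ideal \<rat> r" using Q.pid_subset_iff[OF Q.is_frac_module[OF I], of r] r(3) by blast
  then show ?thesis using r by blast
qed

lemma Rats_is_frac_pid:
  assumes "r \<in> \<rat>" "r \<noteq> 0"
  shows "complex_subfield.is_frac \<rat> (principal_ideal \<rat> r)"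
proof -
  interpret Q: complex_subfield \<rat> by (rule complex_subfield_Rats)
  obtain a b where "b > 0" "r = of_int a / of_int b" using assms(1) by (auto elim: Rats_cases')
  then have "of_int b \<in> Q.\<O>" "(of_int b :: complex) \<noteq> 0" "\<forall>x\<in>principal_ideal \<rat> r. of_int b * x \<in> Q.\<O>"
    by (auto simp: principal_ideal_def integers_of_Rats)
  then show ?thesis unfolding Q.is_frac_alt using Q.is_module_pid Q.pid_self assms(2) by blast
qed

text \<open>The same set for all fields, since ideal products are always formed in the complex
  numbers; computing with it does not presuppose that the ideals form a group.\<close>

definition coset :: "complex set set \<Rightarrow> complex set \<Rightarrow> complex set set" where
  "coset H A = (\<lambda>h. h \<star> A) ` H"

context complex_subfield
begin

lemma r_coset_eq_coset [simp]:
  "H #>\<^bsub>ideal_group F\<^esub> A = coset H A" "H #>\<^bsub>ideal_group F\<lparr>carrier := C\<rparr>\<^esub> A = coset H A"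
  by (auto simp: r_coset_def coset_def)

lemma carrier_Mod:
  "carrier (ideal_group F Mod H) = coset H ` fractional_ideals F"
  "carrier (ideal_group F\<lparr>carrier := C\<rparr> Mod H) = coset H ` C"
  by (auto simp: FactGroup_def RCOSETS_def)

text \<open>Replaces subgroups in coset computations: no general inverses of ideals are available in
  L and N.\<close>

definition module_monoid :: "complex set set \<Rightarrow> bool" where
  "module_monoid H \<longleftrightarrow> \<O> \<in> H \<and> (\<forall>I\<in>H. is_module I) \<and> (\<forall>I\<in>H. \<forall>J\<in>H. I \<star> J \<in> H)"

lemma coset_O: "module_monoid H \<Longrightarrow> coset H \<O> = H"
  by (force simp: coset_def module_monoid_def)

lemma coset_mult:
  assumes H: "module_monoid H" and A: "is_module A"
  shows "coset H A <#>\<^bsub>ideal_group F\<^esub> coset H B = coset H (A \<star> B)"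
    "coset H A <#>\<^bsub>ideal_group F\<lparr>carrier := C\<rparr>\<^esub> coset H B = coset H (A \<star> B)"
proof -
  have "{h \<star> A \<star> (h' \<star> B) |h h'. h \<in> H \<and> h' \<in> H} = coset H (A \<star> B)"
  proof (intro equalityI subsetI)
    fix x assume "x \<in> {h \<star> A \<star> (h' \<star> B) |h h'. h \<in> H \<and> h' \<in> H}"
    then obtain h h' where h: "x = h \<star> A \<star> (h' \<star> B)" "h \<in> H" "h' \<in> H" by blast
    then have "x = (h \<star> h') \<star> (A \<star> B)" by (simp add: idp_ac)
    moreover have "h \<star> h' \<in> H" using H h by (simp add: module_monoid_def)
    ultimately show "x \<in> coset H (A \<star> B)" by (auto simp: coset_def)
  next
    fix x assume "x \<in> coset H (A \<star> B)"
    then obtain h where h: "x = h \<star> (A \<star> B)" "h \<in> H" by (auto simp: coset_def)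
    then have "x = h \<star> A \<star> (\<O> \<star> B)" using A by (simp add: idp_assoc[symmetric]) (simp add: idp_assoc)
    then show "x \<in> {h \<star> A \<star> (h' \<star> B) |h h'. h \<in> H \<and> h' \<in> H}" using h H by (auto simp: module_monoid_def)
  qed
  moreover have "coset H A <#>\<^bsub>ideal_group F\<^esub> coset H B = {h \<star> A \<star> (h' \<star> B) |h h'. h \<in> H \<and> h' \<in> H}"
    "coset H A <#>\<^bsub>ideal_group F\<lparr>carrier := C\<rparr>\<^esub> coset H B = {h \<star> A \<star> (h' \<star> B) |h h'. h \<in> H \<and> h' \<in> H}"
    by (auto simp: set_mult_def coset_def)
  ultimately show "coset H A <#>\<^bsub>ideal_group F\<^esub> coset H B = coset H (A \<star> B)"
    "coset H A <#>\<^bsub>ideal_group F\<lparr>carrier := C\<rparr>\<^esub> coset H B = coset H (A \<star> B)" by simp_all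
qed

text \<open>An inverse is required only for the factor E, and it must lie in H. Ideals from
  subfields provide such inverses.\<close>

lemma coset_absorb:
  assumes H: "module_monoid H" and E: "E \<in> H" "E' \<in> H" "E \<star> E' = \<O>" and A: "is_module A"
  shows "coset H (E \<star> A) = coset H A"
proof (intro equalityI subsetI)
  fix x assume "x \<in> coset H (E \<star> A)"
  then obtain h where h: "x = h \<star> (E \<star> A)" "h \<in> H" by (auto simp: coset_def)
  then have "x = (h \<star> E) \<star> A" by (simp add: idp_assoc)
  then show "x \<in> coset H A" using h H E by (auto simp: coset_def module_monoid_def)
next
  fix x assume "x \<in> coset H A"
  then obtain h where h: "x = h \<star> A" "h \<in> H" by (auto simp: coset_def)
  then have "x = h \<star> (\<O> \<star> A)" using A by simp
  also have "\<dots> = (h \<star> E') \<star> (E \<star> A)" unfolding E(3)[symmetric] by (simp add: idp_ac)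
  finally show "x \<in> coset H (E \<star> A)" using h H E by (auto simp: coset_def module_monoid_def)
qed

lemma coset_absorb_self:
  assumes "module_monoid H" "E \<in> H" "E' \<in> H" "E \<star> E' = \<O>"
  shows "coset H E = H"
  using coset_absorb[OF assms is_module_O] assms coset_O by (simp add: module_monoid_def)

lemma coset_self_mem: "module_monoid H \<Longrightarrow> is_module A \<Longrightarrow> A \<in> coset H A"
  by (auto simp: coset_def module_monoid_def intro!: image_eqI[of _ _ \<O>])

lemma extension_pid:
  assumes "complex_subfield E" "F \<subseteq> E"
  shows "ideal_extension E (pid x) = principal_ideal E x"
proof -
  interpret E: complex_subfield E by fact
  have "\<O> \<star> E.\<O> = E.\<O>"
  proof (rule equalityI)
    have "\<O> \<subseteq> E.\<O>" using assms(2) by (auto simp: integers_of_def)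
    then have "\<O> \<star> E.\<O> \<subseteq> E.\<O> \<star> E.\<O>" by (intro idp_mono) auto
    then show "\<O> \<star> E.\<O> \<subseteq> E.\<O>" by simp
    show "E.\<O> \<subseteq> \<O> \<star> E.\<O>" using idp_prod[OF O_one] by fastforce
  qed
  then show ?thesis by (simp add: ideal_extension_def principal_ideal_def idp_scale)
qed

lemma pid_power_3: "pid x [^]\<^bsub>ideal_group F\<^esub> (3::nat) = pid (x^3)"
  using is_module_pid by (simp add: numeral_3_eq_3 pid_mult mult_ac)

text \<open>Every fractional ideal of the rationals is principal, so ideals and principal ideals
  have the same extensions.\<close>

lemma extended_ideals_Rats: "extended_ideals F \<rat> = pid ` (\<rat> - {0})"
    and extended_principal_ideals_Rats: "extended_principal_ideals F \<rat> = pid ` (\<rat> - {0})"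
proof -
  interpret Q: complex_subfield \<rat> by (rule complex_subfield_Rats)
  have fr: "fractional_ideals \<rat> = principal_ideal \<rat> ` (\<rat> - {0})"
    using Rats_frac_principal Rats_is_frac_pid Q.fractional_ideals_iff by blast
  have "ideal_extension F (principal_ideal \<rat> r) = pid r" for r
    using Q.extension_pid[OF complex_subfield_axioms] by auto
  then show "extended_ideals F \<rat> = pid ` (\<rat> - {0})" "extended_principal_ideals F \<rat> = pid ` (\<rat> - {0})"
    unfolding extended_ideals_def extended_principal_ideals_def principal_ideals_def fr
    by (auto simp: image_image)
qed

lemma module_monoid_pid:
  assumes "1 \<in> S" "\<And>x y. x \<in> S \<Longrightarrow> y \<in> S \<Longrightarrow> x * y \<in> S"
  shows "module_monoid (pid ` S)"
  using assms is_module_pid by (force simp: module_monoid_def pid_mult)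

lemma coset_pid_absorb:
  assumes "r \<in> S" "inverse r \<in> S" "r \<noteq> 0" "module_monoid (pid ` S)" "is_module A"
  shows "coset (pid ` S) (pid r \<star> A) = coset (pid ` S) A" "coset (pid ` S) (pid r) = pid ` S"
proof -
  have *: "pid r \<in> pid ` S" "pid (inverse r) \<in> pid ` S" "pid r \<star> pid (inverse r) = \<O>"
    using assms by (auto simp: pid_mult)
  show "coset (pid ` S) (pid r \<star> A) = coset (pid ` S) A" by (rule coset_absorb[OF assms(4) * assms(5)])
  show "coset (pid ` S) (pid r) = pid ` S" by (rule coset_absorb_self[OF assms(4) *])
qed

end

section \<open>Ideals of the fields in the normal closure\<close>

lemma (in complex_subfield) is_frac_pidI:
  assumes "x \<noteq> 0" "d \<in> \<O>" "d \<noteq> 0" "d * x \<in> \<O>"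
  shows "is_frac (pid x)"
proof -
  have "d * z \<in> \<O>" if z: "z \<in> pid x" for z
  proof -
    obtain y where "z = x * y" "y \<in> \<O>" using z by (auto simp: principal_ideal_def)
    then show ?thesis using O_mult[OF assms(4), of y] by (simp add: mult.assoc)
  qed
  then show ?thesis unfolding is_frac_alt using assms is_module_pid pid_self by blast
qed

lemma (in field_endo) s_pid:
  assumes "s ` \<O> = \<O>" "x \<in> F"
  shows "s ` pid x = pid (s x)"
proof -
  have "s ` pid x = (\<lambda>y. s x * s y) ` \<O>"
    unfolding principal_ideal_def image_image using assms(2) O_subset by (intro image_cong) auto
  also have "\<dots> = (*) (s x) ` (s ` \<O>)" by (simp add: image_image)
  finally show ?thesis by (simp add: principal_ideal_def assms(1))
qed

context quadratic_field
begin

lemma exists_prime_over: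
  assumes q: "Factorial_Ring.prime q"
  obtains P where "P \<in> prime_ideals F" "of_nat q \<in> P"
proof -
  have q1: "q > 1" using q by (rule prime_gt_1_nat)
  have "is_frac (pid (of_nat q))" using q1 by (intro is_frac_pid) auto
  moreover have "pid (of_nat q) \<subseteq> \<O>" using pid_subset_iff[OF is_module_O] by simp
  moreover have "pid (of_nat q) \<noteq> \<O>" using nm_pid_of_nat[of q] q1 nm_O by auto
  ultimately obtain P where "P \<in> prime_ideals F" "pid (of_nat q) \<subseteq> P" using exists_prime_above by meson
  then show ?thesis using pid_self[of "of_nat q"] by (intro that[of P]) auto
qed

text \<open>With (q) = P D, norms give q^2 = \<open>nm P * nm D\<close>. Either \<open>nm P\<close>
  is q, and the definition of the norm yields (q), or D is trivial.\<close>

lemma prime_over: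
  assumes P: "P \<in> prime_ideals F" and q: "Factorial_Ring.prime q" "of_nat q \<in> P"
  shows "nm P = q \<and> pid (of_nat q) = P \<star> s ` P \<or> nm P = q * q \<and> pid (of_nat q) = P"
proof -
  note Pf = prime_idealD(1)[OF P] and PO = prime_idealD(2)[OF P]
  have q0: "q > 0" using q(1) by (simp add: prime_gt_0_nat)
  have "pid (of_nat q) \<subseteq> P" using pid_subset_iff[OF is_frac_module[OF Pf]] q(2) by simp
  moreover have "is_frac (pid (of_nat q))" using q0 by (intro is_frac_pid) auto
  ultimately obtain D where D: "is_frac D" "D \<subseteq> \<O>" "pid (of_nat q) = P \<star> D"
    using ideal_dvd[OF _ Pf, of "pid (of_nat q)"] by metis
  have *: "q * q = nm P * nm D" using nm_mult[OF Pf PO D(1,2)] nm_pid_of_nat[OF q0] D(3) by simp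
  then have "nm P dvd q ^ 2" by (simp add: power2_eq_square)
  then obtain i where i: "i \<le> 2" "nm P = q ^ i" using q(1) by (auto simp: divides_primepow_nat)
  have "i \<noteq> 0" using i nm_prime[OF P] by (intro notI) simp
  then consider "i = 1" | "i = 2" using i(1) by linarith
  then show ?thesis
  proof cases
    case 1
    then show ?thesis using i nm(2)[OF Pf PO] by simp
  next
    case 2
    then have "nm D = 1" using * i q0 by (simp add: power2_eq_square)
    then have "D = \<O>" using nm_eq_1[OF D(1,2)] by simp
    then show ?thesis using 2 i D(3) is_frac_module[OF Pf] by (simp add: power2_eq_square)
  qed
qed

text \<open>The product of Q with its conjugate is contained in P, so primality puts one of the two
  factors inside P, and primes are maximal.\<close>

lemma primes_over_conjugate:
  assumes P: "P \<in> prime_ideals F" and Q: "Q \<in> prime_ideals F"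
    and q: "Factorial_Ring.prime q" "of_nat q \<in> P" "of_nat q \<in> Q"
  shows "P = Q \<or> P = s ` Q"
proof -
  note Pf = prime_idealD(1)[OF P] and PO = prime_idealD(2)[OF P]
  note Qf = prime_idealD(1)[OF Q] and QO = prime_idealD(2)[OF Q]
  have max: "P = R" if R: "R \<in> prime_ideals F" "R \<subseteq> P" for R
    using prime_maximal[OF R(1) Pf PO R(2)] prime_idealD(3)[OF P] by auto
  have qP: "pid (of_nat q) \<subseteq> P" using pid_subset_iff[OF is_frac_module[OF Pf]] q(2) by simp
  have "Q \<star> s ` Q \<subseteq> P"
    using prime_over[OF Q q(1,3)]
  proof
    assume "nm Q = q \<and> pid (of_nat q) = Q \<star> s ` Q"
    then show ?thesis using qP by simp
  next
    assume *: "nm Q = q * q \<and> pid (of_nat q) = Q"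
    have "Q \<star> s ` Q \<subseteq> Q \<star> \<O>" using prime_idealD(2)[OF s_prime[OF Q]] by (intro idp_mono) auto
    also have "\<dots> = Q" using is_frac_module[OF Qf] by simp
    finally show ?thesis using * qP by simp
  qed
  then have prod: "x * y \<in> P" if "x \<in> Q" "y \<in> s ` Q" for x y using idp_prod[OF that] by auto
  have "Q \<subseteq> P \<or> s ` Q \<subseteq> P"
  proof (rule ccontr)
    assume "\<not> ?thesis"
    then obtain x y where xy: "x \<in> Q" "x \<notin> P" "y \<in> s ` Q" "y \<notin> P" by auto
    have "x \<in> \<O>" "y \<in> \<O>" using xy(1,3) QO prime_idealD(2)[OF s_prime[OF Q]] by auto
    then show False using prime_idealD(4)[OF P, of x y] prod[OF xy(1,3)] xy(2,4) by simp
  qed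
  then show ?thesis using max[OF Q] max[OF s_prime[OF Q]] by blast
qed

lemma splits_if_not_self_conjugate:
  assumes P: "P \<in> prime_ideals F" "s ` P \<noteq> P" and q: "Factorial_Ring.prime q" "of_nat q \<in> P"
  shows "splits_in_quadratic q F"
proof -
  have "pid (of_nat q) \<noteq> P" using P(2) s_image_pid[of "of_nat q"] by auto
  then have "pid (of_nat q) = P \<star> s ` P" using prime_over[OF P(1) q] by blast
  then show ?thesis unfolding splits_in_quadratic_def using P s_prime[OF P(1)] by metis
qed

text \<open>If all norms \<open>x s(x)\<close> of elements of \<open>I\<close> are divisible by the rational \<open>h\<close>, then so are the
  traces of \<open>x s(y)\<close>, by polarization, hence the products \<open>x s(y)\<close> themselves.\<close>

lemma norm_generator_mem:
  assumes I: "is_frac I" and g: "g \<in> \<rat>" "g \<noteq> 0" "I \<star> s ` I = pid g"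
  shows "g \<in> (\<lambda>b. b * s b) ` I \<star> \<int>"
proof -
  interpret Q: complex_subfield \<rat> by (rule complex_subfield_Rats)
  have QO: "Q.\<O> = \<int>" by (rule integers_of_Rats)
  define E where "E = (\<lambda>b. b * s b) ` I \<star> \<int>"
  have IF: "I \<subseteq> F" using I is_frac_subset by blast
  obtain b where b: "b \<in> I" "b \<noteq> 0" using I by (auto simp: is_frac_def)
  have Em: "Q.is_module E" unfolding E_def using Q.is_module_idp[OF Q.is_module_O, of "(\<lambda>b. b * s b) ` I"] b(1) by (auto simp: QO)
  have norm_mem: "x * s x \<in> E" if "x \<in> I" for x
    using idp_prod[of "x * s x" "(\<lambda>b. b * s b) ` I" 1 \<int>] that by (simp add: E_def)
  have "E \<subseteq> principal_ideal \<rat> g"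
    unfolding E_def
  proof (rule idp_subsetI)
    fix i j assume i: "i \<in> (\<lambda>b. b * s b) ` I" and j: "j \<in> (\<int> :: complex set)"
    then obtain x where x: "x \<in> I" "i = x * s x" by blast
    then have "i \<in> pid g" using idp_prod[of x I "s x" "s ` I"] g(3) by simp
    then obtain z where z: "i = g * z" "z \<in> \<O>" by (auto simp: principal_ideal_def)
    have "i \<in> \<rat>" using nrm_Rats[of x] x IF by auto
    moreover have "z = i / g" using z g(2) by simp
    ultimately have "z \<in> \<rat>" using g(1) by (metis Rats_divide)
    then have "z * j \<in> \<int>" using O_Rats[OF z(2)] j by simp
    then show "i * j \<in> principal_ideal \<rat> g" by (auto simp: z(1) principal_ideal_def QO mult.assoc)
  qed (use Q.is_module_pid Q.is_moduleD(2) in blast)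
  moreover obtain d where d: "d \<in> Q.\<O>" "d \<noteq> 0" "\<And>x. x \<in> principal_ideal \<rat> g \<Longrightarrow> d * x \<in> Q.\<O>"
    using Rats_is_frac_pid[OF g(1,2)] unfolding Q.is_frac_alt by blast
  ultimately have "\<And>x. x \<in> E \<Longrightarrow> d * x \<in> Q.\<O>" by blast
  moreover have "b * s b \<in> E" "b * s b \<noteq> 0" using norm_mem[OF b(1)] b IF by auto
  ultimately have "Q.is_frac E" unfolding Q.is_frac_alt using Em d(1,2) by blast
  then obtain h where h: "h \<in> \<rat>" "h \<noteq> 0" "E = principal_ideal \<rat> h" using Rats_frac_principal by blast
  have E_iff: "x / h \<in> \<int>" if "x \<in> E" for x using that h by (auto simp: principal_ideal_def QO)
  have hF: "h \<in> F" "s h = h" using h(1) s_Rats by auto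
  have "I \<star> s ` I \<subseteq> pid h"
  proof (rule idp_subsetI)
    fix x y' assume x: "x \<in> I" and y': "y' \<in> s ` I"
    then obtain y where y: "y \<in> I" "y' = s y" by blast
    have F: "x \<in> F" "y \<in> F" using x y IF by auto
    define w where "w = x * s y / h"
    have sw: "s w = s x * y / h" using F hF by (simp add: w_def)
    have "x + y \<in> I" using x y is_moduleD(2)[OF is_frac_module[OF I]] by blast
    then have "(x + y) * s (x + y) - x * s x - y * s y \<in> E"
      using norm_mem x y Q.is_moduleD(5)[OF Em] by blast
    then have "((x + y) * s (x + y) - x * s x - y * s y) / h \<in> \<int>" by (rule E_iff)
    also have "((x + y) * s (x + y) - x * s x - y * s y) / h = w + s w"
      unfolding sw using F by (simp add: w_def add_divide_distrib[symmetric] algebra_simps)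
    finally have "w + s w \<in> \<int>" .
    moreover have ww: "w * s w = (x * s x / h) * (y * s y / h)" unfolding sw by (simp add: w_def mult_ac)
    have "w * s w \<in> \<int>"
      unfolding ww using E_iff[OF norm_mem[OF x]] E_iff[OF norm_mem[OF y(1)]] by (rule Ints_mult)
    ultimately have "w \<in> \<O>" using F hF by (intro O_quadratic) (auto simp: w_def)
    moreover have "x * y' = h * w" using h(2) y by (simp add: w_def)
    ultimately show "x * y' \<in> pid h" by (auto simp: principal_ideal_def)
  qed (use is_module_pid is_moduleD(2) in blast)
  then have "g \<in> pid h" using g(3) pid_self[of g] by blast
  then obtain z where z: "g = h * z" "z \<in> \<O>" by (auto simp: principal_ideal_def)
  have "z = g / h" using z(1) h(2) by simp
  then have "z \<in> \<rat>" using g(1) h(1) by simp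
  then have "z \<in> \<int>" using O_Rats z(2) by blast
  then show ?thesis unfolding E_def[symmetric] h(3) by (auto simp: z(1) principal_ideal_def QO)
qed

end

lemma subset_singleton_prime:
  assumes "finite S" "card S \<le> 1" "\<And>q. q \<in> S \<Longrightarrow> Factorial_Ring.prime (q::nat)"
  obtains q where "Factorial_Ring.prime q" "S \<subseteq> {q}"
proof (cases "S = {}")
  case True
  then show ?thesis using that[OF two_is_prime_nat] by simp
next
  case False
  then obtain q where q: "q \<in> S" by blast
  then have "S \<subseteq> {q}" using assms(1,2) card_le_Suc0_iff_eq[of S] by auto
  then show ?thesis using that[of q] assms(3)[OF q] by simp
qed

locale dihedral_cubic = cyclic_cubic N \<sigma> K \<tau> + T: field_endo N \<tau> + L: complex_subfield L
  for N \<sigma> K \<tau> L +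
  assumes L_N: "L \<subseteq> N"
    and \<tau>_\<tau>: "x \<in> N \<Longrightarrow> \<tau> (\<tau> x) = x"
    and \<tau>_L: "x \<in> L \<Longrightarrow> \<tau> x = x"
    and rel_norm_\<tau>: "x \<in> N \<Longrightarrow> rel_norm N L x = x * \<tau> x"
    and L_irrational: "\<exists>x\<in>L. x \<notin> \<rat>"
begin

abbreviation "OL \<equiv> integers_of L"

lemma OL_ON: "x \<in> OL \<Longrightarrow> x \<in> ON"
  using L_N by (auto simp: integers_of_def)

text \<open>In the basis 1, A, A^2 of N over K with A in L, averaging y with its image under
  \<open>\<tau>\<close> replaces each coordinate by half its trace, which is rational.\<close>

lemma \<tau>_fixed:
  assumes y: "y \<in> N" "\<tau> y = y"
  shows "y \<in> L"
proof -
  obtain A where A: "A \<in> L" "A \<notin> \<rat>" using L_irrational by blast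
  have AN: "A \<in> N" using A L_N by blast
  obtain P where P: "P \<in> prime_ideals K" by (rule K.exists_prime_over[OF two_is_prime_nat])
  have "\<sigma> A \<noteq> A" using \<sigma>_fixed[OF AN] K.s_fixed[of A] \<tau>_L[OF A(1)] A(2) by blast
  then obtain y0 y1 y2 where c: "y0 \<in> K" "y1 \<in> K" "y2 \<in> K" "y = y0 + y1 * A + y2 * A^2"
    by (rule K_coordinates[OF P AN _ y(1)])
  have N: "y0 \<in> N" "y1 \<in> N" "y2 \<in> N" using c K_N by auto
  have r: "y0 + \<tau> y0 \<in> L" "y1 + \<tau> y1 \<in> L" "y2 + \<tau> y2 \<in> L"
    using L.Rats_closed[OF K.tr_Rats] c(1-3) by auto
  have "\<tau> y = \<tau> y0 + \<tau> y1 * A + \<tau> y2 * A^2" unfolding c(4) using N AN \<tau>_L[OF A(1)] by simp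
  then have "y = ((y0 + \<tau> y0) + (y1 + \<tau> y1) * A + (y2 + \<tau> y2) * A^2) / 2"
    using y(2) c(4) by (simp add: field_simps)
  also have "\<dots> \<in> L"
    by (rule L.divide_closed[OF L.add_closed[OF L.add_closed[OF r(1) L.mult_closed[OF r(2) A(1)]]
        L.mult_closed[OF r(3) L.power_closed[OF A(1)]]] L.numeral_closed])
  finally show ?thesis .
qed

lemma \<tau>_ON: "\<tau> ` ON = ON"
proof
  show "ON \<subseteq> \<tau> ` ON"
  proof
    fix x assume x: "x \<in> ON"
    then have "x = \<tau> (\<tau> x)" using \<tau>_\<tau>[of x] N.O_subset by simp
    then show "x \<in> \<tau> ` ON" using x by blast
  qed
qed auto

lemma \<sigma>_ON: "\<sigma> ` ON = ON"
proof
  show "ON \<subseteq> \<sigma> ` ON"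
  proof
    fix x assume x: "x \<in> ON"
    then have "x = \<sigma> (\<sigma> (\<sigma> x))" using \<sigma>_cubed[of x] N.O_subset by simp
    then show "x \<in> \<sigma> ` ON" using x by blast
  qed
qed auto

abbreviation "ext \<equiv> ideal_extension N"

lemma ext_pid: "ext (K.pid x) = N.pid x"
  by (rule K.extension_pid[OF N.complex_subfield_axioms K_subset])

lemma ext_mult: "ext (I \<star> J) = ext I \<star> ext J"
  by (rule extension_idp[OF N.complex_subfield_axioms])

lemma ext_OK: "ext OK = ON"
  using ext_pid[of 1] by simp

lemma mem_ext: "x \<in> I \<Longrightarrow> x \<in> ext I"
  using idp_prod[of x I 1 ON] by (simp add: ideal_extension_def)

lemma is_module_ext: "I \<noteq> {} \<Longrightarrow> N.is_module (ext I)"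
  unfolding ideal_extension_def by (rule N.is_module_idp[OF N.is_module_O])

lemma frac_nonempty: "K.is_frac I \<Longrightarrow> I \<noteq> {}"
  by (auto simp: K.is_frac_def)

lemma ext_subset: "I \<subseteq> K \<Longrightarrow> ext I \<subseteq> N"
  unfolding ideal_extension_def using K_N N.O_subset
  by (intro idp_subsetI) (auto intro: N.mult_closed N.add_closed)

lemma \<tau>_ext: "I \<subseteq> K \<Longrightarrow> \<tau> ` ext I = ext (\<tau> ` I)"
  unfolding ideal_extension_def using K_subset N.O_subset
  by (subst T.s_idp) (auto simp: \<tau>_ON)

lemma \<sigma>_ext: "I \<subseteq> K \<Longrightarrow> \<sigma> ` ext I = ext I"
proof -
  assume I: "I \<subseteq> K"
  then have "\<sigma> ` I = (\<lambda>x. x) ` I" using \<sigma>_K by (intro image_cong) auto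
  then have "\<sigma> ` I = I" by simp
  then show ?thesis unfolding ideal_extension_def
    using I K_subset N.O_subset by (subst N.s_idp) (auto simp: \<sigma>_ON)
qed

lemma module_monoid_extended_ideals: "N.module_monoid (extended_ideals N K)"
  unfolding N.module_monoid_def
proof (intro conjI ballI)
  show "ON \<in> extended_ideals N K"
    unfolding extended_ideals_def using ext_OK K.is_frac_O
    by (intro image_eqI[of _ _ OK]) (simp_all add: K.fractional_ideals_iff)
  fix I assume "I \<in> extended_ideals N K"
  then obtain I' where I': "K.is_frac I'" "I = ext I'" by (auto simp: extended_ideals_def K.fractional_ideals_iff)
  then show "N.is_module I" using is_module_ext[OF frac_nonempty] by simp
  fix J assume "J \<in> extended_ideals N K"
  then obtain J' where J': "K.is_frac J'" "J = ext J'" by (auto simp: extended_ideals_def K.fractional_ideals_iff)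
  then show "I \<star> J \<in> extended_ideals N K"
    unfolding extended_ideals_def I'(2) J'(2) ext_mult[symmetric]
    using K.is_frac_idp[OF I'(1) J'(1)] by (intro imageI) (simp add: K.fractional_ideals_iff)
qed

lemma ext_inverse: "K.is_frac I \<Longrightarrow> ext I \<star> ext (K.fr_inv I) = ON"
  using K.fr_inv(2)[of I] ext_mult[of I "K.fr_inv I"] ext_OK by simp

lemma coset_ext_absorb:
  assumes "K.is_frac I" "N.is_module A"
  shows "coset (extended_ideals N K) (ext I \<star> A) = coset (extended_ideals N K) A"
    "coset (extended_ideals N K) (ext I) = extended_ideals N K"
proof -
  have *: "ext I \<in> extended_ideals N K" "ext (K.fr_inv I) \<in> extended_ideals N K"
    using assms(1) K.fr_inv(1) by (auto simp: extended_ideals_def K.fractional_ideals_iff)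
  show "coset (extended_ideals N K) (ext I \<star> A) = coset (extended_ideals N K) A"
    by (rule N.coset_absorb[OF module_monoid_extended_ideals * ext_inverse[OF assms(1)] assms(2)])
  show "coset (extended_ideals N K) (ext I) = extended_ideals N K"
    by (rule N.coset_absorb_self[OF module_monoid_extended_ideals * ext_inverse[OF assms(1)]])
qed

text \<open>\<open>ideal_norm\<close> is generated by norms of elements, so both inclusions need an
  argument. Norms of elements of the extension of b are g times integers fixed by
  \<open>\<tau>\<close>, hence in L; conversely, by \<open>norm_generator_mem\<close>, the norms of
  elements of b itself already generate g.\<close>

lemma ideal_norm_ext_pid:
  assumes b: "K.is_frac b" and g: "g \<in> \<rat>" "g \<noteq> 0" "b \<star> \<tau> ` b = K.pid g" and A: "A \<in> N"
  shows "ideal_norm N L (ext b \<star> N.pid A) = L.pid (A * \<tau> A * g)"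
proof -
  define B where "B = ext b"
  define M where "M = rel_norm N L ` (B \<star> N.pid A) \<star> OL"
  have bK: "b \<subseteq> K" using K.is_frac_subset[OF b] .
  have Bm: "N.is_module B" unfolding B_def by (rule is_module_ext[OF frac_nonempty[OF b]])
  have BN: "B \<subseteq> N" unfolding B_def by (rule ext_subset[OF bK])
  have BA: "B \<star> N.pid A = (\<lambda>z. A * z) ` B" using N.pid_idp[OF Bm, of A] by (simp add: idp_commute)
  have norm: "rel_norm N L (A * z) = A * \<tau> A * (z * \<tau> z)" if "z \<in> B" for z
  proof -
    have "z \<in> N" using that BN by blast
    then show ?thesis using rel_norm_\<tau>[of "A * z"] A by (simp add: mult_ac)
  qed
  have "B \<star> \<tau> ` B = ext (b \<star> \<tau> ` b)" unfolding B_def \<tau>_ext[OF bK] ext_mult ..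
  then have BB: "B \<star> \<tau> ` B = N.pid g" by (simp add: g(3) ext_pid)
  have Mm: "L.is_module M"
  proof -
    have "B \<star> N.pid A \<noteq> {}" using N.is_moduleD(1)[OF Bm] by (auto simp: BA)
    then show ?thesis unfolding M_def by (intro L.is_module_idp[OF L.is_module_O]) simp
  qed
  have "M \<subseteq> L.pid (A * \<tau> A * g)"
    unfolding M_def
  proof (rule idp_subsetI)
    fix i j assume i: "i \<in> rel_norm N L ` (B \<star> N.pid A)" and j: "j \<in> OL"
    then obtain z where z: "z \<in> B" "i = A * \<tau> A * (z * \<tau> z)" using norm by (auto simp: BA)
    have zN: "z \<in> N" using z BN by blast
    have "z * \<tau> z \<in> N.pid g" using idp_prod[of z B "\<tau> z" "\<tau> ` B"] z BB by simp
    then obtain w where w: "z * \<tau> z = g * w" "w \<in> ON" by (auto simp: principal_ideal_def)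
    have wd: "w = z * \<tau> z / g" using w(1) g(2) by simp
    have "\<tau> g = g" using g(1) T.s_Rats by blast
    then have "\<tau> w = w" unfolding wd using zN g(1) \<tau>_\<tau>[OF zN] by (simp add: mult.commute)
    then have "w \<in> L" using w(2) N.O_subset by (intro \<tau>_fixed) auto
    then have "w * j \<in> OL" using w(2) j by (intro L.O_mult) (auto simp: integers_of_def)
    then show "i * j \<in> L.pid (A * \<tau> A * g)"
      unfolding z(2) w(1) principal_ideal_def by (intro image_eqI[of _ _ "w * j"]) (simp_all add: mult_ac)
  qed (use L.is_module_pid L.is_moduleD(2) in blast)
  moreover have "(\<lambda>b. b * \<tau> b) ` b \<star> \<int> \<subseteq> {y. A * \<tau> A * y \<in> M}"
  proof (rule idp_subsetI)
    fix i j assume i: "i \<in> (\<lambda>b. b * \<tau> b) ` b" and j: "j \<in> (\<int> :: complex set)"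
    then obtain x where x: "x \<in> b" "i = x * \<tau> x" by blast
    have xB: "x \<in> B" unfolding B_def using x(1) by (rule mem_ext)
    have "A * x \<in> B \<star> N.pid A" unfolding BA using xB by (rule imageI)
    then have "rel_norm N L (A * x) \<in> rel_norm N L ` (B \<star> N.pid A)" by (rule imageI)
    moreover have "j \<in> OL" using j by (auto elim: Ints_cases)
    ultimately have "rel_norm N L (A * x) * j \<in> M" unfolding M_def by (rule idp_prod)
    then show "i * j \<in> {y. A * \<tau> A * y \<in> M}" using norm[OF xB] x(2) by (simp add: mult.assoc)
  next
    fix x y assume "x \<in> {y. A * \<tau> A * y \<in> M}" "y \<in> {y. A * \<tau> A * y \<in> M}"
    then show "x + y \<in> {y. A * \<tau> A * y \<in> M}"
      using L.is_moduleD(2)[OF Mm, of "A * \<tau> A * x" "A * \<tau> A * y"] by (simp add: distrib_left)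
  qed
  then have "A * \<tau> A * g \<in> M" using K.norm_generator_mem[OF b g] by blast
  then have "L.pid (A * \<tau> A * g) \<subseteq> M" using L.pid_subset_iff[OF Mm] by blast
  ultimately show ?thesis by (simp add: ideal_norm_def M_def B_def)
qed

end

section \<open>Absolute and relative principal factorizations, capitulation\<close>

context dihedral_cubic
begin

lemma pid_cube_root:
  assumes E: "complex_subfield E" and "x \<in> E" "y \<in> E" "x \<noteq> 0" "y \<noteq> 0" "principal_ideal E (x^3) = principal_ideal E (y^3)"
  shows "principal_ideal E x = principal_ideal E y"
proof -
  interpret E: complex_subfield E by fact
  have "(x / y)^3 \<in> E.\<O>" "(y / x)^3 \<in> E.\<O>"
    using E.pid_eq_iff[of "x^3" "y^3"] assms by (simp_all add: power_divide)
  then have "x / y \<in> E.\<O>" "y / x \<in> E.\<O>"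
    using E.O_root[of "x / y" 3] E.O_root[of "y / x" 3] E.divide_closed[OF assms(2,3)] E.divide_closed[OF assms(3,2)]
    by simp_all
  then show ?thesis using E.pid_eq_iff[of x y] assms by simp
qed

text \<open>Choose q so that f has no other prime divisor, and P above q. A class is indexed by the
  value at P of a rational number a with (\<alpha>^3) = (a). If 3 divides this value, it divides all
  values of a, and then the cube root of the ideal (a) descends to the rationals.\<close>

theorem absolute_dim_le_one:
  assumes f: "f \<ge> 1" "conductor N K = principal_ideal K (of_nat f)"
    and card: "card (prime_factors f) \<le> 1"
  shows "absolute_dim L \<le> 1"
proof -
  obtain q where q: "Factorial_Ring.prime q" "prime_factors f \<subseteq> {q}"
    by (rule subset_singleton_prime[OF _ card]) auto
  obtain P where P: "P \<in> prime_ideals K" "of_nat q \<in> P" by (rule K.exists_prime_over[OF q(1)])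
  define H where "H = L.pid ` (\<rat> - {0})"
  have H: "L.module_monoid H" unfolding H_def by (rule L.module_monoid_pid) auto
  define S where "S = {\<alpha> \<in> L. \<alpha> \<noteq> 0 \<and> (\<exists>a\<in>\<rat>. a \<noteq> 0 \<and> L.pid (\<alpha>^3) = L.pid a)}"
  define ix where "ix \<alpha> k \<longleftrightarrow> (\<exists>a\<in>\<rat>. a \<noteq> 0 \<and> L.pid (\<alpha>^3) = L.pid a \<and> k = K.vl P a)" for \<alpha> k
  have cub: "cubic_principal_ideals L \<rat> = L.pid ` S"
  proof (intro equalityI subsetI)
    fix I assume "I \<in> cubic_principal_ideals L \<rat>"
    then have I: "I [^]\<^bsub>ideal_group L\<^esub> (3::nat) \<in> L.pid ` (\<rat> - {0})" "I \<in> L.pid ` (L - {0})"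
      by (simp_all add: cubic_principal_ideals_def cubic_ideals_def principal_ideals_def L.extended_ideals_Rats)
    obtain \<alpha> where \<alpha>: "\<alpha> \<in> L" "\<alpha> \<noteq> 0" "I = L.pid \<alpha>" using I(2) by blast
    obtain a where a: "a \<in> \<rat>" "a \<noteq> 0" "L.pid (\<alpha>^3) = L.pid a"
      using I(1) unfolding \<alpha>(3) L.pid_power_3 by blast
    then have "\<alpha> \<in> S" using \<alpha>(1,2) unfolding S_def by blast
    then show "I \<in> L.pid ` S" unfolding \<alpha>(3) by (rule imageI)
  next
    fix I assume "I \<in> L.pid ` S"
    then obtain \<alpha> a where \<alpha>: "I = L.pid \<alpha>" "\<alpha> \<in> L" "\<alpha> \<noteq> 0" "a \<in> \<rat>" "a \<noteq> 0" "L.pid (\<alpha>^3) = L.pid a"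
      by (auto simp: S_def)
    obtain m n where mn: "n > 0" "a = of_int m / of_int n" using \<alpha>(4) by (auto elim: Rats_cases')
    obtain z where z: "z \<in> OL" "\<alpha>^3 = a * z"
      using L.pid_self[of "\<alpha>^3"] unfolding \<alpha>(6) by (auto simp: principal_ideal_def)
    have "of_int n * \<alpha>^3 = of_int m * z" using mn by (simp add: z(2))
    moreover have "(of_int n * \<alpha>)^3 = of_int n ^ 2 * (of_int n * \<alpha>^3)"
      by (simp add: power_mult_distrib power2_eq_square power3_eq_cube)
    ultimately have "(of_int n * \<alpha>)^3 = of_int n ^ 2 * (of_int m * z)" by simp
    then have "of_int n * \<alpha> \<in> OL" using L.O_root[of "of_int n * \<alpha>" 3] z(1) \<alpha>(2) by simp
    then have "L.is_frac I" unfolding \<alpha>(1) using \<alpha>(3) mn(1) by (intro L.is_frac_pidI[of _ "of_int n"]) auto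
    then show "I \<in> cubic_principal_ideals L \<rat>"
      unfolding cubic_principal_ideals_def cubic_ideals_def principal_ideals_def L.extended_ideals_Rats
      using \<alpha> by (auto simp: L.fractional_ideals_iff L.pid_power_3)
  qed
  \<comment> \<open>A value at Q that is not divisible by 3 forces Q to lie over q. Then Q is P or
    its conjugate, and the rational number a has the same value at both.\<close>
  have vl_dvd: "3 dvd K.vl Q a" if \<alpha>: "\<alpha> \<in> L" "\<alpha> \<noteq> 0" and a: "a \<in> \<rat>" "a \<noteq> 0" "L.pid (\<alpha>^3) = L.pid a"
    and vP: "3 dvd K.vl P a" and Q: "Q \<in> prime_ideals K" for \<alpha> a Q
  proof (rule ccontr)
    assume nd: "\<not> 3 dvd K.vl Q a"
    obtain p where p: "Factorial_Ring.prime p" "of_nat p \<in> Q" by (rule K.exists_prime_number[OF Q])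
    have "\<alpha>^3 / a \<in> OL" "a / \<alpha>^3 \<in> OL" using L.pid_eq_iff[of "\<alpha>^3" a] \<alpha> a by auto
    then have "p \<in> prime_factors f"
      using ramified_dvd_conductor[OF Q p f _ \<alpha>(2) _ a(2) nd] \<alpha>(1) a(1) L_N OL_ON locI[OF Q] by auto
    then have "p = q" using q(2) by auto
    then have "Q = P \<or> Q = \<tau> ` P" using K.primes_over_conjugate[OF Q P(1) q(1)] p P(2) by simp
    moreover have "K.vl (\<tau> ` P) a = K.vl P a"
      using K.vl_s[OF P(1), of a] K.s_Rats[OF a(1)] a by simp
    ultimately show False using nd vP by auto
  qed
  have triv: "coset H (L.pid \<alpha>) = coset H (L.pid 1)" if \<alpha>S: "\<alpha> \<in> S" and k: "ix \<alpha> k" "3 dvd k" for \<alpha> k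
  proof -
    have \<alpha>: "\<alpha> \<in> L" "\<alpha> \<noteq> 0" using \<alpha>S by (auto simp: S_def)
    obtain a where a: "a \<in> \<rat>" "a \<noteq> 0" "L.pid (\<alpha>^3) = L.pid a" "k = K.vl P a" using k(1) by (auto simp: ix_def)
    have aK: "a \<in> K" "K.is_frac (K.pid a)" using a K.is_frac_pid by auto
    have "3 dvd n" if Q: "Q \<in> prime_ideals K" and n: "K.ideal_val Q (K.pid a) n" for Q n
      using K.ideal_val_unique[OF Q n K.ideal_val_pid[OF Q aK(1) a(2)]] vl_dvd[OF \<alpha> a(1-3) _ Q] k(2) a(4) by simp
    then obtain J where J: "K.is_frac J" "K.pid a = J \<star> J \<star> J" by (rule K.ideal_cube_root[OF aK(2)])
    obtain r where r: "r \<in> \<rat>" "r \<noteq> 0" "J \<star> \<tau> ` J = K.pid r" using K.frac_norm[OF J(1)] .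
    have JK: "J \<subseteq> K" using K.is_frac_subset[OF J(1)] .
    have JJ: "J \<star> J \<subseteq> K" using K.is_frac_subset[OF K.is_frac_idp[OF J(1) J(1)]] .
    have "K.pid a = \<tau> ` K.pid a" using K.s_image_pid[OF aK(1)] K.s_Rats[OF a(1)] by simp
    also have "\<dots> = \<tau> ` J \<star> \<tau> ` J \<star> \<tau> ` J" unfolding J(2) using K.s_idp[OF JJ JK] K.s_idp[OF JK JK] by simp
    finally have "K.pid a \<star> K.pid a = (J \<star> J \<star> J) \<star> (\<tau> ` J \<star> \<tau> ` J \<star> \<tau> ` J)" using J(2) by simp
    also have "\<dots> = (J \<star> \<tau> ` J) \<star> (J \<star> \<tau> ` J) \<star> (J \<star> \<tau> ` J)" by (simp add: idp_ac)
    finally have "K.pid (a^2) = K.pid (r^3)" by (simp add: r(3) K.pid_mult power2_eq_square power3_eq_cube)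
    then have "a^2 / r^3 \<in> OK" "r^3 / a^2 \<in> OK" using K.pid_eq_iff[of "a^2" "r^3"] a(2) r(2) by auto
    then have Z: "a^2 / r^3 \<in> \<int>" "r^3 / a^2 \<in> \<int>" using K.O_Rats a(1) r(1) by auto
    \<comment> \<open>The norm of (a) = J^3 shows that a^2 / r^3 is a unit of the rational integers.
      So a is the cube of a / r up to a unit.\<close>
    define b where "b = a / r"
    have b: "b \<in> \<rat>" "b \<noteq> 0" using a r by (auto simp: b_def)
    have "b^3 / a = a^2 / r^3" "a / b^3 = r^3 / a^2"
      using a(2) r(2) by (simp_all add: b_def power_divide power2_eq_square power3_eq_cube)
    then have "b^3 / a \<in> OL" "a / b^3 \<in> OL" using Z by (auto elim!: Ints_cases)
    then have eq: "L.pid (\<alpha>^3) = L.pid (b^3)" using L.pid_eq_iff[of a "b^3"] a b by simp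
    have "L.pid \<alpha> = L.pid b"
      by (rule pid_cube_root[OF L.complex_subfield_axioms \<alpha>(1) L.Rats_closed[OF b(1)] \<alpha>(2) b(2) eq])
    moreover have "coset H (L.pid b) = H" unfolding H_def
      using b H by (intro L.coset_pid_absorb(2)[OF _ _ _ _ L.is_module_O]) (auto simp: H_def)
    ultimately show ?thesis using L.coset_O[OF H] by simp
  qed
  show ?thesis
    unfolding absolute_dim_def cub L.extended_principal_ideals_Rats H_def[symmetric]
  proof (rule Fp_dim_3_le_one_if_index[where S = S and \<phi> = "\<lambda>\<alpha>. coset H (L.pid \<alpha>)" and index = ix])
    show "1 \<in> S" by (auto simp: S_def intro!: bexI[of _ 1])
    show "x * y \<in> S" if xS: "x \<in> S" and yS: "y \<in> S" for x y
    proof -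
      obtain a where a: "a \<in> \<rat>" "a \<noteq> 0" "L.pid (x^3) = L.pid a" using xS by (auto simp: S_def)
      obtain b where b: "b \<in> \<rat>" "b \<noteq> 0" "L.pid (y^3) = L.pid b" using yS by (auto simp: S_def)
      have "L.pid ((x * y)^3) = L.pid (a * b)"
        unfolding power_mult_distrib L.pid_mult[symmetric] a(3) b(3) ..
      moreover have "a * b \<in> \<rat>" "a * b \<noteq> 0" using a b by auto
      moreover have "x * y \<in> L" "x * y \<noteq> 0" using xS yS by (auto simp: S_def)
      ultimately show ?thesis unfolding S_def by blast
    qed
    show "carrier (ideal_group L\<lparr>carrier := L.pid ` S\<rparr> Mod H) = (\<lambda>\<alpha>. coset H (L.pid \<alpha>)) ` S"
      unfolding L.carrier_Mod by (simp add: image_image)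
    show "\<one>\<^bsub>ideal_group L\<lparr>carrier := L.pid ` S\<rparr> Mod H\<^esub> = coset H (L.pid 1)"
      using L.coset_O[OF H] by simp
    show "coset H (L.pid x) \<otimes>\<^bsub>ideal_group L\<lparr>carrier := L.pid ` S\<rparr> Mod H\<^esub> coset H (L.pid y) = coset H (L.pid (x * y))" for x y
      using L.coset_mult(2)[OF H L.is_module_pid, of _ x "L.pid y"] by (simp add: FactGroup_def L.pid_mult)
    show "\<exists>k. ix x k" if "x \<in> S" for x using that by (auto simp: S_def ix_def)
    show "ix (x * y) (k + l)" if xS: "x \<in> S" and yS: "y \<in> S" and k: "ix x k" and l: "ix y l" for x y k l
    proof -
      obtain a where a: "a \<in> \<rat>" "a \<noteq> 0" "L.pid (x^3) = L.pid a" "k = K.vl P a" using k by (auto simp: ix_def)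
      obtain b where b: "b \<in> \<rat>" "b \<noteq> 0" "L.pid (y^3) = L.pid b" "l = K.vl P b" using l by (auto simp: ix_def)
      have "L.pid ((x * y)^3) = L.pid (a * b)"
        unfolding power_mult_distrib L.pid_mult[symmetric] a(3) b(3) ..
      moreover have "a * b \<in> \<rat>" "a * b \<noteq> 0" using a b by auto
      moreover have "k + l = K.vl P (a * b)" using K.vl_mult[OF P(1), of a b] a b by simp
      ultimately show ?thesis unfolding ix_def by blast
    qed
    show "coset H (L.pid x) = coset H (L.pid 1)" if "x \<in> S" "ix x k" "3 dvd k" for x k
      using triv[OF that] .
  qed
qed

end

section \<open>Relative principal factorizations\<close>

context dihedral_cubic
begin

text \<open>An inverse of the extension of J comes from K. With its help both inclusions reduce to
  the fact that elements of N with integral cubes are integral, so ideals of N need not be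
  factored.\<close>

lemma ext_eq_pid_cube:
  assumes J: "K.is_frac J" and A: "A \<in> N" "A \<noteq> 0" "N.pid (A^3) = ext (J \<star> J \<star> J)"
  shows "N.pid A = ext J"
proof -
  define E where "E = ext (K.fr_inv J)"
  have JE: "ext J \<star> E = ON" unfolding E_def by (rule ext_inverse[OF J])
  have Em: "N.is_module E" unfolding E_def by (rule is_module_ext[OF frac_nonempty[OF K.fr_inv(1)[OF J]]])
  have Jm: "N.is_module (ext J)" by (rule is_module_ext[OF frac_nonempty[OF J]])
  have EN: "E \<subseteq> N" unfolding E_def by (rule ext_subset[OF K.is_frac_subset[OF K.fr_inv(1)[OF J]]])
  have JN: "ext J \<subseteq> N" by (rule ext_subset[OF K.is_frac_subset[OF J]])
  have A3: "N.pid (A^3) = ext J \<star> ext J \<star> ext J" using A(3) by (simp add: ext_mult)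
  have "N.pid (A^3) \<star> (E \<star> E \<star> E) = (ext J \<star> E) \<star> (ext J \<star> E) \<star> (ext J \<star> E)"
    unfolding A3 by (simp add: idp_ac)
  then have A3E: "N.pid (A^3) \<star> (E \<star> E \<star> E) = ON" by (simp add: JE)
  have "A * y \<in> ON" if y: "y \<in> E" for y
  proof -
    have "A^3 * (y * y * y) \<in> N.pid (A^3) \<star> (E \<star> E \<star> E)" by (intro idp_prod N.pid_self y)
    then have "(A * y)^3 \<in> ON" unfolding A3E by (simp add: power3_eq_cube mult_ac)
    then show ?thesis using N.O_root[of "A * y" 3] N.mult_closed[OF A(1) subsetD[OF EN y]] by simp
  qed
  then have "N.pid A \<star> E \<subseteq> ON" unfolding N.pid_idp[OF Em] by auto
  then have "ext J \<star> (N.pid A \<star> E) \<subseteq> ext J \<star> ON" by (intro idp_mono) auto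
  moreover have "ext J \<star> (N.pid A \<star> E) = N.pid A"
    using JE N.is_module_pid[of A] by (simp add: idp_left_commute[of "ext J"])
  ultimately have le: "N.pid A \<subseteq> ext J" using Jm by simp
  have "b \<in> N.pid A" if b: "b \<in> ext J" for b
  proof -
    have "b * b * b \<in> N.pid (A^3)" unfolding A3 by (intro idp_prod b)
    then have "(b / A)^3 \<in> ON" using A(2) by (auto simp: principal_ideal_def power_divide power3_eq_cube[of b])
    then have "b / A \<in> ON" using N.O_root[of "b / A" 3] A(1) b JN by auto
    then show ?thesis unfolding principal_ideal_def using A(2) by (intro image_eqI[of _ _ "b / A"]) auto
  qed
  then show ?thesis using le by blast
qed

text \<open>The hypothesis on \<open>A * \<tau> A\<close> is what the kernel of the norm provides.
  In N the extension of I times its conjugate has the rational generators g and \<open>r^3\<close>;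
  their quotient is a unit of N that lies in K, hence a unit of K.\<close>

lemma ext_pid_conjugate:
  assumes I: "K.is_frac I" and A: "A \<in> N" "A \<noteq> 0" "N.pid (A^3) = ext I"
    and r: "r \<in> \<rat>" "r \<noteq> 0" "L.pid (A * \<tau> A) = L.pid r"
  shows "I \<star> \<tau> ` I = K.pid (r^3)"
proof -
  obtain g where g: "g \<in> \<rat>" "g \<noteq> 0" "I \<star> \<tau> ` I = K.pid g" using K.frac_norm[OF I] .
  have \<tau>A: "\<tau> A \<in> N" "\<tau> A \<noteq> 0" using A by auto
  have "ext (\<tau> ` I) = \<tau> ` ext I" using \<tau>_ext[OF K.is_frac_subset[OF I]] ..
  also have "\<dots> = N.pid (\<tau> A ^ 3)"
    unfolding A(3)[symmetric] using A(1) by (subst T.s_pid) (auto simp: \<tau>_ON)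
  finally have "N.pid g = N.pid ((A * \<tau> A)^3)"
    using g(3) ext_mult[of I "\<tau> ` I"] by (simp add: ext_pid A(3)[symmetric] N.pid_mult power_mult_distrib)
  moreover have "N.pid ((A * \<tau> A)^3) = N.pid (r^3)"
  proof -
    have "A * \<tau> A / r \<in> ON" "r / (A * \<tau> A) \<in> ON"
      using L.pid_eq_iff[of "A * \<tau> A" r] A(2) \<tau>A(2) r OL_ON by auto
    then have "(A * \<tau> A / r)^3 \<in> ON" "(r / (A * \<tau> A))^3 \<in> ON" by (auto intro: N.O_power)
    then show ?thesis using A(2) \<tau>A(2) r(2) by (subst N.pid_eq_iff) (auto simp: power_divide)
  qed
  ultimately have "g / r^3 \<in> ON" "r^3 / g \<in> ON" using N.pid_eq_iff[of g "r^3"] g(2) r(2) by auto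
  moreover have "g / r^3 \<in> K" "r^3 / g \<in> K" using g(1) r(1) by auto
  ultimately have "g / r^3 \<in> OK" "r^3 / g \<in> OK" using ON_K by blast+
  then have "K.pid g = K.pid (r^3)" using K.pid_eq_iff[of g "r^3"] g(2) r(2) by auto
  then show ?thesis using g(3) by simp
qed

text \<open>An element x of I of least value generates I locally at Q, so it can serve as k in
  \<open>ramified_dvd_conductor\<close>. The certificate y of \<open>ideal_val\<close> clears the
  denominator of A^3 / x.\<close>

lemma ramified_ideal_val:
  assumes f: "f \<ge> 1" "conductor N K = principal_ideal K (of_nat f)"
    and I: "K.is_frac I" and A: "A \<in> N" "A \<noteq> 0" "N.pid (A^3) = ext I"
    and Q: "Q \<in> prime_ideals K" and n: "K.ideal_val Q I n" "\<not> 3 dvd n"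
    and p: "Factorial_Ring.prime p" "of_nat p \<in> Q"
  shows "p \<in> prime_factors f"
proof -
  obtain x y where *: "x \<in> I" "y \<in> K" "x \<in> K" "x * y \<in> OK - Q" "\<And>z. z \<in> I \<Longrightarrow> z * y \<in> OK" "K.vl Q x = n"
    using n(1) by (auto simp: K.ideal_val_def)
  have x0: "x \<noteq> 0" using K.out_nonzero[OF Q *(4)] by auto
  have "ext I \<subseteq> {w. w * y \<in> ON}"
    unfolding ideal_extension_def
  proof (rule idp_subsetI)
    fix i j assume "i \<in> I" "j \<in> ON"
    then have "(i * y) * j \<in> ON" using *(5) OK_ON by blast
    then show "i * j \<in> {w. w * y \<in> ON}" by (simp add: mult_ac)
  qed (auto simp: distrib_right)
  then have "A^3 * y \<in> ON" using N.pid_self[of "A^3"] A(3) by auto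
  then have "x * y * (A^3 / x) \<in> ON" using x0 by (simp add: mult.commute)
  moreover have "A^3 / x \<in> N" using A(1) *(3) K_N by auto
  ultimately have 1: "loc Q (A^3 / x)" unfolding loc_def using *(4) by blast
  have "x \<in> N.pid (A^3)" unfolding A(3) using *(1) by (rule mem_ext)
  then have "x / A^3 \<in> ON" using A(2) by (auto simp: principal_ideal_def)
  then have "loc Q (x / A^3)" by (rule locI[OF Q])
  then show ?thesis using ramified_dvd_conductor[OF Q p f A(1,2) *(3) x0 _ 1] n(2) *(6) by simp
qed

theorem relative_dim_le_one:
  assumes f: "f \<ge> 1" "conductor N K = principal_ideal K (of_nat f)"
    and card: "card {p \<in> prime_factors f. splits_in_quadratic p K} \<le> 1"
  shows "relative_dim L K N \<le> 1"
proof -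
  obtain q where q: "Factorial_Ring.prime q" "{p \<in> prime_factors f. splits_in_quadratic p K} \<subseteq> {q}"
    by (rule subset_singleton_prime[OF _ card]) auto
  obtain P where P: "P \<in> prime_ideals K" "of_nat q \<in> P" by (rule K.exists_prime_over[OF q(1)])
  define H where "H = extended_ideals N K"
  define HL where "HL = extended_ideals L \<rat>"
  have HL: "HL = L.pid ` (\<rat> - {0})" by (simp add: HL_def L.extended_ideals_Rats)
  have HLm: "L.module_monoid HL" unfolding HL by (rule L.module_monoid_pid) auto
  have H: "N.module_monoid H" unfolding H_def by (rule module_monoid_extended_ideals)
  have H_iff: "E \<in> H \<longleftrightarrow> (\<exists>I. K.is_frac I \<and> E = ext I)" for E
    by (auto simp: H_def extended_ideals_def K.fractional_ideals_iff)
  \<comment> \<open>The last condition expresses membership in the kernel: the norm of (A) from N to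
    L is generated by \<open>A * \<tau> A\<close>.\<close>
  define S where "S = {A \<in> N. A \<noteq> 0 \<and> (\<exists>I. K.is_frac I \<and> N.pid (A^3) = ext I) \<and> L.pid (A * \<tau> A) \<in> HL}"
  define ix where "ix A k \<longleftrightarrow> (\<exists>I. K.is_frac I \<and> N.pid (A^3) = ext I \<and> K.ideal_val P I k)" for A k
  define \<Phi> where "\<Phi> = induced_map (ideal_group L) HL (ideal_norm N L)"
  \<comment> \<open>The induced map takes a union over all representatives of a coset. Multiplying
    (A) by the extension of b changes the norm by a rational factor only, so every member of the
    union is the same coset.\<close>
  have \<Phi>: "\<Phi> (coset H (N.pid A)) = coset HL (L.pid (A * \<tau> A))" if A: "A \<in> N" for A
  proof -
    have *: "coset HL (ideal_norm N L (ext b \<star> N.pid A)) = coset HL (L.pid (A * \<tau> A))" if b: "K.is_frac b" for b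
    proof -
      obtain g where g: "g \<in> \<rat>" "g \<noteq> 0" "b \<star> \<tau> ` b = K.pid g" using K.frac_norm[OF b] .
      have "ideal_norm N L (ext b \<star> N.pid A) = L.pid g \<star> L.pid (A * \<tau> A)"
        using ideal_norm_ext_pid[OF b g A] by (simp add: L.pid_mult mult_ac)
      then show ?thesis
        using L.coset_pid_absorb(1)[of g "\<rat> - {0}" "L.pid (A * \<tau> A)"] g HLm L.is_module_pid by (simp add: HL)
    qed
    have "fractional_ideals K = {b. K.is_frac b}" by (auto simp: K.fractional_ideals_iff)
    then have "coset H (N.pid A) = (\<lambda>b. ext b \<star> N.pid A) ` {b. K.is_frac b}"
      by (simp add: coset_def H_def extended_ideals_def image_image)
    then have "\<Phi> (coset H (N.pid A)) = (\<Union>b\<in>{b. K.is_frac b}. coset HL (ideal_norm N L (ext b \<star> N.pid A)))"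
      by (simp add: \<Phi>_def induced_map_def)
    also have "\<dots> = (\<Union>b\<in>{b. K.is_frac b}. coset HL (L.pid (A * \<tau> A)))" using * by (intro SUP_cong) auto
    also have "\<dots> = coset HL (L.pid (A * \<tau> A))" using K.is_frac_O by blast
    finally show ?thesis .
  qed
  have cub: "N.pid A \<in> cubic_ideals N K" if A: "A \<in> N" "A \<noteq> 0" "K.is_frac I" "N.pid (A^3) = ext I" for A I
  proof -
    obtain d where d: "d \<in> OK" "d \<noteq> 0" "\<And>z. z \<in> I \<Longrightarrow> d * z \<in> OK" using A(3) by (auto simp: K.is_frac_def)
    have "ext I \<subseteq> {w. d * w \<in> ON}"
      unfolding ideal_extension_def
    proof (rule idp_subsetI)
      fix i j assume "i \<in> I" "j \<in> ON"
      then have "(d * i) * j \<in> ON" using d(3) OK_ON by blast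
      then show "i * j \<in> {w. d * w \<in> ON}" by (simp add: mult_ac)
    qed (auto simp: distrib_left)
    then have "d * A^3 \<in> ON" using N.pid_self[of "A^3"] A(4) by auto
    then have "(d * d) * (d * A^3) \<in> ON" using OK_ON[OF d(1)] by blast
    then have "(d * A)^3 \<in> ON" by (simp add: power3_eq_cube mult_ac)
    then have "d * A \<in> ON" using N.O_root[of "d * A" 3] A(1) N.O_subset[OF OK_ON[OF d(1)]] by simp
    then have "N.is_frac (N.pid A)" using A(2) d OK_ON by (intro N.is_frac_pidI[of _ d]) auto
    then show ?thesis using A(3,4) by (auto simp: cubic_ideals_def N.fractional_ideals_iff N.pid_power_3 extended_ideals_def K.fractional_ideals_iff)
  qed
  define Q where "Q = cubic_ideals_quot N K"
  have Q: "carrier Q = coset H ` cubic_ideals N K" "\<one>\<^bsub>Q\<^esub> = H"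
    by (simp_all add: Q_def cubic_ideals_quot_def N.carrier_Mod H_def)
  have ker: "kernel Q (cubic_ideals_quot L \<rat>) \<Phi> = {c \<in> carrier Q. \<Phi> c = HL}"
    by (simp add: kernel_def cubic_ideals_quot_def HL_def)
  define G where "G = Q\<lparr>carrier := kernel Q (cubic_ideals_quot L \<rat>) \<Phi>
      \<inter> carrier ((ideal_group N)\<lparr>carrier := cubic_principal_ideals N K <#>\<^bsub>ideal_group N\<^esub> H\<rparr> Mod H)\<rparr>"
  have GS: "carrier G = (\<lambda>A. coset H (N.pid A)) ` S"
  proof (intro equalityI subsetI)
    fix c assume "c \<in> carrier G"
    then have c: "\<Phi> c = HL" "c \<in> coset H ` (cubic_principal_ideals N K <#>\<^bsub>ideal_group N\<^esub> H)"
      by (simp_all add: G_def ker N.carrier_Mod)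
    then obtain I E where IE: "I \<in> cubic_principal_ideals N K" "E \<in> H" "c = coset H (I \<star> E)"
      by (auto simp: set_mult_def)
    obtain A where A: "A \<in> N" "A \<noteq> 0" "I = N.pid A" "I [^]\<^bsub>ideal_group N\<^esub> (3::nat) \<in> H"
      using IE(1) by (auto simp: cubic_principal_ideals_def cubic_ideals_def principal_ideals_def H_def)
    obtain b where b: "K.is_frac b" "E = ext b" using IE(2) H_iff by blast
    have cA: "c = coset H (N.pid A)"
      unfolding IE(3) A(3) b(2) H_def using coset_ext_absorb(1)[OF b(1) N.is_module_pid] by (simp add: idp_commute)
    have "coset HL (L.pid (A * \<tau> A)) = HL" using c(1) \<Phi>[OF A(1)] cA by simp
    then have "L.pid (A * \<tau> A) \<in> HL" using L.coset_self_mem[OF HLm L.is_module_pid] by blast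
    moreover have "N.pid (A^3) \<in> H" using A(4) by (simp add: A(3) N.pid_power_3)
    ultimately show "c \<in> (\<lambda>A. coset H (N.pid A)) ` S" using A cA H_iff by (auto simp: S_def)
  next
    fix c assume "c \<in> (\<lambda>A. coset H (N.pid A)) ` S"
    then obtain A I r where A: "c = coset H (N.pid A)" "A \<in> N" "A \<noteq> 0" "K.is_frac I" "N.pid (A^3) = ext I"
      "r \<in> \<rat>" "r \<noteq> 0" "L.pid (A * \<tau> A) = L.pid r"
      by (auto simp: S_def HL)
    have cA: "N.pid A \<in> cubic_ideals N K" using A by (intro cub)
    have "coset HL (L.pid r) = HL"
      using L.coset_pid_absorb(2)[of r "\<rat> - {0}", OF _ _ _ _ L.is_module_O] A(6,7) HLm by (simp add: HL)
    then have "\<Phi> c = HL" using \<Phi>[OF A(2)] A(1,8) by simp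
    moreover have "N.pid A \<in> cubic_principal_ideals N K"
      using cA A by (auto simp: cubic_principal_ideals_def principal_ideals_def)
    then have "N.pid A \<star> ON \<in> cubic_principal_ideals N K <#>\<^bsub>ideal_group N\<^esub> H"
      using H by (auto simp: set_mult_def N.module_monoid_def)
    then have "N.pid A \<in> cubic_principal_ideals N K <#>\<^bsub>ideal_group N\<^esub> H"
      using N.is_module_pid[of A] by simp
    ultimately show "c \<in> carrier G" using cA A(1) by (simp add: G_def ker Q N.carrier_Mod)
  qed
  have val_dvd: "3 dvd n"
    if A: "A \<in> S" and I: "K.is_frac I" "N.pid (A^3) = ext I" and k: "K.ideal_val P I k" "3 dvd k"
      and R: "R \<in> prime_ideals K" "K.ideal_val R I n" for A I k R n
  proof (rule ccontr)
    assume nd: "\<not> 3 dvd n"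
    have AN: "A \<in> N" "A \<noteq> 0" using A by (auto simp: S_def)
    obtain r where r: "r \<in> \<rat>" "r \<noteq> 0" "L.pid (A * \<tau> A) = L.pid r" using A by (auto simp: S_def HL)
    have conj: "I \<star> \<tau> ` I = K.pid (r^3)" by (rule ext_pid_conjugate[OF I(1) AN I(2) r])
    have IK: "I \<subseteq> K" using K.is_frac_subset[OF I(1)] .
    interpret V: discrete_valuation K "K.vl R" "K.unif R" by (rule K.discrete_valuation_vl[OF R(1)])
    have sum: "3 dvd n + m" if m: "K.ideal_val R (\<tau> ` I) m" for m
    proof -
      have "K.ideal_val R (K.pid (r^3)) (n + m)"
        unfolding conj[symmetric] by (rule K.ideal_val_mult[OF R(1,2) m])
      then have "n + m = K.vl R (r^3)"
        using K.ideal_val_unique[OF R(1) _ K.ideal_val_pid[OF R(1), of "r^3"]] r by simp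
      then show ?thesis using V.v_power[of r 3] r by simp
    qed
    obtain p where p: "Factorial_Ring.prime p" "of_nat p \<in> R" by (rule K.exists_prime_number[OF R(1)])
    have pf: "p \<in> prime_factors f" by (rule ramified_ideal_val[OF f I(1) AN I(2) R nd p])
    have "\<tau> ` R \<noteq> R"
    proof
      assume "\<tau> ` R = R"
      then have "3 dvd n + n" using sum[of n] K.ideal_val_s[OF R(1) IK R(2)] by simp
      then show False using nd by presburger
    qed
    then have "splits_in_quadratic p K" using K.splits_if_not_self_conjugate[OF R(1) _ p] by simp
    then have "p = q" using pf q(2) by auto
    then have "R = P \<or> R = \<tau> ` P" using K.primes_over_conjugate[OF R(1) P(1) q(1)] p P(2) by simp
    then show False
    proof
      assume "R = P"
      then have "n = k" using K.ideal_val_unique[OF P(1) _ k(1)] R(2) by simp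
      then show False using nd k(2) by simp
    next
      assume "R = \<tau> ` P"
      then have "3 dvd n + k" using sum[of k] K.ideal_val_s[OF P(1) IK k(1)] by simp
      then show False using nd k(2) by presburger
    qed
  qed
  have S_mult: "\<exists>I'. K.is_frac I' \<and> N.pid ((A * B)^3) = ext I' \<and> (\<forall>k l. K.ideal_val P I k \<longrightarrow> K.ideal_val P J l \<longrightarrow> K.ideal_val P I' (k + l))"
    if "K.is_frac I" "N.pid (A^3) = ext I" "K.is_frac J" "N.pid (B^3) = ext J" for A B I J
    using that K.is_frac_idp[of I J] K.ideal_val_mult[OF P(1), of I _ J]
    by (intro exI[of _ "I \<star> J"]) (simp add: power_mult_distrib N.pid_mult[symmetric] ext_mult)
  have "Fp_dim 3 G \<le> 1"
  proof (rule Fp_dim_3_le_one_if_index[where S = S and \<phi> = "\<lambda>A. coset H (N.pid A)" and index = ix])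
    show "1 \<in> S"
      using K.is_frac_O ext_OK by (auto simp: S_def HL intro!: exI[of _ OK] image_eqI[of _ _ 1])
    show "x * y \<in> S" if xS: "x \<in> S" and yS: "y \<in> S" for x y
    proof -
      obtain I r where x: "x \<in> N" "x \<noteq> 0" "K.is_frac I" "N.pid (x^3) = ext I" "r \<in> \<rat>" "r \<noteq> 0" "L.pid (x * \<tau> x) = L.pid r"
        using xS by (auto simp: S_def HL)
      obtain J r' where y: "y \<in> N" "y \<noteq> 0" "K.is_frac J" "N.pid (y^3) = ext J" "r' \<in> \<rat>" "r' \<noteq> 0" "L.pid (y * \<tau> y) = L.pid r'"
        using yS by (auto simp: S_def HL)
      have "x * y * \<tau> (x * y) = (x * \<tau> x) * (y * \<tau> y)" using x(1) y(1) by (simp add: mult_ac)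
      then have "L.pid (x * y * \<tau> (x * y)) = L.pid (x * \<tau> x) \<star> L.pid (y * \<tau> y)"
        by (simp only: L.pid_mult)
      then have "L.pid (x * y * \<tau> (x * y)) = L.pid (r * r')" by (simp only: x(7) y(7) L.pid_mult)
      moreover have "r * r' \<in> \<rat> - {0}" using x y by simp
      ultimately have "L.pid (x * y * \<tau> (x * y)) \<in> HL" unfolding HL by blast
      moreover obtain I' where "K.is_frac I'" "N.pid ((x * y)^3) = ext I'"
        using S_mult[OF x(3,4) y(3,4)] by blast
      moreover have "x * y \<in> N" "x * y \<noteq> 0" using x(1,2) y(1,2) by simp_all
      ultimately show ?thesis unfolding S_def by blast
    qed
    show "carrier G = (\<lambda>A. coset H (N.pid A)) ` S" by (rule GS)
    show "\<one>\<^bsub>G\<^esub> = coset H (N.pid 1)" using N.coset_O[OF H] Q(2) by (simp add: G_def)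
    show "coset H (N.pid x) \<otimes>\<^bsub>G\<^esub> coset H (N.pid y) = coset H (N.pid (x * y))" for x y
      using N.coset_mult(2)[OF H N.is_module_pid, of _ x "N.pid y"]
      by (simp add: G_def Q_def cubic_ideals_quot_def FactGroup_def N.pid_mult)
    show "\<exists>k. ix x k" if xS: "x \<in> S" for x
    proof -
      obtain I where I: "K.is_frac I" "N.pid (x^3) = ext I" using xS by (auto simp: S_def)
      then show ?thesis using K.ideal_val_exists[OF P(1) I(1)] unfolding ix_def by blast
    qed
    show "ix (x * y) (k + l)" if k: "ix x k" and l: "ix y l" for x y k l
    proof -
      obtain I where I: "K.is_frac I" "N.pid (x^3) = ext I" "K.ideal_val P I k" using k by (auto simp: ix_def)
      obtain J where J: "K.is_frac J" "N.pid (y^3) = ext J" "K.ideal_val P J l" using l by (auto simp: ix_def)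
      show ?thesis unfolding ix_def using S_mult[OF I(1,2) J(1,2)] I(3) J(3) by blast
    qed
    show "coset H (N.pid x) = coset H (N.pid 1)" if xS: "x \<in> S" and k: "ix x k" "3 dvd k" for x k
    proof -
      have xN: "x \<in> N" "x \<noteq> 0" using xS by (auto simp: S_def)
      obtain I where I: "K.is_frac I" "N.pid (x^3) = ext I" "K.ideal_val P I k" using k(1) by (auto simp: ix_def)
      have "3 dvd n" if "R \<in> prime_ideals K" "K.ideal_val R I n" for R n
        by (rule val_dvd[OF xS I(1,2,3) k(2) that])
      then obtain J where J: "K.is_frac J" "I = J \<star> J \<star> J" by (rule K.ideal_cube_root[OF I(1)])
      have "N.pid x = ext J" using I(2) unfolding J(2) by (rule ext_eq_pid_cube[OF J(1) xN])
      then have "coset H (N.pid x) = H" using coset_ext_absorb(2)[OF J(1) N.is_module_O] by (simp add: H_def)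
      then show ?thesis using N.coset_O[OF H] by simp
    qed
  qed
  then show ?thesis unfolding relative_dim_def G_def Q_def \<Phi>_def H_def HL_def .
qed

end

section \<open>Capitulation\<close>

context dihedral_cubic
begin

text \<open>Intersecting with K gives one inclusion. The other follows from the same inclusion for
  the inverse ideal, whose extension is generated by the inverse of \<nu>.\<close>

lemma ext_pid_descends:
  assumes b: "K.is_frac b" and \<nu>: "\<nu> \<in> K" "\<nu> \<noteq> 0" "ext b = N.pid \<nu>"
  shows "b = K.pid \<nu>"
proof -
  have sub: "I \<subseteq> K.pid \<mu>" if I: "K.is_frac I" and \<mu>: "\<mu> \<in> K" "\<mu> \<noteq> 0" "ext I = N.pid \<mu>" for I \<mu>
  proof
    fix x assume x: "x \<in> I"
    then have "x \<in> N.pid \<mu>" using mem_ext \<mu>(3) by blast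
    then have "x / \<mu> \<in> ON" using \<mu>(2) by (auto simp: principal_ideal_def)
    moreover have "x / \<mu> \<in> K" using x K.is_frac_subset[OF I] \<mu>(1) by blast
    ultimately have "x / \<mu> \<in> OK" by (rule ON_K)
    then show "x \<in> K.pid \<mu>" unfolding principal_ideal_def using \<mu>(2) by (intro image_eqI[of _ _ "x / \<mu>"]) auto
  qed
  define E where "E = K.fr_inv b"
  have E: "K.is_frac E" "E \<star> b = OK" using K.fr_inv[OF b] by (simp_all add: E_def)
  have Em: "N.is_module (ext E)" by (rule is_module_ext[OF frac_nonempty[OF E(1)]])
  have "N.pid \<nu> \<star> ext E = ON" unfolding E_def \<nu>(3)[symmetric] by (rule ext_inverse[OF b])
  then have "N.pid (inverse \<nu>) \<star> (N.pid \<nu> \<star> ext E) = N.pid (inverse \<nu>)" using N.is_module_pid by simp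
  moreover have "N.pid (inverse \<nu>) \<star> (N.pid \<nu> \<star> ext E) = ext E"
    unfolding idp_assoc[symmetric] N.pid_mult using \<nu>(2) Em by simp
  ultimately have "ext E = N.pid (inverse \<nu>)" by simp
  then have "E \<subseteq> K.pid (inverse \<nu>)" using \<nu> by (intro sub[OF E(1)]) auto
  then have "K.pid \<nu> \<star> E \<subseteq> K.pid \<nu> \<star> K.pid (inverse \<nu>)" by (intro idp_mono) auto
  also have "\<dots> = OK" using \<nu>(2) by (simp add: K.pid_mult)
  finally have "(K.pid \<nu> \<star> E) \<star> b \<subseteq> OK \<star> b" by (intro idp_mono) auto
  then have "K.pid \<nu> \<subseteq> b" using E(2) K.is_module_pid K.is_frac_module[OF b] by (simp add: idp_assoc)
  then show ?thesis using sub[OF b \<nu>] by blast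
qed

text \<open>If \<open>I\<close> becomes principal in \<open>N\<close>, generated by \<open>\<alpha>\<close>, then the conjugates of \<open>\<alpha>\<close> generate the
  same ideal, so \<open>I\<^sup>3\<close> becomes the ideal generated by the norm of \<open>\<alpha>\<close>.\<close>

lemma capitulating_cube_principal:
  assumes I: "K.is_frac I" and \<alpha>: "\<alpha> \<in> N" "\<alpha> \<noteq> 0" "ext I = N.pid \<alpha>"
  obtains \<nu> where "\<nu> \<in> K" "\<nu> \<noteq> 0" "I \<star> I \<star> I = K.pid \<nu>"
proof -
  define \<nu> where "\<nu> = \<alpha> * \<sigma> \<alpha> * \<sigma> (\<sigma> \<alpha>)"
  have conj: "N.pid (\<sigma> \<beta>) = N.pid \<alpha>" if "\<beta> \<in> N" "N.pid \<beta> = N.pid \<alpha>" for \<beta>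
    using N.s_pid[OF \<sigma>_ON that(1)] \<sigma>_ext[OF K.is_frac_subset[OF I]] that(2) \<alpha>(3) by simp
  have 1: "N.pid (\<sigma> \<alpha>) = N.pid \<alpha>" using conj[OF \<alpha>(1)] by simp
  have 2: "N.pid (\<sigma> (\<sigma> \<alpha>)) = N.pid \<alpha>" using conj[OF _ 1] \<alpha>(1) by simp
  have "\<nu> \<in> N" "\<nu> \<noteq> 0" using \<alpha> by (auto simp: \<nu>_def)
  moreover have "\<sigma> \<nu> = \<nu>" using \<alpha>(1) \<sigma>_cubed[OF \<alpha>(1)] by (simp add: \<nu>_def mult_ac)
  ultimately have \<nu>: "\<nu> \<in> K" "\<nu> \<noteq> 0" using \<sigma>_fixed by blast+
  have "ext (I \<star> I \<star> I) = N.pid \<nu>"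
    unfolding ext_mult \<nu>_def N.pid_mult[symmetric] 1 2 \<alpha>(3) ..
  then have "I \<star> I \<star> I = K.pid \<nu>" using I \<nu> by (intro ext_pid_descends K.is_frac_idp) auto
  then show ?thesis using \<nu> by (intro that[of \<nu>])
qed

theorem capitulation_dim_le_one:
  assumes rank: "p_class_rank 3 K \<le> 1"
  shows "capitulation_dim N K \<le> 1"
proof -
  define H where "H = principal_ideals K"
  define HN where "HN = principal_ideals N"
  have Hpid: "H = K.pid ` (K - {0})" "HN = N.pid ` (N - {0})" by (auto simp: H_def HN_def principal_ideals_def)
  have Hm: "K.module_monoid H" unfolding Hpid by (rule K.module_monoid_pid) auto
  have HNm: "N.module_monoid HN" unfolding Hpid by (rule N.module_monoid_pid) auto
  define Cl where "Cl = class_group K"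
  have Cl_eq: "Cl = ideal_group K Mod H" by (simp add: Cl_def class_group_def H_def)
  interpret I: comm_group "ideal_group K" by (rule K.comm_group_ideal_group)
  have fracK: "K.pid x \<in> fractional_ideals K" if "x \<in> K" "x \<noteq> 0" for x
    using K.is_frac_pid[OF that] by (simp add: K.fractional_ideals_iff)
  have sub: "subgroup H (ideal_group K)"
  proof (rule I.subgroupI)
    show "H \<subseteq> carrier (ideal_group K)" using fracK by (auto simp: Hpid)
    show "H \<noteq> {}" using Hm by (auto simp: K.module_monoid_def)
    fix A assume "A \<in> H"
    then obtain x where x: "x \<in> K" "x \<noteq> 0" "A = K.pid x" by (auto simp: Hpid)
    have "inv\<^bsub>ideal_group K\<^esub> A = K.pid (inverse x)"
      using x fracK by (intro I.inv_equality) (auto simp: K.pid_mult)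
    then show "inv\<^bsub>ideal_group K\<^esub> A \<in> H" using x by (auto simp: Hpid)
    fix B assume "B \<in> H"
    then show "A \<otimes>\<^bsub>ideal_group K\<^esub> B \<in> H" using Hm \<open>A \<in> H\<close> by (simp add: K.module_monoid_def)
  qed
  interpret Cl: comm_group Cl unfolding Cl_eq using sub by (rule I.abelian_FactGroup)
  have H_normal: "H \<lhd> ideal_group K" using sub by (rule I.subgroup_imp_normal)
  have carrier_Cl: "carrier Cl = coset H ` {I. K.is_frac I}"
    unfolding Cl_eq K.carrier_Mod by (auto simp: K.fractional_ideals_iff)
  have one_Cl: "\<one>\<^bsub>Cl\<^esub> = H" by (simp add: Cl_eq)
  have mult_Cl: "coset H A \<otimes>\<^bsub>Cl\<^esub> coset H B = coset H (A \<star> B)" if "K.is_frac A" for A B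
    using K.coset_mult(1)[OF Hm K.is_frac_module[OF that], of B] by (simp add: Cl_eq FactGroup_def)
  have absorb: "coset H (K.pid x \<star> A) = coset H A" "coset H (K.pid x) = H"
    if "x \<in> K" "x \<noteq> 0" "K.is_module A" for x A
    using K.coset_pid_absorb[of x "K - {0}" A] that Hm by (simp_all add: Hpid)
  \<comment> \<open>The comparison of classes killed by 3 with the quotient by cubes counts
    elements, so it depends on the finiteness of the class number.\<close>
  have fin: "finite (carrier Cl)"
  proof -
    obtain m where m: "m > 0"
      "\<And>I. K.is_frac I \<Longrightarrow> \<exists>k J. k \<in> K \<and> k \<noteq> 0 \<and> K.is_frac J \<and> J \<subseteq> OK \<and> of_nat m \<in> J \<and> I = K.pid k \<star> J"
      using K.class_representatives by metis
    have "carrier Cl \<subseteq> coset H ` {J. K.is_frac J \<and> J \<subseteq> OK \<and> of_nat m \<in> J}"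
    proof
      fix c assume "c \<in> carrier Cl"
      then obtain I where I: "K.is_frac I" "c = coset H I" using carrier_Cl by blast
      obtain k J where "k \<in> K" "k \<noteq> 0" "K.is_frac J" "J \<subseteq> OK" "of_nat m \<in> J" "I = K.pid k \<star> J"
        using m(2)[OF I(1)] by blast
      then show "c \<in> coset H ` {J. K.is_frac J \<and> J \<subseteq> OK \<and> of_nat m \<in> J}"
        using absorb(1)[of k J] K.is_frac_module I(2) by blast
    qed
    then show ?thesis by (rule finite_subset) (rule finite_imageI, rule K.finite_ideals_containing[OF m(1)])
  qed
  define Ker where "Ker = kernel Cl (class_group N) (induced_map (ideal_group N) HN ext)"
  \<comment> \<open>The induced map unites the cosets of all extended representatives. For a trivial
    union the extension of I lies in the trivial coset; conversely all representatives differ from I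
    by principal ideals.\<close>
  have Ker: "Ker = coset H ` {I. K.is_frac I \<and> ext I \<in> HN}"
  proof (intro equalityI subsetI)
    fix c assume c: "c \<in> Ker"
    then obtain I where I: "K.is_frac I" "c = coset H I" by (auto simp: Ker_def kernel_def carrier_Cl)
    have "(\<Union>J\<in>coset H I. coset HN (ext J)) = HN"
      using c I(2) by (simp add: Ker_def kernel_def induced_map_def class_group_def HN_def)
    moreover have "I \<in> coset H I" using K.coset_self_mem[OF Hm K.is_frac_module[OF I(1)]] .
    moreover have "ext I \<in> coset HN (ext I)" using N.coset_self_mem[OF HNm is_module_ext[OF frac_nonempty[OF I(1)]]] .
    ultimately have "ext I \<in> HN" by blast
    then show "c \<in> coset H ` {I. K.is_frac I \<and> ext I \<in> HN}" using I by blast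
  next
    fix c assume "c \<in> coset H ` {I. K.is_frac I \<and> ext I \<in> HN}"
    then obtain I \<alpha> where I: "K.is_frac I" "c = coset H I" "\<alpha> \<in> N" "\<alpha> \<noteq> 0" "ext I = N.pid \<alpha>"
      by (auto simp: Hpid)
    have "coset HN (ext J) = HN" if J: "J \<in> c" for J
    proof -
      obtain x where x: "x \<in> K" "x \<noteq> 0" "J = K.pid x \<star> I"
        using J unfolding I(2) coset_def Hpid(1) by blast
      have "ext J = N.pid (x * \<alpha>)" unfolding x(3) ext_mult ext_pid I(5) N.pid_mult ..
      then show ?thesis
        using N.coset_pid_absorb(2)[of "x * \<alpha>" "N - {0}", OF _ _ _ _ N.is_module_O] x(1,2) K_N[OF x(1)] I(3,4) HNm
        by (simp add: Hpid)
    qed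
    moreover have "I \<in> c" using K.coset_self_mem[OF Hm K.is_frac_module[OF I(1)]] I(2) by simp
    ultimately have "(\<Union>J\<in>c. coset HN (ext J)) = HN" by blast
    then show "c \<in> Ker" using I(1,2)
      by (simp add: Ker_def kernel_def induced_map_def class_group_def HN_def carrier_Cl)
  qed
  have cube: "c \<otimes>\<^bsub>Cl\<^esub> c \<otimes>\<^bsub>Cl\<^esub> c = H" if "c \<in> Ker" for c
  proof -
    obtain I \<alpha> where I: "K.is_frac I" "c = coset H I" "\<alpha> \<in> N" "\<alpha> \<noteq> 0" "ext I = N.pid \<alpha>"
      using \<open>c \<in> Ker\<close> by (auto simp: Ker Hpid)
    obtain \<nu> where \<nu>: "\<nu> \<in> K" "\<nu> \<noteq> 0" "I \<star> I \<star> I = K.pid \<nu>"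
      by (rule capitulating_cube_principal[OF I(1,3,4,5)])
    have "c \<otimes>\<^bsub>Cl\<^esub> c \<otimes>\<^bsub>Cl\<^esub> c = coset H (I \<star> I \<star> I)"
      unfolding I(2) mult_Cl[OF I(1)] mult_Cl[OF K.is_frac_idp[OF I(1) I(1)]] ..
    then show ?thesis unfolding \<nu>(3) using absorb(2)[OF \<nu>(1,2) K.is_module_O] by simp
  qed
  have Ker_sub: "Ker \<subseteq> carrier Cl" unfolding Ker carrier_Cl by blast
  have Ker_mult: "c \<otimes>\<^bsub>Cl\<^esub> d \<in> Ker" if c: "c \<in> Ker" and d: "d \<in> Ker" for c d
  proof -
    obtain I where I: "K.is_frac I" "ext I \<in> HN" "c = coset H I" using c unfolding Ker by blast
    obtain J where J: "K.is_frac J" "ext J \<in> HN" "d = coset H J" using d unfolding Ker by blast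
    have "ext (I \<star> J) \<in> HN" unfolding ext_mult using HNm I(2) J(2) by (simp add: N.module_monoid_def)
    then show ?thesis unfolding I(3) J(3) mult_Cl[OF I(1)] Ker using K.is_frac_idp[OF I(1) J(1)] by blast
  qed
  have "subgroup Ker Cl"
  proof (rule Cl.subgroupI[OF Ker_sub])
    have "OK \<in> {I. K.is_frac I \<and> ext I \<in> HN}"
      using K.is_frac_O ext_OK HNm by (simp add: N.module_monoid_def)
    then show "Ker \<noteq> {}" unfolding Ker by blast
    show "inv\<^bsub>Cl\<^esub> c \<in> Ker" if c: "c \<in> Ker" for c
    proof -
      have "c \<in> carrier Cl" using c Ker_sub by blast
      moreover have "c \<otimes>\<^bsub>Cl\<^esub> c \<otimes>\<^bsub>Cl\<^esub> c = \<one>\<^bsub>Cl\<^esub>" using cube[OF c] one_Cl by simp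
      ultimately have "inv\<^bsub>Cl\<^esub> c = c \<otimes>\<^bsub>Cl\<^esub> c" by (intro Cl.inv_equality) auto
      then show ?thesis using Ker_mult[OF c c] by simp
    qed
  qed (rule Ker_mult)
  moreover have "c [^]\<^bsub>Cl\<^esub> (3::nat) = \<one>\<^bsub>Cl\<^esub>" if "c \<in> Ker" for c
    using cube[OF that] that Ker_sub by (simp add: numeral_3_eq_3 one_Cl[symmetric] subset_iff)
  moreover have "Fp_dim 3 (Cl Mod ((\<lambda>c. c [^]\<^bsub>Cl\<^esub> (3::nat)) ` carrier Cl)) \<le> 1"
    using rank unfolding p_class_rank_def Cl_def .
  ultimately have "Fp_dim 3 (Cl\<lparr>carrier := Ker\<rparr>) \<le> 1"
    by (rule Cl.Fp_dim_exponent_3_subgroup_le_one[OF fin])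
  then show ?thesis by (simp add: capitulation_dim_def Ker_def Cl_def HN_def)
qed

end

theorem theorem8p14:
  fixes L N K :: "complex set" and \<rho> f t s :: nat
  assumes L: "subfield L complex_field" "ring.dimension complex_field 3 \<rat> L"
    and L_not_galois: "\<not> galois_over L \<rat>"
    and L_real: "totally_real L"
    and N: "N = normal_closure L"
    and K: "subfield K complex_field" "K \<subseteq> N" "ring.dimension complex_field 2 \<rat> K"
    and K_real: "totally_real K"
    and rank: "\<rho> = p_class_rank 3 K"
    and f: "f \<ge> 1" "conductor N K = principal_ideal K (of_nat f)"
    and t: "t = card (prime_factors f)"
    and s: "s = card {p \<in> prime_factors f. splits_in_quadratic p K}"
  shows "(pf_type L K N = type_gamma \<longrightarrow> t \<ge> 2) \<and>
         (pf_type L K N = type_alpha3 \<longrightarrow> s \<ge> 2 \<and> t \<ge> 2) \<and>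
         (pf_type L K N = type_alpha1 \<longrightarrow> \<rho> \<ge> 2)"
proof (rule normal_closure_automorphisms[OF L L_not_galois N K])
  fix \<sigma> \<tau>
  assume *: "cyclic_cubic N \<sigma> K \<tau>" "field_endo N \<tau>" "\<And>x. x \<in> N \<Longrightarrow> \<tau> (\<tau> x) = x"
    "\<And>x. x \<in> L \<Longrightarrow> \<tau> x = x" "L \<subseteq> N" "\<And>x. x \<in> N \<Longrightarrow> rel_norm N L x = x * \<tau> x"
  interpret C: cubic_field L by (rule cubic_fieldI[OF L])
  have irr: "\<exists>x\<in>L. x \<notin> \<rat>"
    by (rule C.exists_roots) blast
  interpret dihedral_cubic N \<sigma> K \<tau> L
    by (intro dihedral_cubic.intro dihedral_cubic_axioms.intro *(1,2) complex_subfieldI[OF L(1)])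
      (use * irr in auto)
  have 1: "t \<ge> 2" if "pf_type L K N = type_gamma"
  proof (rule ccontr)
    assume "\<not> t \<ge> 2"
    then have "absolute_dim L \<le> 1" using t by (intro absolute_dim_le_one[OF f]) simp
    then show False using that by (simp add: pf_type_def type_gamma_def)
  qed
  have 2: "s \<ge> 2" if "pf_type L K N = type_alpha3"
  proof (rule ccontr)
    assume "\<not> s \<ge> 2"
    then have "relative_dim L K N \<le> 1" using s by (intro relative_dim_le_one[OF f]) simp
    then show False using that by (simp add: pf_type_def type_alpha3_def)
  qed
  have "s \<le> t" unfolding s t by (intro card_mono) auto
  moreover have "\<rho> \<ge> 2" if "pf_type L K N = type_alpha1"
  proof (rule ccontr)
    assume "\<not> \<rho> \<ge> 2"
    then have "capitulation_dim N K \<le> 1" using rank by (intro capitulation_dim_le_one) simp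
    then show False using that by (simp add: pf_type_def type_alpha1_def)
  qed
  ultimately show ?thesis using 1 2 by fastforce
qed

end
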